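(* Let $\alpha,\beta,\delta>0$ and $\mathscr{B}:=\{(\rho,m,\mu)\in\mathcal{M}_\Omega: J_{\alpha,\beta,\delta}(\rho,m,\mu)\le1\}$. Then the set of extremal points of the convex set $\mathscr{B}$ equals $\mathcal{C}\cup\{(0,0,0)\}$. Here $\mathcal{C}$ is the set of triples $(\rho,m,\mu)\in\mathcal{M}_\Omega$ of the form $$\rho=h(t)\,dt\otimes\delta_{\gamma(t)},\qquad m=\dot\gamma(t)\,\rho,\qquad \mu=\dot h(t)\,dt\otimes\delta_{\gamma(t)},$$ where: (i) $h,\sqrt h\in{\rm AC}^2[0,1]$, $\gamma\in C(\{h>0\};\Omega)$ and $\sqrt h\,\gamma\in{\rm AC}^2([0,1];\mathbb{R}^d)$ (with $\sqrt h\gamma:=0$ on $\{h=0\}$); (ii) the set $\{h>0\}:=\{t\in[0,1]:h(t)>0\}$ is connected; (iii) $J_{\alpha,\beta,\delta}(\rho,m,\mu)=1$.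
   Context: Let $\Omega\subset\mathbb{R}^d$ be the closure of a bounded domain, $X_\Omega:=(0,1)\times\Omega$, and $\mathcal{M}_\Omega:=\mathcal{M}(X_\Omega)\times\mathcal{M}(X_\Omega;\mathbb{R}^d)\times\mathcal{M}(X_\Omega)$. ${\rm AC}^2$ denotes absolutely continuous functions with a.e. derivative in $L^2$. For $\delta>0$ define $\Psi_\delta\colon\mathbb{R}\times\mathbb{R}^d\times\mathbb{R}\to[0,\infty]$ by $$\Psi_\delta(t,x,y)=\begin{cases}\dfrac{|x|^2+\delta^2y^2}{2t}&\text{if } t>0,\\[2pt] 0&\text{if } t=0,\ x=0,\ y=0,\\ \infty&\text{otherwise.}\end{cases}$$ Set $B_\delta(\rho,m,\mu):=\int_{X_\Omega}\Psi_\delta\big(\tfrac{d\rho}{d\lambda},\tfrac{dm}{d\lambda},\tfrac{d\mu}{d\lambda}\big)\,d\lambda$ for any $\lambda\in\mathcal{M}^+(X_\Omega)$ with $\rho,m,\mu\ll\lambda$. $J_{\alpha,\beta,\delta}(\rho,m,\mu):=\beta B_\delta(\rho,m,\mu)+\alpha\|\rho\|_{\mathcal{M}(X_\Omega)}$ if $(\rho,m,\mu)$ solves $\partial_t\rho+\operatorname{div}m=\mu$ in $X_\Omega$, and $+\infty$ otherwise. The equation is understood as $$\int\partial_t\varphi\,d\rho+\int\nabla\varphi\cdot dm+\int\varphi\,d\mu=0$$ for all smooth $\varphi$ compactly supported in $(0,1)\times\Omega$; these need not vanish on $\partial\Omega$. *)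

theory Defs
  imports "HOL-Analysis.Analysis"
begin

type_synonym ('d) pt = "real \<times> (real ^ 'd)"

definition closure_of_bounded_domain :: "(real ^ 'd::finite) set \<Rightarrow> bool" where
  "closure_of_bounded_domain \<Omega> \<longleftrightarrow>
     (\<exists>U. open U \<and> connected U \<and> bounded U \<and> U \<noteq> {} \<and> \<Omega> = closure U)"

definition XO :: "(real ^ 'd::finite) set \<Rightarrow> 'd pt set" where
  "XO \<Omega> = {0<..<1} \<times> \<Omega>"

definition borel_sub :: "'a::topological_space set \<Rightarrow> 'a set set" where
  "borel_sub X = {A. A \<in> sets borel \<and> A \<subseteq> X}"

(* A finite signed (or vector-valued) Borel measure on X, represented as a countably
   additive set function on the Borel subsets of X, normalised to 0 elsewhere. *)
definition fin_smeasure :: "'a::topological_space set \<Rightarrow> ('a set \<Rightarrow> 'v::real_normed_vector) \<Rightarrow> bool" where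
  "fin_smeasure X \<nu> \<longleftrightarrow>
     (\<forall>A. A \<notin> borel_sub X \<longrightarrow> \<nu> A = 0) \<and>
     (\<forall>A :: nat \<Rightarrow> 'a set. range A \<subseteq> borel_sub X \<longrightarrow> disjoint_family A \<longrightarrow>
         (\<lambda>n. \<nu> (A n)) sums \<nu> (\<Union>n. A n))"

definition M\<Omega> :: "(real ^ 'd::finite) set \<Rightarrow>
    (('d pt set \<Rightarrow> real) \<times> ('d pt set \<Rightarrow> real ^ 'd) \<times> ('d pt set \<Rightarrow> real)) set" where
  "M\<Omega> \<Omega> = {(\<rho>, m, \<mu>). fin_smeasure (XO \<Omega>) \<rho> \<and> fin_smeasure (XO \<Omega>) m \<and> fin_smeasure (XO \<Omega>) \<mu>}"

definition tv_norm :: "'a::topological_space set \<Rightarrow> ('a set \<Rightarrow> real) \<Rightarrow> real" where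
  "tv_norm X \<nu> = (SUP P \<in> {P. finite P \<and> P \<subseteq> borel_sub X \<and> disjoint P}. \<Sum>A\<in>P. \<bar>\<nu> A\<bar>)"

definition pos_var :: "'a::topological_space set \<Rightarrow> ('a set \<Rightarrow> real) \<Rightarrow> 'a measure" where
  "pos_var X \<nu> = measure_of X (borel_sub X)
      (\<lambda>A. ennreal (SUP B \<in> {B \<in> borel_sub X. B \<subseteq> A}. \<nu> B))"

definition sm_integral :: "'a::topological_space set \<Rightarrow> ('a set \<Rightarrow> real) \<Rightarrow> ('a \<Rightarrow> real) \<Rightarrow> real" where
  "sm_integral X \<nu> f = integral\<^sup>L (pos_var X \<nu>) f - integral\<^sup>L (pos_var X (\<lambda>A. - \<nu> A)) f"

fun Ck :: "nat \<Rightarrow> ('a::euclidean_space \<Rightarrow> real) \<Rightarrow> bool" where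
  "Ck 0 f \<longleftrightarrow> continuous_on UNIV f"
| "Ck (Suc k) f \<longleftrightarrow> (\<forall>x. f differentiable (at x)) \<and>
                     (\<forall>v. Ck k (\<lambda>x. frechet_derivative f (at x) v))"

definition smooth_fun :: "('a::euclidean_space \<Rightarrow> real) \<Rightarrow> bool" where
  "smooth_fun f \<longleftrightarrow> (\<forall>k. Ck k f)"

(* Test functions: smooth, with compact support contained in (0,1) x R^d
   (they need not vanish on the boundary of Omega). *)
definition test_fun :: "('d::finite pt \<Rightarrow> real) \<Rightarrow> bool" where
  "test_fun \<phi> \<longleftrightarrow> smooth_fun \<phi> \<and> compact (closure {p. \<phi> p \<noteq> 0}) \<and>
       closure {p. \<phi> p \<noteq> 0} \<subseteq> {0<..<1} \<times> UNIV"

definition dt :: "('d::finite pt \<Rightarrow> real) \<Rightarrow> 'd pt \<Rightarrow> real" where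
  "dt \<phi> p = frechet_derivative \<phi> (at p) (1, 0)"

definition dx :: "'d::finite \<Rightarrow> ('d pt \<Rightarrow> real) \<Rightarrow> 'd pt \<Rightarrow> real" where
  "dx i \<phi> p = frechet_derivative \<phi> (at p) (0, axis i 1)"

(* weak continuity equation  \<partial>_t \<rho> + div m = \<mu>  in X_Omega *)
definition cont_eq :: "(real ^ 'd::finite) set \<Rightarrow> ('d pt set \<Rightarrow> real) \<Rightarrow> ('d pt set \<Rightarrow> real ^ 'd)
     \<Rightarrow> ('d pt set \<Rightarrow> real) \<Rightarrow> bool" where
  "cont_eq \<Omega> \<rho> m \<mu> \<longleftrightarrow>
     (\<forall>\<phi>. test_fun \<phi> \<longrightarrow>
        sm_integral (XO \<Omega>) \<rho> (dt \<phi>)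
        + (\<Sum>i\<in>UNIV. sm_integral (XO \<Omega>) (\<lambda>A. m A $ i) (dx i \<phi>))
        + sm_integral (XO \<Omega>) \<mu> \<phi> = 0)"

definition Psi :: "real \<Rightarrow> real \<Rightarrow> real ^ 'd \<Rightarrow> real \<Rightarrow> ennreal" where
  "Psi \<delta> t x y =
     (if t > 0 then ennreal ((norm x ^ 2 + \<delta>^2 * y^2) / (2 * t))
      else if t = 0 \<and> x = 0 \<and> y = 0 then 0 else \<infinity>)"

definition dens_data :: "(real ^ 'd::finite) set \<Rightarrow> ('d pt set \<Rightarrow> real) \<Rightarrow> ('d pt set \<Rightarrow> real ^ 'd)
     \<Rightarrow> ('d pt set \<Rightarrow> real) \<Rightarrow>
     ('d pt measure \<times> ('d pt \<Rightarrow> real) \<times> ('d pt \<Rightarrow> real ^ 'd) \<times> ('d pt \<Rightarrow> real)) set" where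
  "dens_data \<Omega> \<rho> m \<mu> = {(L, f, g, k).
      finite_measure L \<and> space L = XO \<Omega> \<and> sets L = borel_sub (XO \<Omega>) \<and>
      integrable L f \<and> integrable L g \<and> integrable L k \<and>
      (\<forall>A\<in>sets L. \<rho> A = (\<integral>p\<in>A. f p \<partial>L) \<and> m A = (\<integral>p\<in>A. g p \<partial>L) \<and> \<mu> A = (\<integral>p\<in>A. k p \<partial>L))}"

(* B_\<delta>; the integral is independent of the admissible \<lambda>, so we take the infimum *)
definition B\<delta> :: "real \<Rightarrow> (real ^ 'd::finite) set \<Rightarrow> ('d pt set \<Rightarrow> real) \<Rightarrow> ('d pt set \<Rightarrow> real ^ 'd)
     \<Rightarrow> ('d pt set \<Rightarrow> real) \<Rightarrow> ennreal" where
  "B\<delta> \<delta> \<Omega> \<rho> m \<mu> = (INF (L, f, g, k) \<in> dens_data \<Omega> \<rho> m \<mu>. \<integral>\<^sup>+ p. Psi \<delta> (f p) (g p) (k p) \<partial>L)"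

definition J :: "real \<Rightarrow> real \<Rightarrow> real \<Rightarrow> (real ^ 'd::finite) set \<Rightarrow> ('d pt set \<Rightarrow> real)
     \<Rightarrow> ('d pt set \<Rightarrow> real ^ 'd) \<Rightarrow> ('d pt set \<Rightarrow> real) \<Rightarrow> ennreal" where
  "J \<alpha> \<beta> \<delta> \<Omega> \<rho> m \<mu> =
     (if cont_eq \<Omega> \<rho> m \<mu>
      then ennreal \<beta> * B\<delta> \<delta> \<Omega> \<rho> m \<mu> + ennreal (\<alpha> * tv_norm (XO \<Omega>) \<rho>)
      else \<infinity>)"

definition Bset :: "real \<Rightarrow> real \<Rightarrow> real \<Rightarrow> (real ^ 'd::finite) set \<Rightarrow>
    (('d pt set \<Rightarrow> real) \<times> ('d pt set \<Rightarrow> real ^ 'd) \<times> ('d pt set \<Rightarrow> real)) set" where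
  "Bset \<alpha> \<beta> \<delta> \<Omega> = {(\<rho>, m, \<mu>) \<in> M\<Omega> \<Omega>. J \<alpha> \<beta> \<delta> \<Omega> \<rho> m \<mu> \<le> 1}"

definition abs_cont01 :: "(real \<Rightarrow> 'v::real_normed_vector) \<Rightarrow> bool" where
  "abs_cont01 f \<longleftrightarrow>
     (\<forall>\<epsilon>>0. \<exists>\<eta>>0. \<forall>(n::nat) (a::nat \<Rightarrow> real) b.
        (\<forall>k<n. 0 \<le> a k \<and> a k \<le> b k \<and> b k \<le> 1) \<and>
        (\<forall>k<n. \<forall>j<n. k \<noteq> j \<longrightarrow> b k \<le> a j \<or> b j \<le> a k) \<and>
        (\<Sum>k<n. b k - a k) < \<eta> \<longrightarrow>
        (\<Sum>k<n. norm (f (b k) - f (a k))) < \<epsilon>)"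

definition AC2 :: "(real \<Rightarrow> 'v::real_normed_vector) \<Rightarrow> bool" where
  "AC2 f \<longleftrightarrow> abs_cont01 f \<and>
     (\<lambda>t. norm (vector_derivative f (at t)) ^ 2) integrable_on {0..1}"

definition Cset :: "real \<Rightarrow> real \<Rightarrow> real \<Rightarrow> (real ^ 'd::finite) set \<Rightarrow>
    (('d pt set \<Rightarrow> real) \<times> ('d pt set \<Rightarrow> real ^ 'd) \<times> ('d pt set \<Rightarrow> real)) set" where
  "Cset \<alpha> \<beta> \<delta> \<Omega> = {(\<rho>, m, \<mu>) \<in> M\<Omega> \<Omega>.
     \<exists>(h :: real \<Rightarrow> real) (\<gamma> :: real \<Rightarrow> real ^ 'd).
       (\<forall>t\<in>{0..1}. 0 \<le> h t) \<and>
       AC2 h \<and> AC2 (\<lambda>t. sqrt (h t)) \<and>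
       continuous_on {t\<in>{0..1}. 0 < h t} \<gamma> \<and> \<gamma> ` {t\<in>{0..1}. 0 < h t} \<subseteq> \<Omega> \<and>
       AC2 (\<lambda>t. if 0 < h t then sqrt (h t) *\<^sub>R \<gamma> t else 0) \<and>
       connected {t\<in>{0..1}. 0 < h t} \<and>
       (\<forall>A\<in>borel_sub (XO \<Omega>).
          \<rho> A = (LINT t:{t\<in>{0<..<1}. 0 < h t}|lborel. h t * indicator A (t, \<gamma> t)) \<and>
          m A = (LINT t:{t\<in>{0<..<1}. 0 < h t}|lborel.
                   indicator A (t, \<gamma> t) *\<^sub>R (h t *\<^sub>R vector_derivative \<gamma> (at t))) \<and>
          \<mu> A = (LINT t:{t\<in>{0<..<1}. 0 < h t}|lborel. deriv h t * indicator A (t, \<gamma> t))) \<and>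
       J \<alpha> \<beta> \<delta> \<Omega> \<rho> m \<mu> = 1}"

definition comb3 :: "real \<Rightarrow> ('a set \<Rightarrow> real) \<times> ('a set \<Rightarrow> real ^ 'd) \<times> ('a set \<Rightarrow> real)
    \<Rightarrow> ('a set \<Rightarrow> real) \<times> ('a set \<Rightarrow> real ^ 'd) \<times> ('a set \<Rightarrow> real)
    \<Rightarrow> ('a set \<Rightarrow> real) \<times> ('a set \<Rightarrow> real ^ 'd) \<times> ('a set \<Rightarrow> real)" where
  "comb3 s x y = (case x of (\<rho>1, m1, \<mu>1) \<Rightarrow> case y of (\<rho>2, m2, \<mu>2) \<Rightarrow>
     (\<lambda>A. (1 - s) * \<rho>1 A + s * \<rho>2 A,
      \<lambda>A. (1 - s) *\<^sub>R m1 A + s *\<^sub>R m2 A,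
      \<lambda>A. (1 - s) * \<mu>1 A + s * \<mu>2 A))"

definition extremal_points :: "(('a set \<Rightarrow> real) \<times> ('a set \<Rightarrow> real ^ 'd) \<times> ('a set \<Rightarrow> real)) set
    \<Rightarrow> (('a set \<Rightarrow> real) \<times> ('a set \<Rightarrow> real ^ 'd) \<times> ('a set \<Rightarrow> real)) set" where
  "extremal_points S = {x \<in> S. \<forall>y\<in>S. \<forall>z\<in>S. \<forall>s\<in>{0<..<1}. x = comb3 s y z \<longrightarrow> y = z}"

end

theory Submission
  imports Defs
begin

text \<open>
  A triple of finite energy has the form \<open>(P, v P, w P)\<close> with \<open>P \<ge> 0\<close> and \<open>v, w\<close> square integrable, and solves the
  continuity equation iff \<open>\<integral> L \<phi> dP = 0\<close> for all test functions, where \<open>L \<phi> = \<partial>\<^sub>t\<phi> + v \<bullet> \<nabla>\<phi> + w \<phi>\<close>. Call a bounded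
  weight \<open>\<theta>\<close> invariant if \<open>\<theta> (P, v P, w P)\<close> solves the equation as well. By the convexity of the energy, a triple with
  \<open>J = 1\<close> is extremal iff its invariant weights are constant.

  If the invariant weights are constant, then by duality every bounded \<open>f\<close> of mean zero is approximated in \<open>L\<^sup>1(P)\<close> by
  some \<open>L \<phi>\<close>. Renormalising \<open>\<phi>\<close> yields \<open>\<integral>\<^bsub>s<t'<t\<^esub> \<bar>\<phi>\<bar> dP \<le> (t - s) \<integral> \<bar>L \<phi>\<bar> dP\<close> with the last integral over the times
  before \<open>t\<close> or over those after \<open>s\<close>. Taking \<open>f\<close> to be a large multiple of \<open>x\<^sub>i\<close> minus its mean on a thin
  time slab, and testing the equation with \<open>x\<^sub>i\<close> times a bounded function of \<open>\<phi>\<close>, one finds that the variance of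
  \<open>x\<^sub>i\<close> over the slab is \<open>o(t - s)\<close>, so \<open>P\<close> lives on a graph \<open>x = \<gamma>(t)\<close>. No superposition principle is needed.
  The equations for \<open>h\<close> and \<open>h \<gamma>\<close> then give the regularity, and cutting time at a zero of \<open>h\<close>
  would give a non-constant invariant weight.

  Conversely, on a curve both \<open>u = \<theta> h\<close> and \<open>h\<close> solve \<open>u' = w u\<close>, hence \<open>u / h\<close> is locally constant on \<open>{h > 0}\<close>,
  which is connected.
\<close>

section \<open>Smooth functions\<close>

text \<open>The velocity is only square integrable, so no characteristics are available and L \<phi>
  = f can be solved only approximately and in mean. This weak solvability is the exact dual of the
  hypothesis, since the bounded functions annihilating all L \<phi> are the invariant weights. The
  price is that \<phi> is controlled in L1 alone, which does not bound a product such as \<phi> v. A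
  bounded function \<psi> of \<phi> with \<psi>^2 \<le> |\<phi>| repairs this: Young's inequality
  then works against v in L2. On a slab of length \<epsilon> the right-hand side is \<tau> /
  \<epsilon> times the centred coordinate. Then \<phi> has L1 size O(\<epsilon> \<tau>) on the slab
  and is negligible elsewhere, because L \<phi> is small before and after it. Testing bounds \<tau>
  / \<epsilon> times the variance by O(\<tau>^2) plus a multiple of the integral of |v| + |w| over
  the slab. For \<epsilon> small in terms of \<tau> the variance is O(\<epsilon> \<tau>); summing
  over slabs and letting \<tau> tend to 0 removes it.\<close>

lemma Ck_SucI:
  assumes "\<And>x. (f has_derivative f' x) (at x)" and "\<And>v. Ck k (\<lambda>x. f' x v)"
  shows "Ck (Suc k) f"
proof -
  have "frechet_derivative f (at x) = f' x" for x
    using assms(1) frechet_derivative_at by metis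
  with assms show ?thesis
    by (auto simp: differentiable_def)
qed

lemma Ck_SucD:
  assumes "Ck (Suc k) f"
  shows "(f has_derivative frechet_derivative f (at x)) (at x)"
    and "Ck k (\<lambda>x. frechet_derivative f (at x) v)"
  using assms by (auto simp: frechet_derivative_works)

lemma Ck_mono_Suc: "Ck (Suc k) f \<Longrightarrow> Ck k f"
proof (induction k arbitrary: f)
  case 0
  then show ?case
    by (auto simp: continuous_on_eq_continuous_at intro: differentiable_imp_continuous_within)
next
  case (Suc k)
  then show ?case by simp
qed

lemma Ck_continuous: "Ck k f \<Longrightarrow> continuous_on UNIV f"
proof (induction k)
  case (Suc k)
  then show ?case using Ck_mono_Suc by blast
qed simp

lemma Ck_const: "Ck k (\<lambda>x. c)"
  by (induction k arbitrary: c) (auto simp: frechet_derivative_const)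

lemma Ck_bounded_linear:
  assumes "bounded_linear f" shows "Ck k f"
proof (cases k)
  case 0
  then show ?thesis using assms by (simp add: linear_continuous_on)
next
  case (Suc j)
  show ?thesis unfolding Suc
    by (rule Ck_SucI[where f' = "\<lambda>x. f"]) (use assms Ck_const in \<open>auto intro: bounded_linear_imp_has_derivative\<close>)
qed

lemma Ck_add: "Ck k f \<Longrightarrow> Ck k g \<Longrightarrow> Ck k (\<lambda>x. f x + g x)"
proof (induction k arbitrary: f g)
  case 0 then show ?case by (auto intro: continuous_intros)
next
  case (Suc k)
  show ?case
    by (rule Ck_SucI[OF has_derivative_add[OF Ck_SucD(1)[OF Suc.prems(1)] Ck_SucD(1)[OF Suc.prems(2)]]])
       (use Suc Ck_SucD(2) in blast)
qed

lemma Ck_mult: "Ck k f \<Longrightarrow> Ck k g \<Longrightarrow> Ck k (\<lambda>x. f x * g x)"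
proof (induction k arbitrary: f g)
  case 0 then show ?case by (auto intro: continuous_intros)
next
  case (Suc k)
  show ?case
    by (rule Ck_SucI[OF has_derivative_mult[OF Ck_SucD(1)[OF Suc.prems(1)] Ck_SucD(1)[OF Suc.prems(2)]]])
       (intro Ck_add Suc.IH Ck_mono_Suc[OF Suc.prems(1)] Ck_mono_Suc[OF Suc.prems(2)]
          Ck_SucD(2)[OF Suc.prems(1)] Ck_SucD(2)[OF Suc.prems(2)])
qed

lemma Ck_inverse: "Ck k f \<Longrightarrow> (\<And>x. f x > 0) \<Longrightarrow> Ck k (\<lambda>x. inverse (f x))"
proof (induction k arbitrary: f)
  case 0
  from 0(2) have "f x \<noteq> 0" for x by (metis less_irrefl)
  with 0(1) show ?case by (auto intro!: continuous_on_inverse)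
next
  case (Suc k)
  have d: "((\<lambda>x. inverse (f x)) has_derivative
      (\<lambda>v. (-1) * (inverse (f x) * frechet_derivative f (at x) v * inverse (f x)))) (at x)" for x
    using DERIV_compose_FDERIV[OF DERIV_inverse Ck_SucD(1)[OF Suc.prems(1)], of x] Suc.prems(2)[of x]
    by (simp add: power2_eq_square mult.commute mult.left_commute)
  show ?case
    by (rule Ck_SucI[OF d])
       (intro Ck_mult Ck_const Suc.IH Ck_mono_Suc[OF Suc.prems(1)] Suc.prems(2) Ck_SucD(2)[OF Suc.prems(1)])
qed

text \<open>The derivative is a multiple of 1 / sqrt f, covered by the hypothesis for sqrt f
  together with \<open>Ck_inverse\<close>; positivity keeps f off the singularity at 0.\<close>

lemma Ck_sqrt: "Ck k f \<Longrightarrow> (\<And>x. f x > 0) \<Longrightarrow> Ck k (\<lambda>x. sqrt (f x))"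
proof (induction k arbitrary: f)
  case 0 then show ?case by (auto intro: continuous_intros)
next
  case (Suc k)
  have d: "((\<lambda>x. sqrt (f x)) has_derivative
      (\<lambda>v. frechet_derivative f (at x) v * ((1/2) * inverse (sqrt (f x))))) (at x)" for x
    using DERIV_compose_FDERIV[OF DERIV_real_sqrt[OF Suc.prems(2)] Ck_SucD(1)[OF Suc.prems(1)], of x]
    by (simp add: mult.commute mult.left_commute)
  show ?case
    by (rule Ck_SucI[OF d])
       (intro Ck_mult Ck_const Ck_inverse Suc.IH Ck_mono_Suc[OF Suc.prems(1)] Suc.prems(2)
         Ck_SucD(2)[OF Suc.prems(1)] real_sqrt_gt_zero)
qed

lemma Ck_compose:
  fixes b :: "real \<Rightarrow> real"
  shows "Ck k b \<Longrightarrow> Ck k f \<Longrightarrow> Ck k (\<lambda>x. b (f x))"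
proof (induction k arbitrary: b f)
  case 0 then show ?case by (auto intro: continuous_on_compose2)
next
  case (Suc k)
  have d: "((\<lambda>x. b (f x)) has_derivative
      (\<lambda>v. frechet_derivative f (at x) v * frechet_derivative b (at (f x)) 1)) (at x)" for x
  proof -
    \<comment> \<open>A linear map on the reals is multiplication by its value at 1. This turns the
      chain rule into a product, to which \<open>Ck_mult\<close> and the induction hypothesis
      apply.\<close>
    have "linear (frechet_derivative b (at (f x)))"
      using Ck_SucD(1)[OF Suc.prems(1)] has_derivative_linear by blast
    then have eq: "frechet_derivative b (at (f x)) v = v * frechet_derivative b (at (f x)) 1" for v
      using linear_cmul[of "frechet_derivative b (at (f x))" v 1] by simp
    show ?thesis
      by (rule has_derivative_eq_rhs
            [OF has_derivative_compose[OF Ck_SucD(1)[OF Suc.prems(2)] Ck_SucD(1)[OF Suc.prems(1)]]])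
         (intro ext, rule eq)
  qed
  show ?case
    by (rule Ck_SucI[OF d], rule Ck_mult[OF Ck_SucD(2)[OF Suc.prems(2)]
          Suc.IH[OF Ck_SucD(2)[OF Suc.prems(1)] Ck_mono_Suc[OF Suc.prems(2)]]])
qed

lemma smooth_const: "smooth_fun (\<lambda>x. c)"
  by (simp add: smooth_fun_def Ck_const)

lemma smooth_bounded_linear: "bounded_linear f \<Longrightarrow> smooth_fun f"
  by (simp add: smooth_fun_def Ck_bounded_linear)

lemma smooth_add: "smooth_fun f \<Longrightarrow> smooth_fun g \<Longrightarrow> smooth_fun (\<lambda>x. f x + g x)"
  by (simp add: smooth_fun_def Ck_add)

lemma smooth_mult: "smooth_fun f \<Longrightarrow> smooth_fun g \<Longrightarrow> smooth_fun (\<lambda>x. f x * g x)"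
  by (simp add: smooth_fun_def Ck_mult)

lemma smooth_diff: "smooth_fun f \<Longrightarrow> smooth_fun g \<Longrightarrow> smooth_fun (\<lambda>x. f x - g x)"
  using smooth_add[OF _ smooth_mult[OF smooth_const[of "-1"]], of f g] by simp

lemma smooth_inverse: "smooth_fun f \<Longrightarrow> (\<And>x. f x > 0) \<Longrightarrow> smooth_fun (\<lambda>x. inverse (f x))"
  by (simp add: smooth_fun_def Ck_inverse)

lemma smooth_sqrt: "smooth_fun f \<Longrightarrow> (\<And>x. f x > 0) \<Longrightarrow> smooth_fun (\<lambda>x. sqrt (f x))"
  by (simp add: smooth_fun_def Ck_sqrt)

lemma smooth_compose:
  fixes b :: "real \<Rightarrow> real"
  shows "smooth_fun b \<Longrightarrow> smooth_fun f \<Longrightarrow> smooth_fun (\<lambda>x. b (f x))"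
  by (simp add: smooth_fun_def Ck_compose)

lemma smooth_has_derivative:
  "smooth_fun f \<Longrightarrow> (f has_derivative frechet_derivative f (at x)) (at x)"
  unfolding smooth_fun_def using Ck_SucD(1) by blast

lemma smooth_frechet_derivative:
  "smooth_fun f \<Longrightarrow> smooth_fun (\<lambda>x. frechet_derivative f (at x) v)"
  unfolding smooth_fun_def using Ck_SucD(2) by blast

lemma smooth_continuous: "smooth_fun f \<Longrightarrow> continuous_on S f"
  unfolding smooth_fun_def using Ck_continuous continuous_on_subset by blast

lemma smooth_primitive:
  fixes f b :: "real \<Rightarrow> real"
  assumes "\<And>x. (f has_real_derivative b x) (at x)" and "smooth_fun b"
  shows "smooth_fun f"
  unfolding smooth_fun_def
proof
  fix k
  have "Ck (Suc k) f"
    by (rule Ck_SucI[where f' = "\<lambda>x v. b x * v"])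
       (use assms in \<open>auto simp: has_field_derivative_def smooth_fun_def intro!: Ck_mult Ck_const\<close>)
  then show "Ck k f" by (rule Ck_mono_Suc)
qed

section \<open>Flat functions, bumps and cut-offs on the line\<close>

definition bump_pow :: "nat \<Rightarrow> real \<Rightarrow> real" where
  "bump_pow k x = (if x \<le> 0 then 0 else inverse x ^ k * exp (- inverse x))"

lemma bump_pow_tendsto_0: "(bump_pow k \<longlongrightarrow> 0) (at 0)"
proof -
  have "((\<lambda>x. inverse x ^ k / exp (inverse x)) \<longlongrightarrow> 0) (at_right (0::real))"
    by (rule filterlim_compose[OF tendsto_power_div_exp_0 filterlim_inverse_at_top_right])
  moreover have "\<forall>\<^sub>F x in at_right (0::real). inverse x ^ k / exp (inverse x) = bump_pow k x"
    by (auto simp: eventually_at_filter bump_pow_def exp_minus field_simps)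
  ultimately have "(bump_pow k \<longlongrightarrow> 0) (at_right 0)"
    by (rule Lim_transform_eventually)
  moreover have "(bump_pow k \<longlongrightarrow> 0) (at_left 0)"
    by (rule Lim_transform_eventually[OF tendsto_const]) (auto simp: eventually_at_filter bump_pow_def)
  ultimately show ?thesis by (simp add: filterlim_at_split)
qed

text \<open>The functions x^(-k) exp(-1/x), extended by 0, are closed under differentiation up to
  linear combinations. Carrying all k along is what makes the induction in
  \<open>smooth_bump_pow\<close> close; the bumps themselves use k = 0.\<close>

lemma bump_pow_derivative:
  "(bump_pow k has_real_derivative (bump_pow (k+2) x + (- real k) * bump_pow (k+1) x)) (at x)"
proof -
  consider "x < 0" | "x = 0" | "x > 0" by linarith
  then show ?thesis
  proof cases
    case 1
    have "((\<lambda>x. 0) has_real_derivative (bump_pow (k+2) x + (- real k) * bump_pow (k+1) x)) (at x)"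
      using 1 by (simp add: bump_pow_def)
    then show ?thesis
      by (rule has_field_derivative_transform_within_open[where S = "{..<0}"]) (use 1 in \<open>auto simp: bump_pow_def\<close>)
  next
    case 2
    \<comment> \<open>At 0 the difference quotient of \<open>bump_pow k\<close> is
      \<open>bump_pow (Suc k)\<close>, so the derivative is again a limit within the family.\<close>
    have "((\<lambda>h. (bump_pow k (0 + h) - bump_pow k 0) / h) \<longlongrightarrow> 0) (at 0)"
      by (rule Lim_transform_eventually[OF bump_pow_tendsto_0[of "Suc k"]])
         (auto simp: eventually_at_filter bump_pow_def field_simps)
    then show ?thesis using 2 by (simp add: DERIV_def bump_pow_def)
  next
    case 3
    have "((\<lambda>x. inverse x ^ k * exp (- inverse x)) has_real_derivative
        real k * (inverse x ^ (k - 1) * (- (inverse x)\<^sup>2)) * exp (- inverse x)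
          + inverse x ^ k * (exp (- inverse x) * (inverse x)\<^sup>2)) (at x)"
      using 3 by (auto intro!: derivative_eq_intros simp: power2_eq_square)
    \<comment> \<open>For k = 0 the truncated subtraction k - 1 is harmless because its coefficient
      is 0; hence the case split.\<close>
    moreover have "real k * (y ^ (k - 1) * (- y\<^sup>2)) * e + y ^ k * (e * y\<^sup>2)
        = y ^ (k + 2) * e + (- real k) * (y ^ (k + 1) * e)" for y e :: real
      by (cases k) (auto simp: algebra_simps power2_eq_square)
    ultimately have "((\<lambda>x. inverse x ^ k * exp (- inverse x)) has_real_derivative
        (bump_pow (k+2) x + (- real k) * bump_pow (k+1) x)) (at x)"
      using 3 by (simp add: bump_pow_def)
    then show ?thesis
      by (rule has_field_derivative_transform_within_open[where S = "{0<..}"]) (use 3 in \<open>auto simp: bump_pow_def\<close>)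
  qed
qed

lemma smooth_bump_pow: "smooth_fun (bump_pow k)"
  unfolding smooth_fun_def
proof
  fix n show "Ck n (bump_pow k)"
  proof (induction n arbitrary: k)
    case 0
    have "isCont (bump_pow k) x" for x
      using bump_pow_derivative DERIV_isCont by blast
    then show ?case by (auto simp: continuous_on_eq_continuous_at)
  next
    case (Suc n)
    have d: "(bump_pow k has_derivative (\<lambda>v. (bump_pow (k+2) x + (- real k) * bump_pow (k+1) x) * v)) (at x)" for x
      using bump_pow_derivative[of k x] by (simp only: has_field_derivative_def)
    show ?case
      by (rule Ck_SucI[OF d]) (intro Ck_mult Ck_add Ck_const Suc)
  qed
qed

text \<open>For n > 0 the support keeps distance 1 / n from the end points, and as n grows the
  values tend to the indicator of the open interval (a, b). Thus indicators of time intervals are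
  limits of admissible test functions, even when a = 0 or b = 1.\<close>

definition bump :: "real \<Rightarrow> real \<Rightarrow> nat \<Rightarrow> real \<Rightarrow> real" where
  "bump a b n t = bump_pow 0 (real n * (t - a) - 1) * bump_pow 0 (real n * (b - t) - 1)"

lemma smooth_bump: "smooth_fun (bump a b n)"
proof -
  have "smooth_fun (\<lambda>t::real. real n * (t - a) - 1)" "smooth_fun (\<lambda>t::real. real n * (b - t) - 1)"
    by (intro smooth_mult smooth_diff smooth_const smooth_bounded_linear bounded_linear_ident)+
  then show ?thesis
    unfolding bump_def[abs_def]
    by (intro smooth_mult[OF smooth_compose[OF smooth_bump_pow] smooth_compose[OF smooth_bump_pow]])
qed

lemma bump_0 [simp]: "bump a b 0 t = 0"
  by (simp add: bump_def bump_pow_def)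

lemma bump_eq_0: "t \<notin> {a + 1 / n<..<b - 1 / n} \<Longrightarrow> bump a b n t = 0"
  by (cases "n = 0") (auto simp: bump_def bump_pow_def field_simps)

lemma bump_pos: "n > 0 \<Longrightarrow> t \<in> {a + 1 / n<..<b - 1 / n} \<Longrightarrow> bump a b n t > 0"
  by (auto simp: bump_def bump_pow_def field_simps)

lemma bump_nonneg: "0 \<le> bump a b n t" and bump_le_1: "bump a b n t \<le> 1"
proof -
  have "0 \<le> bump_pow 0 x" "bump_pow 0 x \<le> 1" for x by (auto simp: bump_pow_def)
  then show "0 \<le> bump a b n t" "bump a b n t \<le> 1" by (auto simp: bump_def intro: mult_le_one)
qed

lemma bump_outside: "t \<notin> {a<..<b} \<Longrightarrow> bump a b n t = 0"
proof (rule bump_eq_0, rule notI)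
  assume "t \<notin> {a<..<b}" "t \<in> {a + 1 / n<..<b - 1 / n}"
  moreover have "0 \<le> 1 / real n" by simp
  ultimately show False unfolding greaterThanLessThan_iff by linarith
qed

lemma bump_tendsto: "(\<lambda>n. bump a b n t) \<longlonglongrightarrow> indicator {a<..<b} t"
proof (cases "t \<in> {a<..<b}")
  case True
  have *: "(\<lambda>n. bump_pow 0 (real n * s - 1)) \<longlonglongrightarrow> 1" if "s > 0" for s
  proof -
    have lim: "filterlim (\<lambda>n. real n * s - 1) at_top sequentially"
      using filterlim_tendsto_add_at_top[OF tendsto_const[of "- 1"]
          filterlim_tendsto_pos_mult_at_top[OF tendsto_const that filterlim_real_sequentially]]
      by (simp add: mult.commute)
    have "(\<lambda>n. exp (- inverse (real n * s - 1))) \<longlonglongrightarrow> exp (- 0)"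
      by (intro tendsto_intros filterlim_compose[OF tendsto_inverse_0_at_top lim] lim tendsto_inverse_0_at_top)
    then have "(\<lambda>n. exp (- inverse (real n * s - 1))) \<longlonglongrightarrow> 1" by simp
    moreover have "\<forall>\<^sub>F n in sequentially. real n * s - 1 > 0"
      using lim unfolding filterlim_at_top_dense by blast
    ultimately show ?thesis
      by (rule Lim_transform_eventually[OF _ eventually_mono]) (auto simp: bump_pow_def)
  qed
  have "(\<lambda>n. bump a b n t) \<longlonglongrightarrow> 1 * 1"
    unfolding bump_def by (intro tendsto_mult *) (use True in auto)
  with True show ?thesis by simp
next
  case False
  then show ?thesis by (simp add: bump_outside)
qed

definition smooth_step :: "real \<Rightarrow> real" where
  "smooth_step x = bump_pow 0 x * inverse (bump_pow 0 x + bump_pow 0 (1 - x))"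

text \<open>The denominator is positive because x and 1 - x are never both nonpositive.\<close>

lemma smooth_smooth_step: "smooth_fun smooth_step"
proof -
  have "smooth_fun (\<lambda>x. bump_pow 0 x + bump_pow 0 (1 - x))"
    by (intro smooth_add smooth_bump_pow smooth_compose[OF smooth_bump_pow] smooth_diff smooth_const
         smooth_bounded_linear bounded_linear_ident)
  then show ?thesis
    unfolding smooth_step_def[abs_def]
    by (intro smooth_mult smooth_bump_pow smooth_inverse) (auto simp: bump_pow_def add_pos_pos)
qed

lemma smooth_step_0: "x \<le> 0 \<Longrightarrow> smooth_step x = 0"
  and smooth_step_1: "x \<ge> 1 \<Longrightarrow> smooth_step x = 1"
  by (auto simp: smooth_step_def bump_pow_def)

section \<open>Lebesgue differentiation on the line\<close>

text \<open>Vitali covering argument. On {f \<le> a} the function g = max 0 (f - a) vanishes, so by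
  outer regularity this set lies in an open set of arbitrarily small g-mass. An interval with too
  large an average that fits into the open set has length at most 1 / \<eta> times its g-mass, and
  the covering lemma selects disjoint ones whose fivefold enlargements still cover.\<close>

lemma negligible_large_averages:
  fixes f :: "real \<Rightarrow> real"
  assumes f: "integrable lborel f" and \<eta>: "\<eta> > 0"
  shows "negligible {x \<in> {-n<..<n}. f x \<le> a \<and> (\<forall>d>0. \<exists>p q. p \<le> x \<and> x \<le> q \<and> p < q \<and> q - p < d \<and>
            \<eta> * (q - p) \<le> (LINT s:{p..q}|lborel. f s) - a * (q - p))}" (is "negligible ?E")
  unfolding negligible_outer_le
proof (intro allI impI)
  fix e :: real assume e: "e > 0"
  have [measurable]: "f \<in> borel_measurable borel" using f by auto
  \<comment> \<open>The cut-off to a bounded interval makes g integrable, which f - a need not be on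
    the whole line.\<close>
  define g where "g x = indicator {-n<..<n} x * max 0 (f x - a)" for x
  have g0: "g x \<ge> 0" for x by (simp add: g_def)
  have [measurable]: "g \<in> borel_measurable borel" unfolding g_def by measurable
  have gi: "integrable lborel g"
  proof (rule Bochner_Integration.integrable_bound)
    show "integrable lborel (\<lambda>x. \<bar>f x\<bar> + indicator {-n<..<n} x * \<bar>a\<bar>)"
      using f emeasure_bounded_finite[of "{-n<..<n}"]
      by (intro Bochner_Integration.integrable_add integrable_mult_left impI) (auto simp: bounded_box)
  qed (auto simp: g_def indicator_def)
  define \<nu> where "\<nu> = density lborel (\<lambda>x. ennreal (g x))"
  have sets\<nu>: "sets \<nu> = sets borel" by (simp add: \<nu>_def)
  have e\<nu>: "emeasure \<nu> A = ennreal (LINT x:A|lborel. g x)" if [measurable]: "A \<in> sets borel" for A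
  proof -
    have "emeasure \<nu> A = (\<integral>\<^sup>+x. ennreal (indicator A x * g x) \<partial>lborel)"
      unfolding \<nu>_def by (subst emeasure_density) (auto intro!: nn_integral_cong simp: indicator_def)
    also have "\<dots> = ennreal (LINT x|lborel. indicator A x * g x)"
      by (rule nn_integral_eq_integral) (use gi g0 integrable_mult_indicator[OF _ gi, of A] in auto)
    finally show ?thesis by (simp add: set_lebesgue_integral_def)
  qed
  have fin: "emeasure \<nu> (space \<nu>) \<noteq> \<infinity>" using e\<nu>[of UNIV] by (simp add: \<nu>_def)
  define B where "B = {x \<in> {-n<..<n}. f x \<le> a}"
  have [measurable]: "B \<in> sets borel" unfolding B_def by measurable
  have "(LINT x:B|lborel. g x) = (LINT x:B|lborel. 0)"
    by (intro set_lebesgue_integral_cong) (auto simp: B_def g_def)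
  then have "emeasure \<nu> B = 0" by (subst e\<nu>) auto
  \<comment> \<open>The mass \<eta> e / 5 pays for the factor 1 / \<eta> in the length bound and for
    the enlargement of the radii by 5.\<close>
  then have "(INF U \<in> {U. B \<subseteq> U \<and> open U}. emeasure \<nu> U) < ennreal (\<eta> * e / 5)"
    using outer_regular[OF sets\<nu> fin, of B] e \<eta> by simp
  then obtain U0 where U0: "B \<subseteq> U0" "open U0" "emeasure \<nu> U0 < ennreal (\<eta> * e / 5)"
    by (auto simp: INF_less_iff)
  define U where "U = U0 \<inter> {-n<..<n}"
  have U: "B \<subseteq> U" "open U" using U0 by (auto simp: U_def B_def)
  define K where "K = {(p, q). p < q \<and> q - p < 1 \<and> {p..q} \<subseteq> U \<and>
      \<eta> * (q - p) \<le> (LINT s:{p..q}|lborel. f s) - a * (q - p)}"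
  define c where "c = (\<lambda>(p::real,q::real). (p + q) / 2)"
  define r where "r = (\<lambda>(p::real,q::real). (q - p) / 2)"
  have cb: "cball (c k) (r k) = {fst k..snd k}" for k
    by (cases k) (auto simp: c_def r_def dist_real_def abs_le_iff field_simps)
  have cb5: "emeasure lborel (cball (c k) (5 * r k)) = ennreal (5 * (snd k - fst k))" if "k \<in> K" for k
  proof -
    have "cball (c k) (5 * r k) = {c k - 5 * r k..c k + 5 * r k}"
      by (auto simp: dist_real_def abs_le_iff)
    then show ?thesis using that by (auto simp: K_def r_def c_def field_simps)
  qed
  have cov: "?E \<subseteq> (\<Union>k\<in>K. cball (c k) (r k))"
  proof
    fix x assume x: "x \<in> ?E"
    then have "x \<in> U" using U by (auto simp: B_def)
    then obtain d where d: "d > 0" "ball x d \<subseteq> U" using U(2) open_contains_ball by blast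
    then obtain p q where pq: "p \<le> x \<and> x \<le> q \<and> p < q \<and> q - p < min d 1 \<and>
            \<eta> * (q - p) \<le> (LINT s:{p..q}|lborel. f s) - a * (q - p)"
      using x by (auto dest!: spec[of _ "min d 1"])
    then have "{p..q} \<subseteq> ball x d" by (auto simp: dist_real_def)
    then have "(p,q) \<in> K" using pq d by (auto simp: K_def)
    then show "x \<in> (\<Union>k\<in>K. cball (c k) (r k))" using pq by (intro UN_I[of "(p,q)"]) (auto simp: cb)
  qed
  have "0 < r k \<and> r k \<le> 1" if "k \<in> K" for k using that by (auto simp: K_def r_def)
  from Vitali_covering_lemma_cballs[OF cov this] obtain C where C: "countable C" "C \<subseteq> K"
     "pairwise (\<lambda>i j. disjnt (cball (c i) (r i)) (cball (c j) (r j))) C"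
     "?E \<subseteq> (\<Union>i\<in>C. cball (c i) (5 * r i))" by blast
  define Y where "Y X k = (if k \<in> to_nat_on C ` C then X (from_nat_into C k) else {})"
    for X :: "real \<times> real \<Rightarrow> real set" and k
  have UY: "(\<Union>k. Y X k) = (\<Union>i\<in>C. X i)" for X
    using C(1) by (auto simp: Y_def)
  let ?S = "\<lambda>i. cball (c i) (r i)" and ?T = "\<lambda>i. cball (c i) (5 * r i)"
  have dis: "disjoint_family (Y ?S)"
    unfolding disjoint_family_on_def
  proof (intro ballI impI)
    fix m k :: nat assume "m \<noteq> k"
    show "Y ?S m \<inter> Y ?S k = {}"
    proof (cases "m \<in> to_nat_on C ` C \<and> k \<in> to_nat_on C ` C")
      case True
      then obtain i j where ij: "i \<in> C" "m = to_nat_on C i" "j \<in> C" "k = to_nat_on C j" by auto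
      then have "disjnt (?S i) (?S j)" using pairwiseD[OF C(3), of i j] \<open>m \<noteq> k\<close> by auto
      then show ?thesis using ij C(1) by (simp add: Y_def disjnt_def del: mem_cball)
    qed (auto simp: Y_def)
  qed
  have sub: "Y ?S k \<subseteq> U0" for k
    using C(1,2) by (auto simp: Y_def cb K_def U_def subset_iff simp del: mem_cball)
  have meas: "range (Y ?S) \<subseteq> sets \<nu>" "range (Y ?T) \<subseteq> sets lborel" by (auto simp: Y_def sets\<nu>)
  have le: "emeasure lborel (Y ?T k) \<le> ennreal (5 / \<eta>) * emeasure \<nu> (Y ?S k)" for k
  proof (cases "k \<in> to_nat_on C ` C")
    case True
    then obtain j where j: "j \<in> C" "k = to_nat_on C j" by auto
    obtain p q where pq: "j = (p, q)" by (cases j)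
    have jK: "(p,q) \<in> K" using j C pq by auto
    then have sub': "{p..q} \<subseteq> {-n<..<n}" by (auto simp: K_def U_def)
    have fi: "set_integrable lborel {p..q} f" "set_integrable lborel {p..q} (\<lambda>s. a)"
      using f by (auto simp: set_integrable_def emeasure_lborel_Icc_eq
          intro: integrable_mult_indicator[where 'b=real, simplified] integrable_real_indicator)
    have "\<eta> * (q - p) \<le> (LINT s:{p..q}|lborel. f s) - a * (q - p)" using jK by (auto simp: K_def)
    also have "\<dots> = (LINT s:{p..q}|lborel. f s - a)"
    proof -
      have "(LINT s:{p..q}|lborel. a) = a * (q - p)"
        using jK by (auto simp: K_def set_lebesgue_integral_def)
      then show ?thesis using fi by (simp add: set_integral_diff)
    qed
    also have "\<dots> \<le> (LINT s:{p..q}|lborel. g s)"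
    proof (rule set_integral_mono)
      show "set_integrable lborel {p..q} (\<lambda>s. f s - a)"
        using fi by (rule set_integral_diff)
      show "set_integrable lborel {p..q} g" using gi by (auto simp: set_integrable_def intro: integrable_mult_indicator[where 'b=real, simplified])
      show "\<And>x. x \<in> {p..q} \<Longrightarrow> f x - a \<le> g x" using sub' by (auto simp: g_def indicator_def)
    qed
    finally have *: "5 * (q - p) \<le> 5 / \<eta> * (LINT s:{p..q}|lborel. g s)" using \<eta> by (simp add: field_simps)
    have "emeasure lborel (Y ?T k) = ennreal (5 * (q - p))"
      using cb5[OF jK] True j C(1) pq by (simp add: Y_def)
    also have "\<dots> \<le> ennreal (5 / \<eta> * (LINT s:{p..q}|lborel. g s))" using * by (rule ennreal_leI)
    also have "\<dots> = ennreal (5 / \<eta>) * ennreal (LINT s:{p..q}|lborel. g s)"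
      using \<eta> by (intro ennreal_mult) (auto simp: set_lebesgue_integral_def g0)
    also have "ennreal (LINT s:{p..q}|lborel. g s) = emeasure \<nu> (Y ?S k)"
      using True j C(1) pq by (simp add: Y_def cb e\<nu>)
    finally show ?thesis .
  qed (auto simp: Y_def)
  define T where "T = (\<Union>i\<in>C. ?T i)"
  have "emeasure lborel T \<le> (\<Sum>k. emeasure lborel (Y ?T k))"
    unfolding T_def UY[symmetric] using meas(2) by (rule emeasure_subadditive_countably)
  also have "\<dots> \<le> (\<Sum>k. ennreal (5 / \<eta>) * emeasure \<nu> (Y ?S k))"
    by (intro suminf_le le) auto
  also have "\<dots> = ennreal (5 / \<eta>) * (\<Sum>k. emeasure \<nu> (Y ?S k))" by simp
  also have "(\<Sum>k. emeasure \<nu> (Y ?S k)) = emeasure \<nu> (\<Union>k. Y ?S k)"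
    by (rule suminf_emeasure[OF meas(1) dis])
  also have "\<dots> \<le> emeasure \<nu> U0" using sub U0 by (intro emeasure_mono) (auto simp: sets\<nu>)
  also have "\<dots> \<le> ennreal (\<eta> * e / 5)" using U0 by simp
  finally have "emeasure lborel T \<le> ennreal (5 / \<eta>) * ennreal (\<eta> * e / 5)" by (simp add: mult_left_mono)
  also have "\<dots> = ennreal e" using \<eta> e by (simp add: ennreal_mult[symmetric])
  finally have T: "emeasure lborel T \<le> ennreal e" .
  have Tm: "T \<in> sets borel" unfolding T_def using C(1) by (auto intro: sets.countable_UN')
  then have T': "emeasure lebesgue T \<le> ennreal e" using T by (simp add: emeasure_completion main_part_sets)
  have "T \<in> lmeasurable"
    using Tm T' by (intro fmeasurableI) (auto simp: le_less_trans[OF _ ennreal_less_top])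
  moreover have "measure lebesgue T \<le> e"
    using T' e by (simp add: measure_def enn2real_leI)
  ultimately show "\<exists>T. ?E \<subseteq> T \<and> T \<in> lmeasurable \<and> measure lebesgue T \<le> e"
    using C(4) T_def by blast
qed

text \<open>The exceptional sets of the preceding lemma are united over rational levels a, margins 1
  / (k + 1) and windows (-n, n). At every other point a rational a between f x and f x + \<eta> / 2
  gives the bound.\<close>

lemma AE_averages_eventually_less:
  fixes f :: "real \<Rightarrow> real"
  assumes f: "integrable lborel f"
  shows "AE x in lborel. \<forall>\<eta>>0. \<exists>d>0. \<forall>p q. p \<le> x \<and> x \<le> q \<and> p < q \<and> q - p < d \<longrightarrow>
            (LINT s:{p..q}|lborel. f s) < (f x + \<eta>) * (q - p)"
proof -
  let ?E = "\<lambda>n k a. {x \<in> {-real n<..<real n}. f x \<le> of_rat a \<and> (\<forall>d>0. \<exists>p q. p \<le> x \<and> x \<le> q \<and> p < q \<and> q - p < d \<and>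
            (1 / real (Suc k)) * (q - p) \<le> (LINT s:{p..q}|lborel. f s) - of_rat a * (q - p))}"
  have "AE x in lebesgue. \<forall>(n::nat) (k::nat) (a::rat). x \<notin> ?E n k a"
    unfolding AE_all_countable
  proof (intro allI)
    fix n k :: nat and a :: rat
    have "negligible (?E n k a)" by (rule negligible_large_averages[OF f]) simp
    then have "?E n k a \<in> null_sets lebesgue" by (simp only: negligible_iff_null_sets)
    then show "AE x in lebesgue. x \<notin> ?E n k a" by (rule AE_not_in)
  qed
  then have "AE x in lborel. \<forall>(n::nat) (k::nat) (a::rat). x \<notin> ?E n k a"
    by (simp only: AE_completion_iff)
  then show ?thesis
  proof (rule AE_mp, intro AE_I2 impI allI)
    fix x \<eta> :: real assume x: "\<forall>(n::nat) (k::nat) (a::rat). x \<notin> ?E n k a" and \<eta>: "\<eta> > 0"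
    obtain n where n: "\<bar>x\<bar> < real n" using reals_Archimedean2 by blast
    obtain a where a: "f x < of_rat a" "of_rat a < f x + \<eta>/2"
      using of_rat_dense[of "f x" "f x + \<eta>/2"] \<eta> by auto
    obtain k where k: "1 / real (Suc k) < \<eta>/2" using nat_approx_posE[of "\<eta>/2"] \<eta> by auto
    have "x \<notin> ?E n k a" using x by blast
    then obtain d where d: "d > 0" "\<And>p q. p \<le> x \<Longrightarrow> x \<le> q \<Longrightarrow> p < q \<Longrightarrow> q - p < d \<Longrightarrow>
        \<not> ((1 / real (Suc k)) * (q - p) \<le> (LINT s:{p..q}|lborel. f s) - of_rat a * (q - p))"
      using n a by (auto simp: abs_less_iff)
    show "\<exists>d>0. \<forall>p q. p \<le> x \<and> x \<le> q \<and> p < q \<and> q - p < d \<longrightarrow>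
            (LINT s:{p..q}|lborel. f s) < (f x + \<eta>) * (q - p)"
    proof (intro exI[of _ d] conjI allI impI d(1))
      fix p q assume pq: "p \<le> x \<and> x \<le> q \<and> p < q \<and> q - p < d"
      then have "(LINT s:{p..q}|lborel. f s) < (1 / real (Suc k) + of_rat a) * (q - p)"
        using d(2)[of p q] by (auto simp: algebra_simps)
      also have "\<dots> \<le> (f x + \<eta>) * (q - p)" using a k pq by (intro mult_right_mono) auto
      finally show "(LINT s:{p..q}|lborel. f s) < (f x + \<eta>) * (q - p)" .
    qed
  qed
qed

text \<open>The one-sided estimate is used for f and for -f. Since x may be an end point of the
  intervals, it controls the difference quotients on both sides of x.\<close>

lemma Lebesgue_differentiation_real:
  fixes f F :: "real \<Rightarrow> real"
  assumes f: "integrable lborel f"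
    and F: "\<And>s t. a < s \<Longrightarrow> s \<le> t \<Longrightarrow> t < b \<Longrightarrow> F t - F s = (LINT r:{s..t}|lborel. f r)"
  shows "AE x in lborel. x \<in> {a<..<b} \<longrightarrow> (F has_real_derivative f x) (at x)"
  using AE_averages_eventually_less[OF f]
        AE_averages_eventually_less[OF integrable_minus[OF f]]
proof eventually_elim
  case (elim x)
  show ?case
  proof
    assume x: "x \<in> {a<..<b}"
    show "(F has_real_derivative f x) (at x)"
      unfolding has_field_derivative_def has_derivative_at_alt
    proof (intro conjI allI impI bounded_linear_mult_right)
      fix e :: real assume e: "e > 0"
      obtain d1 where d1: "d1 > 0" "\<And>p q. p \<le> x \<and> x \<le> q \<and> p < q \<and> q - p < d1 \<Longrightarrow>
            (LINT s:{p..q}|lborel. f s) < (f x + e) * (q - p)" using elim(1) e by blast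
      obtain d2 where d2: "d2 > 0" "\<And>p q. p \<le> x \<and> x \<le> q \<and> p < q \<and> q - p < d2 \<Longrightarrow>
            (LINT s:{p..q}|lborel. - f s) < (- f x + e) * (q - p)" using elim(2) e by blast
      define d where "d = Min {d1, d2, x - a, b - x}"
      have d: "d > 0" "d \<le> d1" "d \<le> d2" "d \<le> x - a" "d \<le> b - x" using x d1 d2 by (auto simp: d_def)
      have key: "\<bar>F q - F p - f x * (q - p)\<bar> \<le> e * (q - p)"
        if "p \<le> x" "x \<le> q" "p < q" "q - p < d" for p q
      proof -
        have "F q - F p = (LINT r:{p..q}|lborel. f r)" using that d by (intro F) auto
        moreover have "(LINT s:{p..q}|lborel. - f s) = - (LINT s:{p..q}|lborel. f s)"
          by (simp add: set_lebesgue_integral_def)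
        ultimately show ?thesis using d1(2)[of p q] d2(2)[of p q] that d
          by (auto simp: abs_le_iff algebra_simps)
      qed
      show "\<exists>d>0. \<forall>y. norm (y - x) < d \<longrightarrow> norm (F y - F x - f x * (y - x)) \<le> e * norm (y - x)"
      proof (intro exI[of _ d] conjI allI impI d(1))
        fix y assume y: "norm (y - x) < d"
        consider "y < x" | "y = x" | "y > x" by linarith
        then show "norm (F y - F x - f x * (y - x)) \<le> e * norm (y - x)"
        proof cases
          case 1
          then show ?thesis using key[of y x] y by (auto simp: abs_le_iff algebra_simps)
        next
          case 3
          then show ?thesis using key[of x y] y by auto
        qed auto
      qed
    qed
  qed
qed

section \<open>Approximation in mean by a duality argument\<close>

text \<open>The sum of the absolute increments has a finite integral, hence is finite almost
  everywhere, and an absolutely summable telescoping series converges.\<close>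

lemma AE_convergent_if_L1_increments:
  fixes \<theta> :: "nat \<Rightarrow> 'a \<Rightarrow> real"
  assumes int: "\<And>n. integrable M (\<lambda>x. \<theta> (Suc n) x - \<theta> n x)"
    and le: "\<And>n. (\<integral>x. \<bar>\<theta> (Suc n) x - \<theta> n x\<bar> \<partial>M) \<le> C * (1/2)^n"
  shows "AE x in M. convergent (\<lambda>n. \<theta> n x)"
proof -
  let ?d = "\<lambda>n x. \<bar>\<theta> (Suc n) x - \<theta> n x\<bar>"
  have [measurable]: "?d n \<in> borel_measurable M" for n using int[of n] by measurable
  have C: "0 \<le> C" using order_trans[OF integral_nonneg_AE[of "?d 0" M] le[of 0]] by simp
  have "(\<integral>\<^sup>+x. (\<Sum>n. ennreal (?d n x)) \<partial>M) = (\<Sum>n. \<integral>\<^sup>+x. ennreal (?d n x) \<partial>M)"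
    by (rule nn_integral_suminf) measurable
  also have "\<dots> \<le> (\<Sum>n. ennreal (C * (1/2)^n))"
  proof (intro suminf_le)
    fix n
    have "(\<integral>\<^sup>+x. ennreal (?d n x) \<partial>M) = ennreal (\<integral>x. ?d n x \<partial>M)"
      using int[of n] by (intro nn_integral_eq_integral) auto
    also have "\<dots> \<le> ennreal (C * (1/2)^n)" using le by (rule ennreal_leI)
    finally show "(\<integral>\<^sup>+x. ennreal (?d n x) \<partial>M) \<le> ennreal (C * (1/2)^n)" .
  qed auto
  also have "\<dots> = ennreal (\<Sum>n. C * (1/2)^n)"
    using C by (intro suminf_ennreal2) (auto intro!: summable_mult)
  also have "\<dots> < \<infinity>" by simp
  finally have "(\<integral>\<^sup>+x. (\<Sum>n. ennreal (?d n x)) \<partial>M) \<noteq> \<infinity>" by simp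
  then have "AE x in M. (\<Sum>n. ennreal (?d n x)) \<noteq> \<infinity>"
    by (intro nn_integral_PInf_AE) measurable
  then show ?thesis
  proof eventually_elim
    case (elim x)
    then have "summable (\<lambda>n. ?d n x)"
      by (intro summable_suminf_not_top) auto
    then have "summable (\<lambda>n. \<theta> (Suc n) x - \<theta> n x)" by (rule summable_rabs_cancel)
    then have "convergent (\<lambda>n. \<Sum>i<n. \<theta> (Suc i) x - \<theta> i x)" by (simp add: summable_iff_convergent)
    then have "convergent (\<lambda>n. \<theta> n x - \<theta> 0 x)" unfolding sum_lessThan_telescope[of "\<lambda>i. \<theta> i x"] .
    then show ?case by (simp add: convergent_diff_const_right_iff)
  qed
qed

text \<open>Within l of the absolute value, but smooth and strictly convex: minimising its integral
  instead of the L1 norm makes the first variation available. The derivative \<open>hyp'\<close> is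
  bounded by 1 and can serve as a dual weight.\<close>

definition hyp :: "real \<Rightarrow> real \<Rightarrow> real" where "hyp l x = sqrt (l\<^sup>2 + x\<^sup>2)"
definition hyp' :: "real \<Rightarrow> real \<Rightarrow> real" where "hyp' l x = x / hyp l x"

section \<open>Convexity estimates for the smoothed absolute value\<close>

context fixes l :: real assumes l: "l > 0" begin

lemma hyp_sq: "hyp l x * hyp l x = l\<^sup>2 + x\<^sup>2" by (simp add: hyp_def)

lemma hyp_ge: "l \<le> hyp l x" "\<bar>x\<bar> \<le> hyp l x" "0 < hyp l x"
proof -
  show "l \<le> hyp l x" "\<bar>x\<bar> \<le> hyp l x" unfolding hyp_def by (rule real_le_rsqrt; simp)+
  then show "0 < hyp l x" using l by linarith
qed

lemma hyp'_le: "\<bar>hyp' l x\<bar> \<le> 1"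
  using hyp_ge(2,3)[of x] by (simp add: hyp'_def abs_divide)

text \<open>The gap \<open>hyp l a - hyp' l a * a\<close> is l^2 / hyp l a: the function is
  homogeneous of degree one up to the error l.\<close>

lemma hyp_le_tangent: "hyp l a \<le> hyp' l a * a + l"
proof -
  have "hyp l a * hyp l a \<le> a * a + l * hyp l a"
    using hyp_sq[of a] mult_left_mono[OF hyp_ge(1)[of a], of l] l by (simp add: power2_eq_square)
  then show ?thesis using hyp_ge(3)[of a] by (simp add: hyp'_def field_simps)
qed

lemma hyp_remainder:
  "hyp l b - hyp l a - hyp' l a * (b - a) = (hyp l a * hyp l b - l\<^sup>2 - a * b) / hyp l a"
proof -
  have "hyp l a * (hyp l b - hyp l a - hyp' l a * (b - a)) = hyp l a * hyp l b - hyp l a * hyp l a - a * (b - a)"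
    using hyp_ge(3)[of a] by (simp add: hyp'_def right_diff_distrib)
  also have "\<dots> = hyp l a * hyp l b - l\<^sup>2 - a * b"
    unfolding hyp_sq by (simp add: power2_eq_square algebra_simps)
  finally show ?thesis using hyp_ge(3)[of a] by (simp add: field_simps)
qed

text \<open>With A = hyp l a and B = hyp l b, the vectors (l / A, a / A) and (l / B, b / B) have
  norm 1, and the remainder of the tangent at a is exactly B / 2 times their squared distance.
  Dropping the first components and using B \<ge> l gives the bound.\<close>

lemma hyp_coercive: "l / 2 * (hyp' l a - hyp' l b)\<^sup>2 \<le> hyp l b - hyp l a - hyp' l a * (b - a)"
proof -
  define A B where "A = hyp l a" and "B = hyp l b"
  have AB: "A > 0" "B > 0" "l \<le> B" and sq: "A * A = l\<^sup>2 + a\<^sup>2" "B * B = l\<^sup>2 + b\<^sup>2"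
    using hyp_ge hyp_sq by (auto simp: A_def B_def)
  have "(a / A - b / B)\<^sup>2 + (l / A - l / B)\<^sup>2 = (l\<^sup>2 + a\<^sup>2) / (A * A) + (l\<^sup>2 + b\<^sup>2) / (B * B) - 2 * (l\<^sup>2 + a * b) / (A * B)"
    using AB by (simp add: power2_eq_square field_simps)
  also have "\<dots> = 2 * (A * B - l\<^sup>2 - a * b) / (A * B)"
    unfolding sq[symmetric] using AB by (simp add: field_simps)
  finally have eq: "(A * B - l\<^sup>2 - a * b) / A = B / 2 * ((a / A - b / B)\<^sup>2 + (l / A - l / B)\<^sup>2)"
    using AB by (simp add: field_simps)
  have "l / 2 * (a / A - b / B)\<^sup>2 \<le> B / 2 * (a / A - b / B)\<^sup>2" using AB by (intro mult_right_mono) auto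
  also have "\<dots> \<le> B / 2 * ((a / A - b / B)\<^sup>2 + (l / A - l / B)\<^sup>2)" using AB by (intro mult_left_mono) auto
  finally show ?thesis unfolding hyp_remainder eq[unfolded A_def B_def, symmetric]
    unfolding A_def B_def hyp'_def eq[unfolded A_def B_def, symmetric] by simp
qed

text \<open>Multiplying A B - (l^2 + a b) by its conjugate leaves l^2 (a - b)^2, the defect in the
  Cauchy-Schwarz inequality for (l, a) and (l, b). This form shows how the remainder decays for
  large arguments.\<close>

lemma hyp_remainder_eq:
  "hyp l b - hyp l a - hyp' l a * (b - a) = l\<^sup>2 * (a - b)\<^sup>2 / (hyp l a * (hyp l a * hyp l b + l\<^sup>2 + a * b))"
  and hyp_denom_pos: "l\<^sup>2 \<le> hyp l a * hyp l b + l\<^sup>2 + a * b"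
proof -
  define A B where "A = hyp l a" and "B = hyp l b"
  have AB: "A > 0" "B > 0" "\<bar>a\<bar> \<le> A" "\<bar>b\<bar> \<le> B" and sq: "A * A = l\<^sup>2 + a\<^sup>2" "B * B = l\<^sup>2 + b\<^sup>2"
    using hyp_ge hyp_sq by (auto simp: A_def B_def)
  have "\<bar>a * b\<bar> \<le> A * B" using AB by (simp add: abs_mult mult_mono)
  then show d: "l\<^sup>2 \<le> hyp l a * hyp l b + l\<^sup>2 + a * b" by (simp add: A_def B_def abs_le_iff)
  have pos: "A * B + l\<^sup>2 + a * b > 0" using d l zero_less_power[of l 2] unfolding A_def B_def by linarith
  have "(A * B - l\<^sup>2 - a * b) * (A * B + l\<^sup>2 + a * b) = (A * A) * (B * B) - (l\<^sup>2 + a * b)\<^sup>2"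
    by (simp add: power2_eq_square algebra_simps)
  also have "\<dots> = l\<^sup>2 * (a - b)\<^sup>2" unfolding sq by (simp add: power2_eq_square algebra_simps)
  finally have "(A * B - l\<^sup>2 - a * b) = l\<^sup>2 * (a - b)\<^sup>2 / (A * B + l\<^sup>2 + a * b)"
    using pos by (simp add: field_simps)
  then show "hyp l b - hyp l a - hyp' l a * (b - a) = l\<^sup>2 * (a - b)\<^sup>2 / (hyp l a * (hyp l a * hyp l b + l\<^sup>2 + a * b))"
    unfolding hyp_remainder A_def B_def by (simp add: mult.commute)
qed

lemma hyp_le_quadratic: "hyp l b \<le> hyp l a + hyp' l a * (b - a) + (b - a)\<^sup>2 / l"
proof -
  have "l * l\<^sup>2 \<le> hyp l a * (hyp l a * hyp l b + l\<^sup>2 + a * b)"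
    using hyp_ge(1)[of a] hyp_denom_pos[of a b] l by (intro mult_mono) auto
  then have "l\<^sup>2 * (a - b)\<^sup>2 / (hyp l a * (hyp l a * hyp l b + l\<^sup>2 + a * b)) \<le> l\<^sup>2 * (a - b)\<^sup>2 / (l * l\<^sup>2)"
    using l by (intro frac_le) auto
  also have "\<dots> = (b - a)\<^sup>2 / l" using l by (simp add: power2_commute)
  finally show ?thesis using hyp_remainder_eq[of b a] by linarith
qed

text \<open>The direction a + f grows with a, so a quadratic bound alone is not uniform. The
  curvature of hyp decays like the cube of 1 / |a| and absorbs the square of the direction. The
  restriction \<bar>\<tau>\<bar> \<le> 1/2 prevents a and its perturbation from having opposite
  signs when |a| \<ge> |f|; for smaller a the direction is bounded by 2 K.\<close>

lemma hyp_le_scaling: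
  assumes \<tau>: "\<bar>\<tau>\<bar> \<le> 1/2" and f: "\<bar>f\<bar> \<le> K"
  shows "hyp l (a + \<tau> * (a + f)) \<le> hyp l a + hyp' l a * (\<tau> * (a + f)) + (4 * l + 4 * K\<^sup>2 / l) * \<tau>\<^sup>2"
proof (cases "\<bar>a\<bar> \<ge> \<bar>f\<bar>")
  case True
  define b where "b = a + \<tau> * (a + f)"
  have "\<bar>\<tau> * (a * (a + f))\<bar> \<le> 1/2 * (\<bar>a\<bar> * (2 * \<bar>a\<bar>))"
    unfolding abs_mult using \<tau> True by (intro mult_mono) auto
  then have "a * b \<ge> 0" by (simp add: b_def algebra_simps abs_le_iff)
  then have den: "hyp l a * (hyp l a * l) \<le> hyp l a * (hyp l a * hyp l b + l\<^sup>2 + a * b)"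
    using hyp_ge[of a] mult_left_mono[OF hyp_ge(1)[of b], of "hyp l a"] zero_le_power2[of l]
    by (intro mult_left_mono) linarith+
  have "(a + f)\<^sup>2 \<le> (2 * \<bar>a\<bar>)\<^sup>2" using True by (intro power2_le_iff_abs_le[THEN iffD2]) auto
  then have af: "(a + f)\<^sup>2 \<le> 4 * (hyp l a * hyp l a)" unfolding hyp_sq using zero_le_power2[of l]
    by (simp add: power_mult_distrib add_increasing)
  have "l\<^sup>2 * (a - b)\<^sup>2 / (hyp l a * (hyp l a * hyp l b + l\<^sup>2 + a * b)) \<le> l\<^sup>2 * (a - b)\<^sup>2 / (hyp l a * (hyp l a * l))"
    using l hyp_ge(3)[of a] den by (intro frac_le) auto
  also have "\<dots> = l * \<tau>\<^sup>2 * ((a + f)\<^sup>2 / (hyp l a * hyp l a))"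
    using l hyp_ge(3)[of a] by (simp add: b_def power2_eq_square)
  also have "\<dots> \<le> l * \<tau>\<^sup>2 * 4"
    using l af hyp_ge(3)[of a] by (intro mult_left_mono) (auto simp: field_simps)
  finally have "hyp l b \<le> hyp l a + hyp' l a * (b - a) + 4 * l * \<tau>\<^sup>2"
    using hyp_remainder_eq[of b a] by linarith
  moreover have "0 \<le> 4 * K\<^sup>2 / l * \<tau>\<^sup>2" using l by simp
  ultimately show ?thesis unfolding b_def distrib_right by simp
next
  case False
  have "(a + f)\<^sup>2 \<le> (2 * K)\<^sup>2" using False f by (intro power2_le_iff_abs_le[THEN iffD2]) auto
  then have "(\<tau> * (a + f))\<^sup>2 / l \<le> (4 * K\<^sup>2 / l) * \<tau>\<^sup>2"
    using l divide_right_mono[OF mult_left_mono[of "(a + f)\<^sup>2" "(2*K)\<^sup>2" "\<tau>\<^sup>2"], of l]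
    unfolding power_mult_distrib by (simp add: mult.commute)
  then have "(\<tau> * (a + f))\<^sup>2 / l \<le> (4 * l + 4 * K\<^sup>2 / l) * \<tau>\<^sup>2"
    using l unfolding distrib_right by (simp add: add_increasing)
  then show ?thesis using hyp_le_quadratic[of "a + \<tau> * (a + f)" a] by simp
qed

lemma hyp_measurable [measurable]: "hyp l \<in> borel_measurable borel" "hyp' l \<in> borel_measurable borel"
  unfolding hyp'_def[abs_def] hyp_def[abs_def] by measurable

end

text \<open>The duality principle of Hahn-Banach type, obtained by minimisation. Along a minimising
  sequence for the integral of \<open>hyp l (F - f)\<close> the weights
  \<open>hyp' l (F - f)\<close> converge to some \<Theta>. Stationarity in every direction of R
  makes \<Theta> an annihilator of R, hence constant, and constants annihilate f. By
  \<open>hyp_le_tangent\<close> the minimum is at most the limit of the pairings with F - f plus l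
  m; the pairing with f vanishes in the limit and the one with F does not stay positive.\<close>

lemma L1_approximation_if_annihilator_const:
  fixes M :: "'a measure" and f :: "'a \<Rightarrow> real"
  assumes fin: "finite_measure M"
    and R: "\<And>F. F \<in> R \<Longrightarrow> F \<in> borel_measurable M" "\<And>F. F \<in> R \<Longrightarrow> integrable M (\<lambda>x. (F x)\<^sup>2)"
    and lin: "\<And>F G c. F \<in> R \<Longrightarrow> G \<in> R \<Longrightarrow> (\<lambda>x. F x + c * G x) \<in> R" and ne: "R \<noteq> {}"
    and const: "\<And>\<theta>. \<theta> \<in> borel_measurable M \<Longrightarrow> (\<And>x. \<bar>\<theta> x\<bar> \<le> 1) \<Longrightarrow>
       (\<And>F. F \<in> R \<Longrightarrow> (\<integral>x. \<theta> x * F x \<partial>M) = 0) \<Longrightarrow> \<exists>c. AE x in M. \<theta> x = c"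
    and f [measurable]: "f \<in> borel_measurable M" and fK: "\<And>x. x \<in> space M \<Longrightarrow> \<bar>f x\<bar> \<le> K" and f0: "(\<integral>x. f x \<partial>M) = 0"
    and lam: "lam > 0"
  shows "\<exists>F\<in>R. (\<integral>x. \<bar>F x - f x\<bar> \<partial>M) < lam"
proof -
  interpret finite_measure M by fact
  define m where "m = measure M (space M)"
  have m: "m \<ge> 0" by (simp add: m_def)
  \<comment> \<open>Chosen so that l m < lam; the denominator m + 1 also covers a measure of mass
    0.\<close>
  define l where "l = lam / (m + 1)"
  have l: "l > 0" using lam m by (simp add: l_def)
  have lm: "l * m < lam" using lam m by (simp add: l_def field_simps)
  note [measurable] = R(1)
  have Ri: "integrable M F" if "F \<in> R" for F
    by (rule square_integrable_imp_integrable[OF R(1)[OF that] R(2)[OF that]])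
  have fi: "integrable M f" by (rule integrable_const_bound[where B=K]) (auto intro!: AE_I2 fK)
  note hm [measurable] = hyp_measurable[OF l]
  have hi: "integrable M (\<lambda>x. hyp l (F x - f x))" if [measurable]: "F \<in> R" for F
  proof (rule Bochner_Integration.integrable_bound)
    show "integrable M (\<lambda>x. l + \<bar>F x\<bar> + \<bar>f x\<bar>)"
      using Ri[OF that] fi by auto
    have "\<bar>hyp l y\<bar> \<le> l + \<bar>y\<bar>" for y
      using hyp_ge(3)[OF l, of y] l sqrt_add_le_add_sqrt[of "l\<^sup>2" "y\<^sup>2"] by (simp add: hyp_def)
    then show "AE x in M. norm (hyp l (F x - f x)) \<le> norm (l + \<bar>F x\<bar> + \<bar>f x\<bar>)"
      using l by (intro AE_I2) (smt (verit) real_norm_def)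
  qed measurable
  define N where "N F = (\<integral>x. hyp l (F x - f x) \<partial>M)" for F
  define I where "I = (INF F\<in>R. N F)"
  have N0: "0 \<le> N F" for F unfolding N_def using hyp_ge(3)[OF l] by (intro integral_nonneg_AE AE_I2) (simp add: less_imp_le)
  have bdd: "bdd_below (N ` R)" by (rule bdd_belowI[of _ 0]) (use N0 in auto)
  have I_le: "I \<le> N F" if "F \<in> R" for F unfolding I_def using bdd that by (rule cINF_lower)
  have "\<exists>F\<in>R. N F < I + (1/4)^n" for n
  proof -
    have "Inf (N ` R) < I + (1/4)^n" unfolding I_def by simp
    then show ?thesis using cInf_less_iff[of "N ` R"] ne bdd by auto
  qed
  then obtain F where F: "\<And>n. F n \<in> R" "\<And>n. N (F n) < I + (1/4)^n" by metis
  define \<theta> where "\<theta> n x = hyp' l (F n x - f x)" for n x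
  have [measurable]: "F n \<in> borel_measurable M" for n using F(1) R(1) by blast
  have [measurable]: "\<theta> n \<in> borel_measurable M" for n unfolding \<theta>_def by measurable
  have \<theta>1: "\<bar>\<theta> n x\<bar> \<le> 1" for n x unfolding \<theta>_def by (rule hyp'_le[OF l])
  have bi: "integrable M (\<lambda>x. u x * G x)" if [measurable]: "u \<in> borel_measurable M" "\<And>x. \<bar>u x\<bar> \<le> 1" and G: "integrable M G" for u G :: "'a \<Rightarrow> real"
  proof (rule Bochner_Integration.integrable_bound[OF G])
    show "(\<lambda>x. u x * G x) \<in> borel_measurable M" using G by measurable
    show "AE x in M. norm (u x * G x) \<le> norm (G x)"
      using that(2) by (intro AE_I2) (simp add: abs_mult mult_left_le_one_le)
  qed
  have ui: "integrable M u" if "u \<in> borel_measurable M" "\<And>x. \<bar>u x\<bar> \<le> B" for u :: "'a \<Rightarrow> real" and B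
    by (rule integrable_const_bound[where B=B]) (use that in auto)
  \<comment> \<open>The remainder estimate of \<open>hyp\<close> at the midpoint makes the derivatives along a minimising
    sequence Cauchy in \<open>L\<^sup>2\<close>, although the sequence itself need not converge.\<close>
  have cauchy: "l / 4 * (\<integral>x. (\<theta> (Suc n) x - \<theta> n x)\<^sup>2 \<partial>M) \<le> 2 * (1/4)^n" for n
  proof -
    define G where "G x = F n x + (1/2) * (F (Suc n) x + (-1) * F n x)" for x
    have GR: "G \<in> R" unfolding G_def using F(1) by (intro lin) auto
    have [measurable]: "G \<in> borel_measurable M" using GR by (rule R(1))
    have pt: "l / 4 * (\<theta> (Suc n) x - \<theta> n x)\<^sup>2 \<le> hyp l (F n x - f x) + hyp l (F (Suc n) x - f x) - 2 * hyp l (G x - f x)" for x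
    proof -
      let ?g = "hyp' l (G x - f x)"
      have "F n x - f x - (G x - f x) = - (F (Suc n) x - f x - (G x - f x))"
        by (simp add: G_def field_simps)
      then have "?g * (F n x - f x - (G x - f x)) = - (?g * (F (Suc n) x - f x - (G x - f x)))"
        by (simp only: mult_minus_right)
      then have "l / 2 * (?g - \<theta> n x)\<^sup>2 + l / 2 * (?g - \<theta> (Suc n) x)\<^sup>2
         \<le> hyp l (F n x - f x) + hyp l (F (Suc n) x - f x) - 2 * hyp l (G x - f x)"
        using hyp_coercive[OF l, of "G x - f x" "F n x - f x"] hyp_coercive[OF l, of "G x - f x" "F (Suc n) x - f x"]
        unfolding \<theta>_def by linarith
      moreover have "(\<theta> (Suc n) x - \<theta> n x)\<^sup>2 \<le> 2 * (?g - \<theta> n x)\<^sup>2 + 2 * (?g - \<theta> (Suc n) x)\<^sup>2"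
        using zero_le_power2[of "(?g - \<theta> n x) + (?g - \<theta> (Suc n) x)"] by (simp add: power2_eq_square algebra_simps)
      then have "l / 4 * (\<theta> (Suc n) x - \<theta> n x)\<^sup>2 \<le> l / 4 * (2 * (?g - \<theta> n x)\<^sup>2 + 2 * (?g - \<theta> (Suc n) x)\<^sup>2)"
        using l by (intro mult_left_mono) auto
      ultimately show ?thesis by (simp add: algebra_simps)
    qed
    have "\<bar>(\<theta> (Suc n) x - \<theta> n x)\<^sup>2\<bar> \<le> 4" for x
      using \<theta>1[of n x] \<theta>1[of "Suc n" x] power2_le_iff_abs_le[of 2 "\<theta> (Suc n) x - \<theta> n x"] by auto
    then have "integrable M (\<lambda>x. (\<theta> (Suc n) x - \<theta> n x)\<^sup>2)" by (intro ui) measurable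
    then have "(\<integral>x. l / 4 * (\<theta> (Suc n) x - \<theta> n x)\<^sup>2 \<partial>M) \<le>
        (\<integral>x. hyp l (F n x - f x) + hyp l (F (Suc n) x - f x) - 2 * hyp l (G x - f x) \<partial>M)"
      using hi[OF F(1)] hi[OF GR] by (intro integral_mono pt) auto
    also have "\<dots> = N (F n) + N (F (Suc n)) - 2 * N G"
      using hi[OF F(1)] hi[OF GR] by (simp add: N_def)
    also have "\<dots> \<le> (1/4)^n + (1/4)^Suc n" using F(2)[of n] F(2)[of "Suc n"] I_le[OF GR] by linarith
    also have "\<dots> \<le> 2 * (1/4)^n" by simp
    finally show ?thesis by simp
  qed
  have L1: "(\<integral>x. \<bar>\<theta> (Suc n) x - \<theta> n x\<bar> \<partial>M) \<le> (m + 8 / l) * (1/2)^n" for n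
  proof -
    let ?d = "\<lambda>x. \<theta> (Suc n) x - \<theta> n x"
    have d2: "\<bar>?d x\<bar> \<le> 2" for x using \<theta>1[of n x] \<theta>1[of "Suc n" x] by linarith
    then have "(?d x)\<^sup>2 \<le> 4" for x using power2_le_iff_abs_le[of 2 "?d x"] by auto
    then have i: "integrable M (\<lambda>x. (?d x)\<^sup>2)" "integrable M (\<lambda>x. \<bar>?d x\<bar>)"
      using d2 by (auto intro!: ui)
    \<comment> \<open>Weighted inequality of arithmetic and geometric mean: the factor 2^n turns the
      bound of order (1/4)^n for the integral of the square into an L1 bound of order (1/2)^n, which
      is summable.\<close>
    have "\<bar>?d x\<bar> \<le> (1/2)^n + 2^n * (?d x)\<^sup>2" for x
    proof -
      have "2 * ((1/2)^n * \<bar>2^n * ?d x\<bar>) \<le> (1/2)^n * (1 + (2^n * ?d x)\<^sup>2)"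
        using mult_left_mono[OF zero_le_power2[of "\<bar>2^n * ?d x\<bar> - 1"], of "(1/2::real)^n"]
        by (simp add: power2_eq_square algebra_simps)
      moreover have "(1/2)^n * \<bar>2^n * ?d x\<bar> = \<bar>?d x\<bar>" "(1/2)^n * (2^n * ?d x)\<^sup>2 = 2^n * (?d x)\<^sup>2"
        by (auto simp: abs_mult power_one_over power_mult_distrib power2_eq_square)
      ultimately have "2 * \<bar>?d x\<bar> \<le> (1/2)^n + 2^n * (?d x)\<^sup>2" by (simp only: distrib_left mult_1_right)
      then show ?thesis by (rule order_trans[rotated]) simp
    qed
    then have "(\<integral>x. \<bar>?d x\<bar> \<partial>M) \<le> (\<integral>x. (1/2)^n + 2^n * (?d x)\<^sup>2 \<partial>M)"
      using i by (intro integral_mono) auto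
    also have "\<dots> = (1/2)^n * m + 2^n * (\<integral>x. (?d x)\<^sup>2 \<partial>M)" using i by (simp add: m_def)
    also have "\<dots> \<le> (1/2)^n * m + 2^n * (8 / l * (1/4)^n)"
      using cauchy[of n] l by (intro add_left_mono mult_left_mono) (auto simp: field_simps)
    also have "2^n * (8 / l * (1/4)^n) = 8 / l * (1/2)^n"
    proof -
      have "(2::real)^n * (1/4)^n = (1/2)^n" by (simp flip: power_mult_distrib)
      then show ?thesis by (metis mult.left_commute)
    qed
    finally show ?thesis by (simp add: algebra_simps)
  qed
  have conv: "AE x in M. convergent (\<lambda>n. \<theta> n x)"
    by (rule AE_convergent_if_L1_increments[OF Bochner_Integration.integrable_diff[OF ui ui] L1])
       (auto intro: \<theta>1)
  \<comment> \<open>Where the sequence diverges \<open>lim\<close> has an unspecified value; the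
    truncation makes the bound by 1 hold at every point, as \<open>const\<close> requires.\<close>
  define \<Theta> where "\<Theta> x = max (-1) (min 1 (lim (\<lambda>n. \<theta> n x)))" for x
  have \<Theta>m [measurable]: "\<Theta> \<in> borel_measurable M" unfolding \<Theta>_def by measurable
  have \<Theta>1: "\<bar>\<Theta> x\<bar> \<le> 1" for x by (auto simp: \<Theta>_def)
  have lim: "AE x in M. (\<lambda>n. \<theta> n x) \<longlonglongrightarrow> \<Theta> x"
    using conv
  proof eventually_elim
    case (elim x)
    then have c: "(\<lambda>n. \<theta> n x) \<longlonglongrightarrow> lim (\<lambda>n. \<theta> n x)" by (simp add: convergent_LIMSEQ_iff)
    have "-1 \<le> \<theta> n x" "\<theta> n x \<le> 1" for n using \<theta>1[of n x] by auto
    then have "-1 \<le> lim (\<lambda>n. \<theta> n x)" "lim (\<lambda>n. \<theta> n x) \<le> 1"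
      using c LIMSEQ_le_const[of "\<lambda>n. \<theta> n x"] LIMSEQ_le_const2[of "\<lambda>n. \<theta> n x"] by blast+
    then show ?case using c by (simp add: \<Theta>_def)
  qed
  have limint: "(\<lambda>n. \<integral>x. \<theta> n x * G x \<partial>M) \<longlonglongrightarrow> (\<integral>x. \<Theta> x * G x \<partial>M)" if G: "integrable M G" for G
  proof (rule integral_dominated_convergence[where w = "\<lambda>x. \<bar>G x\<bar>"])
    have [measurable]: "G \<in> borel_measurable M" using G by auto
    show "(\<lambda>x. \<Theta> x * G x) \<in> borel_measurable M" "\<And>n. (\<lambda>x. \<theta> n x * G x) \<in> borel_measurable M" by measurable
    show "AE x in M. (\<lambda>n. \<theta> n x * G x) \<longlonglongrightarrow> \<Theta> x * G x" using lim by eventually_elim (intro tendsto_intros)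
    show "AE x in M. norm (\<theta> n x * G x) \<le> \<bar>G x\<bar>" for n
      using \<theta>1 by (intro AE_I2) (simp add: abs_mult mult_left_le_one_le)
  qed (use G in auto)
  \<comment> \<open>First variation as an upper bound, with the second-order terms collected in rr.
    It serves both a fixed direction of R and the rescaling of \<open>F n\<close>.\<close>
  have variation: "N (\<lambda>x. F n x + c * G x) \<le> N (F n) + c * (\<integral>x. \<theta> n x * G x \<partial>M) + r"
    if G: "G \<in> R" and r: "\<And>x. x \<in> space M \<Longrightarrow> hyp l (F n x + c * G x - f x) \<le> hyp l (F n x - f x) + \<theta> n x * (c * G x) + rr x"
      and rr: "integrable M rr" "(\<integral>x. rr x \<partial>M) \<le> r" for n c G rr r
  proof -
    have "N (\<lambda>x. F n x + c * G x) \<le> (\<integral>x. hyp l (F n x - f x) + \<theta> n x * (c * G x) + rr x \<partial>M)"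
      unfolding N_def using hi[OF lin[OF F(1) G]] hi[OF F(1)] rr bi[OF _ \<theta>1 integrable_mult_right[OF Ri[OF G]]] r
      by (intro integral_mono Bochner_Integration.integrable_add) auto
    also have "\<dots> = N (F n) + c * (\<integral>x. \<theta> n x * G x \<partial>M) + (\<integral>x. rr x \<partial>M)"
      using hi[OF F(1)] rr bi[OF _ \<theta>1 Ri[OF G]] by (simp add: N_def mult.left_commute[of _ c])
    finally show ?thesis using rr(2) by linarith
  qed
  have annihilates: "(\<integral>x. \<Theta> x * G x \<partial>M) = 0" if G: "G \<in> R" for G
  proof -
    define Q where "Q = (\<integral>x. (G x)\<^sup>2 / l \<partial>M)"
    have v: "I \<le> I + (1/4)^n + c * (\<integral>x. \<theta> n x * G x \<partial>M) + c\<^sup>2 * Q" for n c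
    proof -
      have "N (\<lambda>x. F n x + c * G x) \<le> N (F n) + c * (\<integral>x. \<theta> n x * G x \<partial>M) + c\<^sup>2 * Q"
      proof (rule variation[OF G, where rr = "\<lambda>x. c\<^sup>2 * ((G x)\<^sup>2 / l)"])
        fix x
        show "hyp l (F n x + c * G x - f x) \<le> hyp l (F n x - f x) + \<theta> n x * (c * G x) + c\<^sup>2 * ((G x)\<^sup>2 / l)"
          using hyp_le_quadratic[OF l, of "F n x + c * G x - f x" "F n x - f x"] by (simp add: \<theta>_def power_mult_distrib)
      qed (use R(2)[OF G] in \<open>auto simp: Q_def\<close>)
      then show ?thesis using I_le[OF lin[OF F(1) G, of n c]] F(2)[of n] by linarith
    qed
    \<comment> \<open>The step (1/2)^n, taken with either sign, balances the excess (1/4)^n over the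
      infimum against the second-order term c^2 Q.\<close>
    have b: "\<bar>\<integral>x. \<theta> n x * G x \<partial>M\<bar> \<le> (1/2)^n * (1 + Q)" for n
    proof -
      let ?p = "\<integral>x. \<theta> n x * G x \<partial>M" and ?c = "(1/2::real)^n"
      have "?c * ?p \<le> ?c * (?c * (1 + Q))" "?c * (- ?p) \<le> ?c * (?c * (1 + Q))"
        using v[of n ?c] v[of n "- ?c"] by (auto simp: power2_eq_square algebra_simps simp flip: power_mult_distrib)
      moreover have "?c > 0" by simp
      ultimately have "?p \<le> ?c * (1 + Q)" "- ?p \<le> ?c * (1 + Q)"
        by (auto simp only: mult_le_cancel_left_pos)
      then show ?thesis by (simp only: abs_le_iff)
    qed
    have "(\<lambda>n. (1/2::real)^n * (1 + Q)) \<longlonglongrightarrow> 0" by (intro tendsto_mult_left_zero LIMSEQ_realpow_zero) auto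
    then have "(\<lambda>n. \<integral>x. \<theta> n x * G x \<partial>M) \<longlonglongrightarrow> 0"
      by (rule Lim_null_comparison[rotated]) (use b in auto)
    with limint[OF Ri[OF G]] show ?thesis using LIMSEQ_unique by blast
  qed
  obtain c where c: "AE x in M. \<Theta> x = c" using const[OF \<Theta>m \<Theta>1 annihilates] by blast
  then have "(\<integral>x. \<Theta> x * f x \<partial>M) = (\<integral>x. c * f x \<partial>M)"
    by (intro integral_cong_AE, simp, simp, eventually_elim) simp
  then have \<Theta>f: "(\<integral>x. \<Theta> x * f x \<partial>M) = 0" by (simp add: f0)
  \<comment> \<open>Stationarity under rescaling \<open>F n\<close> itself, which needs \<open>hyp'' l y * y\<^sup>2\<close> to be bounded.\<close>
  define C where "C = (4 * l + 4 * K\<^sup>2 / l) * m"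
  have scal: "(\<integral>x. \<theta> n x * F n x \<partial>M) \<le> (1/2)^n * (2 + C)" for n
  proof -
    \<comment> \<open>Negative, because an upper bound on the pairing with \<open>F n\<close> is
      wanted; halved, to meet the condition of \<open>hyp_le_scaling\<close> also for n = 0.\<close>
    define c where "c = - ((1/2::real)^n / 2)"
    have c1: "\<bar>c\<bar> \<le> 1/2" by (simp add: c_def power_le_one)
    have "N (\<lambda>x. F n x + c * F n x) \<le> N (F n) + c * (\<integral>x. \<theta> n x * F n x \<partial>M) + C * c\<^sup>2"
    proof (rule variation[OF F(1), where rr = "\<lambda>x. (4 * l + 4 * K\<^sup>2 / l) * c\<^sup>2"])
      fix x assume "x \<in> space M"
      then show "hyp l (F n x + c * F n x - f x) \<le> hyp l (F n x - f x) + \<theta> n x * (c * F n x) + (4 * l + 4 * K\<^sup>2 / l) * c\<^sup>2"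
        using hyp_le_scaling[OF l c1 fK, of x "F n x - f x"] by (simp add: \<theta>_def algebra_simps)
    qed (auto simp: C_def m_def)
    then have "(- c) * (\<integral>x. \<theta> n x * F n x \<partial>M) \<le> (1/4)^n + C * c\<^sup>2"
      using I_le[OF lin[OF F(1) F(1), of n c n]] F(2)[of n] by linarith
    also have "\<dots> = (- c) * ((1/2)^n * 2 + C * (- c))"
      by (simp add: c_def power2_eq_square algebra_simps flip: power_mult_distrib)
    finally have "(\<integral>x. \<theta> n x * F n x \<partial>M) \<le> (1/2)^n * 2 + C * (- c)"
      by (rule mult_left_le_imp_le) (simp add: c_def)
    also have "C * (- c) \<le> C * (1/2)^n"
      using l m by (intro mult_left_mono) (auto simp: c_def C_def)
    finally show ?thesis by (simp add: algebra_simps)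
  qed
  have Nle: "N (F n) \<le> (1/2)^n * (2 + C) - (\<integral>x. \<theta> n x * f x \<partial>M) + l * m" for n
  proof -
    have "N (F n) \<le> (\<integral>x. \<theta> n x * F n x - \<theta> n x * f x + l \<partial>M)"
      unfolding N_def
    proof (intro integral_mono hi F(1))
      show "integrable M (\<lambda>x. \<theta> n x * F n x - \<theta> n x * f x + l)"
        using bi[OF _ \<theta>1 Ri[OF F(1)]] bi[OF _ \<theta>1 fi] by simp
      show "hyp l (F n x - f x) \<le> \<theta> n x * F n x - \<theta> n x * f x + l" for x
        using hyp_le_tangent[OF l, of "F n x - f x"] by (simp add: \<theta>_def right_diff_distrib)
    qed
    also have "\<dots> = (\<integral>x. \<theta> n x * F n x \<partial>M) - (\<integral>x. \<theta> n x * f x \<partial>M) + l * m"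
      using bi[OF _ \<theta>1 Ri[OF F(1)]] bi[OF _ \<theta>1 fi] by (simp add: m_def)
    finally show ?thesis using scal[of n] by linarith
  qed
  have "(\<lambda>n. (1/2)^n * (2 + C) - (\<integral>x. \<theta> n x * f x \<partial>M) + l * m) \<longlonglongrightarrow> 0 * (2 + C) - 0 + l * m"
    using limint[OF fi] unfolding \<Theta>f by (intro tendsto_intros LIMSEQ_realpow_zero) auto
  then have "\<forall>\<^sub>F n in sequentially. (1/2)^n * (2 + C) - (\<integral>x. \<theta> n x * f x \<partial>M) + l * m < lam"
    using lm by (intro order_tendstoD(2)) auto
  then obtain n where n: "(1/2)^n * (2 + C) - (\<integral>x. \<theta> n x * f x \<partial>M) + l * m < lam"
    using eventually_happens'[OF sequentially_bot] by blast
  have "(\<integral>x. \<bar>F n x - f x\<bar> \<partial>M) \<le> N (F n)"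
    unfolding N_def using hi[OF F(1)] Ri[OF F(1)] fi hyp_ge(2)[OF l] by (intro integral_mono) auto
  then show ?thesis using Nle[of n] n F(1) by (intro bexI[of _ "F n"]) auto
qed

section \<open>Weak derivatives in time\<close>

text \<open>Because the mean is zero, the integral up to t is minus the integral beyond t, and on
  either side of the support one of the two vanishes. The expression through the integral beyond t
  is exported since Fubini is applied to it afterwards.\<close>

lemma primitive_of_mean_zero:
  fixes \<psi> :: "real \<Rightarrow> real"
  assumes cont: "continuous_on UNIV \<psi>" and supp: "\<And>t. t \<notin> {p..q} \<Longrightarrow> \<psi> t = 0" and pq: "0 < p" "q < 1"
    and int: "integrable lborel \<psi>" and zero: "(LINT r|lborel. \<psi> r) = 0"
  obtains \<xi> where "\<And>t. (\<xi> has_real_derivative \<psi> t) (at t)" "\<And>t. t \<notin> {p..q} \<Longrightarrow> \<xi> t = 0"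
    "\<And>t. \<xi> t = - (LINT r|lborel. indicator {t<..} r * \<psi> r)"
proof
  define \<xi> where "\<xi> t = - (LINT r|lborel. indicator {t<..} r * \<psi> r)" for t
  have [measurable]: "\<psi> \<in> borel_measurable borel" using int by auto
  have ii: "integrable lborel (\<lambda>r. indicator A r * \<psi> r)" if "A \<in> sets borel" for A
    using integrable_mult_indicator[OF _ int, of A] that by simp
  have eq: "\<xi> t = (LINT r|lborel. indicator {..t} r * \<psi> r)" for t
  proof -
    have "(LINT r|lborel. \<psi> r) = (LINT r|lborel. indicator {..t} r * \<psi> r + indicator {t<..} r * \<psi> r)"
      by (intro Bochner_Integration.integral_cong) (auto simp: indicator_def)
    then show ?thesis using ii[of "{..t}"] ii[of "{t<..}"] zero by (simp add: \<xi>_def)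
  qed
  show "\<xi> t = - (LINT r|lborel. indicator {t<..} r * \<psi> r)" for t by (simp add: \<xi>_def)
  show "\<xi> t = 0" if "t \<notin> {p..q}" for t
  proof (cases "t < p")
    case True
    then have "(LINT r|lborel. indicator {..t} r * \<psi> r) = (LINT (r::real)|lborel. 0)"
      by (intro Bochner_Integration.integral_cong) (auto simp: indicator_def intro!: supp)
    then show ?thesis by (simp add: eq)
  next
    case False
    then have "(LINT r|lborel. indicator {t<..} r * \<psi> r) = (LINT (r::real)|lborel. 0)"
      using that by (intro Bochner_Integration.integral_cong) (auto simp: indicator_def intro!: supp)
    then show ?thesis by (simp add: \<xi>_def)
  qed
  show "(\<xi> has_real_derivative \<psi> t) (at t)" for t
  proof -
    define a where "a = t - 1"
    have x: "\<xi> r = \<xi> a + integral {a..r} \<psi>" if "r \<ge> a" for r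
    proof -
      have "(LINT r'|lborel. indicator {..r} r' * \<psi> r') = (LINT r'|lborel. indicator {..a} r' * \<psi> r' + indicator {a<..r} r' * \<psi> r')"
        using that by (intro Bochner_Integration.integral_cong) (auto simp: indicator_def)
      then have "\<xi> r = \<xi> a + (LINT r'|lborel. indicator {a<..r} r' * \<psi> r')"
        using ii[of "{..a}"] ii[of "{a<..r}"] by (simp add: eq)
      also have "(LINT r'|lborel. indicator {a<..r} r' * \<psi> r') = (LINT r':{a..r}|lborel. \<psi> r')"
        unfolding set_lebesgue_integral_def
        by (intro integral_cong_AE, simp, simp, use AE_lborel_singleton[of a] in eventually_elim) (auto simp: indicator_def)
      also have "\<dots> = integral {a..r} \<psi>"
        using ii[of "{a..r}"] by (intro set_borel_integral_eq_integral) (auto simp: set_integrable_def)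
      finally show ?thesis .
    qed
    have "((\<lambda>r. integral {a..r} \<psi>) has_real_derivative \<psi> t) (at t within {a..t+1})"
      by (rule integral_has_real_derivative) (auto simp: a_def intro: continuous_on_subset[OF cont])
    then have "((\<lambda>r. \<xi> a + integral {a..r} \<psi>) has_real_derivative \<psi> t) (at t within {a<..<t+1})"
      by (auto intro!: derivative_eq_intros elim: has_field_derivative_subset)
    then have "((\<lambda>r. \<xi> a + integral {a..r} \<psi>) has_real_derivative \<psi> t) (at t)"
      by (subst (asm) at_within_open) (auto simp: a_def)
    then show ?thesis
      by (rule has_field_derivative_transform_within_open[where S = "{a<..<t+1}"])
         (simp, simp add: a_def, rule x[symmetric], simp)
  qed
qed

text \<open>In the sense of distributions on (0,1), the image of b M under \<tau> is the derivative
  of the image of a M.\<close>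

definition weak_derivative01 :: "'a measure \<Rightarrow> ('a \<Rightarrow> real) \<Rightarrow> ('a \<Rightarrow> real) \<Rightarrow> ('a \<Rightarrow> real) \<Rightarrow> bool" where
  "weak_derivative01 M \<tau> a b \<longleftrightarrow>
     (\<forall>\<xi> \<xi>' p q. smooth_fun \<xi> \<and> (\<forall>t. (\<xi> has_real_derivative \<xi>' t) (at t)) \<and> 0 < p \<and> q < 1 \<and>
        (\<forall>t. t \<notin> {p..q} \<longrightarrow> \<xi> t = 0) \<longrightarrow> (\<integral>x. \<xi>' (\<tau> x) * a x + \<xi> (\<tau> x) * b x \<partial>M) = 0)"

text \<open>Smooth functions of mean zero with compact support in (0,1) are derivatives of
  admissible tests. Hence the defect between the image of a M and the density B, the cumulative
  integral of b, vanishes on such functions and is a constant multiple c of Lebesgue measure. In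
  particular the image of a M has a density on (0,1), whatever the law of \<tau>.\<close>

lemma du_Bois_Reymond:
  fixes a b \<tau> :: "'a \<Rightarrow> real"
  assumes fin: "finite_measure M" and a: "integrable M a" and b: "integrable M b"
    and \<tau> [measurable]: "\<tau> \<in> borel_measurable M"
    and weak: "weak_derivative01 M \<tau> a b"
  obtains c where "\<And>s t. 0 \<le> s \<Longrightarrow> s \<le> t \<Longrightarrow> t \<le> 1 \<Longrightarrow>
     (\<integral>x. indicator {s<..<t} (\<tau> x) * a x \<partial>M)
       = (LINT r:{s..t}|lborel. c + (\<integral>x. indicator {..<r} (\<tau> x) * b x \<partial>M))"
proof -
  interpret finite_measure M by fact
  interpret pair_sigma_finite M lborel ..
  have [measurable]: "a \<in> borel_measurable M" "b \<in> borel_measurable M" using a b by auto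
  define B where "B r = (\<integral>x. indicator {..<r} (\<tau> x) * b x \<partial>M)" for r
  have [measurable]: "B \<in> borel_measurable borel"
  proof -
    have "B = (\<lambda>r. \<integral>x. (if \<tau> x < r then 1 else 0) * b x \<partial>M)"
      unfolding B_def by (intro ext Bochner_Integration.integral_cong) (auto simp: indicator_def)
    then show ?thesis by simp
  qed
  have Bb: "\<bar>B r\<bar> \<le> (\<integral>x. \<bar>b x\<bar> \<partial>M)" for r
  proof -
    have "\<bar>B r\<bar> \<le> (\<integral>x. \<bar>indicator {..<r} (\<tau> x) * b x\<bar> \<partial>M)" unfolding B_def by (rule integral_abs_bound)
    also have "\<dots> \<le> (\<integral>x. \<bar>b x\<bar> \<partial>M)"
      using b by (intro integral_mono_AE integrable_abs Bochner_Integration.integrable_bound[OF b])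
         (auto simp: indicator_def)
    finally show ?thesis .
  qed
  let ?\<beta> = "\<lambda>s t n. bump s t n"
  have bc: "continuous_on UNIV (?\<beta> s t n)" for s t n by (rule smooth_continuous[OF smooth_bump])
  have [measurable]: "?\<beta> s t n \<in> borel_measurable borel" for s t n using bc by (rule borel_measurable_continuous_onI)
  have bump_le: "\<bar>?\<beta> s t n r\<bar> \<le> indicator {s..t} r" for s t n r
    using bump_nonneg[of s t n r] bump_le_1[of s t n r] bump_outside[of r s t n] by (auto simp: indicator_def)
  have indi: "integrable lborel (\<lambda>r. indicator {s..t} r * K)" for s t K :: real
    by (cases "s \<le> t") (auto simp: integrable_real_indicator)
  have bi: "integrable lborel (?\<beta> s t n)" for s t n
    by (rule Bochner_Integration.integrable_bound[OF indi[of s t 1]]) (use bump_le in auto)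
  define \<Phi> where "\<Phi> \<beta> = (\<integral>x. \<beta> (\<tau> x) * a x \<partial>M) - (LINT r|lborel. \<beta> r * B r)" for \<beta> :: "real \<Rightarrow> real"
  define Z where "Z s t n = (LINT r|lborel. ?\<beta> s t n r)" for s t n
  have ia: "integrable M (\<lambda>x. ?\<beta> s t n (\<tau> x) * a x)" for s t n
  proof (rule Bochner_Integration.integrable_bound[OF a])
    show "AE x in M. norm (?\<beta> s t n (\<tau> x) * a x) \<le> norm (a x)"
      using bump_nonneg[of s t n] bump_le_1[of s t n]
      by (intro AE_I2) (simp add: abs_mult mult_left_le_one_le)
  qed measurable
  have iB: "integrable lborel (\<lambda>r. ?\<beta> s t n r * B r)" for s t n
    by (rule Bochner_Integration.integrable_bound[OF indi[of s t "\<integral>x. \<bar>b x\<bar> \<partial>M"]])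
       (use bump_le Bb in \<open>auto simp: abs_mult intro!: mult_mono AE_I2\<close>)
  \<comment> \<open>Fubini trades the density B against the primitive of \<psi> evaluated at \<tau>,
    which up to sign is the test function.\<close>
  have Fub: "(LINT r|lborel. \<psi> r * B r) = (\<integral>x. b x * (LINT r|lborel. indicator {\<tau> x<..} r * \<psi> r) \<partial>M)"
    if \<psi>: "integrable lborel \<psi>" for \<psi>
  proof -
    have [measurable]: "\<psi> \<in> borel_measurable borel" using \<psi> by auto
    let ?f = "\<lambda>(x, r). b x * (indicator {\<tau> x<..} r * \<psi> r)"
    have mi: "Measurable.pred (M \<Otimes>\<^sub>M borel) (\<lambda>p. snd p \<in> {\<tau> (fst p)<..})" by simp
    have fm [measurable]: "?f \<in> borel_measurable (M \<Otimes>\<^sub>M lborel)"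
    proof -
      have "?f = (\<lambda>p. b (fst p) * ((if \<tau> (fst p) < snd p then 1 else 0) * \<psi> (snd p)))"
        by (auto simp: indicator_def)
      then show ?thesis by simp
    qed
    have int2: "integrable (M \<Otimes>\<^sub>M lborel) (\<lambda>(x, r). b x * \<psi> r)"
      by (rule Fubini_integrable) (use b \<psi> in \<open>auto simp: abs_mult\<close>)
    have "integrable (M \<Otimes>\<^sub>M lborel) ?f"
      by (rule Bochner_Integration.integrable_bound[OF int2 fm]) (auto simp: indicator_def)
    from Fubini_integral[OF this]
    have "(LINT r|lborel. (\<integral>x. b x * (indicator {\<tau> x<..} r * \<psi> r) \<partial>M)) =
        (\<integral>x. (LINT r|lborel. b x * (indicator {\<tau> x<..} r * \<psi> r)) \<partial>M)" by simp
    moreover have "(\<integral>x. b x * (indicator {\<tau> x<..} r * \<psi> r) \<partial>M) = \<psi> r * B r" for r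
      unfolding B_def integral_mult_right_zero[symmetric]
      by (intro Bochner_Integration.integral_cong) (auto simp: indicator_def)
    ultimately show ?thesis by simp
  qed
  \<comment> \<open>Weighting each bump with the total integral of the other produces a function of
    mean zero; so the ratio of defect to integral is the same for all bumps.\<close>
  have zero: "\<Phi> (?\<beta> s t n) * Z s' t' n' = \<Phi> (?\<beta> s' t' n') * Z s t n"
    if st: "0 \<le> s" "t \<le> 1" "0 \<le> s'" "t' \<le> 1" for s t s' t' n n'
  proof -
    define \<psi> where "\<psi> r = ?\<beta> s t n r * Z s' t' n' - ?\<beta> s' t' n' r * Z s t n" for r
    \<comment> \<open>For n = 0 the bump is identically 0 while 1 / n evaluates to 0; any positive
      margin is then correct, here 1/2.\<close>
    define e where "e = min (if n = 0 then 1/2 else 1 / n) (if n' = 0 then 1/2 else 1 / n')"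
    have e: "e > 0" "n > 0 \<Longrightarrow> e \<le> 1 / n" "n' > 0 \<Longrightarrow> e \<le> 1 / n'" by (auto simp: e_def)
    have supp: "\<psi> r = 0" if "r \<notin> {e..1 - e}" for r
    proof -
      have "?\<beta> s t n r = 0"
        using that st e by (cases "n = 0") (auto intro!: bump_eq_0)
      moreover have "?\<beta> s' t' n' r = 0"
        using that st e by (cases "n' = 0") (auto intro!: bump_eq_0)
      ultimately show ?thesis by (simp add: \<psi>_def)
    qed
    have \<psi>i: "integrable lborel \<psi>" unfolding \<psi>_def using bi by auto
    have \<psi>0: "(LINT r|lborel. \<psi> r) = 0" unfolding \<psi>_def using bi by (simp add: Z_def)
    have \<psi>s: "smooth_fun \<psi>" unfolding \<psi>_def by (intro smooth_diff smooth_mult smooth_bump smooth_const)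
    obtain \<xi> where \<xi>: "\<And>t. (\<xi> has_real_derivative \<psi> t) (at t)" "\<And>t. t \<notin> {e..1 - e} \<Longrightarrow> \<xi> t = 0"
      "\<And>t. \<xi> t = - (LINT r|lborel. indicator {t<..} r * \<psi> r)"
      by (rule primitive_of_mean_zero[OF smooth_continuous[OF \<psi>s] supp _ _ \<psi>i \<psi>0]) (use e in auto)
    have \<xi>s: "smooth_fun \<xi>" by (rule smooth_primitive[OF \<xi>(1) \<psi>s])
    have [measurable]: "\<xi> \<in> borel_measurable borel" "\<psi> \<in> borel_measurable borel"
      using smooth_continuous[OF \<xi>s] smooth_continuous[OF \<psi>s] by (auto intro: borel_measurable_continuous_onI)
    have i1: "integrable M (\<lambda>x. \<psi> (\<tau> x) * a x)"
      unfolding \<psi>_def left_diff_distrib using ia by (auto simp: mult.assoc mult.commute[of _ "Z _ _ _"] mult.left_commute[of _ "Z _ _ _"])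
    have i2: "integrable M (\<lambda>x. \<xi> (\<tau> x) * b x)"
    proof (rule Bochner_Integration.integrable_bound)
      show "integrable M (\<lambda>x. (LINT r|lborel. \<bar>\<psi> r\<bar>) * b x)" using b by simp
      have "\<bar>\<xi> t\<bar> \<le> (LINT r|lborel. \<bar>\<psi> r\<bar>)" for t
      proof -
        have "\<bar>\<xi> t\<bar> \<le> (LINT r|lborel. \<bar>indicator {t<..} r * \<psi> r\<bar>)" unfolding \<xi>(3) abs_minus_cancel by (rule integral_abs_bound)
        also have "\<dots> \<le> (LINT r|lborel. \<bar>\<psi> r\<bar>)"
          using \<psi>i by (intro integral_mono_AE integrable_abs Bochner_Integration.integrable_bound[OF \<psi>i])
            (auto simp: indicator_def)
        finally show ?thesis .
      qed
      then show "AE x in M. norm (\<xi> (\<tau> x) * b x) \<le> norm ((LINT r|lborel. \<bar>\<psi> r\<bar>) * b x)"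
        by (intro AE_I2) (auto simp: abs_mult intro!: mult_right_mono)
    qed measurable
    have "(\<integral>x. \<psi> (\<tau> x) * a x + \<xi> (\<tau> x) * b x \<partial>M) = 0"
      by (rule weak[unfolded weak_derivative01_def, rule_format, of \<xi> \<psi> e "1 - e"]) (use \<xi>s \<xi>(1,2) e in auto)
    then have "(\<integral>x. \<psi> (\<tau> x) * a x \<partial>M) = - (\<integral>x. \<xi> (\<tau> x) * b x \<partial>M)" using i1 i2 by simp
    also have "\<dots> = (LINT r|lborel. \<psi> r * B r)"
      unfolding Fub[OF \<psi>i] \<xi>(3) by (simp add: mult.commute)
    finally have "(\<integral>x. \<psi> (\<tau> x) * a x \<partial>M) - (LINT r|lborel. \<psi> r * B r) = 0" by simp
    moreover have "(\<integral>x. \<psi> (\<tau> x) * a x \<partial>M) = Z s' t' n' * (\<integral>x. ?\<beta> s t n (\<tau> x) * a x \<partial>M) - Z s t n * (\<integral>x. ?\<beta> s' t' n' (\<tau> x) * a x \<partial>M)"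
      using ia[of s t n] ia[of s' t' n'] unfolding \<psi>_def left_diff_distrib
      by (simp add: mult.assoc mult.commute[of _ "Z _ _ _"] mult.left_commute[of _ "Z _ _ _"])
    moreover have "(LINT r|lborel. \<psi> r * B r) = Z s' t' n' * (LINT r|lborel. ?\<beta> s t n r * B r) - Z s t n * (LINT r|lborel. ?\<beta> s' t' n' r * B r)"
      using iB[of s t n] iB[of s' t' n'] unfolding \<psi>_def left_diff_distrib
      by (simp add: mult.assoc mult.commute[of _ "Z _ _ _"] mult.left_commute[of _ "Z _ _ _"])
    ultimately show ?thesis unfolding \<Phi>_def by (simp add: algebra_simps)
  qed
  \<comment> \<open>A fixed reference bump, positive on (1/4, 3/4); dividing by its integral
    identifies the constant c.\<close>
  have Zpos: "Z 0 1 4 > 0"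
  proof -
    have "Z 0 1 4 \<noteq> 0"
    proof
      assume "Z 0 1 4 = 0"
      then have "AE r in lborel. ?\<beta> 0 1 4 r = 0"
        unfolding Z_def using bi bump_nonneg by (subst (asm) integral_nonneg_eq_0_iff_AE) auto
      then have "AE r in lborel. r \<notin> {1/4<..<3/4::real}"
        by eventually_elim (use bump_pos[of 4 _ 0 1] in \<open>force\<close>)
      then have "emeasure lborel {1/4<..<3/4::real} = 0"
        by (subst (asm) AE_iff_measurable[OF _ refl]) (auto simp: Collect_conj_eq greaterThanLessThan_def greaterThan_def lessThan_def)
      then show False by simp
    qed
    moreover have "Z 0 1 4 \<ge> 0" unfolding Z_def using bump_nonneg by (intro integral_nonneg_AE) auto
    ultimately show ?thesis by simp
  qed
  define c where "c = \<Phi> (?\<beta> 0 1 4) / Z 0 1 4"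
  have \<Phi>c: "\<Phi> (?\<beta> s t n) = c * Z s t n" if "0 \<le> s" "t \<le> 1" for s t n
    using zero[of s t 0 1 n 4] that Zpos by (simp add: c_def field_simps)
  have "(\<integral>x. indicator {s<..<t} (\<tau> x) * a x \<partial>M) = (LINT r:{s..t}|lborel. c + B r)"
    if st: "0 \<le> s" "s \<le> t" "t \<le> 1" for s t
  proof -
    have l1: "(\<lambda>n. \<integral>x. ?\<beta> s t n (\<tau> x) * a x \<partial>M) \<longlonglongrightarrow> (\<integral>x. indicator {s<..<t} (\<tau> x) * a x \<partial>M)"
    proof (rule integral_dominated_convergence[where w = "\<lambda>x. \<bar>a x\<bar>"])
      show "AE x in M. (\<lambda>n. ?\<beta> s t n (\<tau> x) * a x) \<longlonglongrightarrow> indicator {s<..<t} (\<tau> x) * a x"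
        by (intro AE_I2 tendsto_intros bump_tendsto)
      show "AE x in M. norm (?\<beta> s t n (\<tau> x) * a x) \<le> \<bar>a x\<bar>" for n
        using bump_nonneg[of s t n] bump_le_1[of s t n]
        by (intro AE_I2) (simp add: abs_mult mult_left_le_one_le)
    qed (use a in auto)
    have dom: "(\<lambda>n. LINT r|lborel. ?\<beta> s t n r * g r) \<longlonglongrightarrow> (LINT r|lborel. indicator {s<..<t} r * g r)"
      if [measurable]: "g \<in> borel_measurable borel" and g: "\<And>r. \<bar>g r\<bar> \<le> K" for g K
    proof (rule integral_dominated_convergence[where w = "\<lambda>r. indicator {s..t} r * K"])
      show "AE r in lborel. (\<lambda>n. ?\<beta> s t n r * g r) \<longlonglongrightarrow> indicator {s<..<t} r * g r"
        by (intro AE_I2 tendsto_intros bump_tendsto)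
      show "AE r in lborel. norm (?\<beta> s t n r * g r) \<le> indicator {s..t} r * K" for n
        using bump_le[of s t n] g by (intro AE_I2) (auto simp: abs_mult intro!: mult_mono)
    qed (use indi in auto)
    have toC: "(LINT r|lborel. indicator {s<..<t} r * g r) = (LINT r:{s..t}|lborel. g r)"
      if [measurable]: "g \<in> borel_measurable borel" for g :: "real \<Rightarrow> real"
      unfolding set_lebesgue_integral_def
      by (intro integral_cong_AE, simp, simp, use AE_lborel_singleton[of s] AE_lborel_singleton[of t] in eventually_elim)
         (auto simp: indicator_def)
    have l2: "(\<lambda>n. LINT r|lborel. ?\<beta> s t n r * B r) \<longlonglongrightarrow> (LINT r:{s..t}|lborel. B r)"
      using dom[of B, OF _ Bb] toC[of B] by simp
    have l3: "(\<lambda>n. Z s t n) \<longlonglongrightarrow> t - s"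
      using dom[of "\<lambda>_. 1" 1] toC[of "\<lambda>_. 1"] st by (simp add: Z_def set_lebesgue_integral_def)
    have "(\<lambda>n. (\<integral>x. ?\<beta> s t n (\<tau> x) * a x \<partial>M) - (LINT r|lborel. ?\<beta> s t n r * B r)) \<longlonglongrightarrow> c * (t - s)"
      using tendsto_mult[OF tendsto_const[of c] l3] \<Phi>c[OF st(1,3)] by (simp add: \<Phi>_def)
    moreover note tendsto_diff[OF l1 l2]
    ultimately have "(\<integral>x. indicator {s<..<t} (\<tau> x) * a x \<partial>M) - (LINT r:{s..t}|lborel. B r) = c * (t - s)"
      using LIMSEQ_unique by blast
    moreover have "(LINT r:{s..t}|lborel. c + B r) = c * (t - s) + (LINT r:{s..t}|lborel. B r)"
    proof -
      have "set_integrable lborel {s..t} (\<lambda>r. c)" unfolding set_integrable_def using indi[of s t c] by simp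
      moreover have "set_integrable lborel {s..t} B" unfolding set_integrable_def
        by (rule Bochner_Integration.integrable_bound[OF indi[of s t "\<integral>x. \<bar>b x\<bar> \<partial>M"]])
          (use Bb in \<open>auto simp: indicator_def\<close>)
      moreover have "(LINT r:{s..t}|lborel. c) = c * (t - s)" using st by (simp add: set_lebesgue_integral_def)
      ultimately show ?thesis by (simp add: set_integral_add)
    qed
    ultimately show ?thesis by simp
  qed
  then show ?thesis using that unfolding B_def by blast
qed

section \<open>Weighted measures and the continuity equation\<close>

lemma compact_closed_subset:
  "compact K \<Longrightarrow> closed S \<Longrightarrow> S \<subseteq> K \<Longrightarrow> compact (S :: 'a::heine_borel set)"
  using compact_Int_closed[of K S] by (simp add: inf.absorb2)

lemma test_fun_smooth: "test_fun \<phi> \<Longrightarrow> smooth_fun \<phi>"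
  by (simp add: test_fun_def)

lemma test_fun_mult:
  assumes "test_fun \<phi>" "smooth_fun \<psi>"
  shows "test_fun (\<lambda>p. \<phi> p * \<psi> p)"
proof -
  have sub: "closure {p. \<phi> p * \<psi> p \<noteq> 0} \<subseteq> closure {p. \<phi> p \<noteq> 0}"
    by (rule closure_mono) auto
  have "compact (closure {p. \<phi> p * \<psi> p \<noteq> 0})"
    using assms(1) sub unfolding test_fun_def by (blast intro: compact_closed_subset)
  then show ?thesis
    using assms sub by (auto simp: test_fun_def intro: smooth_mult)
qed

lemma frechet_derivative_outside_support:
  assumes "p \<notin> closure {p. \<phi> p \<noteq> 0}"
  shows "frechet_derivative \<phi> (at p) u = 0"
proof -
  have "(\<phi> has_derivative (\<lambda>u. 0)) (at p)"
  proof (rule has_derivative_transform_within_open[where f = "\<lambda>_. 0" and s = "- closure {p. \<phi> p \<noteq> 0}"])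
    show "\<And>x. x \<in> - closure {p. \<phi> p \<noteq> 0} \<Longrightarrow> 0 = \<phi> x"
      using subsetD[OF closure_subset[of "{p. \<phi> p \<noteq> 0}"]] by auto
  qed (use assms in auto)
  then show ?thesis using frechet_derivative_at by metis
qed

lemma test_fun_frechet_derivative:
  assumes "test_fun \<phi>"
  shows "test_fun (\<lambda>p. frechet_derivative \<phi> (at p) u)"
proof -
  let ?S = "closure {p. frechet_derivative \<phi> (at p) u \<noteq> 0}"
  have "{p. frechet_derivative \<phi> (at p) u \<noteq> 0} \<subseteq> closure {p. \<phi> p \<noteq> 0}"
    using frechet_derivative_outside_support by blast
  then have sub: "?S \<subseteq> closure {p. \<phi> p \<noteq> 0}"
    by (metis closed_closure closure_minimal)
  moreover from this have "compact ?S"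
    using assms unfolding test_fun_def by (blast intro: compact_closed_subset)
  ultimately show ?thesis
    using assms by (auto simp: test_fun_def intro: smooth_frechet_derivative)
qed

lemma test_fun_bounded:
  assumes "test_fun \<phi>"
  obtains K where "\<And>p. \<bar>\<phi> p\<bar> \<le> K"
proof -
  have "compact (\<phi> ` closure {p. \<phi> p \<noteq> 0})"
    using assms by (intro compact_continuous_image smooth_continuous) (auto simp: test_fun_def)
  then obtain K where K: "\<And>y. y \<in> \<phi> ` closure {p. \<phi> p \<noteq> 0} \<Longrightarrow> \<bar>y\<bar> \<le> K"
    using compact_imp_bounded bounded_iff real_norm_def by metis
  have "\<bar>\<phi> p\<bar> \<le> max K 0" for p
    using K[of "\<phi> p"] closure_subset[of "{p. \<phi> p \<noteq> 0}"] by (cases "\<phi> p = 0") force+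
  then show ?thesis by (rule that)
qed

text \<open>P is the mass \<rho> as a measure, v and w are the densities of m and \<mu> with respect
  to it: velocity and growth rate. Every triple in \<open>Bset\<close> arises in this way, by
  \<open>transport_representation\<close>.\<close>

locale transport =
  fixes \<Omega> :: "(real ^ 'd::finite) set" and P :: "'d pt measure"
    and v :: "'d pt \<Rightarrow> real ^ 'd" and w :: "'d pt \<Rightarrow> real"
  assumes closed\<Omega>: "closed \<Omega>" and bounded\<Omega>: "bounded \<Omega>"
    and fin: "finite_measure P" and spaceP: "space P = XO \<Omega>" and setsP: "sets P = borel_sub (XO \<Omega>)"
    and v [measurable]: "v \<in> borel_measurable P" and w [measurable]: "w \<in> borel_measurable P"
    and v2: "integrable P (\<lambda>p. (norm (v p))\<^sup>2)" and w2: "integrable P (\<lambda>p. (w p)\<^sup>2)"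
begin

sublocale finite_measure P by (rule fin)

lemma XO_borel: "XO \<Omega> \<in> sets borel"
  unfolding XO_def using closed\<Omega> by (intro borel_Times) auto

lemma sets_P_iff: "A \<in> sets P \<longleftrightarrow> A \<in> sets borel \<and> A \<subseteq> XO \<Omega>"
  by (simp add: setsP borel_sub_def)

lemma measurable_P: "g \<in> borel_measurable borel \<Longrightarrow> g \<in> borel_measurable P"
proof -
  have "sets P = sets (restrict_space borel (XO \<Omega>))"
    using XO_borel by (auto simp: setsP borel_sub_def sets_restrict_space_iff)
  then show "g \<in> borel_measurable borel \<Longrightarrow> g \<in> borel_measurable P"
    using measurable_restrict_space1 measurable_cong_sets by blast
qed

lemma continuous_measurable_P: "continuous_on UNIV g \<Longrightarrow> g \<in> borel_measurable P"
  by (intro measurable_P borel_measurable_continuous_onI)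

lemma fst_measurable_P [measurable]: "fst \<in> borel_measurable P"
  by (intro continuous_measurable_P continuous_intros)

lemma snd_measurable_P [measurable]: "snd \<in> borel_measurable P"
  by (intro continuous_measurable_P continuous_intros)

lemma component_measurable_P [measurable]: "(\<lambda>p. snd p $ i) \<in> borel_measurable P"
  by (intro continuous_measurable_P continuous_intros)

lemma component_v_measurable [measurable]: "(\<lambda>p. v p $ i) \<in> borel_measurable P"
  using measurable_compose[OF v, of "\<lambda>x. x $ i" borel] by (simp add: borel_measurable_continuous_onI continuous_intros)

lemma v_integrable: "integrable P v"
  using square_integrable_imp_integrable[of "\<lambda>p. norm (v p)"] v2 by (simp add: integrable_norm_iff)

lemma w_integrable: "integrable P w"
  using square_integrable_imp_integrable[of w] w2 by simp

lemma v_component_integrable: "integrable P (\<lambda>p. v p $ i)"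
  by (rule Bochner_Integration.integrable_bound[OF v_integrable]) (auto simp: component_le_norm_cart)

lemma bounded_mult_integrable:
  fixes u :: "'d pt \<Rightarrow> real" and g :: "'d pt \<Rightarrow> 'b::{banach, second_countable_topology}"
  assumes [measurable]: "u \<in> borel_measurable P" and K: "\<And>p. p \<in> space P \<Longrightarrow> \<bar>u p\<bar> \<le> K" and g: "integrable P g"
  shows "integrable P (\<lambda>p. u p *\<^sub>R g p)"
proof (rule Bochner_Integration.integrable_bound[where f = "\<lambda>p. K *\<^sub>R g p"])
  show "integrable P (\<lambda>p. K *\<^sub>R g p)" using g by simp
  show "(\<lambda>p. u p *\<^sub>R g p) \<in> borel_measurable P" using g by simp
  show "AE p in P. norm (u p *\<^sub>R g p) \<le> norm (K *\<^sub>R g p)"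
    using K by (intro AE_I2) (auto intro!: mult_right_mono intro: order_trans[OF _ abs_ge_self])
qed

lemma bounded_integrable:
  fixes u :: "'d pt \<Rightarrow> real"
  assumes "u \<in> borel_measurable P" and "\<And>p. p \<in> space P \<Longrightarrow> \<bar>u p\<bar> \<le> K"
  shows "integrable P u"
  by (rule integrable_const_bound[where B = K]) (use assms in \<open>auto intro!: AE_I2\<close>)

definition Lop :: "('d pt \<Rightarrow> real) \<Rightarrow> 'd pt \<Rightarrow> real" where
  "Lop \<phi> p = frechet_derivative \<phi> (at p) (1, v p) + w p * \<phi> p"

lemma Lop_expand:
  assumes "smooth_fun \<phi>"
  shows "Lop \<phi> p = dt \<phi> p + (\<Sum>i\<in>UNIV. v p $ i * dx i \<phi> p) + w p * \<phi> p"
proof -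
  interpret bounded_linear "frechet_derivative \<phi> (at p)"
    by (rule has_derivative_bounded_linear[OF smooth_has_derivative[OF assms]])
  have eq: "(1::real, v p) = (1, 0) + (\<Sum>i\<in>UNIV. v p $ i *\<^sub>R (0, axis i 1))"
  proof -
    have "(\<Sum>i\<in>UNIV. v p $ i *\<^sub>R (0::real, axis i 1)) = (0, \<Sum>i\<in>UNIV. v p $ i *\<^sub>R axis i 1)"
      by (simp add: prod_eq_iff fst_sum snd_sum)
    also have "(\<Sum>i\<in>UNIV. v p $ i *\<^sub>R axis i 1) = v p"
      by (simp add: vec_eq_iff axis_def if_distrib cong: if_cong)
    finally have "(1::real, 0) + (\<Sum>i\<in>UNIV. v p $ i *\<^sub>R (0::real, axis i 1)) = (1, 0) + (0, v p)" by (rule arg_cong)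
    then show ?thesis by (simp only: add_Pair add_0_left add_0_right)
  qed
  show ?thesis unfolding Lop_def eq add sum scale dt_def dx_def by simp
qed

lemma test_measurable:
  assumes "test_fun \<phi>"
  shows "\<phi> \<in> borel_measurable P" "dt \<phi> \<in> borel_measurable P" "dx i \<phi> \<in> borel_measurable P"
  unfolding dt_def[abs_def] dx_def[abs_def]
  by (rule continuous_measurable_P[OF smooth_continuous], rule test_fun_smooth[OF assms])
     (rule continuous_measurable_P[OF smooth_continuous[OF smooth_frechet_derivative[OF test_fun_smooth[OF assms]]]])+

lemma dt_test: "test_fun \<phi> \<Longrightarrow> test_fun (dt \<phi>)" and dx_test: "test_fun \<phi> \<Longrightarrow> test_fun (dx i \<phi>)"
  unfolding dt_def[abs_def] dx_def[abs_def] by (intro test_fun_frechet_derivative; assumption)+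

lemma Lop_measurable: "test_fun \<phi> \<Longrightarrow> Lop \<phi> \<in> borel_measurable P"
proof -
  assume t: "test_fun \<phi>"
  note [measurable] = test_measurable[OF t]
  have "Lop \<phi> = (\<lambda>p. dt \<phi> p + (\<Sum>i\<in>UNIV. v p $ i * dx i \<phi> p) + w p * \<phi> p)"
    using Lop_expand[OF test_fun_smooth[OF t]] by auto
  then show ?thesis by simp
qed

lemma Lop_bound:
  assumes "test_fun \<phi>"
  obtains K where "\<And>p. \<bar>Lop \<phi> p\<bar> \<le> K * (1 + norm (v p) + \<bar>w p\<bar>)"
proof -
  obtain K1 where K1: "\<And>p. \<bar>\<phi> p\<bar> \<le> K1" using test_fun_bounded[OF assms] by blast
  obtain K2 where K2: "\<And>p. \<bar>dt \<phi> p\<bar> \<le> K2" using test_fun_bounded[OF dt_test[OF assms]] by blast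
  have "\<exists>K. \<forall>p. \<bar>dx i \<phi> p\<bar> \<le> K" for i using test_fun_bounded[OF dx_test[OF assms]] by metis
  then obtain K3 where K3: "\<And>i p. \<bar>dx i \<phi> p\<bar> \<le> K3 i" by metis
  have nn: "0 \<le> K1" "0 \<le> K2" "0 \<le> K3 i" for i
    using K1[of undefined] K2[of undefined] K3[of i undefined] by linarith+
  have "\<bar>Lop \<phi> p\<bar> \<le> (K1 + K2 + (\<Sum>i\<in>UNIV. K3 i)) * (1 + norm (v p) + \<bar>w p\<bar>)" for p
  proof -
    have "\<bar>\<Sum>i\<in>UNIV. v p $ i * dx i \<phi> p\<bar> \<le> (\<Sum>i\<in>UNIV. \<bar>v p $ i * dx i \<phi> p\<bar>)" by (rule sum_abs)
    also have "\<dots> \<le> (\<Sum>i\<in>UNIV. norm (v p) * K3 i)"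
      unfolding abs_mult using K3 component_le_norm_cart by (intro sum_mono mult_mono) auto
    finally have "\<bar>\<Sum>i\<in>UNIV. v p $ i * dx i \<phi> p\<bar> \<le> (\<Sum>i\<in>UNIV. K3 i) * norm (v p)"
      by (simp add: sum_distrib_left sum_distrib_right mult.commute)
    moreover have "\<bar>w p * \<phi> p\<bar> \<le> K1 * \<bar>w p\<bar>"
      using mult_left_mono[OF K1[of p], of "\<bar>w p\<bar>"] by (simp add: abs_mult mult.commute)
    ultimately have "\<bar>Lop \<phi> p\<bar> \<le> K2 * 1 + (\<Sum>i\<in>UNIV. K3 i) * norm (v p) + K1 * \<bar>w p\<bar>"
      unfolding Lop_expand[OF test_fun_smooth[OF assms]] using K2[of p] by linarith
    also have "\<dots> \<le> (K1 + K2 + (\<Sum>i\<in>UNIV. K3 i)) * 1 + (K1 + K2 + (\<Sum>i\<in>UNIV. K3 i)) * norm (v p)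
         + (K1 + K2 + (\<Sum>i\<in>UNIV. K3 i)) * \<bar>w p\<bar>"
      using nn by (intro add_mono mult_right_mono) (auto simp: sum_nonneg)
    finally show ?thesis by (simp add: distrib_left)
  qed
  then show ?thesis by (rule that)
qed

lemma Lop_square_integrable:
  assumes "test_fun \<phi>" shows "integrable P (\<lambda>p. (Lop \<phi> p)\<^sup>2)"
proof -
  obtain K where K: "\<And>p. \<bar>Lop \<phi> p\<bar> \<le> K * (1 + norm (v p) + \<bar>w p\<bar>)" using Lop_bound[OF assms] by blast
  show ?thesis
  proof (rule Bochner_Integration.integrable_bound)
    show "integrable P (\<lambda>p. K\<^sup>2 * (3 * (1 + (norm (v p))\<^sup>2 + (w p)\<^sup>2)))" using v2 w2 by simp
    show "AE p in P. norm ((Lop \<phi> p)\<^sup>2) \<le> norm (K\<^sup>2 * (3 * (1 + (norm (v p))\<^sup>2 + (w p)\<^sup>2)))"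
    proof (intro AE_I2)
      fix p
      have "(1 + a + b)\<^sup>2 \<le> 3 * (1 + a\<^sup>2 + b\<^sup>2)" for a b :: real
        using zero_le_power2[of "1 - a"] zero_le_power2[of "1 - b"] zero_le_power2[of "a - b"]
        by (simp add: power2_eq_square algebra_simps)
      then have "(1 + norm (v p) + \<bar>w p\<bar>)\<^sup>2 \<le> 3 * (1 + (norm (v p))\<^sup>2 + (w p)\<^sup>2)" by (metis power2_abs)
      then have "K\<^sup>2 * (1 + norm (v p) + \<bar>w p\<bar>)\<^sup>2 \<le> K\<^sup>2 * (3 * (1 + (norm (v p))\<^sup>2 + (w p)\<^sup>2))"
        by (intro mult_left_mono) auto
      moreover have "(Lop \<phi> p)\<^sup>2 \<le> (K * (1 + norm (v p) + \<bar>w p\<bar>))\<^sup>2"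
        using power_mono[OF K, of p 2] by simp
      ultimately show "norm ((Lop \<phi> p)\<^sup>2) \<le> norm (K\<^sup>2 * (3 * (1 + (norm (v p))\<^sup>2 + (w p)\<^sup>2)))"
        by (simp add: power_mult_distrib)
    qed
  qed (use Lop_measurable[OF assms] in measurable)
qed

lemma Lop_integrable: "test_fun \<phi> \<Longrightarrow> integrable P (Lop \<phi>)"
  using square_integrable_imp_integrable[OF Lop_measurable Lop_square_integrable] .

definition invariant :: "('d pt \<Rightarrow> real) \<Rightarrow> bool" where
  "invariant \<theta> \<longleftrightarrow> (\<forall>\<phi>. test_fun \<phi> \<longrightarrow> (\<integral>p. \<theta> p * Lop \<phi> p \<partial>P) = 0)"

text \<open>The value 0 off the Borel subsets of XO is the normalisation in
  \<open>fin_smeasure\<close>; equality of measures thus becomes equality of set functions.\<close>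

definition wt :: "('d pt \<Rightarrow> 'b) \<Rightarrow> 'd pt set \<Rightarrow> 'b::{banach, second_countable_topology}" where
  "wt u A = (if A \<in> borel_sub (XO \<Omega>) then (\<integral>p\<in>A. u p \<partial>P) else 0)"

lemma wt_eq: "A \<in> sets P \<Longrightarrow> wt u A = (\<integral>p\<in>A. u p \<partial>P)"
  by (simp add: wt_def setsP)

lemma set_integrable_P:
  fixes u :: "'d pt \<Rightarrow> 'b::{banach, second_countable_topology}"
  shows "integrable P u \<Longrightarrow> A \<in> sets P \<Longrightarrow> set_integrable P A u"
  unfolding set_integrable_def by (rule integrable_mult_indicator)

lemma fin_smeasure_wt:
  fixes u :: "'d pt \<Rightarrow> 'b::{banach, second_countable_topology}"
  assumes u: "integrable P u"
  shows "fin_smeasure (XO \<Omega>) (wt u)"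
  unfolding fin_smeasure_def
proof (intro conjI allI impI)
  fix A :: "nat \<Rightarrow> 'd pt set"
  assume A: "range A \<subseteq> borel_sub (XO \<Omega>)" and disj: "disjoint_family A"
  have As: "A i \<in> sets P" for i using A by (auto simp: setsP)
  then have Us: "(\<Union>i. A i) \<in> sets P" by auto
  have sumeq: "(\<Sum>i<n. wt u (A i)) = (\<integral>p\<in>(\<Union>i<n. A i). u p \<partial>P)" for n
  proof (induction n)
    case 0 show ?case by (simp add: set_lebesgue_integral_def)
  next
    case (Suc n)
    have "(\<Union>i<n. A i) \<inter> A n = {}"
      using disj by (auto simp: disjoint_family_on_def) (metis IntI empty_iff less_irrefl)
    moreover have "(\<Union>i<Suc n. A i) = (\<Union>i<n. A i) \<union> A n" by (auto simp: less_Suc_eq)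
    ultimately show ?case
      using set_integral_Un[of "\<Union>i<n. A i" "A n" P u] As set_integrable_P[OF u] Suc by (simp add: wt_eq)
  qed
  have "(\<lambda>n. \<integral>p\<in>(\<Union>i<n. A i). u p \<partial>P) \<longlonglongrightarrow> (\<integral>p\<in>(\<Union>i. A i). u p \<partial>P)"
    unfolding set_lebesgue_integral_def
  proof (rule integral_dominated_convergence[where w = "\<lambda>p. norm (u p)"])
    show "AE p in P. (\<lambda>n. indicat_real (\<Union>i<n. A i) p *\<^sub>R u p) \<longlonglongrightarrow> indicat_real (\<Union>i. A i) p *\<^sub>R u p"
      by (intro AE_I2 tendsto_intros LIMSEQ_indicator_UN)
    show "(\<lambda>p. indicat_real (\<Union>i. A i) p *\<^sub>R u p) \<in> borel_measurable P"
      "(\<lambda>p. indicat_real (\<Union>i<n. A i) p *\<^sub>R u p) \<in> borel_measurable P" for n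
      using u As Us by (auto intro!: borel_measurable_scaleR borel_measurable_indicator)
  qed (use u in \<open>auto simp: indicator_def\<close>)
  then show "(\<lambda>n. wt u (A n)) sums wt u (\<Union>n. A n)"
    unfolding sums_def sumeq using Us by (simp add: wt_eq)
qed (simp add: wt_def)

text \<open>The set where u > 0 is a Hahn set: the supremum in \<open>pos_var\<close> is attained at
  its intersection with A.\<close>

lemma pos_var_wt:
  fixes u :: "'d pt \<Rightarrow> real"
  assumes u: "integrable P u"
  shows "pos_var (XO \<Omega>) (wt u) = density P (\<lambda>p. ennreal (max 0 (u p)))"
proof -
  let ?M = "density P (\<lambda>p. ennreal (max 0 (u p)))"
  have [measurable]: "u \<in> borel_measurable P" using u by auto
  have up: "integrable P (\<lambda>p. max 0 (u p))" using u by (intro Bochner_Integration.integrable_max) auto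
  have sup: "ennreal (SUP B \<in> {B \<in> borel_sub (XO \<Omega>). B \<subseteq> A}. wt u B) = emeasure ?M A" if A [measurable]: "A \<in> sets P" for A
  proof -
    define A' where "A' = A \<inter> {p \<in> space P. u p > 0}"
    have A' [measurable]: "A' \<in> sets P" unfolding A'_def by measurable
    have "(SUP B \<in> {B \<in> borel_sub (XO \<Omega>). B \<subseteq> A}. wt u B) = wt u A'"
    proof (rule cSup_eq_maximum)
      show "wt u A' \<in> wt u ` {B \<in> borel_sub (XO \<Omega>). B \<subseteq> A}" using A' by (auto simp: A'_def setsP)
      fix y assume "y \<in> wt u ` {B \<in> borel_sub (XO \<Omega>). B \<subseteq> A}"
      then obtain B where B: "B \<in> sets P" "B \<subseteq> A" "y = wt u B" by (auto simp: setsP)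
      show "y \<le> wt u A'"
        unfolding B(3) wt_eq[OF B(1)] wt_eq[OF A'] set_lebesgue_integral_def
      proof (rule integral_mono)
        show "integrable P (\<lambda>p. indicat_real B p *\<^sub>R u p)" "integrable P (\<lambda>p. indicat_real A' p *\<^sub>R u p)"
          using u A' B by (auto intro!: integrable_mult_indicator simp del: real_scaleR_def)
        show "indicat_real B p *\<^sub>R u p \<le> indicat_real A' p *\<^sub>R u p" if "p \<in> space P" for p
          using that B by (auto simp: indicator_def A'_def)
      qed
    qed
    also have "wt u A' = (\<integral>p. indicator A p * max 0 (u p) \<partial>P)"
      unfolding wt_eq[OF A'] set_lebesgue_integral_def
      by (intro Bochner_Integration.integral_cong) (auto simp: indicator_def A'_def)
    also have "ennreal \<dots> = (\<integral>\<^sup>+p. ennreal (indicator A p * max 0 (u p)) \<partial>P)"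
      using integrable_mult_indicator[OF A up] by (intro nn_integral_eq_integral[symmetric]) auto
    also have "\<dots> = emeasure ?M A"
      by (subst emeasure_density) (auto intro!: nn_integral_cong simp: indicator_def)
    finally show ?thesis .
  qed
  have "sigma_sets (XO \<Omega>) (borel_sub (XO \<Omega>)) = sets P"
    using sets.sigma_sets_eq[of P] by (simp add: spaceP setsP)
  then have "pos_var (XO \<Omega>) (wt u) = measure_of (XO \<Omega>) (borel_sub (XO \<Omega>)) (emeasure ?M)"
    unfolding pos_var_def using sup by (intro measure_of_eq) (auto simp: borel_sub_def)
  also have "\<dots> = measure_of (space ?M) (sets ?M) (emeasure ?M)" by (simp add: spaceP setsP)
  also have "\<dots> = ?M" by (rule measure_of_of_measure)
  finally show ?thesis .
qed

lemma sm_integral_wt: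
  fixes u g :: "'d pt \<Rightarrow> real"
  assumes u: "integrable P u" and g [measurable]: "g \<in> borel_measurable P" and K: "\<And>p. \<bar>g p\<bar> \<le> K"
  shows "sm_integral (XO \<Omega>) (wt u) g = (\<integral>p. g p * u p \<partial>P)"
proof -
  have [measurable]: "u \<in> borel_measurable P" using u by auto
  have m: "(\<lambda>A. - wt u A) = wt (\<lambda>p. - u p)" by (auto simp: wt_def set_lebesgue_integral_def)
  have i: "integrable P (\<lambda>p. max 0 (u p))" "integrable P (\<lambda>p. max 0 (- u p))"
    using u by (auto intro!: Bochner_Integration.integrable_max)
  have "sm_integral (XO \<Omega>) (wt u) g = (\<integral>p. max 0 (u p) *\<^sub>R g p \<partial>P) - (\<integral>p. max 0 (- u p) *\<^sub>R g p \<partial>P)"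
    unfolding sm_integral_def m pos_var_wt[OF u] pos_var_wt[OF integrable_minus[OF u]]
    by (subst (1 2) integral_density) auto
  also have "\<dots> = (\<integral>p. max 0 (u p) *\<^sub>R g p - max 0 (- u p) *\<^sub>R g p \<partial>P)"
    using bounded_mult_integrable[OF g K i(1)] bounded_mult_integrable[OF g K i(2)]
    by (intro Bochner_Integration.integral_diff[symmetric]) (auto simp: mult.commute)
  also have "\<dots> = (\<integral>p. g p * u p \<partial>P)"
    by (intro Bochner_Integration.integral_cong) (auto simp: max_def algebra_simps)
  finally show ?thesis .
qed

lemma cont_eq_wt_iff:
  assumes \<theta> [measurable]: "\<theta> \<in> borel_measurable P" and K: "\<And>p. p \<in> space P \<Longrightarrow> \<bar>\<theta> p\<bar> \<le> K"
  shows "cont_eq \<Omega> (wt \<theta>) (wt (\<lambda>p. \<theta> p *\<^sub>R v p)) (wt (\<lambda>p. \<theta> p * w p)) \<longleftrightarrow> invariant \<theta>"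
proof -
  have \<theta>i: "integrable P \<theta>" by (rule bounded_integrable[OF \<theta> K])
  have \<theta>v: "integrable P (\<lambda>p. \<theta> p *\<^sub>R v p)" by (rule bounded_mult_integrable[OF \<theta> K v_integrable])
  have \<theta>w: "integrable P (\<lambda>p. \<theta> p * w p)" using bounded_mult_integrable[OF \<theta> K w_integrable] by simp
  have \<theta>vi: "integrable P (\<lambda>p. \<theta> p * v p $ i)" for i
    using bounded_mult_integrable[OF \<theta> K v_component_integrable] by simp
  have comp: "(\<lambda>A. wt (\<lambda>p. \<theta> p *\<^sub>R v p) A $ i) = wt (\<lambda>p. \<theta> p * v p $ i)" for i
  proof
    fix A show "wt (\<lambda>p. \<theta> p *\<^sub>R v p) A $ i = wt (\<lambda>p. \<theta> p * v p $ i) A"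
    proof (cases "A \<in> sets P")
      case True
      have "(\<integral>p\<in>A. \<theta> p *\<^sub>R v p \<partial>P) $ i = (\<integral>p. (indicator A p *\<^sub>R \<theta> p *\<^sub>R v p) $ i \<partial>P)"
        unfolding set_lebesgue_integral_def
        using set_integrable_P[OF \<theta>v True] unfolding set_integrable_def
        by (rule integral_bounded_linear[OF bounded_linear_vec_nth, symmetric])
      then show ?thesis using True by (simp add: wt_eq set_lebesgue_integral_def mult.assoc)
    qed (simp add: wt_def setsP)
  qed
  have "sm_integral (XO \<Omega>) (wt \<theta>) (dt \<phi>)
        + (\<Sum>i\<in>UNIV. sm_integral (XO \<Omega>) (\<lambda>A. wt (\<lambda>p. \<theta> p *\<^sub>R v p) A $ i) (dx i \<phi>))
        + sm_integral (XO \<Omega>) (wt (\<lambda>p. \<theta> p * w p)) \<phi> = (\<integral>p. \<theta> p * Lop \<phi> p \<partial>P)"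
    if t: "test_fun \<phi>" for \<phi>
  proof -
    note [measurable] = test_measurable[OF t]
    have bi: "integrable P (\<lambda>p. g p * u p)" and sm: "sm_integral (XO \<Omega>) (wt u) g = (\<integral>p. g p * u p \<partial>P)"
      if "test_fun g" "integrable P u" for g u
    proof -
      obtain K where K: "\<And>p. \<bar>g p\<bar> \<le> K" using test_fun_bounded[OF \<open>test_fun g\<close>] by blast
      show "integrable P (\<lambda>p. g p * u p)" "sm_integral (XO \<Omega>) (wt u) g = (\<integral>p. g p * u p \<partial>P)"
        using bounded_mult_integrable[OF test_measurable(1)[OF \<open>test_fun g\<close>] K \<open>integrable P u\<close>]
          sm_integral_wt[OF \<open>integrable P u\<close> test_measurable(1)[OF \<open>test_fun g\<close>] K] by auto
    qed
    have "(\<integral>p. \<theta> p * Lop \<phi> p \<partial>P) = (\<integral>p. dt \<phi> p * \<theta> p + (\<Sum>i\<in>UNIV. dx i \<phi> p * (\<theta> p * v p $ i)) + \<phi> p * (\<theta> p * w p) \<partial>P)"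
      unfolding Lop_expand[OF test_fun_smooth[OF t]]
      by (intro Bochner_Integration.integral_cong) (auto simp: algebra_simps sum_distrib_left)
    also have "\<dots> = (\<integral>p. dt \<phi> p * \<theta> p \<partial>P) + (\<Sum>i\<in>UNIV. \<integral>p. dx i \<phi> p * (\<theta> p * v p $ i) \<partial>P) + (\<integral>p. \<phi> p * (\<theta> p * w p) \<partial>P)"
      using bi[OF dt_test[OF t] \<theta>i] bi[OF dx_test[OF t] \<theta>vi] bi[OF t \<theta>w] by simp
    finally show ?thesis
      unfolding comp sm[OF dt_test[OF t] \<theta>i] sm[OF dx_test[OF t] \<theta>vi] sm[OF t \<theta>w] by simp
  qed
  then show ?thesis unfolding cont_eq_def invariant_def by auto
qed

lemma tv_norm_wt:
  assumes \<theta>: "integrable P \<theta>" and nn: "\<And>p. p \<in> space P \<Longrightarrow> 0 \<le> \<theta> p"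
  shows "tv_norm (XO \<Omega>) (wt \<theta>) = (\<integral>p. \<theta> p \<partial>P)"
  unfolding tv_norm_def
proof (rule cSup_eq_maximum)
  have top: "XO \<Omega> \<in> sets P" using spaceP sets.top[of P] by simp
  have wnn: "0 \<le> wt \<theta> A" if "A \<in> sets P" for A
    unfolding wt_eq[OF that] set_lebesgue_integral_def using nn
    by (intro integral_nonneg_AE AE_I2) (auto simp: indicator_def)
  have all: "wt \<theta> (XO \<Omega>) = (\<integral>p. \<theta> p \<partial>P)"
    unfolding wt_eq[OF top] using set_integral_space[OF \<theta>] by (simp add: spaceP)
  show "(\<integral>p. \<theta> p \<partial>P) \<in> (\<lambda>Q. \<Sum>A\<in>Q. \<bar>wt \<theta> A\<bar>) ` {Q. finite Q \<and> Q \<subseteq> borel_sub (XO \<Omega>) \<and> disjoint Q}"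
    using top wnn[OF top] all by (intro image_eqI[of _ _ "{XO \<Omega>}"]) (auto simp: setsP)
  fix y assume "y \<in> (\<lambda>Q. \<Sum>A\<in>Q. \<bar>wt \<theta> A\<bar>) ` {Q. finite Q \<and> Q \<subseteq> borel_sub (XO \<Omega>) \<and> disjoint Q}"
  then obtain Q where Q: "finite Q" "Q \<subseteq> sets P" "disjoint Q" "y = (\<Sum>A\<in>Q. \<bar>wt \<theta> A\<bar>)" by (auto simp: setsP)
  have "y = (\<Sum>A\<in>Q. \<integral>p. indicator A p * \<theta> p \<partial>P)"
    unfolding Q(4) using Q(2) wnn by (intro sum.cong) (auto simp: wt_eq set_lebesgue_integral_def)
  also have "\<dots> = (\<integral>p. (\<Sum>A\<in>Q. indicator A p * \<theta> p) \<partial>P)"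
    using Q(2) \<theta> by (intro Bochner_Integration.integral_sum[symmetric])
       (auto intro!: integrable_mult_indicator[where 'b=real, simplified])
  also have "\<dots> \<le> (\<integral>p. \<theta> p \<partial>P)"
  proof (rule integral_mono[OF _ \<theta>])
    show "integrable P (\<lambda>p. \<Sum>A\<in>Q. indicator A p * \<theta> p)"
      using Q(2) \<theta> by (intro Bochner_Integration.integrable_sum)
       (auto intro!: integrable_mult_indicator[where 'b=real, simplified])
    fix p assume p: "p \<in> space P"
    have "disjoint_family_on (\<lambda>A. A) Q"
      using Q(3) by (simp add: disjoint_family_on_def pairwise_def disjnt_def)
    then have "(\<Sum>A\<in>Q. indicat_real A p) = indicator (\<Union>Q) p"
      by (subst indicator_UN_disjoint[OF Q(1), of "\<lambda>A. A" p, simplified]) auto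
    then show "(\<Sum>A\<in>Q. indicator A p * \<theta> p) \<le> \<theta> p"
      using nn[OF p] by (simp add: sum_distrib_right[symmetric] indicator_def)
  qed
  finally show "y \<le> (\<integral>p. \<theta> p \<partial>P)" .
qed

end

section \<open>The energy does not depend on the reference measure\<close>

lemma density_unique_vec:
  fixes f f' :: "'a \<Rightarrow> real ^ 'd"
  assumes f: "integrable M f" and f': "integrable M f'"
    and eq: "\<And>A. A \<in> sets M \<Longrightarrow> (\<integral>x\<in>A. f x \<partial>M) = (\<integral>x\<in>A. f' x \<partial>M)"
  shows "AE x in M. f x = f' x"
proof -
  have nth: "integrable M (\<lambda>x. u x $ i)" "(\<integral>x\<in>A. u x $ i \<partial>M) = (\<integral>x\<in>A. u x \<partial>M) $ i"
    if u: "integrable M u" and A: "A \<in> sets M" for u :: "'a \<Rightarrow> real ^ 'd" and A i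
  proof -
    show "integrable M (\<lambda>x. u x $ i)" by (rule integrable_bounded_linear[OF bounded_linear_vec_nth u])
    have "(\<integral>x. (indicator A x *\<^sub>R u x) $ i \<partial>M) = (\<integral>x. indicator A x *\<^sub>R u x \<partial>M) $ i"
      using integrable_mult_indicator[OF A u] by (rule integral_bounded_linear[OF bounded_linear_vec_nth])
    then show "(\<integral>x\<in>A. u x $ i \<partial>M) = (\<integral>x\<in>A. u x \<partial>M) $ i" by (simp add: set_lebesgue_integral_def)
  qed
  have "AE x in M. \<forall>i\<in>UNIV. f x $ i = f' x $ i"
  proof (rule AE_finite_allI)
    fix i
    show "AE x in M. f x $ i = f' x $ i"
      using nth(1)[OF f sets.top] nth(1)[OF f' sets.top] nth(2)[OF f] nth(2)[OF f'] eq
      by (intro density_unique_real) auto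
  qed simp
  then show ?thesis by eventually_elim (simp add: vec_eq_iff)
qed

text \<open>Homogeneity of degree one. For c = 0 all three arguments are 0, and the middle branch of
  Psi gives 0.\<close>

lemma Psi_scale:
  assumes "c \<ge> 0"
  shows "Psi \<delta> c (c *\<^sub>R x) (c * y) = ennreal (c * (((norm x)\<^sup>2 + \<delta>\<^sup>2 * y\<^sup>2) / 2))"
proof -
  have "((c * n)\<^sup>2 + \<delta>\<^sup>2 * (c * y)\<^sup>2) / (2 * c) = c * ((n\<^sup>2 + \<delta>\<^sup>2 * y\<^sup>2) / 2)" if "c > 0" for n
    using that by (simp add: power2_eq_square field_simps)
  then show ?thesis using assms by (cases "c = 0") (auto simp: Psi_def)
qed

context transport begin

definition energy :: "real \<Rightarrow> 'd pt \<Rightarrow> real" where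
  "energy \<delta> p = ((norm (v p))\<^sup>2 + \<delta>\<^sup>2 * (w p)\<^sup>2) / 2"

lemma energy_nonneg: "0 \<le> energy \<delta> p" by (simp add: energy_def)

lemma energy_integrable: "integrable P (energy \<delta>)"
  unfolding energy_def[abs_def] using v2 w2 by simp

lemma energy_measurable [measurable]: "energy \<delta> \<in> borel_measurable P"
  using energy_integrable by blast

text \<open>P itself yields the upper bound. Conversely, if data (L, f, g, k) have finite cost, then
  f \<ge> 0 almost everywhere, f L equals \<theta> P, and comparing integrals over all sets forces g
  = f v and k = f w. So every finite cost is the same number.\<close>

lemma B_wt:
  assumes \<theta> [measurable]: "\<theta> \<in> borel_measurable P" and K: "\<And>p. p \<in> space P \<Longrightarrow> \<theta> p \<le> K"
    and nn: "\<And>p. p \<in> space P \<Longrightarrow> 0 \<le> \<theta> p"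
  shows "B\<delta> \<delta> \<Omega> (wt \<theta>) (wt (\<lambda>p. \<theta> p *\<^sub>R v p)) (wt (\<lambda>p. \<theta> p * w p))
     = ennreal (\<integral>p. \<theta> p * energy \<delta> p \<partial>P)"
proof (rule antisym)
  have K': "\<And>p. p \<in> space P \<Longrightarrow> \<bar>\<theta> p\<bar> \<le> K" using K nn by force
  have \<theta>i: "integrable P \<theta>" by (rule bounded_integrable[OF \<theta> K'])
  have \<theta>v: "integrable P (\<lambda>p. \<theta> p *\<^sub>R v p)" by (rule bounded_mult_integrable[OF \<theta> K' v_integrable])
  have \<theta>w: "integrable P (\<lambda>p. \<theta> p * w p)" using bounded_mult_integrable[OF \<theta> K' w_integrable] by simp
  have \<theta>e: "integrable P (\<lambda>p. \<theta> p * energy \<delta> p)" using bounded_mult_integrable[OF \<theta> K' energy_integrable] by simp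
  have nni: "(\<integral>\<^sup>+p. ennreal (\<theta> p * energy \<delta> p) \<partial>P) = ennreal (\<integral>p. \<theta> p * energy \<delta> p \<partial>P)"
    using \<theta>e nn energy_nonneg by (intro nn_integral_eq_integral AE_I2) auto
  have "(P, \<theta>, \<lambda>p. \<theta> p *\<^sub>R v p, \<lambda>p. \<theta> p * w p) \<in>
      dens_data \<Omega> (wt \<theta>) (wt (\<lambda>p. \<theta> p *\<^sub>R v p)) (wt (\<lambda>p. \<theta> p * w p))"
    unfolding dens_data_def using fin spaceP setsP \<theta>i \<theta>v \<theta>w by (auto simp: wt_eq)
  then have "B\<delta> \<delta> \<Omega> (wt \<theta>) (wt (\<lambda>p. \<theta> p *\<^sub>R v p)) (wt (\<lambda>p. \<theta> p * w p))
      \<le> (\<integral>\<^sup>+p. Psi \<delta> (\<theta> p) (\<theta> p *\<^sub>R v p) (\<theta> p * w p) \<partial>P)"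
    unfolding B\<delta>_def by (rule INF_lower2) simp
  also have "\<dots> = (\<integral>\<^sup>+p. ennreal (\<theta> p * energy \<delta> p) \<partial>P)"
    using nn by (intro nn_integral_cong) (simp add: Psi_scale energy_def)
  finally show "B\<delta> \<delta> \<Omega> (wt \<theta>) (wt (\<lambda>p. \<theta> p *\<^sub>R v p)) (wt (\<lambda>p. \<theta> p * w p))
     \<le> ennreal (\<integral>p. \<theta> p * energy \<delta> p \<partial>P)" by (simp only: nni)
  show "ennreal (\<integral>p. \<theta> p * energy \<delta> p \<partial>P) \<le> B\<delta> \<delta> \<Omega> (wt \<theta>) (wt (\<lambda>p. \<theta> p *\<^sub>R v p)) (wt (\<lambda>p. \<theta> p * w p))"
    unfolding B\<delta>_def
  proof (rule INF_greatest, clarify)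
    fix L f g k assume d: "(L, f, g, k) \<in> dens_data \<Omega> (wt \<theta>) (wt (\<lambda>p. \<theta> p *\<^sub>R v p)) (wt (\<lambda>p. \<theta> p * w p))"
    then have L: "finite_measure L" "space L = XO \<Omega>" "sets L = sets P"
      and int: "integrable L f" "integrable L g" "integrable L k"
      and eq: "\<And>A. A \<in> sets P \<Longrightarrow> (\<integral>p\<in>A. \<theta> p \<partial>P) = (\<integral>p\<in>A. f p \<partial>L)"
        "\<And>A. A \<in> sets P \<Longrightarrow> (\<integral>p\<in>A. \<theta> p *\<^sub>R v p \<partial>P) = (\<integral>p\<in>A. g p \<partial>L)"
        "\<And>A. A \<in> sets P \<Longrightarrow> (\<integral>p\<in>A. \<theta> p * w p \<partial>P) = (\<integral>p\<in>A. k p \<partial>L)"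
      unfolding dens_data_def by (auto simp: setsP wt_def)
    have mP: "borel_measurable L = borel_measurable P" using L(3) measurable_cong_sets by blast
    have [measurable]: "f \<in> borel_measurable L" "g \<in> borel_measurable L" "k \<in> borel_measurable L"
      using int by auto
    have [measurable]: "v \<in> borel_measurable L" "w \<in> borel_measurable L" "energy \<delta> \<in> borel_measurable L"
      unfolding mP by (rule v w energy_measurable)+
    show "ennreal (\<integral>p. \<theta> p * energy \<delta> p \<partial>P) \<le> (\<integral>\<^sup>+p. Psi \<delta> (f p) (g p) (k p) \<partial>L)"
    proof (cases "(\<integral>\<^sup>+p. Psi \<delta> (f p) (g p) (k p) \<partial>L) = \<infinity>")
      case False
      \<comment> \<open>Psi is infinite at a negative first argument, so finite cost excludes such
        points up to a null set.\<close>
      have f0: "AE p in L. 0 \<le> f p"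
      proof -
        have [measurable]: "{p \<in> space L. f p < 0} \<in> sets L" by measurable
        have "(\<integral>\<^sup>+p. \<infinity> * indicator {p \<in> space L. f p < 0} p \<partial>L) \<le> (\<integral>\<^sup>+p. Psi \<delta> (f p) (g p) (k p) \<partial>L)"
          by (intro nn_integral_mono) (auto simp: Psi_def indicator_def)
        then have "\<infinity> * emeasure L {p \<in> space L. f p < 0} \<noteq> \<infinity>"
          using False by (auto simp: nn_integral_cmult_indicator top_unique)
        then have "emeasure L {p \<in> space L. f p < 0} = 0"
          by (metis ennreal_top_mult infinity_ennreal_def)
        then show ?thesis by (subst AE_iff_measurable[OF _ refl]) (auto simp: not_le)
      qed
      have dens: "density P \<theta> = density L f"
      proof (rule measure_eqI)
        fix A assume "A \<in> sets (density P \<theta>)"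
        then have A [measurable]: "A \<in> sets P" "A \<in> sets L" by (auto simp: L)
        have "emeasure (density P \<theta>) A = (\<integral>\<^sup>+p. ennreal (indicator A p * \<theta> p) \<partial>P)"
          by (subst emeasure_density) (auto intro!: nn_integral_cong simp: indicator_def)
        also have "\<dots> = ennreal (\<integral>p. indicator A p * \<theta> p \<partial>P)"
          using integrable_mult_indicator[OF A(1) \<theta>i] nn
          by (intro nn_integral_eq_integral AE_I2) (auto simp: indicator_def)
        also have "(\<integral>p. indicator A p * \<theta> p \<partial>P) = (\<integral>p. indicator A p * f p \<partial>L)"
          using eq(1)[OF A(1)] by (simp add: set_lebesgue_integral_def)
        also have "ennreal (\<integral>p. indicator A p * f p \<partial>L) = (\<integral>\<^sup>+p. ennreal (indicator A p * f p) \<partial>L)"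
          using integrable_mult_indicator[OF A(2) int(1)]
          by (intro nn_integral_eq_integral[symmetric]) (use f0 in \<open>auto simp: indicator_def\<close>)
        also have "\<dots> = emeasure (density L f) A"
          by (subst emeasure_density) (auto intro!: nn_integral_cong simp: indicator_def)
        finally show "emeasure (density P \<theta>) A = emeasure (density L f) A" .
      qed (simp add: L)
      have nnAE: "AE p in P. 0 \<le> \<theta> p" using nn by (intro AE_I2)
      have tr: "(\<integral>p\<in>A. \<theta> p *\<^sub>R u p \<partial>P) = (\<integral>p\<in>A. f p *\<^sub>R u p \<partial>L)" if A [measurable]: "A \<in> sets P" and [measurable]: "u \<in> borel_measurable P"
        for A and u :: "_ \<Rightarrow> 'b::{banach, second_countable_topology}"
      proof -
        have [measurable]: "u \<in> borel_measurable L" unfolding mP by fact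
        have [measurable]: "A \<in> sets L" unfolding L by fact
        have "(\<integral>p\<in>A. \<theta> p *\<^sub>R u p \<partial>P) = (\<integral>p. indicator A p *\<^sub>R u p \<partial>density P \<theta>)"
          unfolding set_lebesgue_integral_def by (subst integral_density[OF _ _ nnAE]) (auto simp: mult.commute)
        also have "\<dots> = (\<integral>p\<in>A. f p *\<^sub>R u p \<partial>L)"
          unfolding dens set_lebesgue_integral_def by (subst integral_density[OF _ _ f0]) (auto simp: mult.commute)
        finally show ?thesis .
      qed
      have tri: "integrable L (\<lambda>p. f p *\<^sub>R u p)" if "integrable P (\<lambda>p. \<theta> p *\<^sub>R u p)" "u \<in> borel_measurable P"
        for u :: "_ \<Rightarrow> 'b::{banach, second_countable_topology}"
      proof -
        have [measurable]: "u \<in> borel_measurable L" unfolding mP by fact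
        show ?thesis
          using integrable_density[OF that(2) \<theta> nnAE] integrable_density[of u L f, OF _ _ f0] that(1)
          unfolding dens by simp
      qed
      have gv: "AE p in L. g p = f p *\<^sub>R v p"
        using tri[OF \<theta>v v] int(2) eq(2) tr[OF _ v] by (intro density_unique_vec) (auto simp: L)
      have kw: "AE p in L. k p = f p * w p"
        using tri[of w] \<theta>w int(3) eq(3) tr[OF _ w] by (intro density_unique_real) (auto simp: L)
      have "ennreal (\<integral>p. \<theta> p * energy \<delta> p \<partial>P) = (\<integral>\<^sup>+p. ennreal (energy \<delta> p) \<partial>density P \<theta>)"
        unfolding nni[symmetric] using nn energy_nonneg
        by (subst nn_integral_density) (auto intro!: nn_integral_cong simp: ennreal_mult)
      also have "\<dots> = (\<integral>\<^sup>+p. ennreal (f p) * ennreal (energy \<delta> p) \<partial>L)"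
        unfolding dens by (subst nn_integral_density) auto
      also have "\<dots> = (\<integral>\<^sup>+p. Psi \<delta> (f p) (g p) (k p) \<partial>L)"
        using f0 gv kw
      proof (intro nn_integral_cong_AE, eventually_elim)
        case (elim p)
        then show ?case by (simp add: Psi_scale energy_def ennreal_mult'' flip: ennreal_mult')
      qed
      finally show ?thesis by simp
    qed simp
  qed
qed

lemma J_wt:
  assumes \<theta> [measurable]: "\<theta> \<in> borel_measurable P" and K: "\<And>p. p \<in> space P \<Longrightarrow> \<theta> p \<le> K"
    and nn: "\<And>p. p \<in> space P \<Longrightarrow> 0 \<le> \<theta> p" and inv: "invariant \<theta>" and pos: "\<alpha> > 0" "\<beta> > 0"
  shows "J \<alpha> \<beta> \<delta> \<Omega> (wt \<theta>) (wt (\<lambda>p. \<theta> p *\<^sub>R v p)) (wt (\<lambda>p. \<theta> p * w p))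
     = ennreal (\<integral>p. \<theta> p * (\<beta> * energy \<delta> p + \<alpha>) \<partial>P)"
proof -
  have K': "\<And>p. p \<in> space P \<Longrightarrow> \<bar>\<theta> p\<bar> \<le> K" using K nn by force
  have \<theta>i: "integrable P \<theta>" by (rule bounded_integrable[OF \<theta> K'])
  have \<theta>e: "integrable P (\<lambda>p. \<theta> p * energy \<delta> p)" using bounded_mult_integrable[OF \<theta> K' energy_integrable] by simp
  have i0: "0 \<le> (\<integral>p. \<theta> p * energy \<delta> p \<partial>P)" "0 \<le> (\<integral>p. \<theta> p \<partial>P)"
    using nn energy_nonneg by (auto intro!: integral_nonneg_AE AE_I2)
  have "J \<alpha> \<beta> \<delta> \<Omega> (wt \<theta>) (wt (\<lambda>p. \<theta> p *\<^sub>R v p)) (wt (\<lambda>p. \<theta> p * w p)) =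
     ennreal \<beta> * ennreal (\<integral>p. \<theta> p * energy \<delta> p \<partial>P) + ennreal (\<alpha> * (\<integral>p. \<theta> p \<partial>P))"
    unfolding J_def using cont_eq_wt_iff[OF \<theta> K'] inv B_wt[OF \<theta> K nn] tv_norm_wt[OF \<theta>i nn] by simp
  also have "\<dots> = ennreal (\<beta> * (\<integral>p. \<theta> p * energy \<delta> p \<partial>P) + \<alpha> * (\<integral>p. \<theta> p \<partial>P))"
    using i0 pos by (simp add: ennreal_mult ennreal_plus)
  also have "\<beta> * (\<integral>p. \<theta> p * energy \<delta> p \<partial>P) + \<alpha> * (\<integral>p. \<theta> p \<partial>P) = (\<integral>p. \<theta> p * (\<beta> * energy \<delta> p + \<alpha>) \<partial>P)"
  proof -
    have "(\<integral>p. \<theta> p * (\<beta> * energy \<delta> p + \<alpha>) \<partial>P) = (\<integral>p. \<beta> * (\<theta> p * energy \<delta> p) + \<alpha> * \<theta> p \<partial>P)"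
      by (intro Bochner_Integration.integral_cong) (auto simp: algebra_simps)
    then show ?thesis using \<theta>i \<theta>e by simp
  qed
  finally show ?thesis .
qed

definition triple :: "('d pt \<Rightarrow> real) \<Rightarrow> ('d pt set \<Rightarrow> real) \<times> ('d pt set \<Rightarrow> real ^ 'd) \<times> ('d pt set \<Rightarrow> real)" where
  "triple \<theta> = (wt \<theta>, wt (\<lambda>p. \<theta> p *\<^sub>R v p), wt (\<lambda>p. \<theta> p * w p))"

lemma triple_in_M:
  assumes \<theta>: "\<theta> \<in> borel_measurable P" and K: "\<And>p. p \<in> space P \<Longrightarrow> \<bar>\<theta> p\<bar> \<le> K"
  shows "triple \<theta> \<in> M\<Omega> \<Omega>"
  unfolding triple_def M\<Omega>_def
  using bounded_integrable[OF \<theta> K] bounded_mult_integrable[OF \<theta> K v_integrable] bounded_mult_integrable[OF \<theta> K w_integrable]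
  by (auto intro!: fin_smeasure_wt)

lemma triple_eq_AE:
  assumes "AE p in P. \<theta> p = \<theta>' p" and [measurable]: "\<theta> \<in> borel_measurable P" "\<theta>' \<in> borel_measurable P"
  shows "triple \<theta> = triple \<theta>'"
proof -
  have "wt u = wt u'" if "AE p in P. u p = u' p" and [measurable]: "u \<in> borel_measurable P" "u' \<in> borel_measurable P"
    for u u' :: "_ \<Rightarrow> 'b::{banach, second_countable_topology}"
  proof
    fix A show "wt u A = wt u' A"
    proof (cases "A \<in> sets P")
      case [measurable]: True
      have "AE p in P. indicat_real A p *\<^sub>R u p = indicator A p *\<^sub>R u' p" using that(1) by eventually_elim simp
      then show ?thesis unfolding wt_eq[OF True] set_lebesgue_integral_def by (intro integral_cong_AE) auto
    qed (simp add: wt_def setsP)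
  qed
  note * = this
  show ?thesis unfolding triple_def prod.inject
    by (intro conjI *; (measurable)?; use assms(1) in eventually_elim) auto
qed

lemma triple_eqD:
  assumes "triple \<theta> = triple \<theta>'" and "integrable P \<theta>" "integrable P \<theta>'"
  shows "AE p in P. \<theta> p = \<theta>' p"
proof (rule density_unique_real[OF assms(2,3)])
  fix A assume A: "A \<in> sets P"
  have "wt \<theta> A = wt \<theta>' A" using assms(1) by (simp add: triple_def)
  then show "(\<integral>p\<in>A. \<theta> p \<partial>P) = (\<integral>p\<in>A. \<theta>' p \<partial>P)" using A by (simp add: wt_eq)
qed

lemma triple_in_Bset:
  assumes \<theta>: "\<theta> \<in> borel_measurable P" and K: "\<And>p. p \<in> space P \<Longrightarrow> \<theta> p \<le> K"
    and nn: "\<And>p. p \<in> space P \<Longrightarrow> 0 \<le> \<theta> p" and inv: "invariant \<theta>" and pos: "\<alpha> > 0" "\<beta> > 0"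
    and le: "(\<integral>p. \<theta> p * (\<beta> * energy \<delta> p + \<alpha>) \<partial>P) \<le> 1"
  shows "triple \<theta> \<in> Bset \<alpha> \<beta> \<delta> \<Omega>"
proof -
  have "triple \<theta> \<in> M\<Omega> \<Omega>" using K nn by (intro triple_in_M[OF \<theta>, of K]) force
  then show ?thesis using J_wt[OF \<theta> K nn inv pos, of \<delta>] le unfolding Bset_def triple_def by auto
qed

end

text \<open>Finite cost leaves, up to a null set, only points with f > 0 and points where f, g and k
  all vanish. So m and \<mu> have densities with respect to f L, and the energy is their weighted
  square norm.\<close>

lemma transport_representation:
  fixes \<Omega> :: "(real ^ 'd::finite) set"
  assumes \<Omega>: "closed \<Omega>" "bounded \<Omega>" and pos: "\<alpha> > 0" "\<beta> > 0" "\<delta> > 0"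
    and x: "(\<rho>, m, \<mu>) \<in> Bset \<alpha> \<beta> \<delta> \<Omega>"
  obtains P v w where "transport \<Omega> P v w" "(\<rho>, m, \<mu>) = transport.triple \<Omega> P v w (\<lambda>_. 1)"
    "transport.invariant P v w (\<lambda>_. 1)"
    "J \<alpha> \<beta> \<delta> \<Omega> \<rho> m \<mu> = ennreal (\<integral>p. \<beta> * transport.energy v w \<delta> p + \<alpha> \<partial>P)"
proof -
  have xM: "(\<rho>, m, \<mu>) \<in> M\<Omega> \<Omega>" and J1: "J \<alpha> \<beta> \<delta> \<Omega> \<rho> m \<mu> \<le> 1" using x by (auto simp: Bset_def)
  have ce: "cont_eq \<Omega> \<rho> m \<mu>" using J1 by (auto simp: J_def top_unique split: if_splits)
  have "ennreal \<beta> * B\<delta> \<delta> \<Omega> \<rho> m \<mu> < \<infinity>"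
    using J1 ce by (auto simp: J_def top_unique less_top[symmetric])
  then have "B\<delta> \<delta> \<Omega> \<rho> m \<mu> < \<infinity>" using pos by (auto simp: ennreal_mult_less_top)
  then obtain L f g k where d: "(L, f, g, k) \<in> dens_data \<Omega> \<rho> m \<mu>"
    and fin: "(\<integral>\<^sup>+p. Psi \<delta> (f p) (g p) (k p) \<partial>L) < \<infinity>"
    unfolding B\<delta>_def INF_less_iff by auto
  then have L: "finite_measure L" "space L = XO \<Omega>" "sets L = borel_sub (XO \<Omega>)"
      and int: "integrable L f" "integrable L g" "integrable L k"
      and eq: "\<And>A. A \<in> sets L \<Longrightarrow> \<rho> A = (\<integral>p\<in>A. f p \<partial>L)"
        "\<And>A. A \<in> sets L \<Longrightarrow> m A = (\<integral>p\<in>A. g p \<partial>L)"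
        "\<And>A. A \<in> sets L \<Longrightarrow> \<mu> A = (\<integral>p\<in>A. k p \<partial>L)"
      unfolding dens_data_def by auto
  have [measurable]: "f \<in> borel_measurable L" "g \<in> borel_measurable L" "k \<in> borel_measurable L" using int by auto
  define N where "N = {p \<in> space L. \<not> (f p > 0 \<or> (f p = 0 \<and> norm (g p) = 0 \<and> k p = 0))}"
  have [measurable]: "N \<in> sets L" unfolding N_def by measurable
  have "(\<integral>\<^sup>+p. \<infinity> * indicator N p \<partial>L) \<le> (\<integral>\<^sup>+p. Psi \<delta> (f p) (g p) (k p) \<partial>L)"
    by (intro nn_integral_mono) (auto simp: Psi_def indicator_def N_def)
  then have "\<infinity> * emeasure L N \<noteq> \<infinity>"
    using fin by (auto simp: nn_integral_cmult_indicator top_unique)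
  then have "emeasure L N = 0" by (metis ennreal_top_mult infinity_ennreal_def)
  then have ae: "AE p in L. f p > 0 \<or> (f p = 0 \<and> g p = 0 \<and> k p = 0)"
    by (subst AE_iff_measurable[of N]) (auto simp: N_def)
  then have f0: "AE p in L. 0 \<le> f p" by eventually_elim auto
  define P where "P = density L (\<lambda>p. ennreal (f p))"
  define v where "v p = (if f p > 0 then (1 / f p) *\<^sub>R g p else 0)" for p
  define w where "w p = (if f p > 0 then k p / f p else 0)" for p
  have vm [measurable]: "v \<in> borel_measurable L" and wm [measurable]: "w \<in> borel_measurable L"
    unfolding v_def[abs_def] w_def[abs_def] by measurable
  have fv: "AE p in L. f p *\<^sub>R v p = g p" using ae by eventually_elim (auto simp: v_def)
  have fw: "AE p in L. f p * w p = k p" using ae by eventually_elim (auto simp: w_def)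
  have e: "AE p in L. Psi \<delta> (f p) (g p) (k p) = ennreal (f p * (((norm (v p))\<^sup>2 + \<delta>\<^sup>2 * (w p)\<^sup>2) / 2))"
    using f0 fv fw
  proof eventually_elim
    case (elim p)
    then show ?case using Psi_scale[of "f p" \<delta> "v p" "w p"] by simp
  qed
  have ei: "integrable L (\<lambda>p. f p * (((norm (v p))\<^sup>2 + \<delta>\<^sup>2 * (w p)\<^sup>2) / 2))"
  proof (rule integrableI_nonneg)
    show "(\<integral>\<^sup>+p. ennreal (f p * (((norm (v p))\<^sup>2 + \<delta>\<^sup>2 * (w p)\<^sup>2) / 2)) \<partial>L) < \<infinity>"
      using fin by (subst (asm) nn_integral_cong_AE[OF e])
    show "AE p in L. 0 \<le> f p * (((norm (v p))\<^sup>2 + \<delta>\<^sup>2 * (w p)\<^sup>2) / 2)"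
      using f0 by eventually_elim simp
  qed measurable
  have vi: "integrable L (\<lambda>p. f p * (norm (v p))\<^sup>2)"
  proof (rule Bochner_Integration.integrable_bound[OF integrable_mult_right[OF ei, of 2]])
    show "AE p in L. norm (f p * (norm (v p))\<^sup>2) \<le> norm (2 * (f p * (((norm (v p))\<^sup>2 + \<delta>\<^sup>2 * (w p)\<^sup>2) / 2)))"
      using f0 by eventually_elim (simp add: mult_left_mono)
  qed measurable
  \<comment> \<open>Here \<delta> > 0 enters: the energy sees w only through \<delta>^2 w^2.\<close>
  have wi: "integrable L (\<lambda>p. f p * (w p)\<^sup>2)"
  proof (rule Bochner_Integration.integrable_bound[OF integrable_mult_right[OF ei, of "2 / \<delta>\<^sup>2"]])
    show "AE p in L. norm (f p * (w p)\<^sup>2) \<le> norm (2 / \<delta>\<^sup>2 * (f p * (((norm (v p))\<^sup>2 + \<delta>\<^sup>2 * (w p)\<^sup>2) / 2)))"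
      using f0
    proof eventually_elim
      case (elim p)
      have "f p * (w p)\<^sup>2 \<le> f p * ((norm (v p))\<^sup>2 / \<delta>\<^sup>2 + (w p)\<^sup>2)" using elim by (intro mult_left_mono) auto
      also have "\<dots> = 2 / \<delta>\<^sup>2 * (f p * (((norm (v p))\<^sup>2 + \<delta>\<^sup>2 * (w p)\<^sup>2) / 2))"
        using pos by (simp add: field_simps)
      finally show ?case using elim by simp
    qed
  qed measurable
  have tr: "transport \<Omega> P v w"
  proof (rule transport.intro)
    show "closed \<Omega>" "bounded \<Omega>" by fact+
    have "emeasure P (space P) = (\<integral>\<^sup>+p. ennreal (f p) \<partial>L)"
      unfolding P_def by (subst emeasure_density) (auto intro!: nn_integral_cong simp: indicator_def)
    also have "\<dots> < \<infinity>" using int(1) f0 by (simp add: nn_integral_eq_integral)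
    finally show "finite_measure P" by (intro finite_measureI) simp
    show "space P = XO \<Omega>" "sets P = borel_sub (XO \<Omega>)" by (auto simp: P_def L)
    show "v \<in> borel_measurable P" "w \<in> borel_measurable P" by (auto simp: P_def)
    show "integrable P (\<lambda>p. (norm (v p))\<^sup>2)" unfolding P_def by (subst integrable_density) (use vi f0 in auto)
    show "integrable P (\<lambda>p. (w p)\<^sup>2)" unfolding P_def by (subst integrable_density) (use wi f0 in auto)
  qed
  interpret transport \<Omega> P v w by fact
  have tr_eq: "(\<integral>p\<in>A. u p \<partial>P) = (\<integral>p\<in>A. u' p \<partial>L)"
    if "AE p in L. f p *\<^sub>R u p = u' p" and [measurable]: "u \<in> borel_measurable L" "u' \<in> borel_measurable L" and A [measurable]: "A \<in> sets L"
    for u u' :: "_ \<Rightarrow> 'b::{banach, second_countable_topology}" and A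
  proof -
    have "(\<integral>p\<in>A. u p \<partial>P) = (\<integral>p. f p *\<^sub>R indicator A p *\<^sub>R u p \<partial>L)"
      unfolding set_lebesgue_integral_def P_def by (subst integral_density) (use f0 in auto)
    also have "\<dots> = (\<integral>p\<in>A. u' p \<partial>L)"
      unfolding set_lebesgue_integral_def
    proof (rule integral_cong_AE)
      show "AE p in L. f p *\<^sub>R indicat_real A p *\<^sub>R u p = indicat_real A p *\<^sub>R u' p"
        using that(1) by eventually_elim (metis scaleR_left_commute)
    qed measurable
    finally show ?thesis .
  qed
  have out: "\<rho> A = 0" "m A = 0" "\<mu> A = 0" if "A \<notin> borel_sub (XO \<Omega>)" for A
    using xM that by (auto simp: M\<Omega>_def fin_smeasure_def)
  have "\<rho> = wt (\<lambda>_. 1)"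
  proof
    fix A show "\<rho> A = wt (\<lambda>_. 1) A"
    proof (cases "A \<in> borel_sub (XO \<Omega>)")
      case True
      then show ?thesis using tr_eq[of "\<lambda>_. 1::real" f A] eq(1)[of A] by (simp add: wt_def L)
    qed (simp add: out wt_def)
  qed
  moreover have "m = wt v"
  proof
    fix A show "m A = wt v A"
    proof (cases "A \<in> borel_sub (XO \<Omega>)")
      case True
      then show ?thesis using tr_eq[of v g A] eq(2)[of A] fv by (simp add: wt_def L)
    qed (simp add: out wt_def)
  qed
  moreover have "\<mu> = wt w"
  proof
    fix A show "\<mu> A = wt w A"
    proof (cases "A \<in> borel_sub (XO \<Omega>)")
      case True
      then show ?thesis using tr_eq[of w k A] eq(3)[of A] fw by (simp add: wt_def L)
    qed (simp add: out wt_def)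
  qed
  ultimately have tri: "(\<rho>, m, \<mu>) = triple (\<lambda>_. 1)" by (simp add: triple_def)
  then have inv: "invariant (\<lambda>_. 1)"
    using cont_eq_wt_iff[of "\<lambda>_. 1" 1] ce by (simp add: triple_def)
  have "J \<alpha> \<beta> \<delta> \<Omega> \<rho> m \<mu> = ennreal (\<integral>p. \<beta> * energy \<delta> p + \<alpha> \<partial>P)"
    using J_wt[of "\<lambda>_. 1" 1 \<alpha> \<beta> \<delta>] inv pos tri by (simp add: triple_def)
  with tr tri inv show ?thesis by (rule that)
qed

section \<open>Extremality and invariant weights\<close>

context transport begin

lemma Lop_mult_integrable:
  assumes \<theta>: "\<theta> \<in> borel_measurable P" and K: "\<And>p. p \<in> space P \<Longrightarrow> \<bar>\<theta> p\<bar> \<le> K" and t: "test_fun \<phi>"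
  shows "integrable P (\<lambda>p. \<theta> p * Lop \<phi> p)"
  using bounded_mult_integrable[OF \<theta> K Lop_integrable[OF t]] by simp

lemma invariant_lincomb:
  assumes \<theta>: "\<theta> \<in> borel_measurable P" "\<And>p. p \<in> space P \<Longrightarrow> \<bar>\<theta> p\<bar> \<le> K" "invariant \<theta>"
    and \<theta>': "\<theta>' \<in> borel_measurable P" "\<And>p. p \<in> space P \<Longrightarrow> \<bar>\<theta>' p\<bar> \<le> K'" "invariant \<theta>'"
  shows "invariant (\<lambda>p. a * \<theta> p + b * \<theta>' p)"
  unfolding invariant_def
proof (intro allI impI)
  fix \<phi> :: "'d pt \<Rightarrow> real" assume t: "test_fun \<phi>"
  have "(\<integral>p. (a * \<theta> p + b * \<theta>' p) * Lop \<phi> p \<partial>P) = (\<integral>p. a * (\<theta> p * Lop \<phi> p) + b * (\<theta>' p * Lop \<phi> p) \<partial>P)"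
    by (intro Bochner_Integration.integral_cong) (auto simp: algebra_simps)
  then show "(\<integral>p. (a * \<theta> p + b * \<theta>' p) * Lop \<phi> p \<partial>P) = 0"
    using Lop_mult_integrable[OF \<theta>(1,2) t] Lop_mult_integrable[OF \<theta>'(1,2) t] \<theta>(3) \<theta>'(3) t
    by (simp add: invariant_def)
qed

lemma comb3_triple:
  assumes \<theta>: "\<theta> \<in> borel_measurable P" "\<And>p. p \<in> space P \<Longrightarrow> \<bar>\<theta> p\<bar> \<le> K"
    and \<theta>': "\<theta>' \<in> borel_measurable P" "\<And>p. p \<in> space P \<Longrightarrow> \<bar>\<theta>' p\<bar> \<le> K'"
  shows "comb3 s (triple \<theta>) (triple \<theta>') = triple (\<lambda>p. (1 - s) * \<theta> p + s * \<theta>' p)"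
proof -
  have *: "(1 - s) *\<^sub>R wt u A + s *\<^sub>R wt u' A = wt (\<lambda>p. (1 - s) *\<^sub>R u p + s *\<^sub>R u' p) A"
    if "integrable P u" "integrable P u'" for u u' :: "_ \<Rightarrow> 'b::{banach, second_countable_topology}" and A
  proof (cases "A \<in> sets P")
    case True
    have "(\<integral>p\<in>A. (1 - s) *\<^sub>R u p + s *\<^sub>R u' p \<partial>P) = (\<integral>p\<in>A. (1 - s) *\<^sub>R u p \<partial>P) + (\<integral>p\<in>A. s *\<^sub>R u' p \<partial>P)"
      using set_integrable_P[OF _ True] that by (intro set_integral_add) auto
    then show ?thesis using True by (simp add: wt_eq set_integral_scaleR_right)
  qed (simp add: wt_def setsP)
  note i = bounded_integrable[OF \<theta>] bounded_integrable[OF \<theta>'] bounded_mult_integrable[OF \<theta> v_integrable]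
    bounded_mult_integrable[OF \<theta>' v_integrable] bounded_mult_integrable[OF \<theta> w_integrable] bounded_mult_integrable[OF \<theta>' w_integrable]
  show ?thesis
    unfolding comb3_def triple_def prod.case prod.inject
    using *[OF i(1,2)] *[OF i(3,4)] *[OF i(5,6)] by (auto simp: algebra_simps)
qed

lemma integral_J_integrable:
  assumes "\<theta> \<in> borel_measurable P" "\<And>p. p \<in> space P \<Longrightarrow> \<bar>\<theta> p\<bar> \<le> K"
  shows "integrable P (\<lambda>p. \<theta> p * (\<beta> * energy \<delta> p + \<alpha>))"
  using bounded_mult_integrable[OF assms, of "\<lambda>p. \<beta> * energy \<delta> p + \<alpha>"] energy_integrable by simp

text \<open>The weights 1/2 + \<theta> / 4 and 1/2 - \<theta> / 4 are positive, invariant and add up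
  to 1. Dividing each by its own cost puts both pieces on the level set J = 1, and the given triple
  is their convex combination with the costs as coefficients. Extremality identifies the pieces,
  which makes \<theta> constant.\<close>

lemma extremal_imp_invariant_const:
  assumes ext: "triple (\<lambda>_. 1) \<in> extremal_points (Bset \<alpha> \<beta> \<delta> \<Omega>)" and pos: "\<alpha> > 0" "\<beta> > 0"
    and inv1: "invariant (\<lambda>_. 1)" and J1: "(\<integral>p. \<beta> * energy \<delta> p + \<alpha> \<partial>P) = 1"
    and \<theta> [measurable]: "\<theta> \<in> borel_measurable P" and K: "\<And>p. \<bar>\<theta> p\<bar> \<le> 1" and inv: "invariant \<theta>"
  shows "\<exists>c. AE p in P. \<theta> p = c"
proof -
  let ?e = "\<lambda>p. \<beta> * energy \<delta> p + \<alpha>"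
  \<comment> \<open>The factor 1/4 keeps both weights above 1/4, so that the costs j1 and j2 are
    positive.\<close>
  define \<theta>1 where "\<theta>1 p = 1/2 * 1 + 1/4 * \<theta> p" for p
  define \<theta>2 where "\<theta>2 p = 1/2 * 1 + (-1/4) * \<theta> p" for p
  have b: "1/4 \<le> \<theta>1 p" "\<theta>1 p \<le> 1" "1/4 \<le> \<theta>2 p" "\<theta>2 p \<le> 1" "\<theta>1 p + \<theta>2 p = 1" for p
    using K[of p] by (auto simp: \<theta>1_def \<theta>2_def abs_le_iff)
  have [measurable]: "\<theta>1 \<in> borel_measurable P" "\<theta>2 \<in> borel_measurable P" unfolding \<theta>1_def \<theta>2_def by measurable
  have b': "\<bar>\<theta>1 p\<bar> \<le> 1" "\<bar>\<theta>2 p\<bar> \<le> 1" for p using b[of p] by auto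
  have i12: "invariant \<theta>1" "invariant \<theta>2" unfolding \<theta>1_def \<theta>2_def
    by (rule invariant_lincomb[OF _ _ inv1 \<theta> K inv, of 1]; simp)+
  define j1 where "j1 = (\<integral>p. \<theta>1 p * ?e p \<partial>P)"
  define j2 where "j2 = (\<integral>p. \<theta>2 p * ?e p \<partial>P)"
  have ji: "integrable P (\<lambda>p. \<theta>1 p * ?e p)" "integrable P (\<lambda>p. \<theta>2 p * ?e p)" "integrable P ?e"
    using integral_J_integrable[of \<theta>1 1 \<beta> \<delta> \<alpha>] integral_J_integrable[of \<theta>2 1 \<beta> \<delta> \<alpha>] b' energy_integrable by auto
  have e0: "0 \<le> ?e p" for p using energy_nonneg[of \<delta> p] pos by simp
  have "j1 + j2 = (\<integral>p. (\<theta>1 p + \<theta>2 p) * ?e p \<partial>P)" unfolding j1_def j2_def distrib_right using ji by simp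
  then have j12: "j1 + j2 = 1" using b J1 by simp
  have "(\<integral>p. 1/4 * ?e p \<partial>P) \<le> j1" "(\<integral>p. 1/4 * ?e p \<partial>P) \<le> j2" unfolding j1_def j2_def
    by (intro integral_mono integrable_mult_right ji mult_right_mono b e0)+
  moreover have "(\<integral>p. 1/4 * ?e p \<partial>P) = 1/4 * (\<integral>p. ?e p \<partial>P)" by (rule integral_mult_right_zero)
  ultimately have jpos: "j1 \<ge> 1/4" "j2 \<ge> 1/4" using J1 by auto
  \<comment> \<open>The summand 0 * 1 gives the weight the shape of the linear combination in
    \<open>invariant_lincomb\<close>.\<close>
  have mem: "triple (\<lambda>p. (1/j) * \<eta> p + 0 * 1) \<in> Bset \<alpha> \<beta> \<delta> \<Omega>"
    if [measurable]: "\<eta> \<in> borel_measurable P" and \<eta>: "\<And>p. 0 \<le> \<eta> p" "\<And>p. \<eta> p \<le> 1" "invariant \<eta>" and j: "j > 0" "j = (\<integral>p. \<eta> p * ?e p \<partial>P)" for \<eta> j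
  proof (rule triple_in_Bset[where K = "1/j"])
    show "invariant (\<lambda>p. (1/j) * \<eta> p + 0 * 1)"
      by (rule invariant_lincomb[OF _ _ \<eta>(3) _ _ inv1, of 1 1]) (use \<eta> in \<open>auto simp: abs_le_iff intro: order_trans[of _ 0]\<close>)
    have "(\<integral>p. ((1/j) * \<eta> p + 0 * 1) * ?e p \<partial>P) = (\<integral>p. (1/j) * (\<eta> p * ?e p) \<partial>P)" by (simp add: mult.assoc)
    also have "\<dots> = (1/j) * j" unfolding j(2) by (rule integral_mult_right_zero)
    finally show "(\<integral>p. ((1/j) * \<eta> p + 0 * 1) * ?e p \<partial>P) \<le> 1" using j(1) by simp
    show "(1/j) * \<eta> p + 0 * 1 \<le> 1/j" "0 \<le> (1/j) * \<eta> p + 0 * 1" for p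
      using \<eta>(1,2)[of p] j(1) by (auto simp: field_simps)
  qed (use pos in auto)
  let ?y = "\<lambda>p. (1/j1) * \<theta>1 p + 0 * 1" and ?z = "\<lambda>p. (1/j2) * \<theta>2 p + 0 * 1"
  have b0: "0 \<le> \<theta>1 p" "0 \<le> \<theta>2 p" for p using b[of p] by linarith+
  have y: "triple ?y \<in> Bset \<alpha> \<beta> \<delta> \<Omega>" by (rule mem[OF _ b0(1) b(2) i12(1) _ j1_def]) (use jpos in auto)
  have z: "triple ?z \<in> Bset \<alpha> \<beta> \<delta> \<Omega>" by (rule mem[OF _ b0(2) b(4) i12(2) _ j2_def]) (use jpos in auto)
  have yb: "\<bar>?y p\<bar> \<le> 1/j1" "\<bar>?z p\<bar> \<le> 1/j2" for p using b[of p] jpos by (auto simp: abs_mult field_simps)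
  have "comb3 j2 (triple ?y) (triple ?z) = triple (\<lambda>p. (1 - j2) * ?y p + j2 * ?z p)"
    by (rule comb3_triple[OF _ yb(1) _ yb(2)]) auto
  also have "(\<lambda>p. (1 - j2) * ?y p + j2 * ?z p) = (\<lambda>_. 1)"
  proof
    fix p show "(1 - j2) * ?y p + j2 * ?z p = 1"
    proof -
      have "1 - j2 = j1" "j1 \<noteq> 0" "j2 \<noteq> 0" using j12 jpos by auto
      then show ?thesis using b(5)[of p] by simp
    qed
  qed
  finally have "triple (\<lambda>_. 1) = comb3 j2 (triple ?y) (triple ?z)" by simp
  moreover have "j2 \<in> {0<..<1}" using jpos j12 by auto
  ultimately have eq: "triple ?y = triple ?z" using ext y z unfolding extremal_points_def by blast
  have "AE p in P. ?y p = ?z p"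
    by (rule triple_eqD[OF eq]) (intro bounded_integrable[OF _ yb(1)] bounded_integrable[OF _ yb(2)], measurable)+
  then have "AE p in P. \<theta> p = 4 * j1 - 2"
  proof eventually_elim
    case (elim p)
    then have "\<theta>1 p * j2 = \<theta>2 p * j1" using jpos by (simp add: field_simps)
    then have "\<theta>1 p * (j1 + j2) = (\<theta>1 p + \<theta>2 p) * j1" by (simp add: algebra_simps)
    then have "\<theta>1 p = j1" using j12 b(5)[of p] by simp
    then show ?case by (simp add: \<theta>1_def)
  qed
  then show ?thesis by blast
qed

text \<open>Strict convexity of the energy. Both components have densities k and k' with respect to
  P, and (v, w) is the average of (u, r) and (u', r') with weights (1 - s) k and s k' adding up to
  1. The average of the costs does not exceed the cost of the average, so the convexity gap
  vanishes, and u = v and r = w wherever k > 0.\<close>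

lemma component_is_multiple:
  assumes Y: "transport \<Omega> Q u r" and Z: "transport \<Omega> Q' u' r'" and s: "0 < s" "s < 1" and pos: "\<alpha> > 0" "\<beta> > 0" "\<delta> > 0"
    and eq: "triple (\<lambda>_. 1) = comb3 s (transport.triple \<Omega> Q u r (\<lambda>_. 1)) (transport.triple \<Omega> Q' u' r' (\<lambda>_. 1))"
    and JY: "(\<integral>p. \<beta> * transport.energy u r \<delta> p + \<alpha> \<partial>Q) \<le> 1" and JZ: "(\<integral>p. \<beta> * transport.energy u' r' \<delta> p + \<alpha> \<partial>Q') \<le> 1"
    and JX: "(\<integral>p. \<beta> * energy \<delta> p + \<alpha> \<partial>P) = 1"
  shows "\<exists>\<theta>. \<theta> \<in> borel_measurable P \<and> (\<forall>p. 0 \<le> \<theta> p \<and> \<theta> p \<le> 1 / (1 - s)) \<and> transport.triple \<Omega> Q u r (\<lambda>_. 1) = triple \<theta>"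
proof -
  interpret Y: transport \<Omega> Q u r by fact
  interpret Z: transport \<Omega> Q' u' r' by fact
  have setsQ: "sets Q = sets P" "sets Q' = sets P" by (auto simp: setsP Y.setsP Z.setsP)
  have e1: "wt (\<lambda>_. 1) A = (1 - s) * Y.wt (\<lambda>_. 1) A + s * Z.wt (\<lambda>_. 1) A"
    and e2: "wt v A = (1 - s) *\<^sub>R Y.wt u A + s *\<^sub>R Z.wt u' A"
    and e3: "wt w A = (1 - s) * Y.wt r A + s * Z.wt r' A" for A
    using eq by (auto simp: triple_def Y.triple_def Z.triple_def comb3_def dest!: fun_cong[where x = A])
  have m1: "measure P A = (1 - s) * measure Q A + s * measure Q' A" if "A \<in> sets P" for A
    using e1[of A] that by (simp add: wt_eq Y.wt_eq Z.wt_eq setsQ set_lebesgue_integral_def)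
  have dens: "\<exists>k. k \<in> borel_measurable P \<and> (\<forall>p. 0 \<le> k p) \<and> R = density P (\<lambda>p. ennreal (k p))"
    if R: "finite_measure R" "sets R = sets P" and null: "\<And>A. A \<in> sets P \<Longrightarrow> measure P A = 0 \<Longrightarrow> measure R A = 0" for R
  proof -
    interpret R: finite_measure R by fact
    have ac: "absolutely_continuous P R"
      unfolding absolutely_continuous_def using null R(2)
      by (auto simp: null_sets_def emeasure_eq_measure R.emeasure_eq_measure)
    obtain D where D: "D \<in> borel_measurable P" "AE x in P. RN_deriv P R x = ennreal (D x)" "\<And>x. 0 \<le> D x"
      using real_RN_deriv[OF R(1) ac R(2)] by metis
    have "R = density P (RN_deriv P R)" using density_RN_deriv[OF ac R(2)] by simp
    also have "\<dots> = density P (\<lambda>p. ennreal (D p))" using D by (intro density_cong) auto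
    finally show ?thesis using D by blast
  qed
  have nl: "measure Q A = 0" "measure Q' A = 0" if "A \<in> sets P" "measure P A = 0" for A
  proof -
    have "0 \<le> (1 - s) * measure Q A" "0 \<le> s * measure Q' A" using s by auto
    then have "(1 - s) * measure Q A = 0 \<and> s * measure Q' A = 0" using m1[OF that(1)] that(2) by linarith
    then show "measure Q A = 0" "measure Q' A = 0" using s by auto
  qed
  obtain k where k [measurable]: "k \<in> borel_measurable P" and k0: "\<And>p. 0 \<le> k p" and Qk: "Q = density P (\<lambda>p. ennreal (k p))"
    using dens[OF Y.fin setsQ(1) nl(1)] by metis
  obtain k' where k' [measurable]: "k' \<in> borel_measurable P" and k'0: "\<And>p. 0 \<le> k' p" and Qk': "Q' = density P (\<lambda>p. ennreal (k' p))"
    using dens[OF Z.fin setsQ(2) nl(2)] by metis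
  have bm: "borel_measurable Q = borel_measurable P" "borel_measurable Q' = borel_measurable P"
    using setsQ measurable_cong_sets by blast+
  note [measurable] = Y.v[unfolded bm] Y.w[unfolded bm] Z.v[unfolded bm] Z.w[unfolded bm]
  have tri: "integrable (density P (\<lambda>p. ennreal (h p))) f \<longleftrightarrow> integrable P (\<lambda>p. h p *\<^sub>R f p)"
    and trs: "A \<in> sets P \<Longrightarrow> (\<integral>p\<in>A. f p \<partial>density P (\<lambda>p. ennreal (h p))) = (\<integral>p\<in>A. h p *\<^sub>R f p \<partial>P)"
    and trf: "(\<integral>p. f p \<partial>density P (\<lambda>p. ennreal (h p))) = (\<integral>p. h p *\<^sub>R f p \<partial>P)"
    if [measurable]: "h \<in> borel_measurable P" "f \<in> borel_measurable P" and h: "\<And>p. 0 \<le> h p"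
    for h and f :: "_ \<Rightarrow> 'b::{banach, second_countable_topology}" and A
  proof -
    have h': "AE p in P. 0 \<le> h p" using h by auto
    show "integrable (density P (\<lambda>p. ennreal (h p))) f \<longleftrightarrow> integrable P (\<lambda>p. h p *\<^sub>R f p)"
      by (rule integrable_density[OF _ _ h']) measurable
    show "(\<integral>p. f p \<partial>density P (\<lambda>p. ennreal (h p))) = (\<integral>p. h p *\<^sub>R f p \<partial>P)"
      by (rule integral_density[OF _ _ h']) measurable
    assume [measurable]: "A \<in> sets P"
    show "(\<integral>p\<in>A. f p \<partial>density P (\<lambda>p. ennreal (h p))) = (\<integral>p\<in>A. h p *\<^sub>R f p \<partial>P)"
      unfolding set_lebesgue_integral_def by (subst integral_density[OF _ _ h']) (auto simp: mult.commute)
  qed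
  have ki: "integrable P k" "integrable P k'"
    using Y.integrable_const[of "1::real"] Z.integrable_const[of "1::real"]
      tri[OF k _ k0, of "\<lambda>_. 1::real", folded Qk] tri[OF k' _ k'0, of "\<lambda>_. 1::real", folded Qk'] by simp_all
  have kvi: "integrable P (\<lambda>p. k p *\<^sub>R u p)" "integrable P (\<lambda>p. k' p *\<^sub>R u' p)"
    using Y.v_integrable Z.v_integrable tri[OF k _ k0, of u, folded Qk] tri[OF k' _ k'0, of u', folded Qk'] by simp_all
  have kwi: "integrable P (\<lambda>p. k p * r p)" "integrable P (\<lambda>p. k' p * r' p)"
    using Y.w_integrable Z.w_integrable tri[OF k _ k0, of r, folded Qk] tri[OF k' _ k'0, of r', folded Qk'] by simp_all
  have Ywt: "Y.wt f A = wt (\<lambda>p. k p *\<^sub>R f p) A" if "f \<in> borel_measurable P" for f :: "_ \<Rightarrow> 'b::{banach, second_countable_topology}" and A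
    using trs[OF k that k0, of A, folded Qk] by (simp add: Y.wt_def wt_def setsP)
  have Zwt: "Z.wt f A = wt (\<lambda>p. k' p *\<^sub>R f p) A" if "f \<in> borel_measurable P" for f :: "_ \<Rightarrow> 'b::{banach, second_countable_topology}" and A
    using trs[OF k' that k'0, of A, folded Qk'] by (simp add: Z.wt_def wt_def setsP)
  have wt_comb: "(1 - s) *\<^sub>R wt f A + s *\<^sub>R wt g A = wt (\<lambda>p. (1 - s) *\<^sub>R f p + s *\<^sub>R g p) A"
    if "integrable P f" "integrable P g" for f g :: "_ \<Rightarrow> 'b::{banach, second_countable_topology}" and A
  proof (cases "A \<in> sets P")
    case True
    have "(\<integral>p\<in>A. (1 - s) *\<^sub>R f p + s *\<^sub>R g p \<partial>P) = (\<integral>p\<in>A. (1 - s) *\<^sub>R f p \<partial>P) + (\<integral>p\<in>A. s *\<^sub>R g p \<partial>P)"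
      using set_integrable_P[OF _ True] that by (intro set_integral_add) auto
    then show ?thesis using True by (simp add: wt_eq set_integral_scaleR_right)
  qed (simp add: wt_def setsP)
  have a1: "AE p in P. 1 = (1 - s) * k p + s * k' p"
  proof (rule density_unique_real)
    fix A assume A: "A \<in> sets P"
    show "(\<integral>p\<in>A. 1 \<partial>P) = (\<integral>p\<in>A. (1 - s) * k p + s * k' p \<partial>P)"
      using e1[of A] wt_comb[OF ki, of A] Ywt[of "\<lambda>_. 1::real" A] Zwt[of "\<lambda>_. 1::real" A] A by (simp add: wt_eq)
  qed (use ki in auto)
  have a2: "AE p in P. v p = (1 - s) *\<^sub>R (k p *\<^sub>R u p) + s *\<^sub>R (k' p *\<^sub>R u' p)"
  proof (rule density_unique_vec)
    fix A assume A: "A \<in> sets P"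
    show "(\<integral>p\<in>A. v p \<partial>P) = (\<integral>p\<in>A. (1 - s) *\<^sub>R (k p *\<^sub>R u p) + s *\<^sub>R (k' p *\<^sub>R u' p) \<partial>P)"
      using e2[of A] wt_comb[OF kvi, of A] Ywt[of u A] Zwt[of u' A] A by (simp add: wt_eq)
  qed (intro v_integrable Bochner_Integration.integrable_add integrable_scaleR_right kvi)+
  have a3: "AE p in P. w p = (1 - s) * (k p * r p) + s * (k' p * r' p)"
  proof (rule density_unique_real)
    fix A assume A: "A \<in> sets P"
    show "(\<integral>p\<in>A. w p \<partial>P) = (\<integral>p\<in>A. (1 - s) * (k p * r p) + s * (k' p * r' p) \<partial>P)"
      using e3[of A] wt_comb[OF kwi, of A] Ywt[of r A] Zwt[of r' A] A by (simp add: wt_eq)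
  qed (use kwi w_integrable in auto)
  define E where "E x y = ((norm x)\<^sup>2 + \<delta>\<^sup>2 * y\<^sup>2) / 2" for x :: "real ^ 'd" and y :: real
  have E0: "0 \<le> E x y" for x y by (simp add: E_def)
  have En: "energy \<delta> p = E (v p) (w p)" "Y.energy \<delta> p = E (u p) (r p)" "Z.energy \<delta> p = E (u' p) (r' p)" for p
    by (auto simp: energy_def Y.energy_def Z.energy_def E_def)
  have [measurable]: "(\<lambda>p. E (f p) (g p)) \<in> borel_measurable P" if [measurable]: "f \<in> borel_measurable P" "g \<in> borel_measurable P" for f g
    unfolding E_def by measurable
  have kEi: "integrable P (\<lambda>p. k p * E (u p) (r p))" "integrable P (\<lambda>p. k' p * E (u' p) (r' p))"
    using Y.energy_integrable[of \<delta>] Z.energy_integrable[of \<delta>]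
      tri[OF k Y.energy_measurable[of \<delta>, unfolded bm] k0, folded Qk]
      tri[OF k' Z.energy_measurable[of \<delta>, unfolded bm] k'0, folded Qk']
    by (simp_all add: En)
  have Ei: "integrable P (\<lambda>p. E (v p) (w p))" using energy_integrable[of \<delta>] by (simp add: En(1)[symmetric])
  have JY': "\<beta> * (\<integral>p. k p * E (u p) (r p) \<partial>P) + \<alpha> * (\<integral>p. k p \<partial>P) \<le> 1"
  proof -
    have "(\<integral>p. \<beta> * Y.energy \<delta> p + \<alpha> \<partial>Q) = (\<integral>p. k p *\<^sub>R (\<beta> * Y.energy \<delta> p + \<alpha>) \<partial>P)"
      using Y.energy_measurable[of \<delta>, unfolded bm] by (intro trf[OF k _ k0, folded Qk]) simp
    also have "\<dots> = (\<integral>p. \<beta> * (k p * E (u p) (r p)) + \<alpha> * k p \<partial>P)"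
      by (intro Bochner_Integration.integral_cong) (auto simp: En algebra_simps)
    finally show ?thesis using JY kEi(1) ki(1) by simp
  qed
  have JZ': "\<beta> * (\<integral>p. k' p * E (u' p) (r' p) \<partial>P) + \<alpha> * (\<integral>p. k' p \<partial>P) \<le> 1"
  proof -
    have "(\<integral>p. \<beta> * Z.energy \<delta> p + \<alpha> \<partial>Q') = (\<integral>p. k' p *\<^sub>R (\<beta> * Z.energy \<delta> p + \<alpha>) \<partial>P)"
      using Z.energy_measurable[of \<delta>, unfolded bm] by (intro trf[OF k' _ k'0, folded Qk']) simp
    also have "\<dots> = (\<integral>p. \<beta> * (k' p * E (u' p) (r' p)) + \<alpha> * k' p \<partial>P)"
      by (intro Bochner_Integration.integral_cong) (auto simp: En algebra_simps)
    finally show ?thesis using JZ kEi(2) ki(2) by simp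
  qed
  have JX': "\<beta> * (\<integral>p. E (v p) (w p) \<partial>P) + \<alpha> * measure P (space P) = 1"
    using JX Ei by (simp add: En mult.commute)
  have mass: "measure P (space P) = (1 - s) * (\<integral>p. k p \<partial>P) + s * (\<integral>p. k' p \<partial>P)"
  proof -
    have "(\<integral>p. 1 \<partial>P) = (\<integral>p. (1 - s) * k p + s * k' p \<partial>P)" using a1 by (intro integral_cong_AE) auto
    then show ?thesis using ki by simp
  qed
  \<comment> \<open>The convexity gap. Comparison of the three costs shows that its integral is at
    most 0, because the masses balance.\<close>
  define G where "G p = (1 - s) * (k p * E (u p) (r p)) + s * (k' p * E (u' p) (r' p)) - E (v p) (w p)" for p
  have Gi: "integrable P G" unfolding G_def using kEi Ei by auto
  have Gint: "(\<integral>p. G p \<partial>P) \<le> 0"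
  proof -
    have "\<beta> * (\<integral>p. G p \<partial>P) = (1 - s) * (\<beta> * (\<integral>p. k p * E (u p) (r p) \<partial>P) + \<alpha> * (\<integral>p. k p \<partial>P))
       + s * (\<beta> * (\<integral>p. k' p * E (u' p) (r' p) \<partial>P) + \<alpha> * (\<integral>p. k' p \<partial>P))
       - (\<beta> * (\<integral>p. E (v p) (w p) \<partial>P) + \<alpha> * measure P (space P))"
      unfolding G_def mass using kEi Ei by (simp add: algebra_simps)
    also have "\<dots> \<le> (1 - s) * 1 + s * 1 - 1"
      unfolding JX' using JY' JZ' s by (intro diff_right_mono add_mono mult_left_mono) auto
    finally show ?thesis using pos by (simp add: mult_le_0_iff)
  qed
  \<comment> \<open>The gap is the variance of the two velocities and rates around their mean, hence
    nonnegative.\<close>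
  have Gge: "AE p in P. (1 - s) * k p * E (u p - v p) (r p - w p) + s * k' p * E (u' p - v p) (r' p - w p) = G p"
    using a1 a2 a3
  proof eventually_elim
    case (elim p)
    define a b where "a = (1 - s) * k p" and "b = s * k' p"
    have ab: "a + b = 1" and vv: "v p = a *\<^sub>R u p + b *\<^sub>R u' p" and ww: "w p = a * r p + b * r' p"
      using elim by (auto simp: a_def b_def)
    have nn: "(norm (x - y))\<^sup>2 = (norm x)\<^sup>2 - 2 * inner x y + (norm y)\<^sup>2" for x y :: "real ^ 'd"
      by (simp add: power2_norm_eq_inner inner_diff inner_commute)
    have "a * (norm (u p - v p))\<^sup>2 + b * (norm (u' p - v p))\<^sup>2
        = a * (norm (u p))\<^sup>2 + b * (norm (u' p))\<^sup>2 - 2 * inner (a *\<^sub>R u p + b *\<^sub>R u' p) (v p) + (a + b) * (norm (v p))\<^sup>2"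
      unfolding nn by (simp add: inner_add_left algebra_simps)
    also have "inner (a *\<^sub>R u p + b *\<^sub>R u' p) (v p) = (norm (v p))\<^sup>2" by (simp add: vv[symmetric] power2_norm_eq_inner)
    finally have q1: "a * (norm (u p - v p))\<^sup>2 + b * (norm (u' p - v p))\<^sup>2 = a * (norm (u p))\<^sup>2 + b * (norm (u' p))\<^sup>2 - (norm (v p))\<^sup>2"
      using ab by simp
    have "a * (r p - w p)\<^sup>2 + b * (r' p - w p)\<^sup>2 = a * (r p)\<^sup>2 + b * (r' p)\<^sup>2 - 2 * (a * r p + b * r' p) * w p + (a + b) * (w p)\<^sup>2"
      by (simp add: power2_eq_square algebra_simps)
    also have "(a * r p + b * r' p) = w p" by (simp add: ww)
    finally have q2: "a * (r p - w p)\<^sup>2 + b * (r' p - w p)\<^sup>2 = a * (r p)\<^sup>2 + b * (r' p)\<^sup>2 - (w p)\<^sup>2"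
      using ab by (simp add: power2_eq_square)
    have "a * E (u p - v p) (r p - w p) + b * E (u' p - v p) (r' p - w p) =
      ((a * (norm (u p - v p))\<^sup>2 + b * (norm (u' p - v p))\<^sup>2) + \<delta>\<^sup>2 * (a * (r p - w p)\<^sup>2 + b * (r' p - w p)\<^sup>2)) / 2"
      by (simp add: E_def algebra_simps add_divide_distrib)
    also have "\<dots> = a * E (u p) (r p) + b * E (u' p) (r' p) - E (v p) (w p)"
      unfolding q1 q2 by (simp add: E_def algebra_simps add_divide_distrib diff_divide_distrib)
    finally show ?case by (simp add: G_def a_def b_def mult.assoc)
  qed
  have Gnn: "AE p in P. 0 \<le> G p"
    using Gge by eventually_elim (metis E0 add_nonneg_nonneg diff_ge_0_iff_ge k0 k'0 less_imp_le mult_nonneg_nonneg s)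
  then have "(\<integral>p. G p \<partial>P) = 0" using Gint integral_nonneg_AE[OF Gnn] by simp
  then have "AE p in P. G p = 0" using integral_nonneg_eq_0_iff_AE[OF Gi Gnn] by simp
  then have same: "AE p in P. k p *\<^sub>R u p = k p *\<^sub>R v p \<and> k p * r p = k p * w p"
    using Gge
  proof eventually_elim
    case (elim p)
    have "0 \<le> (1 - s) * k p * E (u p - v p) (r p - w p)" "0 \<le> s * k' p * E (u' p - v p) (r' p - w p)"
      using s k0[of p] k'0[of p] E0 by (auto intro!: mult_nonneg_nonneg)
    then have "(1 - s) * k p * E (u p - v p) (r p - w p) = 0" using elim by linarith
    then have "k p = 0 \<or> E (u p - v p) (r p - w p) = 0" using s by auto
    moreover have "u p = v p \<and> r p = w p" if "E (u p - v p) (r p - w p) = 0"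
    proof -
      have "(norm (u p - v p))\<^sup>2 = 0 \<and> \<delta>\<^sup>2 * (r p - w p)\<^sup>2 = 0"
        using that unfolding E_def by (subst add_nonneg_eq_0_iff[symmetric]) auto
      then show ?thesis using pos by auto
    qed
    ultimately show ?case by auto
  qed
  \<comment> \<open>Almost everywhere k \<le> 1 / (1 - s) already; the truncation makes this bound
    hold at every point without changing the measures.\<close>
  define \<theta> where "\<theta> p = min (k p) (1 / (1 - s))" for p
  have [measurable]: "\<theta> \<in> borel_measurable P" unfolding \<theta>_def by measurable
  have \<theta>b: "0 \<le> \<theta> p \<and> \<theta> p \<le> 1 / (1 - s)" for p using k0 s by (auto simp: \<theta>_def)
  have \<theta>k: "AE p in P. \<theta> p = k p"
    using a1
  proof eventually_elim
    case (elim p)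
    have "0 \<le> s * k' p" using s k'0 by auto
    then have "(1 - s) * k p \<le> 1" using elim by linarith
    then show ?case using s by (simp add: \<theta>_def field_simps)
  qed
  have wt_cong: "wt f = wt g" if "AE p in P. f p = g p" and [measurable]: "f \<in> borel_measurable P" "g \<in> borel_measurable P"
    for f g :: "_ \<Rightarrow> 'b::{banach, second_countable_topology}"
  proof
    fix A show "wt f A = wt g A"
    proof (cases "A \<in> sets P")
      case [measurable]: True
      have "AE p in P. indicat_real A p *\<^sub>R f p = indicator A p *\<^sub>R g p" using that(1) by eventually_elim simp
      then show ?thesis unfolding wt_eq[OF True] set_lebesgue_integral_def by (intro integral_cong_AE) auto
    qed (simp add: wt_def setsP)
  qed
  have "Y.wt (\<lambda>_. 1) = wt \<theta>"
  proof -
    have "Y.wt (\<lambda>_. 1) = wt k" using Ywt[of "\<lambda>_. 1::real"] by auto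
    also have "\<dots> = wt \<theta>" by (rule wt_cong) (use \<theta>k in auto)
    finally show ?thesis .
  qed
  moreover have "Y.wt u = wt (\<lambda>p. \<theta> p *\<^sub>R v p)"
  proof -
    have "Y.wt u = wt (\<lambda>p. k p *\<^sub>R u p)" using Ywt[of u] by auto
    also have "\<dots> = wt (\<lambda>p. \<theta> p *\<^sub>R v p)"
    proof (rule wt_cong)
      show "AE p in P. k p *\<^sub>R u p = \<theta> p *\<^sub>R v p" using \<theta>k same by eventually_elim simp
    qed measurable
    finally show ?thesis .
  qed
  moreover have "Y.wt r = wt (\<lambda>p. \<theta> p * w p)"
  proof -
    have "Y.wt r = wt (\<lambda>p. k p * r p)" using Ywt[of r] by auto
    also have "\<dots> = wt (\<lambda>p. \<theta> p * w p)"
    proof (rule wt_cong)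
      show "AE p in P. k p * r p = \<theta> p * w p" using \<theta>k same by eventually_elim simp
    qed measurable
    finally show ?thesis .
  qed
  ultimately have "Y.triple (\<lambda>_. 1) = triple \<theta>" by (simp add: Y.triple_def triple_def)
  then show ?thesis using \<theta>b by (intro exI[of _ \<theta>]) auto
qed

end

section \<open>Slices in time\<close>

lemma test_fun_compose:
  fixes b :: "real \<Rightarrow> real"
  assumes "test_fun \<phi>" "smooth_fun b" "b 0 = 0"
  shows "test_fun (\<lambda>p. b (\<phi> p))"
proof -
  have sub: "closure {p. b (\<phi> p) \<noteq> 0} \<subseteq> closure {p. \<phi> p \<noteq> 0}"
    using assms(3) by (intro closure_mono) auto
  then have "compact (closure {p. b (\<phi> p) \<noteq> 0})"
    using assms(1) unfolding test_fun_def by (blast intro: compact_closed_subset)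
  then show ?thesis
    using assms(1) sub smooth_compose[OF assms(2) test_fun_smooth[OF assms(1)]] by (auto simp: test_fun_def)
qed

lemma smooth_fst_compose: "smooth_fun (\<xi> :: real \<Rightarrow> real) \<Longrightarrow> smooth_fun (\<lambda>p :: 'd::finite pt. \<xi> (fst p))"
  by (rule smooth_compose[OF _ smooth_bounded_linear[OF bounded_linear_fst]])

lemma smooth_component: "smooth_fun (\<lambda>p :: 'd::finite pt. snd p $ i)"
  by (rule smooth_bounded_linear) (auto intro: bounded_linear_compose[OF bounded_linear_vec_nth bounded_linear_snd])

context transport begin

lemma Lop_mult:
  assumes \<phi>: "smooth_fun \<phi>" and \<psi>: "smooth_fun \<psi>"
  shows "Lop (\<lambda>p. \<phi> p * \<psi> p) p = \<psi> p * Lop \<phi> p + \<phi> p * frechet_derivative \<psi> (at p) (1, v p)"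
proof -
  have "frechet_derivative (\<lambda>p. \<phi> p * \<psi> p) (at p) =
     (\<lambda>h. \<phi> p * frechet_derivative \<psi> (at p) h + frechet_derivative \<phi> (at p) h * \<psi> p)"
    by (rule frechet_derivative_at[symmetric, OF has_derivative_mult[OF smooth_has_derivative[OF \<phi>] smooth_has_derivative[OF \<psi>]]])
  then show ?thesis by (simp add: Lop_def algebra_simps)
qed

lemma frechet_derivative_compose_real:
  fixes b :: "real \<Rightarrow> real" and \<phi> :: "'a::euclidean_space \<Rightarrow> real"
  assumes "smooth_fun \<phi>" "(b has_real_derivative d) (at (\<phi> p))"
  shows "frechet_derivative (\<lambda>p. b (\<phi> p)) (at p) h = frechet_derivative \<phi> (at p) h * d"
  by (subst frechet_derivative_at[OF DERIV_compose_FDERIV[OF assms(2) smooth_has_derivative[OF assms(1)]], symmetric]) (rule refl)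

lemma Lop_compose:
  fixes b :: "real \<Rightarrow> real"
  assumes "smooth_fun \<phi>" "(b has_real_derivative d) (at (\<phi> p))"
  shows "Lop (\<lambda>p. b (\<phi> p)) p = d * Lop \<phi> p + w p * (b (\<phi> p) - \<phi> p * d)"
proof -
  have "frechet_derivative (\<lambda>p. b (\<phi> p)) (at p) (1, v p) = frechet_derivative \<phi> (at p) (1, v p) * d"
    by (rule frechet_derivative_compose_real) fact+
  then show ?thesis by (simp add: Lop_def algebra_simps)
qed

lemma Lop_time_mult:
  assumes \<phi>: "smooth_fun \<phi>" and \<xi>: "smooth_fun \<xi>" "\<And>t. (\<xi> has_real_derivative \<xi>' t) (at t)"
  shows "Lop (\<lambda>p. \<phi> p * \<xi> (fst p)) p = \<xi> (fst p) * Lop \<phi> p + \<phi> p * \<xi>' (fst p)"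
proof -
  have "frechet_derivative (\<lambda>p :: 'd pt. \<xi> (fst p)) (at p) (1, v p) = frechet_derivative fst (at p) (1, v p) * \<xi>' (fst p)"
    by (rule frechet_derivative_compose_real[OF smooth_bounded_linear[OF bounded_linear_fst] \<xi>(2)])
  moreover have "frechet_derivative (fst :: 'd pt \<Rightarrow> real) (at p) = fst"
    by (rule frechet_derivative_at[symmetric, OF bounded_linear_imp_has_derivative[OF bounded_linear_fst]])
  ultimately show ?thesis unfolding Lop_mult[OF \<phi> smooth_fst_compose[OF \<xi>(1)]] by simp
qed

lemma Lop_component_mult:
  assumes \<phi>: "smooth_fun \<phi>"
  shows "Lop (\<lambda>p. \<phi> p * (snd p $ i - a)) p = (snd p $ i - a) * Lop \<phi> p + \<phi> p * v p $ i"
proof -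
  have sm: "smooth_fun (\<lambda>p :: 'd pt. snd p $ i - a)" by (intro smooth_diff smooth_component smooth_const)
  have "((\<lambda>p :: 'd pt. snd p $ i - a) has_derivative (\<lambda>h. snd h $ i - 0)) (at p)"
    by (intro has_derivative_diff has_derivative_const bounded_linear_imp_has_derivative)
       (auto intro: bounded_linear_compose[OF bounded_linear_vec_nth bounded_linear_snd])
  from frechet_derivative_at[OF this, symmetric]
  have "frechet_derivative (\<lambda>p :: 'd pt. snd p $ i - a) (at p) (1, v p) = v p $ i" by simp
  then show ?thesis unfolding Lop_mult[OF \<phi> sm] by simp
qed

text \<open>The vanishing near time 0 fixes the constant left open by \<open>du_Bois_Reymond\<close>
  in \<open>test_slice\<close>.\<close>

lemma test_time_support:
  assumes "test_fun \<phi>"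
  obtains e where "0 < e" "e < 1" "\<And>p. fst p < e \<Longrightarrow> \<phi> p = 0" "\<And>p. fst p < e \<Longrightarrow> Lop \<phi> p = 0"
proof -
  let ?S = "closure {p. \<phi> p \<noteq> 0}"
  have S: "compact ?S" "?S \<subseteq> {0<..<1} \<times> UNIV" using assms by (auto simp: test_fun_def)
  obtain e where e: "0 < e" "e < 1" "\<And>p. p \<in> ?S \<Longrightarrow> e \<le> fst p"
  proof (cases "?S = {}")
    case True
    have "1/2 \<le> fst p" if h: "p \<in> ?S" for p using h[unfolded True] by (rule emptyE)
    with that[of "1/2"] show ?thesis by fastforce
  next
    case False
    obtain p0 where p0: "p0 \<in> ?S" "\<And>p. p \<in> ?S \<Longrightarrow> fst p0 \<le> fst p"
      using continuous_attains_inf[OF S(1) False continuous_on_fst[OF continuous_on_id]] by auto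
    then have "0 < fst p0" "fst p0 < 1" using S(2) by (auto simp: mem_Times_iff)
    then show ?thesis by (rule that[OF _ _ p0(2)])
  qed
  have out: "p \<notin> ?S" if "fst p < e" for p using e(3)[of p] that by force
  show ?thesis
  proof (rule that[OF e(1,2)])
    show z: "\<phi> p = 0" if "fst p < e" for p using out[OF that] subsetD[OF closure_subset[of "{p. \<phi> p \<noteq> 0}"], of p] by auto
    show "Lop \<phi> p = 0" if "fst p < e" for p
      using frechet_derivative_outside_support[OF out[OF that]] z[OF that] by (simp add: Lop_def)
  qed
qed

lemma indicator_mult_integrable:
  assumes u: "integrable P u" and [measurable]: "S \<in> sets borel"
  shows "integrable P (\<lambda>p. indicator S (fst p) * (u p :: real))"
  using bounded_mult_integrable[of "\<lambda>p. indicator S (fst p)" 1 u] u by (simp add: indicator_def)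

text \<open>For u = Lop \<phi> this is, by \<open>test_slice\<close>, the density in time of \<phi>
  P, as a representative defined at every r.\<close>

definition boundary_flux :: "('d pt \<Rightarrow> real) \<Rightarrow> real \<Rightarrow> real" where
  "boundary_flux u r = (\<integral>p. indicator {..<r} (fst p) * u p \<partial>P)"

text \<open>Multiplying \<phi> by functions of time turns the invariance of 1 into a weak derivative
  in time. The constant of \<open>du_Bois_Reymond\<close> is 0 because \<phi> and Lop \<phi> vanish
  near time 0.\<close>

lemma test_slice:
  assumes inv: "invariant (\<lambda>_. 1)" and t: "test_fun \<phi>" and st: "0 \<le> s" "s \<le> t" "t \<le> 1"
  shows "(\<integral>p. indicator {s<..<t} (fst p) * \<phi> p \<partial>P) = (LINT r:{s..t}|lborel. boundary_flux (Lop \<phi>) r)"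
proof -
  have weak: "weak_derivative01 P fst \<phi> (Lop \<phi>)"
    unfolding weak_derivative01_def
  proof (intro allI impI, elim conjE)
    fix \<xi> \<xi>' :: "real \<Rightarrow> real" assume \<xi>: "smooth_fun \<xi>" "\<forall>t. (\<xi> has_real_derivative \<xi>' t) (at t)"
    have "(\<integral>p. 1 * Lop (\<lambda>p. \<phi> p * \<xi> (fst p)) p \<partial>P) = 0"
      using inv test_fun_mult[OF t smooth_fst_compose[OF \<xi>(1)]] unfolding invariant_def by blast
    moreover have "1 * Lop (\<lambda>p. \<phi> p * \<xi> (fst p)) p = \<xi>' (fst p) * \<phi> p + \<xi> (fst p) * Lop \<phi> p" for p
      using Lop_time_mult[OF test_fun_smooth[OF t] \<xi>(1), of \<xi>'] \<xi>(2) by simp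
    ultimately show "(\<integral>p. \<xi>' (fst p) * \<phi> p + \<xi> (fst p) * Lop \<phi> p \<partial>P) = 0" by simp
  qed
  obtain K where K: "\<And>p. \<bar>\<phi> p\<bar> \<le> K" using test_fun_bounded[OF t] by blast
  have \<phi>i: "integrable P \<phi>" by (rule bounded_integrable[OF test_measurable(1)[OF t] K])
  obtain c where c: "\<And>s t. 0 \<le> s \<Longrightarrow> s \<le> t \<Longrightarrow> t \<le> 1 \<Longrightarrow>
     (\<integral>p. indicator {s<..<t} (fst p) * \<phi> p \<partial>P)
       = (LINT r:{s..t}|lborel. c + (\<integral>p. indicator {..<r} (fst p) * Lop \<phi> p \<partial>P))"
    using du_Bois_Reymond[OF fin \<phi>i Lop_integrable[OF t] fst_measurable_P weak] by blast
  obtain e where e: "0 < e" "e < 1" "\<And>p. fst p < e \<Longrightarrow> \<phi> p = 0" "\<And>p. fst p < e \<Longrightarrow> Lop \<phi> p = 0"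
    using test_time_support[OF t] by blast
  have "(\<integral>p. indicator {0<..<e} (fst p) * \<phi> p \<partial>P) = (\<integral>p. 0 \<partial>P)"
    by (intro Bochner_Integration.integral_cong) (auto simp: indicator_def e)
  moreover have "(LINT r:{0..e}|lborel. c + (\<integral>p. indicator {..<r} (fst p) * Lop \<phi> p \<partial>P)) = (LINT r:{0..e}|lborel. c)"
  proof (intro set_lebesgue_integral_cong)
    show "\<forall>r. r \<in> {0..e} \<longrightarrow> c + (\<integral>p. indicator {..<r} (fst p) * Lop \<phi> p \<partial>P) = c"
    proof (intro allI impI)
      fix r assume "r \<in> {0..e}"
      then have "(\<integral>p. indicator {..<r} (fst p) * Lop \<phi> p \<partial>P) = (\<integral>p. 0 \<partial>P)"
        by (intro Bochner_Integration.integral_cong) (auto simp: indicator_def e)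
      then show "c + (\<integral>p. indicator {..<r} (fst p) * Lop \<phi> p \<partial>P) = c" by simp
    qed
  qed simp
  moreover have "(LINT r:{0..e}|lborel. c) = c * e" using e by (simp add: set_lebesgue_integral_def)
  ultimately have "c = 0" using c[of 0 e] e by simp
  then show ?thesis using c[OF st] by (simp add: boundary_flux_def)
qed

lemma boundary_flux_bound:
  assumes u: "integrable P u"
  shows "\<bar>boundary_flux u r\<bar> \<le> (\<integral>p. indicator {..<r} (fst p) * \<bar>u p\<bar> \<partial>P)"
proof -
  have "\<bar>boundary_flux u r\<bar> \<le> (\<integral>p. \<bar>indicator {..<r} (fst p) * u p\<bar> \<partial>P)"
    unfolding boundary_flux_def by (rule integral_abs_bound)
  then show ?thesis by (simp add: abs_mult)
qed

text \<open>The total integral of Lop \<phi> is 0, so the part before r is minus the part after it.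
  Having both bounds makes \<phi> small on a time interval as soon as Lop \<phi> is small either
  before its end or after its beginning.\<close>

lemma boundary_flux_Lop_bound':
  assumes inv: "invariant (\<lambda>_. 1)" and t: "test_fun \<phi>"
  shows "\<bar>boundary_flux (Lop \<phi>) r\<bar> \<le> (\<integral>p. indicator {r..} (fst p) * \<bar>Lop \<phi> p\<bar> \<partial>P)"
proof -
  have "(\<integral>p. Lop \<phi> p \<partial>P) = 0" using inv t by (simp add: invariant_def)
  moreover have "(\<integral>p. Lop \<phi> p \<partial>P) = (\<integral>p. indicator {..<r} (fst p) * Lop \<phi> p + indicator {r..} (fst p) * Lop \<phi> p \<partial>P)"
    by (intro Bochner_Integration.integral_cong) (auto simp: indicator_def)
  ultimately have "boundary_flux (Lop \<phi>) r = - (\<integral>p. indicator {r..} (fst p) * Lop \<phi> p \<partial>P)"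
    using indicator_mult_integrable[OF Lop_integrable[OF t]] by (simp add: boundary_flux_def)
  moreover have "\<bar>\<integral>p. indicator {r..} (fst p) * Lop \<phi> p \<partial>P\<bar> \<le> (\<integral>p. \<bar>indicator {r..} (fst p) * Lop \<phi> p\<bar> \<partial>P)"
    by (rule integral_abs_bound)
  ultimately show ?thesis by (simp add: abs_mult)
qed

lemma set_integral_le_const:
  fixes g :: "real \<Rightarrow> real"
  assumes "s \<le> t" "\<And>r. r \<in> {s..t} \<Longrightarrow> \<bar>g r\<bar> \<le> M" "0 \<le> M"
  shows "(LINT r:{s..t}|lborel. g r) \<le> (t - s) * M"
proof (cases "set_integrable lborel {s..t} g")
  case True
  have Mi: "set_integrable lborel {s..t} (\<lambda>_. M)" unfolding set_integrable_def using assms(1) by (simp add: integrable_real_indicator)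
  have "(LINT r:{s..t}|lborel. g r) \<le> (LINT r:{s..t}|lborel. M)"
    by (rule set_integral_mono[OF True Mi]) (use assms(2) in \<open>auto simp: abs_le_iff\<close>)
  then show ?thesis using assms(1) by (simp add: set_lebesgue_integral_def)
next
  \<comment> \<open>A function that is not integrable has integral 0 by convention, and the bound is
    trivial.\<close>
  case False
  then show ?thesis using assms by (simp add: set_lebesgue_integral_def set_integrable_def not_integrable_integral_eq)
qed

lemma test_slice_le:
  assumes inv: "invariant (\<lambda>_. 1)" and t: "test_fun \<phi>" and st: "0 \<le> s" "s \<le> t" "t \<le> 1"
    and T: "T = {..<t} \<or> T = {s..}"
  shows "(\<integral>p. indicator {s<..<t} (fst p) * \<phi> p \<partial>P) \<le> (t - s) * (\<integral>p. indicator T (fst p) * \<bar>Lop \<phi> p\<bar> \<partial>P)"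
  unfolding test_slice[OF inv t st]
proof (rule set_integral_le_const[OF st(2)])
  have Li: "integrable P (\<lambda>p. indicator S (fst p) * \<bar>Lop \<phi> p\<bar>)" if "S \<in> sets borel" for S
    using Lop_integrable[OF t] that by (intro indicator_mult_integrable) auto
  fix r assume r: "r \<in> {s..t}"
  have "(\<integral>p. indicator {..<r} (fst p) * \<bar>Lop \<phi> p\<bar> \<partial>P) \<le> (\<integral>p. indicator {..<t} (fst p) * \<bar>Lop \<phi> p\<bar> \<partial>P)"
    using r by (intro integral_mono Li) (auto simp: indicator_def)
  moreover have "(\<integral>p. indicator {r..} (fst p) * \<bar>Lop \<phi> p\<bar> \<partial>P) \<le> (\<integral>p. indicator {s..} (fst p) * \<bar>Lop \<phi> p\<bar> \<partial>P)"
    using r by (intro integral_mono Li) (auto simp: indicator_def)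
  ultimately show "\<bar>boundary_flux (Lop \<phi>) r\<bar> \<le> (\<integral>p. indicator T (fst p) * \<bar>Lop \<phi> p\<bar> \<partial>P)"
    using T boundary_flux_bound[OF Lop_integrable[OF t], of r] boundary_flux_Lop_bound'[OF inv t, of r] by auto
qed (intro integral_nonneg_AE AE_I2, simp)

text \<open>Renormalisation with \<open>sqrt (y\<^sup>2 + k\<^sup>2) - k\<close> costs only \<open>k\<close>, since it is nearly 1-homogeneous.\<close>

lemma test_slice_abs_le:
  assumes inv: "invariant (\<lambda>_. 1)" and t: "test_fun \<phi>" and st: "0 \<le> s" "s \<le> t" "t \<le> 1"
    and T: "T = {..<t} \<or> T = {s..}"
  shows "(\<integral>p. indicator {s<..<t} (fst p) * \<bar>\<phi> p\<bar> \<partial>P) \<le> (t - s) * (\<integral>p. indicator T (fst p) * \<bar>Lop \<phi> p\<bar> \<partial>P)"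
proof -
  let ?I = "\<lambda>p :: 'd pt. indicat_real {s<..<t} (fst p)"
  define A where "A = (\<integral>p. indicator T (fst p) * \<bar>Lop \<phi> p\<bar> \<partial>P)"
  define W where "W = (\<integral>p. \<bar>w p\<bar> \<partial>P)"
  obtain K where K: "\<And>p. \<bar>\<phi> p\<bar> \<le> K" using test_fun_bounded[OF t] by blast
  have [measurable]: "T \<in> sets borel" using T by auto
  have \<phi>i: "integrable P (\<lambda>p. \<bar>\<phi> p\<bar>)" using bounded_integrable[OF test_measurable(1)[OF t] K] by simp
  have main: "(\<integral>p. ?I p * \<bar>\<phi> p\<bar> \<partial>P) \<le> (t - s) * (A + k * W) + k * measure P (space P)" if k: "k > 0" for k
  proof -
    define b where "b y = sqrt (y * y + k * k) - k" for y
    define b' where "b' y = y / sqrt (y * y + k * k)" for y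
    have q: "y * y + k * k > 0" for y :: real using k by (simp add: add_nonneg_pos)
    have bs: "smooth_fun b" unfolding b_def
      by (intro smooth_diff smooth_sqrt smooth_add smooth_mult smooth_const smooth_bounded_linear bounded_linear_ident q)
    have b0: "b 0 = 0" using k by (simp add: b_def)
    have bd: "(b has_real_derivative b' y) (at y)" for y
      unfolding b_def b'_def using q[of y] by (auto intro!: derivative_eq_intros simp: field_simps)
    have sq: "\<bar>y\<bar> \<le> sqrt (y * y + k * k)" "k \<le> sqrt (y * y + k * k)" "0 < sqrt (y * y + k * k)" for y
      using k q[of y] real_sqrt_le_mono[of "y * y" "y * y + k * k"] real_sqrt_le_mono[of "k * k" "y * y + k * k"] by auto
    have b'1: "\<bar>b' y\<bar> \<le> 1" for y using sq(1,3)[of y] by (simp add: b'_def abs_divide)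
    \<comment> \<open>b - y b' is what multiplies w in \<open>Lop_compose\<close>. With Q the square
      root it equals k^2 / Q - k and lies between -k and 0.\<close>
    have rem: "\<bar>b y - y * b' y\<bar> \<le> k" for y
    proof -
      define Q where "Q = sqrt (y * y + k * k)"
      have QQ: "Q * Q = y * y + k * k" using q[of y] by (simp add: Q_def)
      have "Q - y * (y / Q) = k * k / Q"
      proof -
        have "Q \<noteq> 0" using sq(3)[of y] by (simp only: Q_def)
        then have "Q - y * (y / Q) = (Q * Q - y * y) / Q" by (simp add: field_simps)
        then show ?thesis by (simp add: QQ)
      qed
      moreover have "0 \<le> k * k / Q" "k * k / Q \<le> k"
      proof -
        have "0 < Q" "k \<le> Q" using sq(2,3)[of y] by (auto simp only: Q_def)
        then show "0 \<le> k * k / Q" "k * k / Q \<le> k" using k by (auto simp: divide_le_eq)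
      qed
      ultimately show ?thesis by (simp add: b_def b'_def Q_def[symmetric] abs_le_iff)
    qed
    define \<psi> where "\<psi> p = b (\<phi> p)" for p
    have \<psi>t: "test_fun \<psi>" unfolding \<psi>_def by (rule test_fun_compose[OF t bs b0])
    have L\<psi>: "\<bar>Lop \<psi> p\<bar> \<le> \<bar>Lop \<phi> p\<bar> + k * \<bar>w p\<bar>" for p
    proof -
      have "\<bar>b' (\<phi> p) * Lop \<phi> p\<bar> \<le> 1 * \<bar>Lop \<phi> p\<bar>" unfolding abs_mult using b'1 by (intro mult_right_mono) auto
      moreover have "\<bar>w p * (b (\<phi> p) - \<phi> p * b' (\<phi> p))\<bar> \<le> \<bar>w p\<bar> * k" unfolding abs_mult using rem by (intro mult_left_mono) auto
      ultimately show ?thesis unfolding \<psi>_def Lop_compose[OF test_fun_smooth[OF t] bd] by (simp add: mult.commute)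
    qed
    have i1: "integrable P (\<lambda>p. indicator T (fst p) * \<bar>Lop \<phi> p\<bar>)" using Lop_integrable[OF t] by (intro indicator_mult_integrable) auto
    have i2: "integrable P (\<lambda>p. k * \<bar>w p\<bar>)" using w_integrable by auto
    have "(\<integral>p. indicator T (fst p) * \<bar>Lop \<psi> p\<bar> \<partial>P) \<le> (\<integral>p. indicator T (fst p) * \<bar>Lop \<phi> p\<bar> + k * \<bar>w p\<bar> \<partial>P)"
    proof (intro integral_mono Bochner_Integration.integrable_add i1 i2)
      show "integrable P (\<lambda>p. indicator T (fst p) * \<bar>Lop \<psi> p\<bar>)" using Lop_integrable[OF \<psi>t] by (intro indicator_mult_integrable) auto
      show "indicator T (fst p) * \<bar>Lop \<psi> p\<bar> \<le> indicator T (fst p) * \<bar>Lop \<phi> p\<bar> + k * \<bar>w p\<bar>" for p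
        using L\<psi>[of p] k by (auto simp: indicator_def)
    qed
    also have "\<dots> = A + k * W" using i1 w_integrable by (simp add: A_def W_def)
    finally have LT: "(\<integral>p. indicator T (fst p) * \<bar>Lop \<psi> p\<bar> \<partial>P) \<le> A + k * W" .
    obtain K' where K': "\<And>p. \<bar>\<psi> p\<bar> \<le> K'" using test_fun_bounded[OF \<psi>t] by blast
    have \<psi>i: "integrable P \<psi>" by (rule bounded_integrable[OF test_measurable(1)[OF \<psi>t] K'])
    have "(\<integral>p. ?I p * \<bar>\<phi> p\<bar> \<partial>P) \<le> (\<integral>p. ?I p * \<psi> p + k \<partial>P)"
    proof (intro integral_mono indicator_mult_integrable Bochner_Integration.integrable_add \<phi>i \<psi>i)
      show "?I p * \<bar>\<phi> p\<bar> \<le> ?I p * \<psi> p + k" for p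
        using sq(1)[of "\<phi> p"] k by (auto simp: \<psi>_def b_def indicator_def)
    qed auto
    also have "\<dots> = (\<integral>p. ?I p * \<psi> p \<partial>P) + k * measure P (space P)"
      using indicator_mult_integrable[OF \<psi>i, of "{s<..<t}"] by simp
    also have "(\<integral>p. ?I p * \<psi> p \<partial>P) \<le> (t - s) * (\<integral>p. indicator T (fst p) * \<bar>Lop \<psi> p\<bar> \<partial>P)"
      by (rule test_slice_le[OF inv \<psi>t st T])
    also have "\<dots> \<le> (t - s) * (A + k * W)" using LT st by (intro mult_left_mono) auto
    finally show ?thesis by simp
  qed
  have "((\<lambda>k. (t - s) * (A + k * W) + k * measure P (space P)) \<longlongrightarrow> (t - s) * (A + 0 * W) + 0 * measure P (space P)) (at_right 0)"
    by (intro tendsto_intros)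
  then have "(\<integral>p. ?I p * \<bar>\<phi> p\<bar> \<partial>P) \<le> (t - s) * (A + 0 * W) + 0 * measure P (space P)"
    by (rule tendsto_lowerbound) (auto simp: eventually_at_filter main)
  then show ?thesis by (simp add: A_def)
qed

end

lemma nonneg_if_interval_integrals_nonneg:
  fixes f :: "real \<Rightarrow> real"
  assumes ab: "a < b" and cont: "continuous_on {a..b} f"
    and int: "\<And>s t. a \<le> s \<Longrightarrow> s \<le> t \<Longrightarrow> t \<le> b \<Longrightarrow> 0 \<le> (LINT r:{s..t}|lborel. f r)"
    and r: "r \<in> {a..b}"
  shows "0 \<le> f r"
proof (rule ccontr)
  assume "\<not> 0 \<le> f r"
  then have fr: "f r < 0" by simp
  then obtain d where d: "d > 0" "\<And>x. x \<in> {a..b} \<Longrightarrow> \<bar>x - r\<bar> < d \<Longrightarrow> \<bar>f x - f r\<bar> < - f r / 2"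
    using cont r unfolding continuous_on_iff dist_real_def by (metis half_gt_zero neg_0_less_iff_less)
  define s t where "s = max a (r - d/2)" and "t = min b (r + d/2)"
  have st: "a \<le> s" "s < t" "t \<le> b" using r d(1) ab by (auto simp: s_def t_def)
  have lt: "f x \<le> f r / 2" if "x \<in> {s..t}" for x
  proof -
    have "x \<in> {a..b}" "\<bar>x - r\<bar> < d" using that r d(1) by (auto simp: s_def t_def abs_less_iff)
    then show ?thesis using d(2)[of x] by (auto simp: abs_less_iff)
  qed
  have fi: "set_integrable lborel {s..t} f"
    using st cont by (intro borel_integrable_atLeastAtMost') (auto intro: continuous_on_subset)
  have ci: "set_integrable lborel {s..t} (\<lambda>_. f r / 2)"
    by (intro borel_integrable_atLeastAtMost') auto
  have "(LINT x:{s..t}|lborel. f x) \<le> (LINT x:{s..t}|lborel. f r / 2)"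
    by (rule set_integral_mono[OF fi ci lt])
  also have "\<dots> = (t - s) * (f r / 2)" using st by (simp add: set_lebesgue_integral_def)
  also have "\<dots> < 0" using st fr by (intro mult_pos_neg) auto
  finally show False using int[of s t] st by simp
qed

lemma smooth_inner_snd: "smooth_fun (\<lambda>p :: 'd::finite pt. snd p \<bullet> snd p)"
  unfolding smooth_fun_def
proof
  fix k
  have bl: "bounded_linear (\<lambda>p :: 'd pt. 2 * (snd p \<bullet> snd h))" for h :: "'d pt"
    by (rule bounded_linear_compose[OF bounded_linear_mult_right bounded_linear_compose[OF bounded_linear_inner_left bounded_linear_snd]])
  have "Ck (Suc k) (\<lambda>p :: 'd pt. snd p \<bullet> snd p)"
  proof (rule Ck_SucI)
    show "((\<lambda>p :: 'd pt. snd p \<bullet> snd p) has_derivative (\<lambda>h. 2 * (snd p \<bullet> snd h))) (at p)" for p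
      by (auto intro!: derivative_eq_intros simp: inner_commute)
    show "Ck k (\<lambda>p :: 'd pt. 2 * (snd p \<bullet> snd h))" for h :: "'d pt" by (rule Ck_bounded_linear[OF bl])
  qed
  then show "Ck k (\<lambda>p :: 'd pt. snd p \<bullet> snd p)" by (rule Ck_mono_Suc)
qed

context transport begin

text \<open>Admits \<omega> without compact support, such as constants and coordinates: a cut-off in
  space equal to 1 near the bounded set \<Omega> is invisible to P, and \<xi> provides the compact
  support in time.\<close>

lemma weak_derivative_smooth:
  assumes inv: "invariant \<theta>" and \<omega>: "smooth_fun \<omega>"
  shows "weak_derivative01 P fst (\<lambda>p. \<theta> p * \<omega> p) (\<lambda>p. \<theta> p * Lop \<omega> p)"
  unfolding weak_derivative01_def
proof (intro allI impI, elim conjE)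
  fix \<xi> \<xi>' :: "real \<Rightarrow> real" and a b :: real
  assume \<xi>: "smooth_fun \<xi>" "\<forall>t. (\<xi> has_real_derivative \<xi>' t) (at t)" and ab: "0 < a" "b < 1"
    and supp: "\<forall>t. t \<notin> {a..b} \<longrightarrow> \<xi> t = 0"
  \<comment> \<open>The strict inequality leaves around every point of XO an open set where the
    cut-off is constant, so its derivative vanishes there as well.\<close>
  obtain R where R: "\<And>x. x \<in> \<Omega> \<Longrightarrow> norm x < R" "R > 0" using bounded\<Omega> bounded_pos_less by metis
  define \<kappa> where "\<kappa> p = smooth_step (R\<^sup>2 + 1 - snd p \<bullet> snd p)" for p :: "'d pt"
  have \<kappa>s: "smooth_fun \<kappa>" unfolding \<kappa>_def
    by (rule smooth_compose[OF smooth_smooth_step]) (intro smooth_diff smooth_const smooth_inner_snd)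
  have in_iff: "snd p \<bullet> snd p = (norm (snd p))\<^sup>2" for p :: "'d pt" by (simp add: power2_norm_eq_inner)
  have \<kappa>1: "\<kappa> p = 1" and D\<kappa>: "frechet_derivative \<kappa> (at p) h = 0" if p: "p \<in> space P" for p h
  proof -
    let ?U = "{q :: 'd pt. norm (snd q) < R}"
    have U: "open ?U" by (intro open_Collect_less continuous_intros)
    have pU: "p \<in> ?U" using p R(1) by (auto simp: spaceP XO_def)
    have one: "1 = \<kappa> q" if "q \<in> ?U" for q
    proof -
      have "(norm (snd q))\<^sup>2 \<le> R\<^sup>2" using that R(2) by (intro power_mono) auto
      then show ?thesis by (simp add: \<kappa>_def in_iff smooth_step_1)
    qed
    show "\<kappa> p = 1" using one[OF pU] by simp
    have "(\<kappa> has_derivative (\<lambda>_. 0)) (at p)"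
      by (rule has_derivative_transform_within_open[OF has_derivative_const U pU one])
    from frechet_derivative_at[OF this] show "frechet_derivative \<kappa> (at p) h = 0" by metis
  qed
  have \<omega>\<kappa>: "smooth_fun (\<lambda>p. \<omega> p * \<kappa> p)" by (rule smooth_mult[OF \<omega> \<kappa>s])
  let ?\<phi> = "\<lambda>p. (\<omega> p * \<kappa> p) * \<xi> (fst p)"
  have "test_fun ?\<phi>"
  proof -
    let ?S = "{a..b} \<times> cball (0::real^'d) (sqrt (R\<^sup>2 + 1))"
    have "{p. ?\<phi> p \<noteq> 0} \<subseteq> ?S"
    proof
      fix p assume p: "p \<in> {p. ?\<phi> p \<noteq> 0}"
      then have "fst p \<in> {a..b}" using supp by auto
      moreover have "norm (snd p) \<le> sqrt (R\<^sup>2 + 1)"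
      proof (rule ccontr)
        assume "\<not> norm (snd p) \<le> sqrt (R\<^sup>2 + 1)"
        then have "R\<^sup>2 + 1 \<le> (norm (snd p))\<^sup>2" by (meson less_imp_le not_le real_le_lsqrt norm_ge_zero real_sqrt_le_iff sqrt_le_D)
        then show False using p by (simp add: \<kappa>_def in_iff smooth_step_0)
      qed
      ultimately show "p \<in> ?S" by (simp add: mem_Times_iff)
    qed
    moreover have S: "compact ?S" by (intro compact_Times) auto
    ultimately have sub: "closure {p. ?\<phi> p \<noteq> 0} \<subseteq> ?S" by (intro closure_minimal compact_imp_closed)
    have "compact (closure {p. ?\<phi> p \<noteq> 0})" by (rule compact_closed_subset[OF S closed_closure sub])
    moreover have "?S \<subseteq> {0<..<1} \<times> UNIV" using ab by auto
    ultimately show ?thesis unfolding test_fun_def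
      using smooth_mult[OF \<omega>\<kappa> smooth_fst_compose[OF \<xi>(1)]] sub by blast
  qed
  then have "(\<integral>p. \<theta> p * Lop ?\<phi> p \<partial>P) = 0" using inv unfolding invariant_def by blast
  moreover have "(\<integral>p. \<theta> p * Lop ?\<phi> p \<partial>P) = (\<integral>p. \<xi>' (fst p) * (\<theta> p * \<omega> p) + \<xi> (fst p) * (\<theta> p * Lop \<omega> p) \<partial>P)"
  proof (rule Bochner_Integration.integral_cong[OF refl])
    fix p assume p: "p \<in> space P"
    have "Lop (\<lambda>p. \<omega> p * \<kappa> p) p = Lop \<omega> p" unfolding Lop_mult[OF \<omega> \<kappa>s] using \<kappa>1[OF p] D\<kappa>[OF p] by simp
    then show "\<theta> p * Lop ?\<phi> p = \<xi>' (fst p) * (\<theta> p * \<omega> p) + \<xi> (fst p) * (\<theta> p * Lop \<omega> p)"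
      using Lop_time_mult[OF \<omega>\<kappa> \<xi>(1), of \<xi>' p] \<xi>(2) \<kappa>1[OF p] by (simp add: algebra_simps)
  qed
  ultimately show "(\<integral>p. \<xi>' (fst p) * (\<theta> p * \<omega> p) + \<xi> (fst p) * (\<theta> p * Lop \<omega> p) \<partial>P) = 0" by simp
qed

section \<open>Mass and first moments of time slabs\<close>

lemma Lop_one: "Lop (\<lambda>_. 1) p = w p"
  by (simp add: Lop_def frechet_derivative_const)

lemma Lop_component: "Lop (\<lambda>p. snd p $ i) p = v p $ i + w p * snd p $ i"
  using Lop_component_mult[OF smooth_const[of 1], of i 0 p] by (simp add: Lop_one mult.commute)

lemma component_bounded:
  obtains R where "R > 0" "\<And>p i. p \<in> space P \<Longrightarrow> \<bar>snd p $ i\<bar> \<le> R"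
proof -
  obtain R where R: "\<And>x. x \<in> \<Omega> \<Longrightarrow> norm x \<le> R" "R > 0" using bounded\<Omega> bounded_pos by metis
  have "\<bar>snd p $ i\<bar> \<le> R" if "p \<in> space P" for p i
    using that R(1)[of "snd p"] component_le_norm_cart[of "snd p" i] by (auto simp: spaceP XO_def)
  then show ?thesis using R(2) that by blast
qed

lemma component_integrable: "integrable P (\<lambda>p. snd p $ i)"
proof -
  obtain R where R: "R > 0" "\<And>p i. p \<in> space P \<Longrightarrow> \<bar>snd p $ i\<bar> \<le> R" using component_bounded by blast
  show ?thesis by (rule bounded_integrable[OF component_measurable_P R(2)])
qed

lemma component_Lop_integrable: "integrable P (\<lambda>p. v p $ i + w p * snd p $ i)"
proof -
  obtain R where R: "R > 0" "\<And>p i. p \<in> space P \<Longrightarrow> \<bar>snd p $ i\<bar> \<le> R" using component_bounded by blast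
  have "integrable P (\<lambda>p. w p * snd p $ i)"
    using bounded_mult_integrable[OF component_measurable_P R(2) w_integrable] by (simp add: mult.commute)
  then show ?thesis using v_component_integrable by (rule Bochner_Integration.integrable_add[rotated])
qed

lemma slab_measure:
  assumes inv: "invariant (\<lambda>_. 1)"
  obtains c where "\<And>s t. 0 \<le> s \<Longrightarrow> s \<le> t \<Longrightarrow> t \<le> 1 \<Longrightarrow>
      (\<integral>p. indicator {s<..<t} (fst p) \<partial>P) = (LINT r:{s..t}|lborel. c + boundary_flux w r)"
proof -
  have weak: "weak_derivative01 P fst (\<lambda>_. 1) w"
    using weak_derivative_smooth[OF inv smooth_const[of 1]] by (simp add: Lop_one)
  obtain c where "\<And>s t. 0 \<le> s \<Longrightarrow> s \<le> t \<Longrightarrow> t \<le> 1 \<Longrightarrow>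
      (\<integral>p. indicator {s<..<t} (fst p) * 1 \<partial>P) = (LINT r:{s..t}|lborel. c + (\<integral>p. indicator {..<r} (fst p) * w p \<partial>P))"
    using du_Bois_Reymond[OF fin integrable_const[of 1] w_integrable fst_measurable_P weak] by blast
  then show ?thesis by (intro that[of c]) (simp add: boundary_flux_def)
qed

lemma slab_measure_le:
  assumes inv: "invariant (\<lambda>_. 1)"
  obtains C where "0 \<le> C" "\<And>s t. 0 \<le> s \<Longrightarrow> s \<le> t \<Longrightarrow> t \<le> 1 \<Longrightarrow>
      (\<integral>p. indicator {s<..<t} (fst p) \<partial>P) \<le> (t - s) * C"
proof -
  obtain c where c: "\<And>s t. 0 \<le> s \<Longrightarrow> s \<le> t \<Longrightarrow> t \<le> 1 \<Longrightarrow>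
      (\<integral>p. indicator {s<..<t} (fst p) \<partial>P) = (LINT r:{s..t}|lborel. c + boundary_flux w r)"
    using slab_measure[OF inv] by blast
  have le: "\<bar>c + boundary_flux w r\<bar> \<le> \<bar>c\<bar> + (\<integral>p. \<bar>w p\<bar> \<partial>P)" for r
  proof -
    have "(\<integral>p. indicator {..<r} (fst p) * \<bar>w p\<bar> \<partial>P) \<le> (\<integral>p. \<bar>w p\<bar> \<partial>P)"
      using w_integrable by (intro integral_mono indicator_mult_integrable) (auto simp: indicator_def)
    then show ?thesis using boundary_flux_bound[OF w_integrable, of r] by linarith
  qed
  have nn: "0 \<le> \<bar>c\<bar> + (\<integral>p. \<bar>w p\<bar> \<partial>P)" by (intro add_nonneg_nonneg integral_nonneg_AE) auto
  show ?thesis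
  proof (rule that[OF nn])
    fix s t :: real assume st: "0 \<le> s" "s \<le> t" "t \<le> 1"
    show "(\<integral>p. indicator {s<..<t} (fst p) \<partial>P) \<le> (t - s) * (\<bar>c\<bar> + (\<integral>p. \<bar>w p\<bar> \<partial>P))"
      unfolding c[OF st] by (rule set_integral_le_const[OF st(2) le nn])
  qed
qed

text \<open>A slab of width 2 e has mass at most 2 e C, so time has no atoms. This lets open and
  half-open slabs be interchanged.\<close>

lemma AE_time_neq:
  assumes inv: "invariant (\<lambda>_. 1)"
  shows "AE p in P. fst p \<noteq> r"
proof (cases "r \<in> {0<..<1}")
  case False
  then show ?thesis by (intro AE_I2) (auto simp: spaceP XO_def)
next
  case True
  obtain C where C: "0 \<le> C" "\<And>s t. 0 \<le> s \<Longrightarrow> s \<le> t \<Longrightarrow> t \<le> 1 \<Longrightarrow>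
      (\<integral>p. indicator {s<..<t} (fst p) \<partial>P) \<le> (t - s) * C"
    using slab_measure_le[OF inv] by blast
  let ?N = "{p \<in> space P. fst p = r}"
  have [measurable]: "?N \<in> sets P" by measurable
  have le: "measure P ?N \<le> 2 * e * C" if e: "0 < e" "e < min r (1 - r)" for e
  proof -
    have "measure P ?N = (\<integral>p. indicator ?N p \<partial>P)" by simp
    also have "\<dots> \<le> (\<integral>p. indicator {r - e<..<r + e} (fst p) \<partial>P)"
    proof (intro integral_mono)
      show "integrable P (\<lambda>p. indicat_real {r - e<..<r + e} (fst p))"
        by (rule bounded_integrable[where K = 1]) (auto simp: indicator_def)
      show "indicat_real ?N p \<le> indicator {r - e<..<r + e} (fst p)" for p using e by (auto simp: indicator_def)
    qed (auto simp: emeasure_eq_measure)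
    also have "\<dots> \<le> ((r + e) - (r - e)) * C" using e by (intro C(2)) auto
    finally show ?thesis by simp
  qed
  have "((\<lambda>e. 2 * e * C) \<longlongrightarrow> 2 * 0 * C) (at_right 0)" by (intro tendsto_intros)
  moreover have "\<forall>\<^sub>F e in at_right 0. measure P ?N \<le> 2 * e * C"
    unfolding eventually_at_right_field using True le by (intro exI[of _ "min r (1 - r)"]) auto
  ultimately have "measure P ?N \<le> 2 * 0 * C"
    by (intro tendsto_lowerbound) auto
  then have "emeasure P ?N = 0" by (simp add: emeasure_eq_measure measure_le_0_iff)
  then show ?thesis by (subst AE_iff_measurable[OF _ refl]) auto
qed

text \<open>The indicator jumps only at points whose time is the limit time, which form a null set;
  dominated convergence applies.\<close>

lemma boundary_flux_continuous:
  assumes inv: "invariant (\<lambda>_. 1)" and u: "integrable P u"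
  shows "continuous_on UNIV (boundary_flux u)"
proof -
  have [measurable]: "u \<in> borel_measurable P" using u by auto
  have "(\<lambda>n. boundary_flux u (x n)) \<longlonglongrightarrow> boundary_flux u a" if x: "x \<longlonglongrightarrow> a" for x a
    unfolding boundary_flux_def
  proof (rule integral_dominated_convergence[where w = "\<lambda>p. \<bar>u p\<bar>"])
    show "AE p in P. (\<lambda>n. indicat_real {..<x n} (fst p) * u p) \<longlonglongrightarrow> indicat_real {..<a} (fst p) * u p"
      using AE_time_neq[OF inv, of a]
    proof eventually_elim
      case (elim p)
      have "\<forall>\<^sub>F n in sequentially. indicat_real {..<x n} (fst p) = indicator {..<a} (fst p)"
      proof (cases "fst p < a")
        case True
        then have "\<forall>\<^sub>F n in sequentially. fst p < x n" using x by (rule order_tendstoD(1)[rotated])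
        then show ?thesis by eventually_elim (simp add: True)
      next
        case False
        then have "a < fst p" using elim by simp
        then have "\<forall>\<^sub>F n in sequentially. x n < fst p" using x by (rule order_tendstoD(2)[rotated])
        then show ?thesis by eventually_elim (use False in auto)
      qed
      then have "(\<lambda>n. indicat_real {..<x n} (fst p)) \<longlonglongrightarrow> indicator {..<a} (fst p)" by (rule tendsto_eventually)
      then show ?case by (intro tendsto_intros)
    qed
  qed (use u in \<open>auto simp: indicator_def\<close>)
  then show ?thesis by (auto simp: continuous_on_sequentially o_def)
qed

lemma boundary_flux_diff:
  assumes inv: "invariant (\<lambda>_. 1)" and u: "integrable P u" and "s \<le> t"
  shows "boundary_flux u t - boundary_flux u s = (\<integral>p. indicator {s<..<t} (fst p) * u p \<partial>P)"
proof -
  have [measurable]: "u \<in> borel_measurable P" using u by auto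
  have "boundary_flux u t - boundary_flux u s = (\<integral>p. indicator {..<t} (fst p) * u p - indicator {..<s} (fst p) * u p \<partial>P)"
    unfolding boundary_flux_def using indicator_mult_integrable[OF u] by simp
  also have "\<dots> = (\<integral>p. indicator {s<..<t} (fst p) * u p \<partial>P)"
    by (intro integral_cong_AE, simp, simp, use AE_time_neq[OF inv, of s] in eventually_elim) (use assms(3) in \<open>auto simp: indicator_def\<close>)
  finally show ?thesis .
qed

text \<open>A bounded smooth function close to the identity near 0: it is at most min 1 |y|, so its
  square is at most |y|, and its derivative differs from 1 by at most 3 |y|. All errors are thus
  controlled by |y| itself, as needed for a test function that is small only in L1.\<close>

definition renorm :: "real \<Rightarrow> real" where "renorm y = y / sqrt (1 + y * y)"
definition renorm' :: "real \<Rightarrow> real" where "renorm' y = 1 / (sqrt (1 + y * y)) ^ 3"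

lemma renorm_facts:
  shows smooth_renorm: "smooth_fun renorm" and renorm_0: "renorm 0 = 0"
    and renorm_deriv: "(renorm has_real_derivative renorm' y) (at y)"
    and renorm_le: "\<bar>renorm y\<bar> \<le> min 1 \<bar>y\<bar>" and renorm'_01: "0 \<le> renorm' y" "renorm' y \<le> 1"
    and renorm'_ge: "1 - renorm' y \<le> 3 * \<bar>y\<bar>" and renorm_rem: "\<bar>renorm y - y * renorm' y\<bar> \<le> min 1 \<bar>y\<bar>"
proof -
  have q: "1 + y * y > 0" for y :: real by (simp add: add_pos_nonneg)
  have eq: "renorm = (\<lambda>y. y * inverse (sqrt (1 + y * y)))" by (auto simp: renorm_def divide_inverse)
  show "smooth_fun renorm" unfolding eq
    by (intro smooth_mult smooth_inverse smooth_sqrt smooth_add smooth_const smooth_bounded_linear bounded_linear_ident q)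
       (use q in auto)
  show "renorm 0 = 0" by (simp add: renorm_def)
  define Q where "Q = sqrt (1 + y * y)"
  have QQ: "Q * Q = 1 + y * y" using q[of y] by (simp add: Q_def)
  have Q1: "1 \<le> Q" using real_sqrt_le_mono[of 1 "1 + y * y"] by (simp add: Q_def)
  have Qy: "\<bar>y\<bar> \<le> Q" using real_sqrt_le_mono[of "y * y" "1 + y * y"] by (simp add: Q_def)
  have Qy1: "Q \<le> 1 + \<bar>y\<bar>" unfolding Q_def by (rule real_le_lsqrt) (auto simp: power2_eq_square algebra_simps abs_mult_self_eq)
  have Q0: "Q > 0" using Q1 by simp
  have "(renorm has_real_derivative (1 * Q - y * ((y + y) * (1 / (2 * Q)))) / (Q * Q)) (at y)"
    unfolding renorm_def[abs_def] Q_def using q[of y] by (auto intro!: derivative_eq_intros simp: field_simps)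
  moreover have "(1 * Q - y * ((y + y) * (1 / (2 * Q)))) / (Q * Q) = (Q * Q - y * y) / Q ^ 3"
    using Q0 by (simp add: field_simps power3_eq_cube)
  ultimately show "(renorm has_real_derivative renorm' y) (at y)" by (simp add: QQ renorm'_def Q_def)
  have r: "\<bar>renorm y\<bar> = \<bar>y\<bar> / Q" using Q0 by (simp add: renorm_def Q_def[symmetric] abs_divide)
  show rle: "\<bar>renorm y\<bar> \<le> min 1 \<bar>y\<bar>" unfolding r using Q0 Q1 Qy by (auto simp: divide_le_eq mult_le_cancel_left1)
  have r': "renorm' y = 1 / Q ^ 3" by (simp add: renorm'_def Q_def)
  show "0 \<le> renorm' y" unfolding r' using Q0 by simp
  have "1 \<le> Q ^ 3" using Q1 by simp
  then show r'1: "renorm' y \<le> 1" unfolding r' using Q0 by (simp add: divide_le_eq)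
  define z where "z = 1 / Q"
  have z: "0 \<le> z" "z \<le> 1" using Q0 Q1 by (auto simp: z_def)
  have "1 - z ^ 3 = (1 - z) * (1 + z + z * z)" by (simp add: power3_eq_cube algebra_simps)
  also have "\<dots> \<le> (1 - z) * 3" using z mult_le_one[of z z] by (intro mult_left_mono) auto
  also have "1 - z \<le> \<bar>y\<bar>"
  proof -
    have "1 - z = (Q - 1) / Q" using Q0 by (simp add: z_def field_simps)
    also have "\<dots> \<le> (Q - 1) / 1" using Q0 Q1 by (intro divide_left_mono) auto
    finally show ?thesis using Qy1 by simp
  qed
  finally show "1 - renorm' y \<le> 3 * \<bar>y\<bar>" unfolding r' z_def by (simp add: power_one_over)
  have "renorm y - y * renorm' y = renorm y * (1 - z * z)"
    using Q0 by (simp add: renorm_def Q_def[symmetric] r' z_def power3_eq_cube field_simps)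
  then have "\<bar>renorm y - y * renorm' y\<bar> = \<bar>renorm y\<bar> * (1 - z * z)"
    using z mult_le_one[of z z] by (simp add: abs_mult)
  also have "\<dots> \<le> \<bar>renorm y\<bar>" using z by (intro mult_left_le) auto
  finally show "\<bar>renorm y - y * renorm' y\<bar> \<le> min 1 \<bar>y\<bar>" using rle by linarith
qed

end

section \<open>Concentration on a curve\<close>

context transport begin

text \<open>Mean zero is forced on f when the weight 1 is invariant, since Lop \<phi> then has mean
  zero. The approximation is in L1 and comes with no bound on \<phi>.\<close>

definition approximable :: bool where
  "approximable \<longleftrightarrow> (\<forall>f lam K. f \<in> borel_measurable P \<longrightarrow> (\<forall>p\<in>space P. \<bar>f p\<bar> \<le> K) \<longrightarrow> (\<integral>p. f p \<partial>P) = 0 \<longrightarrow> lam > 0 \<longrightarrow>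
      (\<exists>\<phi>. test_fun \<phi> \<and> (\<integral>p. \<bar>Lop \<phi> p - f p\<bar> \<partial>P) < lam))"

text \<open>Let X be the coordinate centred on the slab, f = \<tau> / (t - s) X there and 0
  elsewhere, and let Lop \<phi> be close to f. Testing the equation with renorm of \<phi> times X
  expresses the pairing of X with f, which is \<tau> / (t - s) times the variance, through errors.
  On the slab \<phi> has L1 norm of order (t - s) \<tau>, which yields a term of order \<tau>^2, and
  the terms with v and w are bounded by their integrals over the slab. Outside the slab Lop \<phi>
  is only the approximation error, so all contributions from there disappear in the limit.\<close>

lemma slab_variance:
  assumes inv: "invariant (\<lambda>_. 1)" and approx: approximable
    and R: "R > 0" "\<And>p. p \<in> space P \<Longrightarrow> \<bar>snd p $ i\<bar> \<le> R"
    and H: "(\<integral>p. indicator {s<..<t} (fst p) \<partial>P) \<le> (t - s) * H"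
    and st: "0 \<le> s" "s < t" "t \<le> 1" and m: "(\<integral>p. indicat_real {s<..<t} (fst p) \<partial>P) > 0"
    and a: "a = (\<integral>p. indicator {s<..<t} (fst p) * snd p $ i \<partial>P) / (\<integral>p. indicator {s<..<t} (fst p) \<partial>P)"
    and \<tau>: "\<tau> > 0"
  shows "(\<integral>p. indicator {s<..<t} (fst p) * (snd p $ i - a)\<^sup>2 \<partial>P) \<le>
     (t - s) * (24 * R ^ 3 * H * \<tau> + (1 / \<tau>) * (\<integral>p. indicator {s<..<t} (fst p) * (2 * R * \<bar>w p\<bar> + norm (v p)) \<partial>P))"
proof -
  define I where "I p = indicat_real {s<..<t} (fst p)" for p :: "'d pt"
  \<comment> \<open>The open intervals before and after the slab; the times s and t themselves are
    null by \<open>AE_time_neq\<close>.\<close>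
  define I0 where "I0 p = indicat_real {0<..<s} (fst p)" for p :: "'d pt"
  define I1 where "I1 p = indicat_real {t<..<1} (fst p)" for p :: "'d pt"
  define X where "X p = snd p $ i - a" for p :: "'d pt"
  define g where "g p = 2 * R * \<bar>w p\<bar> + norm (v p)" for p
  define \<epsilon> where "\<epsilon> = t - s"
  \<comment> \<open>Centring gives f mean zero, as \<open>approximable\<close> demands. The scaling
    makes its L1 norm of order \<tau>, whatever the length of the slab.\<close>
  define f where "f p = \<tau> / \<epsilon> * (I p * X p)" for p
  define M where "M = (\<integral>p. I p \<partial>P)"
  have \<epsilon>: "\<epsilon> > 0" using st by (simp add: \<epsilon>_def)
  have M: "M > 0" "M \<le> \<epsilon> * H" using m H by (auto simp: M_def I_def \<epsilon>_def)
  have [measurable]: "I \<in> borel_measurable P" "I0 \<in> borel_measurable P" "I1 \<in> borel_measurable P" "X \<in> borel_measurable P"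
    unfolding I_def I0_def I1_def X_def by measurable
  have [measurable]: "g \<in> borel_measurable P" "f \<in> borel_measurable P" unfolding g_def f_def by measurable
  have I01: "0 \<le> I p" "I p \<le> 1" "I p * I p = I p" for p by (auto simp: I_def indicator_def)
  have Ii: "integrable P I" by (rule bounded_integrable[where K = 1]) (auto simp: I_def indicator_def)
  have Ixi: "integrable P (\<lambda>p. I p * snd p $ i)" unfolding I_def by (intro indicator_mult_integrable component_integrable) auto
  have aM: "a * M = (\<integral>p. I p * snd p $ i \<partial>P)" using M(1) a by (simp add: M_def I_def)
  have aR: "\<bar>a\<bar> \<le> R"
  proof -
    have "\<bar>a * M\<bar> \<le> (\<integral>p. \<bar>I p * snd p $ i\<bar> \<partial>P)" unfolding aM by (rule integral_abs_bound)
    also have "\<dots> \<le> (\<integral>p. R * I p \<partial>P)"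
      using Ixi Ii R(2) I01 by (intro integral_mono integrable_abs integrable_mult_right) (auto simp: abs_mult mult.commute intro!: mult_right_mono)
    also have "\<dots> = R * M" by (simp add: M_def)
    finally show ?thesis using M(1) by (simp add: abs_mult)
  qed
  have XR: "\<bar>X p\<bar> \<le> 2 * R" if "p \<in> space P" for p using R(2)[OF that] aR by (auto simp: X_def)
  have IXi: "integrable P (\<lambda>p. I p * X p)" unfolding X_def right_diff_distrib using Ixi Ii by auto
  have "(\<integral>p. I p * X p \<partial>P) = 0" unfolding X_def right_diff_distrib using Ixi Ii aM by (simp add: M_def mult.commute)
  then have f0: "(\<integral>p. f p \<partial>P) = 0" by (simp add: f_def)
  have fI: "\<bar>f p\<bar> \<le> \<tau> / \<epsilon> * (2 * R) * I p" if "p \<in> space P" for p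
  proof -
    have "\<bar>f p\<bar> = \<tau> / \<epsilon> * (I p * \<bar>X p\<bar>)" using \<tau> \<epsilon> I01[of p] by (simp add: f_def abs_mult)
    also have "\<dots> \<le> \<tau> / \<epsilon> * (I p * (2 * R))" using \<tau> \<epsilon> I01[of p] XR[OF that] by (intro mult_left_mono) auto
    finally show ?thesis by (simp add: mult.commute mult.left_commute)
  qed
  have fK: "\<bar>f p\<bar> \<le> \<tau> / \<epsilon> * (2 * R)" if "p \<in> space P" for p
    using fI[OF that] mult_left_mono[OF I01(2)[of p], of "\<tau> / \<epsilon> * (2 * R)"] \<tau> \<epsilon> R by simp
  have fi: "integrable P f" by (rule bounded_integrable[OF _ fK]) auto
  have f1: "(\<integral>p. \<bar>f p\<bar> \<partial>P) \<le> 2 * R * \<tau> * H"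
  proof -
    have "(\<integral>p. \<bar>f p\<bar> \<partial>P) \<le> (\<integral>p. \<tau> / \<epsilon> * (2 * R) * I p \<partial>P)"
      using fi Ii fI by (intro integral_mono integrable_abs integrable_mult_right) auto
    also have "\<dots> = \<tau> / \<epsilon> * (2 * R) * M" by (simp add: M_def)
    also have "\<dots> \<le> \<tau> / \<epsilon> * (2 * R) * (\<epsilon> * H)" using M(2) \<tau> \<epsilon> R by (intro mult_left_mono) auto
    also have "\<dots> = 2 * R * \<tau> * H" using \<epsilon> by simp
    finally show ?thesis .
  qed
  have gi: "integrable P g" unfolding g_def using w_integrable v_integrable by auto
  have g0: "0 \<le> g p" for p using R by (simp add: g_def)
  have g2i: "integrable P (\<lambda>p. (g p)\<^sup>2)"
  proof (rule Bochner_Integration.integrable_bound)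
    show "integrable P (\<lambda>p. 8 * R\<^sup>2 * (w p)\<^sup>2 + 2 * (norm (v p))\<^sup>2)" using v2 w2 by simp
    show "AE p in P. norm ((g p)\<^sup>2) \<le> norm (8 * R\<^sup>2 * (w p)\<^sup>2 + 2 * (norm (v p))\<^sup>2)"
    proof (rule AE_I2)
      fix p
      have "(x + y)\<^sup>2 \<le> 2 * x\<^sup>2 + 2 * y\<^sup>2" for x y :: real
        using zero_le_power2[of "x - y"] by (simp add: power2_eq_square algebra_simps)
      from this[of "2 * R * \<bar>w p\<bar>" "norm (v p)"]
      show "norm ((g p)\<^sup>2) \<le> norm (8 * R\<^sup>2 * (w p)\<^sup>2 + 2 * (norm (v p))\<^sup>2)"
        by (simp add: g_def power_mult_distrib)
    qed
  qed measurable
  define V where "V = (\<integral>p. I p * (X p)\<^sup>2 \<partial>P)"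
  define GI where "GI = (\<integral>p. I p * g p \<partial>P)"
  define G2 where "G2 = (\<integral>p. (g p)\<^sup>2 \<partial>P)"
  have Igi: "integrable P (\<lambda>p. I p * g p)" unfolding I_def by (intro indicator_mult_integrable gi) auto
  have Xfi: "integrable P (\<lambda>p. X p * f p)" using bounded_mult_integrable[OF _ XR fi] by simp
  have Xf: "(\<integral>p. X p * f p \<partial>P) = \<tau> / \<epsilon> * V"
  proof -
    have "(\<integral>p. X p * f p \<partial>P) = (\<integral>p. \<tau> / \<epsilon> * (I p * (X p)\<^sup>2) \<partial>P)"
      by (intro Bochner_Integration.integral_cong) (auto simp: f_def power2_eq_square)
    then show ?thesis by (simp only: V_def integral_mult_right_zero)
  qed
  have key: "\<tau> / \<epsilon> * V \<le> 12 * R\<^sup>2 * \<tau> * (2 * R * \<tau> * H + lam) + 2 * R * lam + GI + sqrt lam * (G2 + 1/2)" if lam: "lam > 0" for lam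
  proof -
    obtain \<phi> where \<phi>: "test_fun \<phi>" "(\<integral>p. \<bar>Lop \<phi> p - f p\<bar> \<partial>P) < lam"
      using approx f0 fK lam \<open>f \<in> borel_measurable P\<close> unfolding approximable_def by meson
    note [measurable] = test_measurable[OF \<phi>(1)] Lop_measurable[OF \<phi>(1)]
    define e where "e p = Lop \<phi> p - f p" for p
    \<comment> \<open>With \<nu> = sqrt lam, Young's inequality leaves the terms \<nu> G2 and lam /
      \<nu>, both of order sqrt lam.\<close>
    define \<nu> where "\<nu> = sqrt lam"
    have \<nu>: "\<nu> > 0" "\<nu> * \<nu> = lam" using lam by (auto simp: \<nu>_def)
    have ei: "integrable P (\<lambda>p. \<bar>e p\<bar>)" unfolding e_def using Lop_integrable[OF \<phi>(1)] fi by auto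
    define \<psi> where "\<psi> p = renorm (\<phi> p)" for p
    have \<psi>t: "test_fun \<psi>" unfolding \<psi>_def by (rule test_fun_compose[OF \<phi>(1) smooth_renorm renorm_0])
    define \<Xi> where "\<Xi> = (\<lambda>p. \<psi> p * (snd p $ i - a))"
    have \<Xi>t: "test_fun \<Xi>" unfolding \<Xi>_def by (intro test_fun_mult \<psi>t smooth_diff smooth_component smooth_const)
    have \<Xi>0: "(\<integral>p. Lop \<Xi> p \<partial>P) = 0" using inv \<Xi>t by (simp add: invariant_def)
    obtain K where K: "\<And>p. \<bar>\<phi> p\<bar> \<le> K" using test_fun_bounded[OF \<phi>(1)] by blast
    have \<phi>i: "integrable P (\<lambda>p. \<bar>\<phi> p\<bar>)" using bounded_integrable[OF test_measurable(1)[OF \<phi>(1)] K] by simp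
    have I\<phi>i: "integrable P (\<lambda>p. I p * \<bar>\<phi> p\<bar>)" "integrable P (\<lambda>p. I0 p * \<bar>\<phi> p\<bar>)" "integrable P (\<lambda>p. I1 p * \<bar>\<phi> p\<bar>)"
      unfolding I_def I0_def I1_def by (intro indicator_mult_integrable \<phi>i; simp)+
    have Leb: "(\<integral>p. indicator T (fst p) * \<bar>Lop \<phi> p\<bar> \<partial>P) \<le> (\<integral>p. \<bar>f p\<bar> \<partial>P) + lam" if "T \<in> sets borel" for T
    proof -
      have "(\<integral>p. indicator T (fst p) * \<bar>Lop \<phi> p\<bar> \<partial>P) \<le> (\<integral>p. \<bar>f p\<bar> + \<bar>e p\<bar> \<partial>P)"
        using Lop_integrable[OF \<phi>(1)] fi ei that
        by (intro integral_mono indicator_mult_integrable) (auto simp: indicator_def e_def)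
      then show ?thesis using fi ei \<phi>(2) by (simp add: e_def)
    qed
    \<comment> \<open>Where f vanishes, Lop \<phi> is the pure error. With the two choices of T in
      \<open>test_slice_abs_le\<close> this makes \<phi> small both before and after the
      slab.\<close>
    have Lout: "(\<integral>p. indicator T (fst p) * \<bar>Lop \<phi> p\<bar> \<partial>P) \<le> lam" if "T \<in> sets borel" "T \<inter> {s<..<t} = {}" for T
    proof -
      have "(\<integral>p. indicator T (fst p) * \<bar>Lop \<phi> p\<bar> \<partial>P) \<le> (\<integral>p. \<bar>e p\<bar> \<partial>P)"
        using Lop_integrable[OF \<phi>(1)] ei that
        by (intro integral_mono indicator_mult_integrable) (auto simp: indicator_def e_def f_def I_def)
      then show ?thesis using \<phi>(2) by (simp add: e_def)
    qed
    have sI: "(\<integral>p. I p * \<bar>\<phi> p\<bar> \<partial>P) \<le> \<epsilon> * (2 * R * \<tau> * H + lam)"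
    proof -
      have "(\<integral>p. I p * \<bar>\<phi> p\<bar> \<partial>P) \<le> (t - s) * (\<integral>p. indicator {..<t} (fst p) * \<bar>Lop \<phi> p\<bar> \<partial>P)"
        unfolding I_def using st by (intro test_slice_abs_le[OF inv \<phi>(1)]) auto
      also have "\<dots> \<le> (t - s) * (2 * R * \<tau> * H + lam)"
        using Leb[of "{..<t}"] f1 st by (intro mult_left_mono) auto
      finally show ?thesis by (simp add: \<epsilon>_def)
    qed
    have s0: "(\<integral>p. I0 p * \<bar>\<phi> p\<bar> \<partial>P) \<le> lam"
    proof -
      have "(\<integral>p. I0 p * \<bar>\<phi> p\<bar> \<partial>P) \<le> (s - 0) * (\<integral>p. indicator {..<s} (fst p) * \<bar>Lop \<phi> p\<bar> \<partial>P)"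
        unfolding I0_def using st by (intro test_slice_abs_le[OF inv \<phi>(1)]) auto
      also have "\<dots> \<le> (s - 0) * lam" using st by (intro mult_left_mono Lout) auto
      also have "\<dots> \<le> 1 * lam" using st lam by (intro mult_right_mono) auto
      finally show ?thesis by simp
    qed
    have s1: "(\<integral>p. I1 p * \<bar>\<phi> p\<bar> \<partial>P) \<le> lam"
    proof -
      have "(\<integral>p. I1 p * \<bar>\<phi> p\<bar> \<partial>P) \<le> (1 - t) * (\<integral>p. indicator {t..} (fst p) * \<bar>Lop \<phi> p\<bar> \<partial>P)"
        unfolding I1_def using st by (intro test_slice_abs_le[OF inv \<phi>(1)]) auto
      also have "\<dots> \<le> (1 - t) * lam" using st by (intro mult_left_mono Lout) auto
      also have "\<dots> \<le> 1 * lam" using st lam by (intro mult_right_mono) auto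
      finally show ?thesis by simp
    qed
    \<comment> \<open>Pointwise majorant of X f, with one summand per source: the test function,
      whose Lop integrates to 0; the nonlinearity of renorm on the slab; the approximation error;
      the terms with v and w on the slab; and the same terms outside it.\<close>
    define Z where "Z p = Lop \<Xi> p + \<tau> / \<epsilon> * (12 * R\<^sup>2) * (I p * \<bar>\<phi> p\<bar>) + 2 * R * \<bar>e p\<bar> + I p * g p + \<nu> * (g p)\<^sup>2
        + 1 / (4 * \<nu>) * (I0 p * \<bar>\<phi> p\<bar>) + 1 / (4 * \<nu>) * (I1 p * \<bar>\<phi> p\<bar>)" for p
    have "AE p in P. X p * f p \<le> Z p"
      using AE_time_neq[OF inv, of s] AE_time_neq[OF inv, of t] AE_space
    proof eventually_elim
      case (elim p)
      define b where "b = renorm' (\<phi> p)"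
      define r where "r = renorm (\<phi> p) - \<phi> p * b"
      define mm where "mm = min 1 \<bar>\<phi> p\<bar>"
      have b: "0 \<le> b" "b \<le> 1" "1 - b \<le> 3 * \<bar>\<phi> p\<bar>" using renorm'_01 renorm'_ge by (auto simp: b_def)
      have mm: "\<bar>\<psi> p\<bar> \<le> mm" "\<bar>r\<bar> \<le> mm" "0 \<le> mm" "mm \<le> 1" "mm * mm \<le> \<bar>\<phi> p\<bar>"
        using renorm_le[of "\<phi> p"] renorm_rem[of "\<phi> p"] mult_mono[of mm 1 mm "\<bar>\<phi> p\<bar>"] by (auto simp: \<psi>_def r_def b_def mm_def)
      have L: "Lop \<Xi> p = X p * (b * Lop \<phi> p + w p * r) + \<psi> p * v p $ i"
        unfolding \<Xi>_def Lop_component_mult[OF test_fun_smooth[OF \<psi>t]] unfolding \<psi>_def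
          Lop_compose[OF test_fun_smooth[OF \<phi>(1)] renorm_deriv] by (simp add: X_def r_def b_def)
      \<comment> \<open>The factor 12 R^2 is (2 R)^2 from the square of X times 3 from 1 - b \<le> 3
        |\<phi>|.\<close>
      have t1: "X p * f p * (1 - b) \<le> \<tau> / \<epsilon> * (12 * R\<^sup>2) * (I p * \<bar>\<phi> p\<bar>)"
      proof -
        have c2: "(X p)\<^sup>2 \<le> (2 * R)\<^sup>2" using XR[OF elim(3)] R by (intro power2_le_iff_abs_le[THEN iffD2]) auto
        have "X p * f p * (1 - b) = \<tau> / \<epsilon> * I p * ((X p)\<^sup>2 * (1 - b))" by (simp add: f_def power2_eq_square)
        also have "\<dots> \<le> \<tau> / \<epsilon> * I p * ((2 * R)\<^sup>2 * (3 * \<bar>\<phi> p\<bar>))"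
          using c2 b \<tau> \<epsilon> I01[of p] by (intro mult_left_mono mult_mono) auto
        finally show ?thesis by (simp add: power_mult_distrib mult.assoc mult.left_commute)
      qed
      have t2: "- (X p * b * e p) \<le> 2 * R * \<bar>e p\<bar>"
      proof -
        have "\<bar>X p * b * e p\<bar> \<le> (2 * R * 1) * \<bar>e p\<bar>"
          unfolding abs_mult using XR[OF elim(3)] b R by (intro mult_right_mono mult_mono) auto
        then show ?thesis by simp
      qed
      have t3: "- (X p * (w p * r)) - \<psi> p * v p $ i \<le> g p * mm"
      proof -
        have "\<bar>X p * (w p * r)\<bar> \<le> 2 * R * (\<bar>w p\<bar> * mm)"
          unfolding abs_mult using XR[OF elim(3)] mm R by (intro mult_mono mult_left_mono) auto
        moreover have "\<bar>\<psi> p * v p $ i\<bar> \<le> mm * norm (v p)"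
          unfolding abs_mult using mm component_le_norm_cart[of "v p" i] by (intro mult_mono) auto
        ultimately show ?thesis by (simp add: g_def algebra_simps)
      qed
      \<comment> \<open>On the slab mm \<le> 1 suffices. Elsewhere g is only square integrable and
        \<phi> only small in L1; Young's inequality together with mm^2 \<le> |\<phi>| separates
        them.\<close>
      have t4: "g p * mm \<le> I p * g p + \<nu> * (g p)\<^sup>2 + 1 / (4 * \<nu>) * (I0 p * \<bar>\<phi> p\<bar>) + 1 / (4 * \<nu>) * (I1 p * \<bar>\<phi> p\<bar>)"
      proof (cases "fst p \<in> {s<..<t}")
        case True
        have "g p * mm \<le> g p" using g0[of p] mm by (simp add: mult_left_le)
        moreover have "0 \<le> \<nu> * (g p)\<^sup>2" "0 \<le> 1 / (4 * \<nu>) * (I0 p * \<bar>\<phi> p\<bar>)" "0 \<le> 1 / (4 * \<nu>) * (I1 p * \<bar>\<phi> p\<bar>)"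
          using \<nu> by (auto simp: I0_def I1_def)
        ultimately show ?thesis using True by (simp add: I_def)
      next
        case False
        then have one: "I0 p + I1 p = 1" using elim st by (auto simp: I0_def I1_def indicator_def spaceP XO_def)
        have "0 \<le> \<nu> * (g p - mm / (2 * \<nu>))\<^sup>2" using \<nu> by simp
        also have "\<dots> = \<nu> * (g p)\<^sup>2 - g p * mm + mm * mm / (4 * \<nu>)"
          using \<nu>(1) by (simp add: power2_eq_square field_simps)
        finally have "g p * mm \<le> \<nu> * (g p)\<^sup>2 + mm * mm / (4 * \<nu>)" by simp
        also have "mm * mm / (4 * \<nu>) \<le> \<bar>\<phi> p\<bar> / (4 * \<nu>)" using mm \<nu> by (intro divide_right_mono) auto
        also have "\<bar>\<phi> p\<bar> / (4 * \<nu>) = 1 / (4 * \<nu>) * ((I0 p + I1 p) * \<bar>\<phi> p\<bar>)" unfolding one by simp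
        finally show ?thesis using I01(1)[of p] g0[of p] by (simp add: algebra_simps add_increasing)
      qed
      have "X p * f p = X p * f p * (1 - b) + Lop \<Xi> p - (X p * b * e p) - X p * (w p * r) - \<psi> p * v p $ i"
        unfolding L e_def by (simp add: algebra_simps)
      also have "\<dots> \<le> Z p" unfolding Z_def using t1 t2 t3 t4 by linarith
      finally show ?case .
    qed
    then have "(\<integral>p. X p * f p \<partial>P) \<le> (\<integral>p. Z p \<partial>P)"
      unfolding Z_def using Xfi Lop_integrable[OF \<Xi>t] I\<phi>i ei Igi g2i
      by (intro integral_mono_AE) (auto simp: Z_def)
    also have "(\<integral>p. Z p \<partial>P) = \<tau> / \<epsilon> * (12 * R\<^sup>2) * (\<integral>p. I p * \<bar>\<phi> p\<bar> \<partial>P) + 2 * R * (\<integral>p. \<bar>e p\<bar> \<partial>P) + GI + \<nu> * G2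
        + 1 / (4 * \<nu>) * (\<integral>p. I0 p * \<bar>\<phi> p\<bar> \<partial>P) + 1 / (4 * \<nu>) * (\<integral>p. I1 p * \<bar>\<phi> p\<bar> \<partial>P)"
      unfolding Z_def GI_def G2_def using Lop_integrable[OF \<Xi>t] I\<phi>i ei Igi g2i \<Xi>0 by simp
    also have "\<dots> \<le> \<tau> / \<epsilon> * (12 * R\<^sup>2) * (\<epsilon> * (2 * R * \<tau> * H + lam)) + 2 * R * lam + GI + \<nu> * G2 + 1 / (4 * \<nu>) * lam + 1 / (4 * \<nu>) * lam"
      using \<tau> \<epsilon> R \<nu> sI s0 s1 \<phi>(2) by (intro add_mono mult_left_mono) (auto simp: e_def)
    also have "1 / (4 * \<nu>) * lam = \<nu> / 4" using \<nu> by (simp flip: \<nu>(2))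
    also have "\<tau> / \<epsilon> * (12 * R\<^sup>2) * (\<epsilon> * (2 * R * \<tau> * H + lam)) = 12 * R\<^sup>2 * \<tau> * (2 * R * \<tau> * H + lam)"
      using \<epsilon> by simp
    finally show ?thesis unfolding Xf \<nu>_def[symmetric] by (simp add: algebra_simps)
  qed
  \<comment> \<open>As lam tends to 0 every trace of the approximation error disappears;
    multiplication by \<epsilon> / \<tau> then gives the claim, with 24 R^3 from 12 R^2 times 2
    R.\<close>
  have "((\<lambda>lam. 12 * R\<^sup>2 * \<tau> * (2 * R * \<tau> * H + lam) + 2 * R * lam + GI + sqrt lam * (G2 + 1/2)) \<longlongrightarrow>
       12 * R\<^sup>2 * \<tau> * (2 * R * \<tau> * H + 0) + 2 * R * 0 + GI + sqrt 0 * (G2 + 1/2)) (at_right 0)"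
    by (intro tendsto_intros)
  then have "\<tau> / \<epsilon> * V \<le> 12 * R\<^sup>2 * \<tau> * (2 * R * \<tau> * H + 0) + 2 * R * 0 + GI + sqrt 0 * (G2 + 1/2)"
    by (rule tendsto_lowerbound[OF _ eventually_mono[OF eventually_at_right_less[of 0] key]]) (assumption | rule trivial_limit_at_right_real)+
  then have "\<tau> / \<epsilon> * V \<le> \<tau> * (24 * R ^ 3 * H * \<tau> + (1 / \<tau>) * GI)"
    using \<tau> by (simp add: power2_eq_square power3_eq_cube algebra_simps)
  then have "(\<epsilon> / \<tau>) * (\<tau> / \<epsilon> * V) \<le> (\<epsilon> / \<tau>) * (\<tau> * (24 * R ^ 3 * H * \<tau> + (1 / \<tau>) * GI))"
    using \<tau> \<epsilon> by (intro mult_left_mono) auto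
  moreover have "(\<epsilon> / \<tau>) * (\<tau> / \<epsilon> * V) = V" using \<tau> \<epsilon> by simp
  moreover have "(\<epsilon> / \<tau>) * (\<tau> * y) = \<epsilon> * y" for y using \<tau> by simp
  ultimately have "V \<le> \<epsilon> * (24 * R ^ 3 * H * \<tau> + (1 / \<tau>) * GI)" by simp
  then show ?thesis by (simp only: V_def GI_def I_def X_def g_def \<epsilon>_def)
qed

end

lemma test_fun_add:
  assumes "test_fun \<phi>" "test_fun \<psi>"
  shows "test_fun (\<lambda>p. \<phi> p + \<psi> p)"
proof -
  let ?S = "closure {p. \<phi> p \<noteq> 0} \<union> closure {p. \<psi> p \<noteq> 0}"
  have "closure {p. \<phi> p + \<psi> p \<noteq> 0} \<subseteq> closure ({p. \<phi> p \<noteq> 0} \<union> {p. \<psi> p \<noteq> 0})"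
    by (intro closure_mono) auto
  then have sub: "closure {p. \<phi> p + \<psi> p \<noteq> 0} \<subseteq> ?S" by (simp add: closure_Un)
  have "compact ?S" using assms by (auto simp: test_fun_def)
  then have "compact (closure {p. \<phi> p + \<psi> p \<noteq> 0})" by (rule compact_closed_subset[OF _ closed_closure sub])
  moreover have "?S \<subseteq> {0<..<1} \<times> UNIV" using assms by (auto simp: test_fun_def)
  ultimately show ?thesis
    using sub smooth_add[OF test_fun_smooth[OF assms(1)] test_fun_smooth[OF assms(2)]] unfolding test_fun_def by blast
qed

lemma test_fun_0: "test_fun (\<lambda>_. 0)"
  by (simp add: test_fun_def smooth_const)

context transport begin

lemma Lop_add_cmult:
  assumes \<phi>: "smooth_fun \<phi>" and \<psi>: "smooth_fun \<psi>"
  shows "Lop (\<lambda>p. \<phi> p + \<psi> p * c) p = Lop \<phi> p + c * Lop \<psi> p"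
proof -
  have "frechet_derivative (\<lambda>p. \<phi> p + \<psi> p * c) (at p) =
     (\<lambda>h. frechet_derivative \<phi> (at p) h + frechet_derivative \<psi> (at p) h * c)"
    by (rule frechet_derivative_at[symmetric, OF has_derivative_add[OF smooth_has_derivative[OF \<phi>] has_derivative_mult_left[OF smooth_has_derivative[OF \<psi>]]]])
  then show ?thesis by (simp add: Lop_def algebra_simps)
qed

lemma approximable_if_invariant_const:
  assumes const: "\<And>\<theta>. \<theta> \<in> borel_measurable P \<Longrightarrow> (\<And>p. \<bar>\<theta> p\<bar> \<le> 1) \<Longrightarrow> invariant \<theta> \<Longrightarrow> \<exists>c. AE p in P. \<theta> p = c"
  shows approximable
  unfolding approximable_def
proof (intro allI impI)
  fix f :: "'d pt \<Rightarrow> real" and lam K :: real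
  assume f: "f \<in> borel_measurable P" "\<forall>p\<in>space P. \<bar>f p\<bar> \<le> K" "(\<integral>p. f p \<partial>P) = 0" "lam > 0"
  have "\<exists>F\<in>Lop ` {\<phi>. test_fun \<phi>}. (\<integral>p. \<bar>F p - f p\<bar> \<partial>P) < lam"
  proof (rule L1_approximation_if_annihilator_const[OF fin _ _ _ _ _ f(1) _ f(3,4)])
    show "Lop ` {\<phi>. test_fun \<phi>} \<noteq> {}" using test_fun_0 by blast
    show "\<And>F. F \<in> Lop ` {\<phi>. test_fun \<phi>} \<Longrightarrow> F \<in> borel_measurable P" using Lop_measurable by blast
    show "\<And>F. F \<in> Lop ` {\<phi>. test_fun \<phi>} \<Longrightarrow> integrable P (\<lambda>p. (F p)\<^sup>2)" using Lop_square_integrable by blast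
    show "\<bar>f p\<bar> \<le> K" if "p \<in> space P" for p using f(2) that by blast
  next
    fix F G c assume "F \<in> Lop ` {\<phi>. test_fun \<phi>}" "G \<in> Lop ` {\<phi>. test_fun \<phi>}"
    then obtain \<phi> \<psi> where t: "test_fun \<phi>" "test_fun \<psi>" "F = Lop \<phi>" "G = Lop \<psi>" by blast
    have "(\<lambda>p. F p + c * G p) = Lop (\<lambda>p. \<phi> p + \<psi> p * c)"
      using Lop_add_cmult[OF test_fun_smooth[OF t(1)] test_fun_smooth[OF t(2)]] t by auto
    moreover have "test_fun (\<lambda>p. \<phi> p + \<psi> p * c)"
      using test_fun_add[OF t(1) test_fun_mult[OF t(2) smooth_const[of c]]] .
    ultimately show "(\<lambda>p. F p + c * G p) \<in> Lop ` {\<phi>. test_fun \<phi>}" by blast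
  next
    fix \<theta> assume "\<theta> \<in> borel_measurable P" "\<And>p. \<bar>\<theta> p\<bar> \<le> 1"
      "\<And>F. F \<in> Lop ` {\<phi>. test_fun \<phi>} \<Longrightarrow> (\<integral>p. \<theta> p * F p \<partial>P) = 0"
    then show "\<exists>c. AE p in P. \<theta> p = c" by (intro const) (auto simp: invariant_def)
  qed
  then show "\<exists>\<phi>. test_fun \<phi> \<and> (\<integral>p. \<bar>Lop \<phi> p - f p\<bar> \<partial>P) < lam" by blast
qed

text \<open>The density is continuous, hence nonnegative at every time and not just almost
  everywhere. The two measures are compared on half-lines.\<close>

lemma time_density:
  assumes inv: "invariant (\<lambda>_. 1)"
  obtains c where
    "\<And>t. t \<in> {0..1} \<Longrightarrow> 0 \<le> c + boundary_flux w t"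
    "\<And>s t. 0 \<le> s \<Longrightarrow> s \<le> t \<Longrightarrow> t \<le> 1 \<Longrightarrow> (\<integral>p. indicator {s<..<t} (fst p) \<partial>P) = (LINT r:{s..t}|lborel. c + boundary_flux w r)"
    "distr P borel fst = density lborel (\<lambda>t. ennreal (indicator {0<..<1} t * (c + boundary_flux w t)))"
proof -
  obtain c where c: "\<And>s t. 0 \<le> s \<Longrightarrow> s \<le> t \<Longrightarrow> t \<le> 1 \<Longrightarrow>
      (\<integral>p. indicator {s<..<t} (fst p) \<partial>P) = (LINT r:{s..t}|lborel. c + boundary_flux w r)"
    using slab_measure[OF inv] by blast
  define h where "h t = c + boundary_flux w t" for t
  have hc: "continuous_on S h" for S unfolding h_def
    by (intro continuous_intros continuous_on_subset[OF boundary_flux_continuous[OF inv w_integrable]]) auto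
  have [measurable]: "h \<in> borel_measurable borel" by (rule borel_measurable_continuous_onI[OF hc])
  have h0: "0 \<le> h t" if "t \<in> {0..1}" for t
  proof (rule nonneg_if_interval_integrals_nonneg[OF _ hc _ that])
    fix s t :: real assume "0 \<le> s" "s \<le> t" "t \<le> 1"
    from c[OF this] show "0 \<le> (LINT r:{s..t}|lborel. h r)"
      unfolding h_def by (metis integral_nonneg_AE AE_I2 indicator_pos_le)
  qed simp
  let ?D = "density lborel (\<lambda>t. ennreal (indicator {0<..<1} t * h t))"
  have eq: "emeasure (distr P borel fst) {a<..} = emeasure ?D {a<..}" for a
  proof (cases "max a 0 < 1")
    case True
    define s t where "s = max a 0" and "t = (1::real)"
    have st: "0 \<le> s" "s \<le> t" "t \<le> 1" using True by (auto simp: s_def t_def)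
    have hi: "integrable lborel (\<lambda>r. indicator {s..t} r * h r)"
      using borel_integrable_atLeastAtMost'[OF hc, of s t] by (simp add: set_integrable_def)
    have "emeasure (distr P borel fst) {a<..} = emeasure P {p \<in> space P. fst p \<in> {s<..<t}}"
      by (subst emeasure_distr) (auto intro!: arg_cong[where f = "emeasure P"] simp: s_def t_def spaceP XO_def)
    also have "\<dots> = ennreal (\<integral>p. indicator {p \<in> space P. fst p \<in> {s<..<t}} p \<partial>P)"
      by (simp add: emeasure_eq_measure)
    also have "(\<integral>p. indicator {p \<in> space P. fst p \<in> {s<..<t}} p \<partial>P) = (\<integral>p. indicat_real {s<..<t} (fst p) \<partial>P)"
      by (intro Bochner_Integration.integral_cong) (auto simp: indicator_def)
    also have "\<dots> = (LINT r|lborel. indicator {s..t} r * h r)"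
      using c[OF st] by (simp add: h_def set_lebesgue_integral_def)
    also have "ennreal \<dots> = (\<integral>\<^sup>+r. ennreal (indicator {s..t} r * h r) \<partial>lborel)"
      using hi h0 st by (intro nn_integral_eq_integral[symmetric]) (auto simp: indicator_def)
    also have "\<dots> = (\<integral>\<^sup>+r. ennreal (indicator {0<..<1} r * h r) * indicator {a<..} r \<partial>lborel)"
      by (intro nn_integral_cong_AE, use AE_lborel_singleton[of s] AE_lborel_singleton[of t] in eventually_elim)
         (use True in \<open>auto simp: indicator_def s_def t_def\<close>)
    also have "\<dots> = emeasure ?D {a<..}" by (subst emeasure_density) auto
    finally show ?thesis .
  next
    case False
    then have e: "fst -` {a<..} \<inter> space P = {}" by (auto simp: spaceP XO_def)
    have z: "ennreal (indicator {0<..<1} r * h r) * indicator {a<..} r = 0" for r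
      using False by (auto simp: indicator_def)
    show ?thesis by (subst emeasure_distr, simp, simp, subst emeasure_density) (simp_all add: e z)
  qed
  have deq: "distr P borel fst = ?D"
  proof (rule measure_eqI_lessThan)
    show "emeasure (distr P borel fst) {x<..} < \<infinity>" for x
      by (subst emeasure_distr) (auto simp: emeasure_eq_measure)
  qed (use eq in auto)
  show ?thesis using that[of c] h0 c deq unfolding h_def by blast
qed

lemma moment_density:
  assumes inv: "invariant (\<lambda>_. 1)"
  obtains c where "\<And>s t. 0 \<le> s \<Longrightarrow> s \<le> t \<Longrightarrow> t \<le> 1 \<Longrightarrow>
     (\<integral>p. indicator {s<..<t} (fst p) * snd p $ i \<partial>P) =
     (LINT r:{s..t}|lborel. c + boundary_flux (\<lambda>p. v p $ i + w p * snd p $ i) r)"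
proof -
  have weak: "weak_derivative01 P fst (\<lambda>p. snd p $ i) (\<lambda>p. v p $ i + w p * snd p $ i)"
    using weak_derivative_smooth[OF inv smooth_component[of i]] by (simp add: Lop_component)
  obtain c where "\<And>s t. 0 \<le> s \<Longrightarrow> s \<le> t \<Longrightarrow> t \<le> 1 \<Longrightarrow>
      (\<integral>p. indicator {s<..<t} (fst p) * snd p $ i \<partial>P) =
      (LINT r:{s..t}|lborel. c + (\<integral>p. indicator {..<r} (fst p) * (v p $ i + w p * snd p $ i) \<partial>P))"
    using du_Bois_Reymond[OF fin component_integrable component_Lop_integrable fst_measurable_P weak] by blast
  then show ?thesis by (intro that[of c]) (simp add: boundary_flux_def)
qed

text \<open>q / h is the barycentre of the slices. On a short slab it oscillates by less than \<tau>
  and the integral of g is at most \<tau>^2, so \<open>slab_variance\<close> bounds the squared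
  deviation by a multiple of \<tau> times the length. Bisection adds these local bounds up to C
  \<tau> (T - S), and \<tau> is arbitrary.\<close>

lemma AE_component_eq:
  assumes inv: "invariant (\<lambda>_. 1)" and approx: approximable
    and h: "\<And>s t. 0 \<le> s \<Longrightarrow> s \<le> t \<Longrightarrow> t \<le> 1 \<Longrightarrow> (\<integral>p. indicator {s<..<t} (fst p) \<partial>P) = (LINT r:{s..t}|lborel. h r)"
    and q: "\<And>s t. 0 \<le> s \<Longrightarrow> s \<le> t \<Longrightarrow> t \<le> 1 \<Longrightarrow> (\<integral>p. indicator {s<..<t} (fst p) * snd p $ i \<partial>P) = (LINT r:{s..t}|lborel. q r)"
    and hc: "continuous_on UNIV h" and qc: "continuous_on UNIV q"
    and S: "0 \<le> S" "S \<le> T" "T \<le> 1" and pos: "\<And>t. t \<in> {S..T} \<Longrightarrow> 0 < h t"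
  shows "AE p in P. fst p \<in> {S<..<T} \<longrightarrow> snd p $ i = q (fst p) / h (fst p)"
proof -
  define \<gamma> where "\<gamma> t = q t / h t" for t
  have [measurable]: "h \<in> borel_measurable borel" "q \<in> borel_measurable borel"
    using hc qc by (auto intro: borel_measurable_continuous_onI)
  have "\<gamma> \<in> borel_measurable borel" unfolding \<gamma>_def by measurable
  then have [measurable]: "(\<lambda>p. \<gamma> (fst p)) \<in> borel_measurable P"
    by (rule measurable_compose[OF fst_measurable_P])
  have \<gamma>c: "continuous_on {S..T} \<gamma>" unfolding \<gamma>_def
    by (intro continuous_intros continuous_on_subset[OF hc] continuous_on_subset[OF qc]) (use pos in force)+
  obtain R where R: "R > 0" "\<And>p i. p \<in> space P \<Longrightarrow> \<bar>snd p $ i\<bar> \<le> R" using component_bounded by blast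
  obtain H where H: "0 \<le> H" "\<And>s t. 0 \<le> s \<Longrightarrow> s \<le> t \<Longrightarrow> t \<le> 1 \<Longrightarrow> (\<integral>p. indicator {s<..<t} (fst p) \<partial>P) \<le> (t - s) * H"
    using slab_measure_le[OF inv] by blast
  have "bounded (\<gamma> ` {S..T})" by (intro compact_imp_bounded compact_continuous_image \<gamma>c) auto
  then obtain B where B: "\<And>t. t \<in> {S..T} \<Longrightarrow> \<bar>\<gamma> t\<bar> \<le> B"
    unfolding bounded_iff real_norm_def by blast
  let ?d = "\<lambda>a b p. indicator {a<..<b} (fst p) * (snd p $ i - \<gamma> (fst p))\<^sup>2"
  have di: "integrable P (?d a b)" if "S \<le> a" "b \<le> T" for a b
  proof (rule bounded_integrable[where K = "(R + B)\<^sup>2"])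
    fix p assume p: "p \<in> space P"
    show "\<bar>?d a b p\<bar> \<le> (R + B)\<^sup>2"
    proof (cases "fst p \<in> {a<..<b}")
      case True
      then have "\<bar>snd p $ i - \<gamma> (fst p)\<bar> \<le> R + B" using R(2)[OF p, of i] B[of "fst p"] that by auto
      then have "(snd p $ i - \<gamma> (fst p))\<^sup>2 \<le> (R + B)\<^sup>2"
        using power_mono[of "\<bar>snd p $ i - \<gamma> (fst p)\<bar>" "R + B" 2] by simp
      then show ?thesis using True by simp
    qed simp
  qed measurable
  \<comment> \<open>Twice the variance around the slab mean, bounded through (24 R^3 H + 1) \<tau>,
    plus 8 \<tau>^2 H for replacing that mean by \<gamma>; \<tau> < 1 reduces \<tau>^2 to
    \<tau>.\<close>
  define C where "C = 2 * (24 * R ^ 3 * H + 1) + 8 * H"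
  define g where "g p = 2 * R * \<bar>w p\<bar> + norm (v p)" for p
  have gi: "integrable P g" unfolding g_def using w_integrable v_integrable by auto
  have bound: "(\<integral>p. ?d S T p \<partial>P) \<le> C * \<tau> * (T - S)" if \<tau>: "0 < \<tau>" "\<tau> < 1" for \<tau>
  proof -
    \<comment> \<open>The premise has the shape of the bisection predicate, which is confined to
      subintervals of [S, T].\<close>
    have "S \<le> S \<and> T \<le> T \<longrightarrow> (\<integral>p. ?d S T p \<partial>P) \<le> C * \<tau> * (T - S)"
      using S(2)
    proof (induct rule: Bolzano[where P = "\<lambda>a b. S \<le> a \<and> b \<le> T \<longrightarrow> (\<integral>p. ?d a b p \<partial>P) \<le> C * \<tau> * (b - a)"])
      case (trans a b c)
      show ?case
      proof
        assume ac: "S \<le> a \<and> c \<le> T"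
        have "(\<integral>p. ?d a c p \<partial>P) = (\<integral>p. ?d a b p + ?d b c p \<partial>P)"
          by (intro integral_cong_AE, simp, simp, use AE_time_neq[OF inv, of b] in eventually_elim)
             (use trans in \<open>auto simp: indicator_def\<close>)
        also have "\<dots> = (\<integral>p. ?d a b p \<partial>P) + (\<integral>p. ?d b c p \<partial>P)"
          using di[of a b] di[of b c] ac trans by simp
        also have "\<dots> \<le> C * \<tau> * (b - a) + C * \<tau> * (c - b)" using trans ac by (intro add_mono) auto
        finally show "(\<integral>p. ?d a c p \<partial>P) \<le> C * \<tau> * (c - a)" by (simp add: algebra_simps)
      qed
    next
      case (local x)
      have "continuous (at x) (boundary_flux g)"
        using boundary_flux_continuous[OF inv gi] by (simp add: continuous_on_eq_continuous_at)
      \<comment> \<open>The bound \<tau>^2 / 2 on each side makes the integral of g over the slab at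
        most \<tau>^2, which compensates the factor 1 / \<tau> in
        \<open>slab_variance\<close>.\<close>
      then obtain d1 where d1: "d1 > 0" "\<And>r. \<bar>r - x\<bar> < d1 \<Longrightarrow> \<bar>boundary_flux g r - boundary_flux g x\<bar> < \<tau>\<^sup>2 / 2"
        using \<tau> unfolding continuous_at_eps_delta dist_real_def by (metis half_gt_zero zero_less_power)
      obtain d2 where d2: "d2 > 0" "\<And>r. r \<in> {S..T} \<Longrightarrow> \<bar>r - x\<bar> < d2 \<Longrightarrow> \<bar>\<gamma> r - \<gamma> x\<bar> < \<tau>"
        using \<gamma>c \<tau> local unfolding continuous_on_iff dist_real_def by (metis atLeastAtMost_iff)
      show ?case
      proof (intro exI[of _ "min d1 d2"] conjI allI impI)
        fix a b assume ab: "a \<le> x \<and> x \<le> b \<and> b - a < min d1 d2" "S \<le> a \<and> b \<le> T"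
        have ab': "0 \<le> a" "a \<le> b" "b \<le> 1" using ab S by auto
        have \<gamma>x: "\<bar>\<gamma> r - \<gamma> x\<bar> < \<tau>" if "r \<in> {a..b}" for r using that ab by (intro d2) auto
        \<comment> \<open>A slab of mass 0 has no mean value and is treated apart.\<close>
        show "(\<integral>p. ?d a b p \<partial>P) \<le> C * \<tau> * (b - a)"
        proof (cases "(\<integral>p. indicat_real {a<..<b} (fst p) \<partial>P) > 0")
          case True
          then have "a < b" using ab' by (cases "a = b") auto
          define m where "m = (\<integral>p. indicat_real {a<..<b} (fst p) \<partial>P)"
          define av where "av = (\<integral>p. indicator {a<..<b} (fst p) * snd p $ i \<partial>P) / m"
          have hab: "m = (LINT r:{a..b}|lborel. h r)" using h[OF ab'] by (simp add: m_def)
          have qi: "set_integrable lborel {a..b} q" "set_integrable lborel {a..b} h"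
            using continuous_on_subset[OF qc] continuous_on_subset[OF hc] by (auto intro!: borel_integrable_atLeastAtMost')
          \<comment> \<open>m av and m are the integrals of q = h \<gamma> and of h over the slab;
            so av is an h-weighted mean of \<gamma> and inherits its oscillation bound.\<close>
          have "m * (av - \<gamma> x) = (LINT r:{a..b}|lborel. q r) - (LINT r:{a..b}|lborel. h r * \<gamma> x)"
            using True q[OF ab'] hab by (simp add: av_def m_def[symmetric] right_diff_distrib)
          also have "\<dots> = (LINT r:{a..b}|lborel. q r - h r * \<gamma> x)"
            using qi by (intro set_integral_diff(2)[symmetric]) auto
          finally have mav: "m * (av - \<gamma> x) = (LINT r:{a..b}|lborel. q r - h r * \<gamma> x)" .
          have qh: "\<bar>q r - h r * \<gamma> x\<bar> \<le> h r * \<tau>" if r: "r \<in> {a..b}" for r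
          proof -
            have hr: "h r > 0" using r ab(2) by (intro pos) auto
            then have "q r - h r * \<gamma> x = h r * (\<gamma> r - \<gamma> x)" by (simp add: \<gamma>_def field_simps)
            then show ?thesis using hr \<gamma>x[OF r] by (simp add: abs_mult)
          qed
          have di2: "set_integrable lborel {a..b} (\<lambda>r. q r - h r * \<gamma> x)" using qi by (intro set_integral_diff(1)) auto
          have htau: "(LINT r:{a..b}|lborel. h r * \<tau>) = m * \<tau>" using hab by simp
          have "m * (av - \<gamma> x) \<le> m * \<tau>" unfolding mav htau[symmetric]
            using di2 qi qh by (intro set_integral_mono) (auto simp: abs_le_iff)
          moreover have "m * (\<gamma> x - av) \<le> m * \<tau>"
          proof -
            have "(LINT r:{a..b}|lborel. h r * (- \<tau>)) \<le> m * (av - \<gamma> x)" unfolding mav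
            proof (rule set_integral_mono[OF _ di2])
              show "set_integrable lborel {a..b} (\<lambda>r. h r * (- \<tau>))" using qi(2) by (rule set_integrable_mult_left)
              show "h r * (- \<tau>) \<le> q r - h r * \<gamma> x" if "r \<in> {a..b}" for r using qh[OF that] by (simp add: abs_le_iff)
            qed
            moreover have "(LINT r:{a..b}|lborel. h r * (- \<tau>)) = m * (- \<tau>)" unfolding hab by (rule set_integral_mult_left)
            ultimately show ?thesis by (simp add: algebra_simps)
          qed
          ultimately have av: "\<bar>av - \<gamma> x\<bar> \<le> \<tau>" using True by (simp add: m_def[symmetric] abs_le_iff)
          have var: "(\<integral>p. indicator {a<..<b} (fst p) * (snd p $ i - av)\<^sup>2 \<partial>P) \<le>
              (b - a) * (24 * R ^ 3 * H * \<tau> + (1 / \<tau>) * (\<integral>p. indicator {a<..<b} (fst p) * g p \<partial>P))"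
            unfolding g_def using slab_variance[OF inv approx R(1) R(2) H(2)[OF ab'] ab'(1) \<open>a < b\<close> ab'(3) True _ \<tau>(1), where a = av and i = i]
            by (simp add: av_def m_def)
          have "(\<integral>p. indicator {a<..<b} (fst p) * g p \<partial>P) = boundary_flux g b - boundary_flux g a"
            by (rule boundary_flux_diff[OF inv gi ab'(2), symmetric])
          also have "\<dots> \<le> \<tau>\<^sup>2"
          proof -
            have c: "\<bar>a - x\<bar> < d1" "\<bar>b - x\<bar> < d1" using ab by auto
            show ?thesis using d1(2)[OF c(1)] d1(2)[OF c(2)] unfolding abs_less_iff by linarith
          qed
          finally have "(1 / \<tau>) * (\<integral>p. indicator {a<..<b} (fst p) * g p \<partial>P) \<le> (1 / \<tau>) * \<tau>\<^sup>2"
            using \<tau> by (intro mult_left_mono) auto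
          then have "(1 / \<tau>) * (\<integral>p. indicator {a<..<b} (fst p) * g p \<partial>P) \<le> \<tau>" using \<tau> by (simp add: power2_eq_square)
          then have "(b - a) * (24 * R ^ 3 * H * \<tau> + (1 / \<tau>) * (\<integral>p. indicator {a<..<b} (fst p) * g p \<partial>P)) \<le> (b - a) * (24 * R ^ 3 * H * \<tau> + \<tau>)"
            using ab' by (intro mult_left_mono) auto
          with var have var': "(\<integral>p. indicator {a<..<b} (fst p) * (snd p $ i - av)\<^sup>2 \<partial>P) \<le> (b - a) * (24 * R ^ 3 * H * \<tau> + \<tau>)" by linarith
          have vi: "integrable P (\<lambda>p. indicator {a<..<b} (fst p) * (snd p $ i - av)\<^sup>2)"
          proof (rule indicator_mult_integrable)
            show "integrable P (\<lambda>p. (snd p $ i - av)\<^sup>2)"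
            proof (rule bounded_integrable[where K = "(R + \<bar>av\<bar>)\<^sup>2"])
              fix p assume p: "p \<in> space P"
              have "\<bar>snd p $ i - av\<bar> \<le> R + \<bar>av\<bar>" using R(2)[OF p, of i] by linarith
              then show "\<bar>(snd p $ i - av)\<^sup>2\<bar> \<le> (R + \<bar>av\<bar>)\<^sup>2"
                using power_mono[of "\<bar>snd p $ i - av\<bar>" "R + \<bar>av\<bar>" 2] by simp
            qed measurable
          qed simp
          have Ii: "integrable P (\<lambda>p. indicat_real {a<..<b} (fst p))"
            by (rule bounded_integrable[where K = 1]) (auto simp: indicator_def)
          have "(\<integral>p. ?d a b p \<partial>P) \<le> (\<integral>p. 2 * (indicator {a<..<b} (fst p) * (snd p $ i - av)\<^sup>2) + 8 * \<tau>\<^sup>2 * indicator {a<..<b} (fst p) \<partial>P)"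
          proof (intro integral_mono Bochner_Integration.integrable_add integrable_mult_right vi Ii di)
            fix p
            have sq: "(y - z)\<^sup>2 \<le> 2 * (y - u)\<^sup>2 + 2 * (u - z)\<^sup>2" for y z u :: real
              using zero_le_power2[of "(y - u) - (u - z)"] by (simp add: power2_eq_square algebra_simps)
            show "?d a b p \<le> 2 * (indicator {a<..<b} (fst p) * (snd p $ i - av)\<^sup>2) + 8 * \<tau>\<^sup>2 * indicator {a<..<b} (fst p)"
            proof (cases "fst p \<in> {a<..<b}")
              case True
              then have "\<bar>av - \<gamma> (fst p)\<bar> \<le> 2 * \<tau>" using av \<gamma>x[of "fst p"] by auto
              then have "(av - \<gamma> (fst p))\<^sup>2 \<le> (2 * \<tau>)\<^sup>2" using power_mono[of "\<bar>av - \<gamma> (fst p)\<bar>" "2 * \<tau>" 2] by simp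
              then show ?thesis using True sq[of "snd p $ i" "\<gamma> (fst p)" av] by (simp add: power_mult_distrib)
            qed simp
          qed (use ab in auto)
          also have "\<dots> = 2 * (\<integral>p. indicator {a<..<b} (fst p) * (snd p $ i - av)\<^sup>2 \<partial>P) + 8 * \<tau>\<^sup>2 * (\<integral>p. indicator {a<..<b} (fst p) \<partial>P)"
            using vi Ii by simp
          also have "\<dots> \<le> 2 * ((b - a) * (24 * R ^ 3 * H * \<tau> + \<tau>)) + 8 * \<tau>\<^sup>2 * ((b - a) * H)"
            using var' H(2)[OF ab'] by (intro add_mono mult_left_mono) auto
          also have "8 * \<tau>\<^sup>2 * ((b - a) * H) \<le> 8 * \<tau> * ((b - a) * H)"
            using \<tau> ab' H(1) by (intro mult_right_mono) (auto simp: power2_eq_square mult_left_le)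
          finally show ?thesis by (simp add: C_def algebra_simps)
        next
          case False
          have nn: "0 \<le> (\<integral>p. indicat_real {a<..<b} (fst p) \<partial>P)" by (intro integral_nonneg_AE) auto
          have Ii: "integrable P (\<lambda>p. indicat_real {a<..<b} (fst p))"
            by (rule bounded_integrable[where K = 1]) (auto simp: indicator_def)
          have "AE p in P. indicat_real {a<..<b} (fst p) = 0"
            using False nn integral_nonneg_eq_0_iff_AE[OF Ii] by auto
          then have "(\<integral>p. ?d a b p \<partial>P) = (\<integral>p. 0 \<partial>P)"
            by (intro integral_cong_AE, simp, simp, eventually_elim) simp
          then show ?thesis using ab' \<tau> H(1) R(1) by (simp add: C_def)
        qed
      qed (use d1 d2 in auto)
    qed
    then show ?thesis by simp
  qed
  have "((\<lambda>\<tau>. C * \<tau> * (T - S)) \<longlongrightarrow> C * 0 * (T - S)) (at_right 0)" by (intro tendsto_intros)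
  moreover have "\<forall>\<^sub>F \<tau> in at_right 0. (\<integral>p. ?d S T p \<partial>P) \<le> C * \<tau> * (T - S)"
    unfolding eventually_at_right_field using bound by (intro exI[of _ 1]) auto
  ultimately have "(\<integral>p. ?d S T p \<partial>P) \<le> C * 0 * (T - S)"
    by (rule tendsto_lowerbound) (rule trivial_limit_at_right_real)
  moreover have "0 \<le> (\<integral>p. ?d S T p \<partial>P)" by (intro integral_nonneg_AE AE_I2) auto
  ultimately have "(\<integral>p. ?d S T p \<partial>P) = 0" by simp
  then have "AE p in P. ?d S T p = 0" using integral_nonneg_eq_0_iff_AE[OF di[of S T]] by auto
  then show ?thesis by eventually_elim (auto simp: \<gamma>_def)
qed

end

section \<open>Absolutely continuous curves\<close>

lemma deriv_eq_vector_derivative: "deriv f t = vector_derivative f (at t)"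
  by (simp add: deriv_def vector_derivative_def has_real_derivative_iff_has_vector_derivative)

text \<open>At points of non-differentiability \<open>vector_derivative\<close> is one fixed junk value, so it is Borel as
  soon as the set of differentiability is.\<close>

lemma borel_measurable_vector_derivative:
  fixes f :: "real \<Rightarrow> 'v::euclidean_space"
  assumes U: "open U" and f: "continuous_on U f"
  shows "(\<lambda>t. indicator U t *\<^sub>R vector_derivative f (at t)) \<in> borel_measurable borel"
proof -
  \<comment> \<open>Extension by 0 gives a Borel function on the whole line, so difference quotients
    are measurable for every increment.\<close>
  define F where "F t = indicator U t *\<^sub>R f t" for t
  have Um [measurable]: "U \<in> sets borel" using U by simp
  have [measurable]: "F \<in> borel_measurable borel"
    unfolding F_def using borel_measurable_continuous_on_indicator[OF Um f] .
  define dq where "dq r t = (1 / r) *\<^sub>R (F (t + r) - F t)" for r t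
  have [measurable]: "dq r \<in> borel_measurable borel" for r unfolding dq_def by measurable
  define L where "L t = lim (\<lambda>n. dq (1 / real (Suc n)) t)" for t
  have [measurable]: "L \<in> borel_measurable borel" unfolding L_def by measurable
  \<comment> \<open>Convergence is required along rational increments, which makes the set a
    countable combination of Borel sets; on U the value \<open>L\<close> is the only candidate for
    the derivative.\<close>
  define D where "D = {t \<in> U. \<forall>k::nat. \<exists>n::nat. \<forall>r::rat. 0 < \<bar>real_of_rat r\<bar> \<and> \<bar>real_of_rat r\<bar> < 1 / real (Suc n) \<longrightarrow>
      norm (dq (of_rat r) t - L t) \<le> 1 / real (Suc k)}"
  have Dm [measurable]: "D \<in> sets borel"
  proof -
    define C where "C k n r = {t. 0 < \<bar>real_of_rat r\<bar> \<and> \<bar>real_of_rat r\<bar> < 1 / real (Suc n) \<longrightarrow>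
        norm (dq (of_rat r) t - L t) \<le> 1 / real (Suc k)}" for k n and r :: rat
    have piece: "C k n r \<in> sets borel" for k n r
    proof (cases "0 < \<bar>real_of_rat r\<bar> \<and> \<bar>real_of_rat r\<bar> < 1 / real (Suc n)")
      case True
      then have "C k n r = {t \<in> space borel. norm (dq (of_rat r) t - L t) \<le> 1 / real (Suc k)}" by (simp add: C_def)
      also have "\<dots> \<in> sets borel" by (rule borel_measurable_le) measurable
      finally show ?thesis .
    next
      case False
      then have "C k n r = UNIV" by (auto simp: C_def)
      then show ?thesis by simp
    qed
    have "(\<Inter>r. C k n r) \<in> sets borel" for k n by (intro sets.countable_INT'' piece) simp_all
    then have "(\<Union>n. \<Inter>r. C k n r) \<in> sets borel" for k by (intro sets.countable_nat_UN image_subsetI)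
    then have "(\<Inter>k. \<Union>n. \<Inter>r. C k n r) \<in> sets borel" by (intro sets.countable_INT'') simp_all
    moreover have "D = U \<inter> (\<Inter>k. \<Union>n. \<Inter>r. C k n r)"
      by (simp only: set_eq_iff D_def C_def mem_Collect_eq Int_iff INT_iff UN_iff UNIV_I bex_simps simp_thms) blast
    ultimately show ?thesis using Um by simp
  qed
  have near: "\<exists>d>0. \<forall>r. \<bar>r\<bar> < d \<longrightarrow> t + r \<in> U" if tU: "t \<in> U" for t
  proof -
    obtain d where d: "d > 0" "ball t d \<subseteq> U" by (rule openE[OF U tU])
    have "t + r \<in> ball t d" if "\<bar>r\<bar> < d" for r using that by (simp add: dist_real_def)
    then show ?thesis using d by (intro exI[of _ d]) auto
  qed
  have dq_f: "dq r t = (1 / r) *\<^sub>R (f (t + r) - f t)" if "t \<in> U" "t + r \<in> U" for r t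
    using that by (simp add: dq_def F_def)
  have deriv_iff: "(f has_vector_derivative l) (at t) \<longleftrightarrow> (\<forall>e>0. \<exists>d>0. \<forall>r. 0 < \<bar>r\<bar> \<and> \<bar>r\<bar> < d \<longrightarrow> norm (dq r t - l) \<le> e)" if t: "t \<in> U" for t l
  proof -
    obtain d0 where d0: "d0 > 0" "\<And>r. \<bar>r\<bar> < d0 \<Longrightarrow> t + r \<in> U" using near[OF t] by blast
    have eqn: "norm (f y - f t - (y - t) *\<^sub>R l) \<le> e * norm (y - t) \<longleftrightarrow> norm (dq (y - t) t - l) \<le> e" if "y \<noteq> t" "\<bar>y - t\<bar> < d0" for y e
    proof -
      have "f y - f t - (y - t) *\<^sub>R l = (y - t) *\<^sub>R (dq (y - t) t - l)"
      proof -
        have "(y - t) *\<^sub>R dq (y - t) t = f y - f t"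
          using dq_f[OF t, of "y - t"] d0(2)[OF that(2)] that(1) by simp
        then show ?thesis by (simp only: scaleR_diff_right)
      qed
      then have "norm (f y - f t - (y - t) *\<^sub>R l) = \<bar>y - t\<bar> * norm (dq (y - t) t - l)" by simp
      then show ?thesis using that(1) by (simp add: mult.commute[of e])
    qed
    show ?thesis
      unfolding has_vector_derivative_def has_derivative_at_alt
    proof (intro iffI conjI allI impI bounded_linear_scaleR_left)
      fix e :: real assume e: "0 < e" and h: "bounded_linear (\<lambda>x. x *\<^sub>R l) \<and> (\<forall>e>0. \<exists>d>0. \<forall>y. norm (y - t) < d \<longrightarrow> norm (f y - f t - (y - t) *\<^sub>R l) \<le> e * norm (y - t))"
      obtain d where d: "d > 0" "\<And>y. norm (y - t) < d \<Longrightarrow> norm (f y - f t - (y - t) *\<^sub>R l) \<le> e * norm (y - t)"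
        using h[THEN conjunct2, rule_format, OF e] by blast
      show "\<exists>d>0. \<forall>r. 0 < \<bar>r\<bar> \<and> \<bar>r\<bar> < d \<longrightarrow> norm (dq r t - l) \<le> e"
      proof (intro exI[of _ "min d d0"] conjI allI impI)
        fix r assume r: "0 < \<bar>r\<bar> \<and> \<bar>r\<bar> < min d d0"
        then show "norm (dq r t - l) \<le> e" using d(2)[of "t + r"] eqn[of "t + r" e] by auto
      qed (use d d0 in auto)
    next
      fix e :: real assume e: "0 < e" and h: "\<forall>e>0. \<exists>d>0. \<forall>r. 0 < \<bar>r\<bar> \<and> \<bar>r\<bar> < d \<longrightarrow> norm (dq r t - l) \<le> e"
      obtain d where d: "d > 0" "\<And>r. 0 < \<bar>r\<bar> \<and> \<bar>r\<bar> < d \<Longrightarrow> norm (dq r t - l) \<le> e"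
        using h[rule_format, OF e] by blast
      show "\<exists>d>0. \<forall>y. norm (y - t) < d \<longrightarrow> norm (f y - f t - (y - t) *\<^sub>R l) \<le> e * norm (y - t)"
      proof (intro exI[of _ "min d d0"] conjI allI impI)
        fix y assume y: "norm (y - t) < min d d0"
        show "norm (f y - f t - (y - t) *\<^sub>R l) \<le> e * norm (y - t)"
        proof (cases "y = t")
          case False
          then show ?thesis using eqn[of y e] d(2)[of "y - t"] y by auto
        qed simp
      qed (use d d0 in auto)
    qed
  qed
  have on_D: "(f has_vector_derivative L t) (at t)" if "t \<in> D" for t
  proof -
    have t: "t \<in> U" using that by (auto simp: D_def)
    obtain d0 where d0: "d0 > 0" "\<And>r. \<bar>r\<bar> < d0 \<Longrightarrow> t + r \<in> U" using near[OF t] by blast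
    show ?thesis unfolding deriv_iff[OF t]
    proof (intro allI impI)
      fix e :: real assume "e > 0"
      then obtain k where k: "1 / real (Suc k) < e" using nat_approx_posE by blast
      obtain n where n: "\<And>r::rat. 0 < \<bar>real_of_rat r\<bar> \<Longrightarrow> \<bar>real_of_rat r\<bar> < 1 / real (Suc n) \<Longrightarrow> norm (dq (of_rat r) t - L t) \<le> 1 / real (Suc k)"
        using \<open>t \<in> D\<close> unfolding D_def by blast
      define d where "d = min d0 (1 / real (Suc n))"
      have "norm (dq r t - L t) \<le> e" if r: "0 < \<bar>r\<bar>" "\<bar>r\<bar> < d" for r
      proof (rule ccontr)
        assume "\<not> norm (dq r t - L t) \<le> e"
        \<comment> \<open>The difference quotient is continuous in the increment away from 0, so the
          violating increments form an open set and include a rational one.\<close>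
        define V where "V = {0 - d<..<d} - {0}"
        have Vo: "open V" unfolding V_def by auto
        have Vc: "continuous_on V (\<lambda>r. norm (dq r t - L t))"
        proof -
          have "continuous_on V (\<lambda>r. norm ((1 / r) *\<^sub>R (f (t + r) - f t) - L t))"
            by (intro continuous_intros continuous_on_compose2[OF f]) (auto simp: V_def d_def intro!: d0(2))
          then show ?thesis
            by (rule continuous_on_eq) (auto simp: V_def d_def dq_f[OF t d0(2)])
        qed
        have "open (V \<inter> (\<lambda>r. norm (dq r t - L t)) -` {e<..})"
          by (rule continuous_open_preimage[OF Vc Vo open_greaterThan])
        moreover have "r \<in> V \<inter> (\<lambda>r. norm (dq r t - L t)) -` {e<..}"
          using r \<open>\<not> norm (dq r t - L t) \<le> e\<close> by (auto simp: V_def)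
        ultimately obtain s where s: "s > 0" "ball r s \<subseteq> V \<inter> (\<lambda>r. norm (dq r t - L t)) -` {e<..}"
          by (rule openE)
        obtain q where q: "r < real_of_rat q" "real_of_rat q < r + s" using of_rat_dense[of r "r + s"] s(1) by auto
        define y where "y = real_of_rat q"
        have "y \<in> ball r s" using q by (auto simp: dist_real_def y_def)
        then have yV: "y \<in> V" "norm (dq y t - L t) > e" using s(2) by auto
        then have "0 < \<bar>y\<bar>" "\<bar>y\<bar> < d" by (auto simp: V_def)
        moreover have "d \<le> 1 / real (Suc n)" by (simp add: d_def)
        ultimately have "norm (dq y t - L t) \<le> 1 / real (Suc k)" using n[of q, folded y_def] by linarith
        then show False using yV(2) k by linarith
      qed
      moreover have "d > 0" using d0 by (simp add: d_def)
      ultimately show "\<exists>d>0. \<forall>r. 0 < \<bar>r\<bar> \<and> \<bar>r\<bar> < d \<longrightarrow> norm (dq r t - L t) \<le> e" by blast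
    qed
  qed
  have in_D: "t \<in> D" if t: "t \<in> U" and l: "(f has_vector_derivative l) (at t)" for t l
  proof -
    note lim = l[unfolded deriv_iff[OF t]]
    have "(\<lambda>n. dq (1 / real (Suc n)) t) \<longlonglongrightarrow> l"
      unfolding LIMSEQ_iff
    proof (intro allI impI)
      fix e :: real assume e: "e > 0"
      then have e2: "e / 2 > 0" by simp
      obtain d where d: "d > 0" "\<And>r. 0 < \<bar>r\<bar> \<and> \<bar>r\<bar> < d \<Longrightarrow> norm (dq r t - l) \<le> e / 2"
        using lim[rule_format, OF e2] by blast
      obtain N where N: "1 / real (Suc N) < d" using nat_approx_posE[OF d(1)] by blast
      show "\<exists>N. \<forall>n\<ge>N. norm (dq (1 / real (Suc n)) t - l) < e"
      proof (intro exI[of _ N] allI impI)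
        fix n assume "n \<ge> N"
        then have "1 / real (Suc n) \<le> 1 / real (Suc N)" by (simp add: frac_le)
        then have "norm (dq (1 / real (Suc n)) t - l) \<le> e / 2" using N by (intro d(2)) auto
        then show "norm (dq (1 / real (Suc n)) t - l) < e" using e by simp
      qed
    qed
    then have Ll: "L t = l" unfolding L_def by (rule limI)
    show ?thesis unfolding D_def mem_Collect_eq Ll
    proof (intro conjI t allI)
      fix k :: nat
      have k0: "0 < 1 / real (Suc k)" by simp
      obtain d where d: "d > 0" "\<And>r. 0 < \<bar>r\<bar> \<and> \<bar>r\<bar> < d \<Longrightarrow> norm (dq r t - l) \<le> 1 / real (Suc k)"
        using lim[rule_format, OF k0] by blast
      obtain n where n: "1 / real (Suc n) < d" using nat_approx_posE[OF d(1)] by blast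
      show "\<exists>n. \<forall>r. 0 < \<bar>real_of_rat r\<bar> \<and> \<bar>real_of_rat r\<bar> < 1 / real (Suc n) \<longrightarrow> norm (dq (real_of_rat r) t - l) \<le> 1 / real (Suc k)"
        using n by (intro exI[of _ n] allI impI d(2)) linarith
    qed
  qed
  define c0 :: 'v where "c0 = (SOME f'. False)"
  have "indicator U t *\<^sub>R vector_derivative f (at t) = indicator U t *\<^sub>R (if t \<in> D then L t else c0)" for t
  proof (cases "t \<in> U")
    case True
    show ?thesis
    proof (cases "t \<in> D")
      case True
      then show ?thesis using vector_derivative_at[OF on_D[OF True]] by simp
    next
      case False
      then have "\<not> (f has_vector_derivative l) (at t)" for l using in_D[OF True] by blast
      then show ?thesis using False by (simp add: vector_derivative_def c0_def)
    qed
  qed simp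
  then have eq: "(\<lambda>t. indicator U t *\<^sub>R vector_derivative f (at t)) = (\<lambda>t. indicator U t *\<^sub>R (if t \<in> D then L t else c0))" by blast
  show ?thesis unfolding eq by measurable
qed

text \<open>Young's inequality \<omega> \<le> \<nu> \<omega>^2 + 1 / (4 \<nu>) gives absolute
  continuity from the L2 bound. Where the derivative exists, its norm is almost everywhere at most
  \<omega>, by Lebesgue differentiation of the primitive of \<omega>.\<close>

lemma AC2_if_increments_le:
  fixes f :: "real \<Rightarrow> 'v::euclidean_space" and \<omega> :: "real \<Rightarrow> real"
  assumes [measurable]: "\<omega> \<in> borel_measurable borel" and nn: "\<And>t. 0 \<le> \<omega> t"
    and \<omega>i: "integrable lborel \<omega>" and \<omega>2: "integrable lborel (\<lambda>t. (\<omega> t)\<^sup>2)"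
    and inc: "\<And>s t. 0 \<le> s \<Longrightarrow> s \<le> t \<Longrightarrow> t \<le> 1 \<Longrightarrow> norm (f t - f s) \<le> (LINT r:{s..t}|lborel. \<omega> r)"
  shows "AC2 f"
  unfolding AC2_def
proof
  define Q where "Q = (LINT r|lborel. (\<omega> r)\<^sup>2)"
  have Q0: "0 \<le> Q" unfolding Q_def by (intro integral_nonneg_AE) auto
  have open_int: "(LINT r:{s..t}|lborel. \<omega> r) = (LINT r|lborel. indicator {s<..<t} r * \<omega> r)" for s t
    unfolding set_lebesgue_integral_def
    by (intro integral_cong_AE, simp, simp, use AE_lborel_singleton[of s] AE_lborel_singleton[of t] in eventually_elim)
       (auto simp: indicator_def)
  have ii: "integrable lborel (\<lambda>r. indicator S r * g r)" if "integrable lborel g" "S \<in> sets borel" for g :: "real \<Rightarrow> real" and S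
    using integrable_mult_indicator[of S lborel g] that by simp
  show "abs_cont01 f"
    unfolding abs_cont01_def
  proof (intro allI impI)
    fix \<epsilon> :: real assume \<epsilon>: "\<epsilon> > 0"
    \<comment> \<open>With this \<nu> the quadratic term contributes at most \<epsilon> / 2; the
      total length 2 \<nu> \<epsilon> chosen below contributes less than the other half through 1 /
      (4 \<nu>).\<close>
    define \<nu> where "\<nu> = \<epsilon> / (2 * (Q + 1))"
    have \<nu>: "\<nu> > 0" "\<nu> * Q \<le> \<epsilon> / 2" using \<epsilon> Q0 by (auto simp: \<nu>_def field_simps)
    show "\<exists>\<eta>>0. \<forall>(n::nat) (a::nat \<Rightarrow> real) b. (\<forall>k<n. 0 \<le> a k \<and> a k \<le> b k \<and> b k \<le> 1) \<and>
        (\<forall>k<n. \<forall>j<n. k \<noteq> j \<longrightarrow> b k \<le> a j \<or> b j \<le> a k) \<and> (\<Sum>k<n. b k - a k) < \<eta> \<longrightarrow>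
        (\<Sum>k<n. norm (f (b k) - f (a k))) < \<epsilon>"
    proof (intro exI[of _ "2 * \<nu> * \<epsilon>"] conjI allI impI, goal_cases)
      case (2 n a b)
      let ?I = "\<lambda>k. {a k<..<b k}"
      have ab: "0 \<le> a k" "a k \<le> b k" "b k \<le> 1" if "k < n" for k using 2 that by auto
      have each: "norm (f (b k) - f (a k)) \<le> \<nu> * (LINT r|lborel. indicator (?I k) r * (\<omega> r)\<^sup>2) + (b k - a k) / (4 * \<nu>)" if k: "k < n" for k
      proof -
        have "norm (f (b k) - f (a k)) \<le> (LINT r|lborel. indicator (?I k) r * \<omega> r)"
          using inc[OF ab[OF k]] by (simp add: open_int)
        also have "\<dots> \<le> (LINT r|lborel. \<nu> * (indicator (?I k) r * (\<omega> r)\<^sup>2) + 1 / (4 * \<nu>) * indicator (?I k) r)"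
        proof (intro integral_mono ii \<omega>i Bochner_Integration.integrable_add integrable_mult_right \<omega>2)
          show "integrable lborel (indicat_real (?I k))" using ab[OF k] by (simp add: integrable_real_indicator)
          fix r
          have "0 \<le> \<nu> * (\<omega> r - 1 / (2 * \<nu>))\<^sup>2" using \<nu> by simp
          also have "\<dots> = \<nu> * (\<omega> r)\<^sup>2 - \<omega> r + 1 / (4 * \<nu>)" using \<nu>(1) by (simp add: power2_eq_square field_simps)
          finally show "indicator (?I k) r * \<omega> r \<le> \<nu> * (indicator (?I k) r * (\<omega> r)\<^sup>2) + 1 / (4 * \<nu>) * indicator (?I k) r"
            by (auto simp: indicator_def)
        qed auto
        also have "\<dots> = \<nu> * (LINT r|lborel. indicator (?I k) r * (\<omega> r)\<^sup>2) + 1 / (4 * \<nu>) * (b k - a k)"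
          using ii[OF \<omega>2, of "?I k"] ab[OF k] by (simp add: integrable_real_indicator)
        finally show ?thesis by simp
      qed
      have dj: "disjoint_family_on ?I {..<n}"
        unfolding disjoint_family_on_def
      proof (intro ballI impI)
        fix k j assume "k \<in> {..<n}" "j \<in> {..<n}" "k \<noteq> j"
        then have "b k \<le> a j \<or> b j \<le> a k" using 2 by simp
        then show "?I k \<inter> ?I j = {}" by auto
      qed
      have "(\<Sum>k<n. LINT r|lborel. indicator (?I k) r * (\<omega> r)\<^sup>2) = (LINT r|lborel. (\<Sum>k<n. indicator (?I k) r * (\<omega> r)\<^sup>2))"
        by (intro Bochner_Integration.integral_sum[symmetric] ii \<omega>2) auto
      also have "\<dots> \<le> Q" unfolding Q_def
      proof (intro integral_mono Bochner_Integration.integrable_sum ii \<omega>2)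
        fix r
        have "(\<Sum>k<n. indicat_real (?I k) r) = indicator (\<Union>k<n. ?I k) r"
          by (rule indicator_UN_disjoint[OF finite_lessThan dj, symmetric])
        then show "(\<Sum>k<n. indicator (?I k) r * (\<omega> r)\<^sup>2) \<le> (\<omega> r)\<^sup>2"
          by (simp add: sum_distrib_right[symmetric] indicator_def)
      qed auto
      finally have sumQ: "(\<Sum>k<n. LINT r|lborel. indicator (?I k) r * (\<omega> r)\<^sup>2) \<le> Q" .
      have "(\<Sum>k<n. norm (f (b k) - f (a k))) \<le> (\<Sum>k<n. \<nu> * (LINT r|lborel. indicator (?I k) r * (\<omega> r)\<^sup>2) + (b k - a k) / (4 * \<nu>))"
        by (intro sum_mono each) auto
      also have "\<dots> = \<nu> * (\<Sum>k<n. LINT r|lborel. indicator (?I k) r * (\<omega> r)\<^sup>2) + (\<Sum>k<n. b k - a k) / (4 * \<nu>)"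
        by (simp add: sum.distrib sum_distrib_left sum_divide_distrib)
      also have "\<dots> < \<nu> * Q + (2 * \<nu> * \<epsilon>) / (4 * \<nu>)"
        using sumQ \<nu>(1) 2 by (intro add_le_less_mono mult_left_mono divide_strict_right_mono) auto
      also have "\<dots> \<le> \<epsilon> / 2 + \<epsilon> / 2" using \<nu> by (intro add_mono) auto
      finally show ?case by simp
    qed (use \<nu> \<epsilon> in auto)
  qed
  have cont: "continuous_on {0<..<1} f"
  proof -
    have "\<exists>d>0. \<forall>y\<in>{0<..<1}. dist y x < d \<longrightarrow> dist (f y) (f x) < e" if x: "x \<in> {0<..<1}" and e: "e > 0" for x e
    proof -
      obtain \<eta> where \<eta>: "\<eta> > 0" "\<And>(n::nat) (a::nat \<Rightarrow> real) b. (\<forall>k<n. 0 \<le> a k \<and> a k \<le> b k \<and> b k \<le> 1) \<and>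
        (\<forall>k<n. \<forall>j<n. k \<noteq> j \<longrightarrow> b k \<le> a j \<or> b j \<le> a k) \<and> (\<Sum>k<n. b k - a k) < \<eta> \<Longrightarrow>
        (\<Sum>k<n. norm (f (b k) - f (a k))) < e"
        using \<open>abs_cont01 f\<close>[unfolded abs_cont01_def, rule_format, OF e] by blast
      have "dist (f y) (f x) < e" if y: "y \<in> {0<..<1}" "dist y x < \<eta>" for y
        using \<eta>(2)[of "Suc 0" "\<lambda>_. min x y" "\<lambda>_. max x y"] x y
        by (cases "x \<le> y") (auto simp: dist_norm norm_minus_commute min_def max_def)
      then show ?thesis using \<eta>(1) by blast
    qed
    then show ?thesis unfolding continuous_on_iff by blast
  qed
  have [measurable]: "(\<lambda>t. indicator {0<..<1} t *\<^sub>R vector_derivative f (at t)) \<in> borel_measurable borel"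
    by (rule borel_measurable_vector_derivative[OF _ cont]) auto
  \<comment> \<open>The value of \<open>vector_derivative\<close> wherever f is not differentiable.
    It is not known to be 0, but as one fixed vector it is square integrable on the bounded
    interval.\<close>
  define c0 :: 'v where "c0 = (SOME f'. False)"
  have LD: "AE x in lborel. x \<in> {0<..<1} \<longrightarrow> ((\<lambda>t. LINT r|lborel. indicator {..t} r * \<omega> r) has_real_derivative \<omega> x) (at x)"
  proof (rule Lebesgue_differentiation_real[OF \<omega>i])
    fix s t :: real assume st: "s \<le> t"
    have "(LINT r|lborel. indicator {..t} r * \<omega> r) - (LINT r|lborel. indicator {..s} r * \<omega> r) = (LINT r|lborel. indicator {..t} r * \<omega> r - indicator {..s} r * \<omega> r)"
      using ii[OF \<omega>i] by simp
    also have "\<dots> = (LINT r:{s..t}|lborel. \<omega> r)" unfolding set_lebesgue_integral_def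
      by (intro integral_cong_AE, simp, simp, use AE_lborel_singleton[of s] in eventually_elim) (use st in \<open>auto simp: indicator_def\<close>)
    finally show "(LINT r|lborel. indicator {..t} r * \<omega> r) - (LINT r|lborel. indicator {..s} r * \<omega> r) = (LINT r:{s..t}|lborel. \<omega> r)" .
  qed
  have le: "AE t in lborel. norm (indicator {0<..<1} t * (norm (vector_derivative f (at t)))\<^sup>2) \<le> norm ((\<omega> t)\<^sup>2 + indicator {0<..<1} t * (norm c0)\<^sup>2)"
    using LD
  proof eventually_elim
    case (elim t)
    show ?case
    proof (cases "t \<in> {0<..<1}")
      case True
      have "norm (vector_derivative f (at t)) \<le> \<omega> t \<or> vector_derivative f (at t) = c0"
      proof (cases "\<exists>l. (f has_vector_derivative l) (at t)")
        case True
        then obtain l where l: "(f has_vector_derivative l) (at t)" by blast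
        define W where "W t = (LINT r|lborel. indicator {..t} r * \<omega> r)" for t
        have Wd: "(W has_vector_derivative \<omega> t) (at t)"
          using elim \<open>t \<in> {0<..<1}\<close> unfolding W_def by (simp add: has_real_derivative_iff_has_vector_derivative)
        define z where "z n = (1 - t) / real (Suc n)" for n
        have z: "z n > 0" "t + z n \<le> 1" for n
          using \<open>t \<in> {0<..<1}\<close> by (auto simp: z_def field_simps mult_left_le_one_le)
        have z0: "filterlim z (at 0) sequentially"
        proof -
          have "(\<lambda>n. (1 - t) * inverse (real (Suc n))) \<longlonglongrightarrow> (1 - t) * 0" by (intro tendsto_intros LIMSEQ_inverse_real_of_nat)
          then have "z \<longlonglongrightarrow> 0" by (simp add: z_def[abs_def] divide_inverse)
          moreover have "z n \<noteq> 0" for n using z(1)[of n] by simp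
          ultimately show ?thesis by (auto simp: filterlim_at)
        qed
        have quot: "(\<lambda>n. (1 / z n) *\<^sub>R (g (t + z n) - g t)) \<longlonglongrightarrow> l'" if g: "(g has_vector_derivative l') (at t)" for g :: "real \<Rightarrow> 'b::real_normed_vector" and l'
        proof -
          have "((\<lambda>h. (1 / h) *\<^sub>R (g (t + h) - g t)) \<longlongrightarrow> l') (at 0)"
          proof -
            have "((\<lambda>h. norm (g (t + h) - g t - h *\<^sub>R l') / norm h) \<longlongrightarrow> 0) (at 0)"
              using g unfolding has_vector_derivative_def has_derivative_at by blast
            then have "((\<lambda>h. (1 / h) *\<^sub>R (g (t + h) - g t) - l') \<longlongrightarrow> 0) (at 0)"
            proof (rule Lim_null_comparison[rotated])
              show "\<forall>\<^sub>F h in at 0. norm ((1 / h) *\<^sub>R (g (t + h) - g t) - l') \<le> norm (g (t + h) - g t - h *\<^sub>R l') / norm h"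
                unfolding eventually_at_filter
              proof (intro always_eventually allI impI)
                fix h :: real assume h: "h \<noteq> 0"
                have "(1 / h) *\<^sub>R (g (t + h) - g t) - l' = (1 / h) *\<^sub>R (g (t + h) - g t - h *\<^sub>R l')"
                  using h by (simp add: scaleR_diff_right)
                then show "norm ((1 / h) *\<^sub>R (g (t + h) - g t) - l') \<le> norm (g (t + h) - g t - h *\<^sub>R l') / norm h" by simp
              qed
            qed
            then show ?thesis by (simp add: LIM_zero_iff)
          qed
          then show ?thesis by (rule filterlim_compose[OF _ z0])
        qed
        have "norm ((1 / z n) *\<^sub>R (f (t + z n) - f t)) \<le> (1 / z n) *\<^sub>R (W (t + z n) - W t)" for n
        proof -
          have "W (t + z n) - W t = (LINT r|lborel. indicator {..t + z n} r * \<omega> r - indicator {..t} r * \<omega> r)"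
            unfolding W_def using ii[OF \<omega>i] by simp
          also have "\<dots> = (LINT r:{t..t + z n}|lborel. \<omega> r)" unfolding set_lebesgue_integral_def
            by (intro integral_cong_AE, simp, simp, use AE_lborel_singleton[of t] in eventually_elim)
               (use z(1)[of n] in \<open>auto simp: indicator_def\<close>)
          finally have "norm (f (t + z n) - f t) \<le> W (t + z n) - W t"
            using inc[of t "t + z n"] z[of n] \<open>t \<in> {0<..<1}\<close> by simp
          then show ?thesis using z(1)[of n] by (simp add: divide_right_mono)
        qed
        then have "norm l \<le> \<omega> t" by (intro LIMSEQ_le[OF tendsto_norm[OF quot[OF l]] quot[OF Wd]]) auto
        then show ?thesis using vector_derivative_at[OF l] by simp
      next
        case False
        then show ?thesis by (simp add: vector_derivative_def c0_def)
      qed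
      then have "(norm (vector_derivative f (at t)))\<^sup>2 \<le> (\<omega> t)\<^sup>2 + (norm c0)\<^sup>2"
      proof
        assume "norm (vector_derivative f (at t)) \<le> \<omega> t"
        then have "(norm (vector_derivative f (at t)))\<^sup>2 \<le> (\<omega> t)\<^sup>2" by (intro power_mono) auto
        then show ?thesis by (simp add: add_increasing2)
      qed simp
      then show ?thesis using True by simp
    qed simp
  qed
  have int: "integrable lborel (\<lambda>t. indicator {0<..<1} t * (norm (vector_derivative f (at t)))\<^sup>2)"
  proof (rule Bochner_Integration.integrable_bound[OF _ _ le])
    show "integrable lborel (\<lambda>t. (\<omega> t)\<^sup>2 + indicator {0<..<1} t * (norm c0)\<^sup>2)"
      using \<omega>2 by (auto simp: integrable_real_indicator)
    have "(\<lambda>t. (norm (indicator {0<..<1} t *\<^sub>R vector_derivative f (at t)))\<^sup>2) \<in> borel_measurable lborel" by measurable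
    also have "(\<lambda>t. (norm (indicator {0<..<1} t *\<^sub>R vector_derivative f (at t)))\<^sup>2) = (\<lambda>t. indicator {0<..<1} t * (norm (vector_derivative f (at t)))\<^sup>2)"
      by (auto simp: indicator_def)
    finally show "(\<lambda>t. indicator {0<..<1} t * (norm (vector_derivative f (at t)))\<^sup>2) \<in> borel_measurable lborel" .
  qed
  then have "set_integrable lborel {0<..<1} (\<lambda>t. (norm (vector_derivative f (at t)))\<^sup>2)"
    by (simp add: set_integrable_def)
  then have "(\<lambda>t. (norm (vector_derivative f (at t)))\<^sup>2) integrable_on {0<..<1}"
    by (rule set_borel_integral_eq_integral(1))
  then show "(\<lambda>t. norm (vector_derivative f (at t)) ^ 2) integrable_on {0..1}"
    using integrable_on_open_interval[of "\<lambda>t. (norm (vector_derivative f (at t)))\<^sup>2" 0 1] by (simp add: box_real)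
qed

lemma not_AE_interval:
  assumes "AE r in lborel. r \<notin> {a<..<b::real}" shows "b \<le> a"
proof (rule ccontr)
  assume "\<not> b \<le> a"
  moreover have "{x \<in> space lborel. \<not> x \<notin> {a<..<b}} = {a<..<b}" by auto
  ultimately have "emeasure lborel {a<..<b} = 0" using assms AE_iff_measurable[of "{a<..<b}" lborel "\<lambda>r. r \<notin> {a<..<b}"] by simp
  then show False using \<open>\<not> b \<le> a\<close> by (simp add: emeasure_lborel_Ioo)
qed

text \<open>Increments of G add up and norms of increments of f are subadditive, so bisection passes
  from short intervals around each point to all intervals. The admissible length may depend on the
  point.\<close>

lemma increment_le_if_local:
  fixes f :: "real \<Rightarrow> 'v::real_normed_vector" and G :: "real \<Rightarrow> real"
  assumes loc: "\<And>x. x \<in> {0..1} \<Longrightarrow> \<exists>d>0. \<forall>s t. 0 \<le> s \<and> s \<le> x \<and> x \<le> t \<and> t \<le> 1 \<and> t - s < d \<longrightarrow> norm (f t - f s) \<le> G t - G s"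
    and st: "0 \<le> s" "s \<le> t" "t \<le> 1"
  shows "norm (f t - f s) \<le> G t - G s"
proof -
  have "0 \<le> s \<and> t \<le> 1 \<longrightarrow> norm (f t - f s) \<le> G t - G s"
    using st(2)
  proof (induct rule: Bolzano[where P = "\<lambda>s t. 0 \<le> s \<and> t \<le> 1 \<longrightarrow> norm (f t - f s) \<le> G t - G s"])
    case (trans a b c)
    show ?case
    proof
      assume "0 \<le> a \<and> c \<le> 1"
      then have "norm (f b - f a) \<le> G b - G a" "norm (f c - f b) \<le> G c - G b" using trans by auto
      moreover have "norm (f c - f a) \<le> norm (f c - f b) + norm (f b - f a)" using norm_triangle_ineq[of "f c - f b" "f b - f a"] by simp
      ultimately show "norm (f c - f a) \<le> G c - G a" by linarith
    qed
  next
    case (local x)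
    then have x: "x \<in> {0..1}" using st by auto
    obtain d where "d > 0" "\<forall>s t. 0 \<le> s \<and> s \<le> x \<and> x \<le> t \<and> t \<le> 1 \<and> t - s < d \<longrightarrow> norm (f t - f s) \<le> G t - G s"
      using loc[OF x] by blast
    then show ?case by (intro exI[of _ d]) auto
  qed
  with st show ?thesis by simp
qed

lemma indicator_integrable:
  fixes u :: "real \<Rightarrow> 'b::{banach, second_countable_topology}"
  assumes "integrable lborel u" "S \<in> sets borel"
  shows "integrable lborel (\<lambda>r. indicator S r *\<^sub>R u r)"
  using integrable_mult_indicator[of S lborel u] assms by simp

lemma set_integral_eq_open:
  fixes u :: "real \<Rightarrow> 'b::{banach, second_countable_topology}"
  assumes u: "integrable lborel u"
  shows "(LINT r:{s..t}|lborel. u r) = (LINT r|lborel. indicator {s<..<t} r *\<^sub>R u r)"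
proof -
  have [measurable]: "u \<in> borel_measurable borel" using u by auto
  show ?thesis unfolding set_lebesgue_integral_def
    by (intro integral_cong_AE, simp, simp, use AE_lborel_singleton[of s] AE_lborel_singleton[of t] in eventually_elim)
       (auto simp: indicator_def)
qed

lemma primitive_diff:
  fixes u :: "real \<Rightarrow> real"
  assumes u: "integrable lborel u" and st: "s \<le> t"
  shows "(LINT r|lborel. indicator {..t} r * u r) - (LINT r|lborel. indicator {..s} r * u r) = (LINT r:{s..t}|lborel. u r)"
proof -
  have [measurable]: "u \<in> borel_measurable borel" using u by auto
  have "(LINT r|lborel. indicator {..t} r * u r) - (LINT r|lborel. indicator {..s} r * u r) = (LINT r|lborel. indicator {..t} r * u r - indicator {..s} r * u r)"
    using indicator_integrable[OF u, of "{..t}"] indicator_integrable[OF u, of "{..s}"] by simp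
  also have "\<dots> = (LINT r:{s..t}|lborel. u r)" unfolding set_lebesgue_integral_def
    by (intro integral_cong_AE, simp, simp, use AE_lborel_singleton[of s] in eventually_elim) (use st in \<open>auto simp: indicator_def\<close>)
  finally show ?thesis .
qed

section \<open>Measures on the graph of a curve\<close>

context transport begin

lemma extend_measurable:
  fixes u :: "'d pt \<Rightarrow> 'b::real_normed_vector"
  assumes "u \<in> borel_measurable P"
  shows "(\<lambda>p. indicator (XO \<Omega>) p *\<^sub>R u p) \<in> borel_measurable borel"
proof -
  have "sets P = sets (restrict_space borel (XO \<Omega>))"
    using XO_borel by (auto simp: setsP borel_sub_def sets_restrict_space_iff)
  then have "u \<in> borel_measurable (restrict_space borel (XO \<Omega>))"
    using assms measurable_cong_sets by blast
  then show ?thesis by (subst (asm) borel_measurable_restrict_space_iff) (use XO_borel in auto)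
qed

text \<open>The factor sets the value to 0 where the graph leaves XO; a function measurable on XO
  thus becomes Borel on the whole line.\<close>

definition along :: "(real \<Rightarrow> real ^ 'd) \<Rightarrow> ('d pt \<Rightarrow> 'b::real_normed_vector) \<Rightarrow> real \<Rightarrow> 'b" where
  "along \<gamma> u t = indicator (XO \<Omega>) (t, \<gamma> t) *\<^sub>R u (t, \<gamma> t)"

text \<open>Encodes that P is h dt carried by the graph of \<gamma>: the law of time has density h,
  and almost every point lies on the graph.\<close>

definition concentrated :: "(real \<Rightarrow> real) \<Rightarrow> (real \<Rightarrow> real ^ 'd) \<Rightarrow> bool" where
  "concentrated h \<gamma> \<longleftrightarrow> h \<in> borel_measurable borel \<and> \<gamma> \<in> borel_measurable borel \<and> (\<forall>t\<in>{0<..<1}. 0 \<le> h t) \<and>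
     distr P borel fst = density lborel (\<lambda>t. ennreal (indicator {0<..<1} t * h t)) \<and> (AE p in P. snd p = \<gamma> (fst p))"

lemma along_facts:
  fixes u :: "'d pt \<Rightarrow> 'b::{banach, second_countable_topology}"
  assumes c: "concentrated h \<gamma>" and u [measurable]: "u \<in> borel_measurable P"
  shows along_measurable: "along \<gamma> u \<in> borel_measurable borel"
    and along_AE: "AE p in P. u p = along \<gamma> u (fst p)"
    and along_integrable: "integrable P u \<longleftrightarrow> integrable lborel (\<lambda>t. (indicator {0<..<1} t * h t) *\<^sub>R along \<gamma> u t)"
    and along_integral: "(\<integral>p. u p \<partial>P) = (LINT t|lborel. (indicator {0<..<1} t * h t) *\<^sub>R along \<gamma> u t)"
proof -
  have [measurable]: "h \<in> borel_measurable borel" "\<gamma> \<in> borel_measurable borel" and h0: "\<And>t. t \<in> {0<..<1} \<Longrightarrow> 0 \<le> h t"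
    and d: "distr P borel fst = density lborel (\<lambda>t. ennreal (indicator {0<..<1} t * h t))" and conc: "AE p in P. snd p = \<gamma> (fst p)"
    using c by (auto simp: concentrated_def)
  have "(\<lambda>t. (t, \<gamma> t)) \<in> borel_measurable borel" by measurable
  from measurable_compose[OF this extend_measurable[OF u]]
  show m [measurable]: "along \<gamma> u \<in> borel_measurable borel" unfolding along_def .
  show ae: "AE p in P. u p = along \<gamma> u (fst p)"
    using conc AE_space
  proof eventually_elim
    case (elim p)
    then have "(fst p, \<gamma> (fst p)) = p" by (simp add: prod_eq_iff)
    then show ?case using elim by (simp add: along_def spaceP)
  qed
  have nn: "AE t in lborel. 0 \<le> indicator {0<..<1} t * h t" using h0 by (auto simp: indicator_def)
  have m2: "(\<lambda>p. along \<gamma> u (fst p)) \<in> borel_measurable P" by (rule measurable_compose[OF fst_measurable_P m])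
  have "integrable P u \<longleftrightarrow> integrable P (\<lambda>p. along \<gamma> u (fst p))" by (rule integrable_cong_AE[OF u m2 ae])
  also have "\<dots> \<longleftrightarrow> integrable (distr P borel fst) (along \<gamma> u)" by (rule integrable_distr_eq[symmetric, OF fst_measurable_P]) simp
  also have "\<dots> \<longleftrightarrow> integrable lborel (\<lambda>t. (indicator {0<..<1} t * h t) *\<^sub>R along \<gamma> u t)"
    unfolding d by (rule integrable_density[OF _ _ nn]) measurable
  finally show "integrable P u \<longleftrightarrow> integrable lborel (\<lambda>t. (indicator {0<..<1} t * h t) *\<^sub>R along \<gamma> u t)" .
  have "(\<integral>p. u p \<partial>P) = (\<integral>p. along \<gamma> u (fst p) \<partial>P)" by (rule integral_cong_AE[OF u m2 ae])
  also have "\<dots> = (\<integral>t. along \<gamma> u t \<partial>distr P borel fst)" by (rule integral_distr[symmetric, OF fst_measurable_P]) simp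
  also have "\<dots> = (LINT t|lborel. (indicator {0<..<1} t * h t) *\<^sub>R along \<gamma> u t)"
    unfolding d by (rule integral_density[OF _ _ nn]) measurable
  finally show "(\<integral>p. u p \<partial>P) = (LINT t|lborel. (indicator {0<..<1} t * h t) *\<^sub>R along \<gamma> u t)" .
qed

text \<open>q is the density in time of the vector of first moments, so q / h is the barycentre of
  the slices, the only candidate for the curve. Boundedness of \<Omega> gives |q| \<le> C h, an
  estimate that survives at the zeros of h.\<close>

lemma concentrated_on_curve:
  assumes inv: "invariant (\<lambda>_. 1)" and approx: approximable
  obtains h :: "real \<Rightarrow> real" and q :: "real \<Rightarrow> real ^ 'd" and C where
    "continuous_on UNIV h" "continuous_on UNIV q" "\<And>t. t \<in> {0..1} \<Longrightarrow> 0 \<le> h t" "0 \<le> C" "\<And>t. t \<in> {0..1} \<Longrightarrow> norm (q t) \<le> C * h t"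
    "\<And>s t. s \<le> t \<Longrightarrow> h t - h s = (\<integral>p. indicator {s<..<t} (fst p) * w p \<partial>P)"
    "\<And>s t i. s \<le> t \<Longrightarrow> q t $ i - q s $ i = (\<integral>p. indicator {s<..<t} (fst p) * (v p $ i + w p * snd p $ i) \<partial>P)"
    "\<And>s t. 0 \<le> s \<Longrightarrow> s \<le> t \<Longrightarrow> t \<le> 1 \<Longrightarrow> (\<integral>p. indicator {s<..<t} (fst p) \<partial>P) = (LINT r:{s..t}|lborel. h r)"
    "concentrated h (\<lambda>t. (1 / h t) *\<^sub>R q t)"
proof -
  obtain c where c: "\<And>t. t \<in> {0..1} \<Longrightarrow> 0 \<le> c + boundary_flux w t"
    "\<And>s t. 0 \<le> s \<Longrightarrow> s \<le> t \<Longrightarrow> t \<le> 1 \<Longrightarrow> (\<integral>p. indicator {s<..<t} (fst p) \<partial>P) = (LINT r:{s..t}|lborel. c + boundary_flux w r)"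
    "distr P borel fst = density lborel (\<lambda>t. ennreal (indicator {0<..<1} t * (c + boundary_flux w t)))"
    using time_density[OF inv] by blast
  define h where "h t = c + boundary_flux w t" for t
  have ex: "\<exists>c. \<forall>s t. 0 \<le> s \<longrightarrow> s \<le> t \<longrightarrow> t \<le> 1 \<longrightarrow> (\<integral>p. indicator {s<..<t} (fst p) * snd p $ i \<partial>P) =
     (LINT r:{s..t}|lborel. c + boundary_flux (\<lambda>p. v p $ i + w p * snd p $ i) r)" for i
  proof (rule moment_density[OF inv, of i])
    fix c assume a: "\<And>s t. 0 \<le> s \<Longrightarrow> s \<le> t \<Longrightarrow> t \<le> 1 \<Longrightarrow> (\<integral>p. indicator {s<..<t} (fst p) * snd p $ i \<partial>P) =
     (LINT r:{s..t}|lborel. c + boundary_flux (\<lambda>p. v p $ i + w p * snd p $ i) r)"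
    show ?thesis by (intro exI[of _ c] allI impI) (rule a)
  qed
  obtain e where e0: "\<forall>i. \<forall>s t. 0 \<le> s \<longrightarrow> s \<le> t \<longrightarrow> t \<le> 1 \<longrightarrow> (\<integral>p. indicator {s<..<t} (fst p) * snd p $ i \<partial>P) =
     (LINT r:{s..t}|lborel. e i + boundary_flux (\<lambda>p. v p $ i + w p * snd p $ i) r)"
    using choice[OF allI[OF ex]] by (rule exE)
  note e = e0[rule_format]
  define qi where "qi i t = e i + boundary_flux (\<lambda>p. v p $ i + w p * snd p $ i) t" for i t
  define q where "q t = (\<chi> i. qi i t)" for t
  have hc: "continuous_on S h" for S unfolding h_def
    by (intro continuous_intros continuous_on_subset[OF boundary_flux_continuous[OF inv w_integrable]]) auto
  have qic: "continuous_on S (qi i)" for S i unfolding qi_def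
    by (intro continuous_intros continuous_on_subset[OF boundary_flux_continuous[OF inv component_Lop_integrable]]) auto
  have qc: "continuous_on S q" for S unfolding q_def by (intro continuous_on_vec_lambda qic)
  have h0: "0 \<le> h t" if "t \<in> {0..1}" for t using c(1)[OF that] by (simp add: h_def)
  have hI: "(\<integral>p. indicator {s<..<t} (fst p) \<partial>P) = (LINT r:{s..t}|lborel. h r)" if "0 \<le> s" "s \<le> t" "t \<le> 1" for s t
    using c(2)[OF that] by (simp add: h_def)
  have qI: "(\<integral>p. indicator {s<..<t} (fst p) * snd p $ i \<partial>P) = (LINT r:{s..t}|lborel. qi i r)" if "0 \<le> s" "s \<le> t" "t \<le> 1" for s t i
    using e[OF that] by (simp add: qi_def)
  have [measurable]: "h \<in> borel_measurable borel" "q \<in> borel_measurable borel"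
    using hc qc by (auto intro: borel_measurable_continuous_onI)
  obtain R where R: "R > 0" "\<And>p i. p \<in> space P \<Longrightarrow> \<bar>snd p $ i\<bar> \<le> R" using component_bounded by blast
  have qle: "\<bar>qi i t\<bar> \<le> R * h t" if t: "t \<in> {0..1}" for t i
  proof -
    have si: "set_integrable lborel {s..t} (qi i)" "set_integrable lborel {s..t} (\<lambda>r. R * h r)" for s t
      by (intro borel_integrable_atLeastAtMost' continuous_intros hc qic)+
    have Ii: "integrable P (\<lambda>p. indicat_real {s<..<t} (fst p))" for s t
      by (rule bounded_integrable[where K = 1]) (auto simp: indicator_def)
    have Ixi: "integrable P (\<lambda>p. indicator {s<..<t} (fst p) * snd p $ i)" for s t
      by (intro indicator_mult_integrable component_integrable) auto
    have le: "(\<integral>p. indicator {s<..<t} (fst p) * snd p $ i \<partial>P) \<le> R * (\<integral>p. indicat_real {s<..<t} (fst p) \<partial>P)"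
         "- (\<integral>p. indicator {s<..<t} (fst p) * snd p $ i \<partial>P) \<le> R * (\<integral>p. indicat_real {s<..<t} (fst p) \<partial>P)" for s t
    proof -
      have "(\<integral>p. indicator {s<..<t} (fst p) * snd p $ i \<partial>P) \<le> (\<integral>p. R * indicat_real {s<..<t} (fst p) \<partial>P)"
        using R(2) by (intro integral_mono Ixi integrable_mult_right Ii) (auto simp: indicator_def abs_le_iff)
      moreover have "(\<integral>p. - (indicator {s<..<t} (fst p) * snd p $ i) \<partial>P) \<le> (\<integral>p. R * indicat_real {s<..<t} (fst p) \<partial>P)"
        using R(2) by (intro integral_mono integrable_minus Ixi integrable_mult_right Ii) (auto simp: indicator_def abs_le_iff)
      ultimately show "(\<integral>p. indicator {s<..<t} (fst p) * snd p $ i \<partial>P) \<le> R * (\<integral>p. indicat_real {s<..<t} (fst p) \<partial>P)"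
         "- (\<integral>p. indicator {s<..<t} (fst p) * snd p $ i \<partial>P) \<le> R * (\<integral>p. indicat_real {s<..<t} (fst p) \<partial>P)" by simp_all
    qed
    have "0 \<le> R * h t - qi i t"
    proof (rule nonneg_if_interval_integrals_nonneg[OF _ _ _ t])
      fix s t :: real assume st: "0 \<le> s" "s \<le> t" "t \<le> 1"
      have "(LINT r:{s..t}|lborel. R * h r - qi i r) = R * (LINT r:{s..t}|lborel. h r) - (LINT r:{s..t}|lborel. qi i r)"
        using set_integral_diff(2)[OF si(2,1), of s t] by simp
      then show "0 \<le> (LINT r:{s..t}|lborel. R * h r - qi i r)" using le(1)[of s t] hI[OF st] qI[OF st] by simp
    qed (auto intro!: continuous_intros hc qic)
    moreover have "0 \<le> R * h t + qi i t"
    proof (rule nonneg_if_interval_integrals_nonneg[OF _ _ _ t])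
      fix s t :: real assume st: "0 \<le> s" "s \<le> t" "t \<le> 1"
      have "(LINT r:{s..t}|lborel. R * h r + qi i r) = R * (LINT r:{s..t}|lborel. h r) + (LINT r:{s..t}|lborel. qi i r)"
        using set_integral_add(2)[OF si(2,1), of s t] by simp
      then show "0 \<le> (LINT r:{s..t}|lborel. R * h r + qi i r)" using le(2)[of s t] hI[OF st] qI[OF st] by simp
    qed (auto intro!: continuous_intros hc qic)
    ultimately show ?thesis by (simp add: abs_le_iff)
  qed
  have qn: "norm (q t) \<le> (real CARD('d) * R) * h t" if t: "t \<in> {0..1}" for t
  proof -
    have "norm (q t) \<le> (\<Sum>i\<in>UNIV. \<bar>q t $ i\<bar>)" by (rule norm_le_l1_cart)
    also have "\<dots> \<le> (\<Sum>i\<in>(UNIV::'d set). R * h t)" using qle[OF t] by (intro sum_mono) (simp add: q_def)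
    finally show ?thesis by simp
  qed
  have "AE p in P. 0 < h (fst p)"
  proof -
    have "AE t in density lborel (\<lambda>t. ennreal (indicator {0<..<1} t * h t)). 0 < h t"
      by (subst AE_density) (auto intro!: AE_I2 simp: indicator_def)
    then have "AE t in distr P borel fst. 0 < h t" unfolding c(3)[folded h_def] .
    then show ?thesis by (subst (asm) AE_distr_iff) auto
  qed
  \<comment> \<open>With rational end points only countably many exceptional sets arise, and by
    continuity of h every time in (0,1) with h > 0 lies in such an interval.\<close>
  moreover have "AE p in P. \<forall>(S::rat) (T::rat) i. 0 \<le> real_of_rat S \<and> real_of_rat S \<le> of_rat T \<and> real_of_rat T \<le> 1 \<and> (\<forall>t\<in>{real_of_rat S..of_rat T}. 0 < h t) \<longrightarrow>
      fst p \<in> {of_rat S<..<of_rat T} \<longrightarrow> snd p $ i = qi i (fst p) / h (fst p)"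
    unfolding AE_all_countable
  proof (intro allI)
    fix S T :: rat and i
    show "AE p in P. 0 \<le> real_of_rat S \<and> real_of_rat S \<le> of_rat T \<and> real_of_rat T \<le> 1 \<and> (\<forall>t\<in>{real_of_rat S..of_rat T}. 0 < h t) \<longrightarrow>
      fst p \<in> {of_rat S<..<of_rat T} \<longrightarrow> snd p $ i = qi i (fst p) / h (fst p)"
    proof (cases "0 \<le> real_of_rat S \<and> real_of_rat S \<le> of_rat T \<and> real_of_rat T \<le> 1 \<and> (\<forall>t\<in>{real_of_rat S..of_rat T}. 0 < h t)")
      case True
      then have "AE p in P. fst p \<in> {of_rat S<..<of_rat T} \<longrightarrow> snd p $ i = qi i (fst p) / h (fst p)"
        by (intro AE_component_eq[OF inv approx hI qI hc qic]) auto
      then show ?thesis by eventually_elim blast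
    qed (intro AE_I2, blast)
  qed
  ultimately have conc: "AE p in P. snd p = (1 / h (fst p)) *\<^sub>R q (fst p)"
    using AE_space
  proof eventually_elim
    case (elim p)
    have p01: "fst p \<in> {0<..<1}" using elim(3) by (auto simp: spaceP XO_def)
    have "open {t. 0 < h t}" by (intro open_Collect_less continuous_on_const hc)
    then have "open ({t. 0 < h t} \<inter> {0<..<1})" by auto
    then obtain d where d: "d > 0" "ball (fst p) d \<subseteq> {t. 0 < h t} \<inter> {0<..<1}"
      by (rule openE) (use elim(1) p01 in auto)
    obtain S where S: "fst p - d < real_of_rat S" "real_of_rat S < fst p" using of_rat_dense[of "fst p - d" "fst p"] d(1) by auto
    obtain T where T: "fst p < real_of_rat T" "real_of_rat T < fst p + d" using of_rat_dense[of "fst p" "fst p + d"] d(1) by auto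
    have sub: "{real_of_rat S..of_rat T} \<subseteq> {t. 0 < h t} \<inter> {0<..<1}"
      using S T d(2) by (auto simp: subset_iff dist_real_def)
    have "real_of_rat S \<in> {real_of_rat S..of_rat T}" "real_of_rat T \<in> {real_of_rat S..of_rat T}"
      using S T unfolding atLeastAtMost_iff by linarith+
    then have "real_of_rat S \<in> {0<..<1}" "real_of_rat T \<in> {0<..<1}" using sub by blast+
    then have prem: "0 \<le> real_of_rat S \<and> real_of_rat S \<le> of_rat T \<and> real_of_rat T \<le> 1 \<and> (\<forall>t\<in>{real_of_rat S..of_rat T}. 0 < h t)"
      using S T sub unfolding greaterThanLessThan_iff by (intro conjI) (linarith | blast)+
    have "fst p \<in> {of_rat S<..<of_rat T}" using S T unfolding greaterThanLessThan_iff by blast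
    then have "snd p $ i = qi i (fst p) / h (fst p)" for i
      using elim(2) prem by blast
    then show ?case by (simp add: vec_eq_iff q_def)
  qed
  show ?thesis
  proof (rule that[of h q "real CARD('d) * R"])
    show "h t - h s = (\<integral>p. indicator {s<..<t} (fst p) * w p \<partial>P)" if "s \<le> t" for s t
      using boundary_flux_diff[OF inv w_integrable that] by (simp add: h_def)
    show "q t $ i - q s $ i = (\<integral>p. indicator {s<..<t} (fst p) * (v p $ i + w p * snd p $ i) \<partial>P)" if "s \<le> t" for s t i
      using boundary_flux_diff[OF inv component_Lop_integrable that] by (simp add: q_def qi_def)
    show "concentrated h (\<lambda>t. (1 / h t) *\<^sub>R q t)"
      unfolding concentrated_def using conc c(3)[folded h_def] h0 by auto
    show "0 \<le> real CARD('d) * R" using R(1) by simp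
  qed (use hc qc h0 qn hI in auto)
qed

text \<open>If h vanishes at z, the flux of every test function through time z vanishes, being
  bounded by the supremum of the function times h z. So the indicator of the times before z is an
  invariant weight; it is not constant, because h > 0 at a and at b puts mass on both sides.\<close>

lemma positivity_interval:
  fixes h :: "real \<Rightarrow> real"
  assumes inv: "invariant (\<lambda>_. 1)"
    and const: "\<And>\<theta>. \<theta> \<in> borel_measurable P \<Longrightarrow> (\<And>p. \<bar>\<theta> p\<bar> \<le> 1) \<Longrightarrow> invariant \<theta> \<Longrightarrow> \<exists>c. AE p in P. \<theta> p = c"
    and hc: "continuous_on UNIV h" and h0: "\<And>t. t \<in> {0..1} \<Longrightarrow> 0 \<le> h t"
    and hI: "\<And>s t. 0 \<le> s \<Longrightarrow> s \<le> t \<Longrightarrow> t \<le> 1 \<Longrightarrow> (\<integral>p. indicator {s<..<t} (fst p) \<partial>P) = (LINT r:{s..t}|lborel. h r)"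
  shows "connected {t \<in> {0..1}. 0 < h t}"
  unfolding is_interval_connected_1[symmetric] is_interval_1
proof (intro ballI allI impI, elim conjE)
  fix a b z assume a: "a \<in> {t \<in> {0..1}. 0 < h t}" and b: "b \<in> {t \<in> {0..1}. 0 < h t}" and z: "a \<le> z" "z \<le> b"
  have z01: "z \<in> {0..1}" using a b z by auto
  show "z \<in> {t \<in> {0..1}. 0 < h t}"
  proof (rule ccontr)
    assume "z \<notin> {t \<in> {0..1}. 0 < h t}"
    then have hz: "h z = 0" using z01 h0[OF z01] by (simp add: not_less)
    then have az: "a < z" "z < b" using a b z by (auto simp: less_le)
    define \<theta> where "\<theta> p = indicat_real {..<z} (fst p)" for p :: "'d pt"
    have [measurable]: "\<theta> \<in> borel_measurable P" unfolding \<theta>_def by measurable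
    have flux0: "boundary_flux (Lop \<phi>) z = 0" if t: "test_fun \<phi>" for \<phi>
    proof -
      obtain K where K: "\<And>p. \<bar>\<phi> p\<bar> \<le> K" using test_fun_bounded[OF t] by blast
      have \<phi>i: "integrable P \<phi>" by (rule bounded_integrable[OF test_measurable(1)[OF t] K])
      have Ii: "integrable P (\<lambda>p. indicat_real {s<..<t} (fst p))" for s t
        by (rule bounded_integrable[where K = 1]) (auto simp: indicator_def)
      note flc = boundary_flux_continuous[OF inv Lop_integrable[OF t]]
      have si: "set_integrable lborel {s..t} (\<lambda>r. K * h r)" "set_integrable lborel {s..t} (boundary_flux (Lop \<phi>))" for s t
        by (intro borel_integrable_atLeastAtMost' continuous_intros continuous_on_subset[OF hc] continuous_on_subset[OF flc]; simp)+
      have "0 \<le> K * h z - boundary_flux (Lop \<phi>) z"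
      proof (rule nonneg_if_interval_integrals_nonneg[OF _ _ _ z01])
        fix s t :: real assume st: "0 \<le> s" "s \<le> t" "t \<le> 1"
        have "(\<integral>p. indicator {s<..<t} (fst p) * \<phi> p \<partial>P) \<le> (\<integral>p. K * indicat_real {s<..<t} (fst p) \<partial>P)"
          using K by (intro integral_mono indicator_mult_integrable \<phi>i integrable_mult_right Ii) (auto simp: indicator_def abs_le_iff)
        then show "0 \<le> (LINT r:{s..t}|lborel. K * h r - boundary_flux (Lop \<phi>) r)"
          using set_integral_diff(2)[OF si, of s t] test_slice[OF inv \<open>test_fun \<phi>\<close> st] hI[OF st] by simp
      qed (auto intro!: continuous_intros continuous_on_subset[OF hc] continuous_on_subset[OF flc])
      moreover have "0 \<le> K * h z + boundary_flux (Lop \<phi>) z"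
      proof (rule nonneg_if_interval_integrals_nonneg[OF _ _ _ z01])
        fix s t :: real assume st: "0 \<le> s" "s \<le> t" "t \<le> 1"
        have "(\<integral>p. - (indicator {s<..<t} (fst p) * \<phi> p) \<partial>P) \<le> (\<integral>p. K * indicat_real {s<..<t} (fst p) \<partial>P)"
          using K by (intro integral_mono integrable_minus indicator_mult_integrable \<phi>i integrable_mult_right Ii) (auto simp: indicator_def abs_le_iff)
        then show "0 \<le> (LINT r:{s..t}|lborel. K * h r + boundary_flux (Lop \<phi>) r)"
          using set_integral_add(2)[OF si, of s t] test_slice[OF inv \<open>test_fun \<phi>\<close> st] hI[OF st] by simp
      qed (auto intro!: continuous_intros continuous_on_subset[OF hc] continuous_on_subset[OF flc])
      ultimately show ?thesis using hz by simp
    qed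
    have "invariant \<theta>" unfolding invariant_def
      using flux0 by (simp add: boundary_flux_def \<theta>_def)
    then obtain k where k: "AE p in P. \<theta> p = k" using const[of \<theta>] by (auto simp: \<theta>_def indicator_def)
    \<comment> \<open>A slab without mass forces h \<le> 0 on it by continuity, end points included;
      this matters when a = 0 or b = 1.\<close>
    have vanish: False if ae: "AE p in P. fst p \<notin> {s0<..<t0}" and st0: "0 \<le> s0" "s0 < t0" "t0 \<le> 1" and y: "y \<in> {s0..t0}" "0 < h y" for s0 t0 y
    proof -
      have "0 \<le> - h y"
      proof (rule nonneg_if_interval_integrals_nonneg[OF st0(2) _ _ y(1)])
        fix s t assume st: "s0 \<le> s" "s \<le> t" "t \<le> t0"
        have "(\<integral>p. indicat_real {s<..<t} (fst p) \<partial>P) = (\<integral>p. 0 \<partial>P)"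
          by (intro integral_cong_AE, simp, simp, use ae in eventually_elim) (use st in \<open>auto simp: indicator_def\<close>)
        then have "(LINT r:{s..t}|lborel. h r) = 0" using hI[of s t] st st0 by simp
        then show "0 \<le> (LINT r:{s..t}|lborel. - h r)" by (simp add: set_lebesgue_integral_def)
      qed (auto intro!: continuous_intros continuous_on_subset[OF hc])
      then show False using y by simp
    qed
    show False
    proof (cases "k = 1")
      case True
      have "AE p in P. fst p \<notin> {z<..<1}" using k by eventually_elim (use True in \<open>auto simp: \<theta>_def indicator_def split: if_splits\<close>)
      then show False using vanish[of z 1 b] az b z01 by auto
    next
      case False
      have "AE p in P. fst p \<notin> {0<..<z}" using k by eventually_elim (use False in \<open>auto simp: \<theta>_def indicator_def split: if_splits\<close>)
      then show False using vanish[of 0 z a] az a z01 by auto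
    qed
  qed
qed

end

section \<open>Extremal points are curves\<close>

lemma has_vector_derivative_if_components:
  fixes q :: "real \<Rightarrow> real ^ 'd"
  assumes "\<And>i. ((\<lambda>t. q t $ i) has_real_derivative d $ i) (at t)"
  shows "(q has_vector_derivative d) (at t)"
  unfolding has_vector_derivative_def
proof (subst has_derivative_componentwise_within, intro ballI)
  fix e :: "real ^ 'd" assume "e \<in> Basis"
  then obtain i where e: "e = axis i 1" by (auto simp: Basis_vec_def)
  have "((\<lambda>t. q t $ i) has_derivative (\<lambda>x. d $ i * x)) (at t)" using assms[of i] by (simp add: has_field_derivative_def)
  then show "((\<lambda>t. q t \<bullet> e) has_derivative (\<lambda>x. (x *\<^sub>R d) \<bullet> e)) (at t)"
    by (simp add: e inner_axis mult.commute)
qed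

context transport begin

text \<open>The formulas come from Lebesgue differentiation; the substance is the regularity. In h'
  = h W and q' = h (V + W \<gamma>) one factor sqrt h combines with V and W into the square
  integrable function b, while the other remains as a factor in the increment bounds. The curves h,
  sqrt h and sqrt h \<gamma> are all compared with one primitive of b.\<close>

lemma triple_one_in_Cset:
  assumes inv: "invariant (\<lambda>_. 1)" and approx: approximable
    and const: "\<And>\<theta>. \<theta> \<in> borel_measurable P \<Longrightarrow> (\<And>p. \<bar>\<theta> p\<bar> \<le> 1) \<Longrightarrow> invariant \<theta> \<Longrightarrow> \<exists>c. AE p in P. \<theta> p = c"
    and J1: "J \<alpha> \<beta> \<delta> \<Omega> (wt (\<lambda>_. 1)) (wt v) (wt w) = 1"
  shows "(wt (\<lambda>_. 1), wt v, wt w) \<in> Cset \<alpha> \<beta> \<delta> \<Omega>"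
proof -
  obtain h q C where hc: "continuous_on UNIV h" and qc: "continuous_on UNIV q" and h0: "\<And>t. t \<in> {0..1} \<Longrightarrow> 0 \<le> h t"
    and C: "0 \<le> C" and qC: "\<And>t. t \<in> {0..1} \<Longrightarrow> norm (q t) \<le> C * h t"
    and hd: "\<And>s t. s \<le> t \<Longrightarrow> h t - h s = (\<integral>p. indicator {s<..<t} (fst p) * w p \<partial>P)"
    and qd: "\<And>s t i. s \<le> t \<Longrightarrow> q t $ i - q s $ i = (\<integral>p. indicator {s<..<t} (fst p) * (v p $ i + w p * snd p $ i) \<partial>P)"
    and hI: "\<And>s t. 0 \<le> s \<Longrightarrow> s \<le> t \<Longrightarrow> t \<le> 1 \<Longrightarrow> (\<integral>p. indicator {s<..<t} (fst p) \<partial>P) = (LINT r:{s..t}|lborel. h r)"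
    and conc': "concentrated h (\<lambda>t. (1 / h t) *\<^sub>R q t)"
    by (rule concentrated_on_curve[OF inv approx]) (rule that; assumption)
  define \<gamma> where "\<gamma> t = (1 / h t) *\<^sub>R q t" for t
  have conc: "concentrated h \<gamma>" using conc' by (simp add: \<gamma>_def[abs_def])
  have hm [measurable]: "h \<in> borel_measurable borel" and \<gamma>m [measurable]: "\<gamma> \<in> borel_measurable borel" using conc by (auto simp: concentrated_def)
  define W where "W = along \<gamma> w"
  define V where "V = along \<gamma> v"
  have [measurable]: "W \<in> borel_measurable borel" "V \<in> borel_measurable borel"
    unfolding W_def V_def by (rule along_measurable[OF conc]; simp)+
  define I where "I t = indicat_real {0<..<1} t" for t :: real
  have [measurable]: "I \<in> borel_measurable borel" unfolding I_def by measurable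
  have Ih0: "0 \<le> I t * h t" for t using h0[of t] by (auto simp: I_def indicator_def)
  have hWi: "integrable lborel (\<lambda>t. I t * h t * W t)"
    using along_integrable[OF conc w] w_integrable by (simp add: W_def I_def)
  have hdW: "h t - h s = (LINT r:{s..t}|lborel. I r * h r * W r)" if "s \<le> t" for s t
  proof -
    have "along \<gamma> (\<lambda>p. indicator {s<..<t} (fst p) * w p) = (\<lambda>r. indicator {s<..<t} r * W r)"
      by (auto simp: along_def W_def)
    then have "h t - h s = (LINT r|lborel. (I r * h r) *\<^sub>R (indicator {s<..<t} r * W r))"
      using hd[OF that] along_integral[OF conc, of "\<lambda>p. indicator {s<..<t} (fst p) * w p"] by (simp add: I_def)
    also have "\<dots> = (LINT r:{s..t}|lborel. I r * h r * W r)"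
      unfolding set_integral_eq_open[OF hWi] by (intro Bochner_Integration.integral_cong) auto
    finally show ?thesis .
  qed
  define u2 where "u2 p = v p + w p *\<^sub>R snd p" for p
  obtain R where R: "\<And>x. x \<in> \<Omega> \<Longrightarrow> norm x \<le> R" using bounded\<Omega> by (auto simp: bounded_iff)
  have [measurable]: "u2 \<in> borel_measurable P" unfolding u2_def by measurable
  have u2i: "integrable P u2"
  proof -
    have "integrable P (\<lambda>p. w p *\<^sub>R snd p)"
    proof (rule Bochner_Integration.integrable_bound)
      show "integrable P (\<lambda>p. R * w p)" using w_integrable by simp
      show "AE p in P. norm (w p *\<^sub>R snd p) \<le> norm (R * w p)"
      proof (rule AE_I2)
        fix p assume "p \<in> space P"
        then have "norm (snd p) \<le> \<bar>R\<bar>" using R[of "snd p"] by (auto simp: spaceP XO_def)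
        then show "norm (w p *\<^sub>R snd p) \<le> norm (R * w p)" using mult_left_mono[of "norm (snd p)" "\<bar>R\<bar>" "\<bar>w p\<bar>"] by (simp add: abs_mult mult.commute)
      qed
    qed measurable
    then show ?thesis unfolding u2_def using v_integrable by simp
  qed
  define dq where "dq r = (I r * h r) *\<^sub>R (V r + W r *\<^sub>R \<gamma> r)" for r
  have [measurable]: "dq \<in> borel_measurable borel" unfolding dq_def by measurable
  have al2: "along \<gamma> u2 r = V r + W r *\<^sub>R \<gamma> r" for r
    by (simp add: along_def u2_def V_def W_def scaleR_add_right)
  have dqi: "integrable lborel dq"
    using along_integrable[OF conc, of u2] u2i al2 by (simp add: dq_def[abs_def] I_def)
  have qdq: "q t - q s = (LINT r:{s..t}|lborel. dq r)" if "s \<le> t" for s t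
  proof -
    have i: "integrable P (\<lambda>p. indicat_real {s<..<t} (fst p) *\<^sub>R u2 p)"
      by (rule bounded_mult_integrable[where K = 1, OF _ _ u2i]) (auto simp: indicator_def)
    have "q t - q s = (\<integral>p. indicat_real {s<..<t} (fst p) *\<^sub>R u2 p \<partial>P)"
    proof (rule vec_eq_iff[THEN iffD2], rule allI)
      fix j
      have "(q t - q s) $ j = (\<integral>p. (indicat_real {s<..<t} (fst p) *\<^sub>R u2 p) $ j \<partial>P)"
        using qd[OF that, of j] by (simp add: u2_def)
      also have "\<dots> = (\<integral>p. indicat_real {s<..<t} (fst p) *\<^sub>R u2 p \<partial>P) $ j"
        by (rule integral_bounded_linear[OF bounded_linear_vec_nth i])
      finally show "(q t - q s) $ j = (\<integral>p. indicat_real {s<..<t} (fst p) *\<^sub>R u2 p \<partial>P) $ j" .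
    qed
    also have "\<dots> = (LINT r|lborel. (I r * h r) *\<^sub>R along \<gamma> (\<lambda>p. indicat_real {s<..<t} (fst p) *\<^sub>R u2 p) r)"
      unfolding I_def by (rule along_integral[OF conc]) measurable
    also have "\<dots> = (LINT r|lborel. indicator {s<..<t} r *\<^sub>R dq r)"
    proof (intro Bochner_Integration.integral_cong refl)
      fix r
      have "along \<gamma> (\<lambda>p. indicat_real {s<..<t} (fst p) *\<^sub>R u2 p) r = indicat_real {s<..<t} r *\<^sub>R along \<gamma> u2 r"
        by (simp add: along_def)
      then show "(I r * h r) *\<^sub>R along \<gamma> (\<lambda>p. indicat_real {s<..<t} (fst p) *\<^sub>R u2 p) r = indicator {s<..<t} r *\<^sub>R dq r"
        by (simp add: dq_def al2)
    qed
    finally show ?thesis unfolding set_integral_eq_open[OF dqi] .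
  qed
  \<comment> \<open>Its square integrability is that of v and w, transported to the curve. Its
    primitive serves as the modulus for every \<open>AC2\<close> claim.\<close>
  define b where "b t = I t * sqrt (h t) * (\<bar>W t\<bar> + norm (V t))" for t
  have bm [measurable]: "b \<in> borel_measurable borel" unfolding b_def by measurable
  have b0: "0 \<le> b t" for t using h0[of t] by (auto simp: b_def I_def indicator_def)
  have b2i: "integrable lborel (\<lambda>t. (b t)\<^sup>2)"
  proof (rule Bochner_Integration.integrable_bound)
    have "along \<gamma> (\<lambda>p. (w p)\<^sup>2) = (\<lambda>t. (W t)\<^sup>2)" by (auto simp: along_def W_def indicator_def)
    then have "integrable lborel (\<lambda>t. I t * h t * (W t)\<^sup>2)" using along_integrable[OF conc, of "\<lambda>p. (w p)\<^sup>2"] w2 by (simp add: I_def)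
    moreover have "along \<gamma> (\<lambda>p. (norm (v p))\<^sup>2) = (\<lambda>t. (norm (V t))\<^sup>2)" by (auto simp: along_def V_def indicator_def)
    then have "integrable lborel (\<lambda>t. I t * h t * (norm (V t))\<^sup>2)" using along_integrable[OF conc, of "\<lambda>p. (norm (v p))\<^sup>2"] v2 by (simp add: I_def)
    ultimately show "integrable lborel (\<lambda>t. 2 * (I t * h t * (W t)\<^sup>2) + 2 * (I t * h t * (norm (V t))\<^sup>2))" by simp
    show "AE t in lborel. norm ((b t)\<^sup>2) \<le> norm (2 * (I t * h t * (W t)\<^sup>2) + 2 * (I t * h t * (norm (V t))\<^sup>2))"
    proof (rule AE_I2)
      fix t
      have "(x + y)\<^sup>2 \<le> 2 * x\<^sup>2 + 2 * y\<^sup>2" for x y :: real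
        using zero_le_power2[of "x - y"] by (simp add: power2_eq_square algebra_simps)
      from this[of "\<bar>W t\<bar>" "norm (V t)"] have "(I t * h t) * (\<bar>W t\<bar> + norm (V t))\<^sup>2 \<le> (I t * h t) * (2 * (W t)\<^sup>2 + 2 * (norm (V t))\<^sup>2)"
        using Ih0[of t] by (intro mult_left_mono) auto
      moreover have "(b t)\<^sup>2 = (I t * h t) * (\<bar>W t\<bar> + norm (V t))\<^sup>2"
        using h0[of t] by (auto simp: b_def I_def indicator_def power_mult_distrib)
      ultimately have "(b t)\<^sup>2 \<le> 2 * (I t * h t * (W t)\<^sup>2) + 2 * (I t * h t * (norm (V t))\<^sup>2)" by (simp add: algebra_simps)
      then show "norm ((b t)\<^sup>2) \<le> norm (2 * (I t * h t * (W t)\<^sup>2) + 2 * (I t * h t * (norm (V t))\<^sup>2))"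
        unfolding real_norm_def abs_power2 by (rule order_trans[OF _ abs_ge_self])
    qed
  qed measurable
  have bi: "integrable lborel b"
  proof (rule Bochner_Integration.integrable_bound)
    show "integrable lborel (\<lambda>t. I t + (b t)\<^sup>2)" using b2i by (simp add: I_def integrable_real_indicator)
    show "AE t in lborel. norm (b t) \<le> norm (I t + (b t)\<^sup>2)"
    proof (rule AE_I2)
      fix t
      have "y \<le> 1 + y\<^sup>2" for y :: real using zero_le_power2[of "y - 1/2"] by (simp add: power2_eq_square algebra_simps)
      from this[of "b t"] show "norm (b t) \<le> norm (I t + (b t)\<^sup>2)" using b0[of t] by (cases "t \<in> {0<..<1}") (auto simp: b_def I_def)
    qed
  qed measurable
  define Bf where "Bf t = (LINT r|lborel. indicator {..t} r * b r)" for t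
  have Bf: "Bf t - Bf s = (LINT r:{s..t}|lborel. b r)" if "s \<le> t" for s t
    unfolding Bf_def by (rule primitive_diff[OF bi that])
  have Bf0: "0 \<le> Bf t - Bf s" if "s \<le> t" for s t
    unfolding Bf[OF that] set_lebesgue_integral_def using b0 by (intro integral_nonneg_AE) auto
  have setint: "set_integrable lborel {s..t} u" if "integrable lborel u" for s t and u :: "real \<Rightarrow> 'c::{banach, second_countable_topology}"
    using that unfolding set_integrable_def by (intro integrable_mult_indicator) auto
  have incr: "norm (LINT r:{s..t}|lborel. u r) \<le> m * (Bf t - Bf s)"
    if u: "integrable lborel u" "\<And>r. r \<in> {s..t} \<Longrightarrow> norm (u r) \<le> m * b r" and st: "s \<le> t"
    for u :: "real \<Rightarrow> 'c::{banach, second_countable_topology}" and m s t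
  proof -
    have "norm (LINT r:{s..t}|lborel. u r) \<le> (LINT r:{s..t}|lborel. norm (u r))"
      by (rule set_integral_norm_bound[OF setint[OF u(1)]])
    also have "\<dots> \<le> (LINT r:{s..t}|lborel. m * b r)"
      using setint[OF integrable_norm[OF u(1)]] setint[OF integrable_mult_right[OF bi]] u(2) by (intro set_integral_mono) auto
    also have "\<dots> = m * (Bf t - Bf s)" unfolding Bf[OF st] by simp
    finally show ?thesis .
  qed
  \<comment> \<open>Of the two factors sqrt h in h, one is bounded by m and the other is absorbed
    into b.\<close>
  have hW_le: "\<bar>I r * h r * W r\<bar> \<le> m * b r" if "r \<in> {0<..<1} \<Longrightarrow> sqrt (h r) \<le> m" for r m
  proof (cases "r \<in> {0<..<1}")
    case True
    then have hr: "0 \<le> h r" using h0[of r] by auto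
    have "\<bar>I r * h r * W r\<bar> = sqrt (h r) * (sqrt (h r) * \<bar>W r\<bar>)" using True hr by (simp add: I_def abs_mult flip: mult.assoc)
    also have "\<dots> \<le> m * (sqrt (h r) * (\<bar>W r\<bar> + norm (V r)))"
      using that[OF True] hr by (intro mult_mono mult_left_mono) (auto intro: order_trans[of 0 "sqrt (h r)"])
    finally show ?thesis using True by (simp add: b_def I_def)
  qed (simp add: I_def b_def)
  have dq_le: "norm (dq r) \<le> (1 + C) * m * b r" if m: "r \<in> {0<..<1} \<Longrightarrow> sqrt (h r) \<le> m" for r m
  proof (cases "r \<in> {0<..<1} \<and> h r > 0")
    case True
    then have hr: "0 < h r" and r: "r \<in> {0<..<1}" by auto
    have "norm (\<gamma> r) \<le> C" using qC[of r] r hr by (simp add: \<gamma>_def field_simps)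
    then have "norm (W r *\<^sub>R \<gamma> r) \<le> \<bar>W r\<bar> * C" by (simp add: mult_left_mono)
    then have "norm (V r + W r *\<^sub>R \<gamma> r) \<le> norm (V r) + \<bar>W r\<bar> * C" using norm_triangle_ineq[of "V r" "W r *\<^sub>R \<gamma> r"] by linarith
    also have "\<dots> \<le> (1 + C) * (\<bar>W r\<bar> + norm (V r))" using C by (simp add: algebra_simps)
    finally have n: "norm (V r + W r *\<^sub>R \<gamma> r) \<le> (1 + C) * (\<bar>W r\<bar> + norm (V r))" .
    have "norm (dq r) = sqrt (h r) * (sqrt (h r) * norm (V r + W r *\<^sub>R \<gamma> r))" using r hr by (simp add: dq_def I_def flip: mult.assoc)
    also have "\<dots> \<le> m * (sqrt (h r) * ((1 + C) * (\<bar>W r\<bar> + norm (V r))))"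
      using m[OF r] hr n by (intro mult_mono mult_left_mono) (auto intro: order_trans[of 0 "sqrt (h r)"])
    finally show ?thesis using r by (simp add: b_def I_def algebra_simps)
  next
    case False
    then have "r \<notin> {0<..<1} \<or> h r = 0" using h0[of r] by force
    then show ?thesis using False by (auto simp: dq_def b_def I_def)
  qed
  have h_incr: "\<bar>h t - h s\<bar> \<le> m * (Bf t - Bf s)" if "s \<le> t" "\<And>r. r \<in> {s..t} \<Longrightarrow> r \<in> {0<..<1} \<Longrightarrow> sqrt (h r) \<le> m" for s t m
    using incr[OF hWi, of s t m] hW_le that by (simp add: hdW[OF that(1)])
  have q_incr: "norm (q t - q s) \<le> (1 + C) * m * (Bf t - Bf s)" if "s \<le> t" "\<And>r. r \<in> {s..t} \<Longrightarrow> r \<in> {0<..<1} \<Longrightarrow> sqrt (h r) \<le> m" for s t m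
    unfolding qdq[OF that(1)] using dq_le that by (intro incr[OF dqi]) auto
  have AC2_from: "AC2 f" if "0 \<le> K" "\<And>s t. 0 \<le> s \<Longrightarrow> s \<le> t \<Longrightarrow> t \<le> 1 \<Longrightarrow> norm (f t - f s) \<le> K * (Bf t - Bf s)" for f :: "real \<Rightarrow> 'c::euclidean_space" and K
  proof (rule AC2_if_increments_le[where \<omega> = "\<lambda>t. K * b t"])
    show "integrable lborel (\<lambda>t. (K * b t)\<^sup>2)" using b2i by (simp add: power_mult_distrib)
    show "norm (f t - f s) \<le> (LINT r:{s..t}|lborel. K * b r)" if "0 \<le> s" "s \<le> t" "t \<le> 1" for s t
      using \<open>\<And>s t. 0 \<le> s \<Longrightarrow> s \<le> t \<Longrightarrow> t \<le> 1 \<Longrightarrow> norm (f t - f s) \<le> K * (Bf t - Bf s)\<close>[OF that] Bf[OF that(2)] by simp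
  qed (use bi b0 \<open>0 \<le> K\<close> in auto)
  have AC_h: "AC2 h"
  proof -
    have "continuous_on {0..1} (\<lambda>t. sqrt (h t))" by (intro continuous_intros continuous_on_subset[OF hc]) auto
    then have "bounded ((\<lambda>t. sqrt (h t)) ` {0..1})" by (intro compact_imp_bounded compact_continuous_image) auto
    then obtain M where "\<forall>x\<in>(\<lambda>t. sqrt (h t)) ` {0..1}. norm x \<le> M" by (auto simp: bounded_iff)
    then have M: "sqrt (h t) \<le> max 0 M" if "t \<in> {0..1}" for t using that by force
    show ?thesis
    proof (rule AC2_from[of "max 0 M"])
      fix s t :: real assume "0 \<le> s" "s \<le> t" "t \<le> 1"
      then show "norm (h t - h s) \<le> max 0 M * (Bf t - Bf s)" using M by (simp only: real_norm_def) (intro h_incr; force)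
    qed simp
  qed
  \<comment> \<open>The square root is not Lipschitz at 0, so it is regularised; the bounds below do
    not depend on k, which finally tends to 0.\<close>
  define f where "f k t = sqrt (h t + k)" for k t
  have fpos: "f k t > 0" "f k t * f k t = h t + k" if "k > 0" "t \<in> {0..1}" for k t
    using h0[OF that(2)] that(1) by (auto simp: f_def)
  \<comment> \<open>By continuity of h, near x the values of h + k agree up to the factor 4 and
    their roots up to the factor 2. The radius depends on k, but the bound that
    \<open>increment_le_if_local\<close> draws from it does not.\<close>
  have near: "\<exists>d>0. \<forall>s t. 0 \<le> s \<and> s \<le> x \<and> x \<le> t \<and> t \<le> 1 \<and> t - s < d \<longrightarrow> (\<forall>r\<in>{s..t}. f k r \<le> 2 * f k s \<and> f k r \<le> 2 * f k t)"
    if x: "x \<in> {0..1}" and k: "k > 0" for x k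
  proof -
    define A where "A = h x + k"
    have A: "A > 0" using h0[OF x] k by (simp add: A_def)
    have "continuous (at x) h" using hc by (simp add: continuous_on_eq_continuous_at)
    then obtain d where d: "d > 0" "\<And>r. \<bar>r - x\<bar> < d \<Longrightarrow> \<bar>h r - h x\<bar> < A / 2"
      using A unfolding continuous_at_eps_delta dist_real_def by (metis half_gt_zero)
    have cmp: "f k r \<le> 2 * f k r'" if "\<bar>r - x\<bar> < d" "\<bar>r' - x\<bar> < d" for r r'
    proof -
      have "h r + k \<le> 4 * (h r' + k)" using d(2)[OF that(1), unfolded abs_less_iff, THEN conjunct1] d(2)[OF that(2), unfolded abs_less_iff, THEN conjunct2] A unfolding A_def by (simp add: field_simps)
      then have "sqrt (h r + k) \<le> sqrt (4 * (h r' + k))" by (rule real_sqrt_le_mono)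
      then show ?thesis by (simp only: f_def real_sqrt_mult real_sqrt_four)
    qed
    show ?thesis
    proof (intro exI[of _ d] conjI allI impI ballI d(1))
      fix s t r assume st: "0 \<le> s \<and> s \<le> x \<and> x \<le> t \<and> t \<le> 1 \<and> t - s < d" and r: "r \<in> {s..t}"
      then have "\<bar>r - x\<bar> < d" "\<bar>s - x\<bar> < d" "\<bar>t - x\<bar> < d" by auto
      then show "f k r \<le> 2 * f k s" "f k r \<le> 2 * f k t" using cmp by blast+
    qed
  qed
  have sq_le: "sqrt (h r) \<le> f k r" if "k > 0" for r k using that by (simp add: f_def)
  have f_incr: "\<bar>f k t - f k s\<bar> \<le> 2 * Bf t - 2 * Bf s" if k: "k > 0" and st: "0 \<le> s" "s \<le> t" "t \<le> 1" for k s t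
  proof -
    have "norm (f k t - f k s) \<le> 2 * Bf t - 2 * Bf s"
    proof (rule increment_le_if_local[OF _ st])
      fix x :: real assume x: "x \<in> {0..1}"
      obtain d where d: "d > 0" "\<And>s t r. 0 \<le> s \<and> s \<le> x \<and> x \<le> t \<and> t \<le> 1 \<and> t - s < d \<Longrightarrow> r \<in> {s..t} \<Longrightarrow> f k r \<le> 2 * f k s"
        using near[OF x k] by blast
      show "\<exists>d>0. \<forall>s t. 0 \<le> s \<and> s \<le> x \<and> x \<le> t \<and> t \<le> 1 \<and> t - s < d \<longrightarrow> norm (f k t - f k s) \<le> 2 * Bf t - 2 * Bf s"
      proof (intro exI[of _ d] conjI allI impI d(1))
        fix s t assume st: "0 \<le> s \<and> s \<le> x \<and> x \<le> t \<and> t \<le> 1 \<and> t - s < d"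
        have "sqrt (h r) \<le> 2 * f k s" if "r \<in> {s..t}" for r using d(2)[OF st that] sq_le[OF k, of r] by linarith
        then have hi: "\<bar>h t - h s\<bar> \<le> 2 * f k s * (Bf t - Bf s)" using st by (intro h_incr) auto
        have fs: "f k s > 0" "f k t > 0" "f k s * f k s = h s + k" "f k t * f k t = h t + k" using fpos[OF k, of s] fpos[OF k, of t] st by auto
        \<comment> \<open>The difference of the roots times their sum is the difference of h, and
          the increment bound for h carries the same factor f k s, which cancels.\<close>
        have "\<bar>f k t - f k s\<bar> * f k s \<le> \<bar>f k t - f k s\<bar> * (f k t + f k s)" using fs by (intro mult_left_mono) auto
        also have "\<dots> = \<bar>(f k t - f k s) * (f k t + f k s)\<bar>" using fs by (simp add: abs_mult)
        also have "(f k t - f k s) * (f k t + f k s) = h t - h s" using fs(3,4) by (simp add: algebra_simps)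
        finally have "\<bar>f k t - f k s\<bar> * f k s \<le> \<bar>h t - h s\<bar>" .
        then have "\<bar>f k t - f k s\<bar> * f k s \<le> (2 * (Bf t - Bf s)) * f k s" using hi by (simp add: algebra_simps)
        then show "norm (f k t - f k s) \<le> 2 * Bf t - 2 * Bf s" using fs(1) by (simp add: mult_le_cancel_right)
      qed
    qed
    then show ?thesis by simp
  qed
  have flim: "((\<lambda>k. f k t) \<longlongrightarrow> sqrt (h t)) (at_right 0)" for t
  proof -
    have "((\<lambda>k. sqrt (h t + k)) \<longlongrightarrow> sqrt (h t + 0)) (at_right 0)" by (intro tendsto_intros)
    then show ?thesis by (simp add: f_def)
  qed
  have AC_sqrt: "AC2 (\<lambda>t. sqrt (h t))"
  proof (rule AC2_from[of 2])
    fix s t :: real assume st: "0 \<le> s" "s \<le> t" "t \<le> 1"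
    have "\<bar>sqrt (h t) - sqrt (h s)\<bar> \<le> 2 * Bf t - 2 * Bf s"
      by (rule tendsto_upperbound[OF tendsto_rabs[OF tendsto_diff[OF flim flim]] eventually_mono[OF eventually_at_right_less[of 0] f_incr[OF _ st]] trivial_limit_at_right_real])
    then show "norm (sqrt (h t) - sqrt (h s)) \<le> 2 * (Bf t - Bf s)" by simp
  qed simp
  define \<sigma> where "\<sigma> t = (if 0 < h t then sqrt (h t) *\<^sub>R \<gamma> t else 0)" for t
  \<comment> \<open>2 (1 + C) comes from the increment of q divided by the root, 4 C from the
    increment of the reciprocal root times q; these are \<open>t1\<close> and \<open>t2\<close>
    below.\<close>
  define K where "K = 2 * (1 + C) + 4 * C"
  have s_incr: "norm ((1 / f k t) *\<^sub>R q t - (1 / f k s) *\<^sub>R q s) \<le> K * Bf t - K * Bf s" if k: "k > 0" and st: "0 \<le> s" "s \<le> t" "t \<le> 1" for k s t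
  proof (rule increment_le_if_local[OF _ st])
    fix x :: real assume x: "x \<in> {0..1}"
    obtain d where d: "d > 0" "\<And>s t r. 0 \<le> s \<and> s \<le> x \<and> x \<le> t \<and> t \<le> 1 \<and> t - s < d \<Longrightarrow> r \<in> {s..t} \<Longrightarrow> f k r \<le> 2 * f k t"
      using near[OF x k] by blast
    show "\<exists>d>0. \<forall>s t. 0 \<le> s \<and> s \<le> x \<and> x \<le> t \<and> t \<le> 1 \<and> t - s < d \<longrightarrow> norm ((1 / f k t) *\<^sub>R q t - (1 / f k s) *\<^sub>R q s) \<le> K * Bf t - K * Bf s"
    proof (intro exI[of _ d] conjI allI impI d(1))
      fix s t assume st: "0 \<le> s \<and> s \<le> x \<and> x \<le> t \<and> t \<le> 1 \<and> t - s < d"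
      define D where "D = Bf t - Bf s"
      have D0: "D \<ge> 0" using Bf0[of s t] st by (simp add: D_def)
      have fs: "f k s > 0" "f k t > 0" "f k s * f k s = h s + k" using fpos[OF k, of s] fpos[OF k, of t] st by auto
      have "sqrt (h r) \<le> 2 * f k t" if "r \<in> {s..t}" for r using d(2)[OF st that] sq_le[OF k, of r] by linarith
      then have qi: "norm (q t - q s) \<le> (1 + C) * (2 * f k t) * D" unfolding D_def using st by (intro q_incr) auto
      have t1: "norm ((1 / f k t) *\<^sub>R (q t - q s)) \<le> 2 * (1 + C) * D"
      proof -
        have "norm ((1 / f k t) *\<^sub>R (q t - q s)) = norm (q t - q s) / f k t" using fs by simp
        also have "\<dots> \<le> ((1 + C) * (2 * f k t) * D) / f k t" using qi fs by (intro divide_right_mono) auto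
        also have "\<dots> = 2 * (1 + C) * D" using fs by simp
        finally show ?thesis .
      qed
      have t2: "norm ((1 / f k t - 1 / f k s) *\<^sub>R q s) \<le> 4 * C * D"
      proof -
        have e1: "norm (q s) \<le> C * (f k s * f k s)"
          using qC[of s] st C k mult_left_mono[of "h s" "h s + k" C] by (simp add: fs(3))
        have e2: "f k s \<le> 2 * f k t" using d(2)[OF st, of s] st by simp
        have e3: "\<bar>f k s - f k t\<bar> \<le> 2 * D" using f_incr[OF k, of s t] st by (simp add: D_def abs_minus_commute)
        have "1 / f k t - 1 / f k s = (f k s - f k t) / (f k t * f k s)" using fs by (simp add: field_simps)
        then have "norm ((1 / f k t - 1 / f k s) *\<^sub>R q s) = \<bar>f k s - f k t\<bar> * (norm (q s) / (f k t * f k s))" using fs by (simp add: abs_divide abs_mult)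
        also have "\<dots> \<le> (2 * D) * (2 * C)"
        proof (intro mult_mono e3)
          have "norm (q s) \<le> C * (f k s * (2 * f k t))"
            using e1 mult_left_mono[OF mult_left_mono[OF e2, of "f k s"], of C] fs C by simp
          then show "norm (q s) / (f k t * f k s) \<le> 2 * C" using fs by (simp add: divide_le_eq algebra_simps)
        qed (use D0 fs in auto)
        finally show ?thesis by (simp add: mult.commute mult.left_commute)
      qed
      have "(1 / f k t) *\<^sub>R q t - (1 / f k s) *\<^sub>R q s = (1 / f k t) *\<^sub>R (q t - q s) + (1 / f k t - 1 / f k s) *\<^sub>R q s"
        by (simp add: algebra_simps)
      then have "norm ((1 / f k t) *\<^sub>R q t - (1 / f k s) *\<^sub>R q s) \<le> 2 * (1 + C) * D + 4 * C * D"
        using norm_triangle_mono[OF t1 t2] by simp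
      then show "norm ((1 / f k t) *\<^sub>R q t - (1 / f k s) *\<^sub>R q s) \<le> K * Bf t - K * Bf s" by (simp add: K_def D_def algebra_simps)
    qed
  qed
  have slim: "((\<lambda>k. (1 / f k t) *\<^sub>R q t) \<longlongrightarrow> \<sigma> t) (at_right 0)" if t: "t \<in> {0..1}" for t
  proof (cases "0 < h t")
    case True
    have "((\<lambda>k. (1 / f k t) *\<^sub>R q t) \<longlongrightarrow> (1 / sqrt (h t)) *\<^sub>R q t) (at_right 0)"
      using True by (intro tendsto_intros flim) auto
    moreover have "\<sigma> t = (1 / sqrt (h t)) *\<^sub>R q t" using True by (simp add: \<sigma>_def \<gamma>_def real_sqrt_divide divide_inverse[symmetric] real_div_sqrt field_simps)
    ultimately show ?thesis by simp
  next
    case False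
    then have "h t = 0" using h0[OF t] by simp
    then have "q t = 0" using qC[OF t] by simp
    then show ?thesis using False by (simp add: \<sigma>_def)
  qed
  have AC_s: "AC2 \<sigma>"
  proof (rule AC2_from[of K])
    fix s t :: real assume st: "0 \<le> s" "s \<le> t" "t \<le> 1"
    have "norm (\<sigma> t - \<sigma> s) \<le> K * Bf t - K * Bf s"
      using st by (intro tendsto_upperbound[OF tendsto_norm[OF tendsto_diff[OF slim slim]] eventually_mono[OF eventually_at_right_less[of 0] s_incr[OF _ st]] trivial_limit_at_right_real]) auto
    then show "norm (\<sigma> t - \<sigma> s) \<le> K * (Bf t - Bf s)" by (simp add: right_diff_distrib)
  qed (use C in \<open>simp add: K_def\<close>)
  define S where "S = {t \<in> {0<..<1}. 0 < h t}"
  have So: "open S"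
  proof -
    have "S = {0<..<1} \<inter> {t. 0 < h t}" by (auto simp: S_def)
    then show ?thesis by (auto intro!: open_Collect_less hc)
  qed
  have Sm [measurable]: "S \<in> sets borel" using So by simp
  have \<gamma>c: "continuous_on {t. 0 < h t} \<gamma>" unfolding \<gamma>_def[abs_def]
    by (intro continuous_intros continuous_on_subset[OF hc] continuous_on_subset[OF qc]) auto
  have \<gamma>AE: "AE r in lborel. r \<in> S \<longrightarrow> \<gamma> r \<in> \<Omega>"
  proof -
    have [measurable]: "{t. \<gamma> t \<in> \<Omega>} \<in> sets borel" using measurable_sets[OF \<gamma>m, of \<Omega>] closed\<Omega> by (simp add: vimage_def)
    have dd: "distr P borel fst = density lborel (\<lambda>t. ennreal (indicator {0<..<1} t * h t))" using conc unfolding concentrated_def by (elim conjE)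
    have "AE p in P. snd p = \<gamma> (fst p)" using conc by (simp add: concentrated_def)
    then have "AE p in P. \<gamma> (fst p) \<in> \<Omega>" using AE_space by eventually_elim (auto simp: spaceP XO_def)
    then have "AE t in distr P borel fst. \<gamma> t \<in> \<Omega>" by (subst AE_distr_iff) auto
    then have "AE t in density lborel (\<lambda>t. ennreal (indicator {0<..<1} t * h t)). \<gamma> t \<in> \<Omega>" by (subst dd[symmetric])
    then show ?thesis by (subst (asm) AE_density) (auto elim!: eventually_mono simp: S_def)
  qed
  \<comment> \<open>From almost everywhere to everywhere: the times whose position lies outside the
    closed set \<Omega> form an open subset of {h > 0}. If it met [0,1], it would contain an
    interval of (0,1) of positive length, also near t = 0 or t = 1.\<close>
  have \<gamma>\<Omega>: "\<gamma> t \<in> \<Omega>" if t: "t \<in> {0..1}" "0 < h t" for t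
  proof (rule ccontr)
    assume n: "\<gamma> t \<notin> \<Omega>"
    have "open ({t. 0 < h t} \<inter> \<gamma> -` (- \<Omega>))"
      using closed\<Omega> by (intro continuous_open_preimage[OF \<gamma>c]) (auto intro!: open_Collect_less hc)
    then obtain d where d: "d > 0" "ball t d \<subseteq> {t. 0 < h t} \<inter> \<gamma> -` (- \<Omega>)" by (rule openE) (use n t in auto)
    have "{max 0 (t - d)<..<min 1 (t + d)} \<subseteq> ball t d" by (auto simp: dist_real_def)
    then have bad: "\<gamma> r \<notin> \<Omega> \<and> r \<in> S" if "r \<in> {max 0 (t - d)<..<min 1 (t + d)}" for r using d(2) that by (auto simp: S_def)
    have "AE r in lborel. r \<notin> {max 0 (t - d)<..<min 1 (t + d)}" using \<gamma>AE by eventually_elim (use bad in blast)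
    then show False using not_AE_interval d(1) t(1) by fastforce
  qed
  have LDh: "AE r in lborel. r \<in> {0<..<1} \<longrightarrow> (h has_real_derivative (I r * h r * W r)) (at r)"
    by (rule Lebesgue_differentiation_real[OF hWi]) (rule hdW)
  have LDq: "AE r in lborel. \<forall>i\<in>UNIV. r \<in> {0<..<1} \<longrightarrow> ((\<lambda>t. q t $ i) has_real_derivative dq r $ i) (at r)"
  proof (rule AE_finite_allI)
    fix i
    have di: "integrable lborel (\<lambda>r. dq r $ i)" by (rule integrable_bounded_linear[OF bounded_linear_vec_nth dqi])
    show "AE r in lborel. r \<in> {0<..<1} \<longrightarrow> ((\<lambda>t. q t $ i) has_real_derivative dq r $ i) (at r)"
    proof (rule Lebesgue_differentiation_real[OF di])
      fix s t :: real assume st: "s \<le> t"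
      have "(LINT r|lborel. (indicator {s..t} r *\<^sub>R dq r) $ i) = (LINT r|lborel. indicator {s..t} r *\<^sub>R dq r) $ i"
        by (rule integral_bounded_linear[OF bounded_linear_vec_nth]) (use indicator_integrable[OF dqi] in auto)
      then have "(LINT r:{s..t}|lborel. dq r $ i) = (LINT r:{s..t}|lborel. dq r) $ i" by (simp add: set_lebesgue_integral_def)
      then show "q t $ i - q s $ i = (LINT r:{s..t}|lborel. dq r $ i)" using qdq[OF st] by (metis vector_minus_component)
    qed
  qed simp
  \<comment> \<open>Quotient rule for \<gamma> = q / h; the terms with W cancel and leave V.\<close>
  have LD\<gamma>: "AE r in lborel. r \<in> S \<longrightarrow> (h has_real_derivative (h r * W r)) (at r) \<and> (\<gamma> has_vector_derivative V r) (at r)"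
    using LDh LDq
  proof eventually_elim
    case (elim r)
    show ?case
    proof
      assume r: "r \<in> S"
      then have r01: "r \<in> {0<..<1}" and hr: "0 < h r" by (auto simp: S_def)
      have dh: "(h has_real_derivative (h r * W r)) (at r)" using elim(1) r01 by (simp add: I_def)
      have dq': "(q has_vector_derivative dq r) (at r)" using elim(2) r01 by (intro has_vector_derivative_if_components) auto
      have "((\<lambda>t. 1 / h t) has_real_derivative (- (W r / h r))) (at r)"
        using dh hr by (auto intro!: derivative_eq_intros simp: field_simps power2_eq_square)
      from has_vector_derivative_scaleR[OF this dq']
      have "(\<gamma> has_vector_derivative ((1 / h r) *\<^sub>R dq r + (- (W r / h r)) *\<^sub>R q r)) (at r)" by (simp add: \<gamma>_def[abs_def])
      moreover have "(1 / h r) *\<^sub>R dq r + (- (W r / h r)) *\<^sub>R q r = V r"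
        using r01 hr by (simp add: dq_def I_def \<gamma>_def)
      ultimately show "(h has_real_derivative (h r * W r)) (at r) \<and> (\<gamma> has_vector_derivative V r) (at r)" using dh by simp
    qed
  qed
  have vdm: "(\<lambda>t. indicator S t *\<^sub>R vector_derivative \<gamma> (at t)) \<in> borel_measurable borel"
    by (rule borel_measurable_vector_derivative[OF So continuous_on_subset[OF \<gamma>c]]) (auto simp: S_def)
  then have vdm': "(\<lambda>t. indicator S t *\<^sub>R vector_derivative \<gamma> (at t)) \<in> borel_measurable lborel" by simp
  have vdhm: "(\<lambda>t. indicator S t *\<^sub>R deriv h t) \<in> borel_measurable borel"
    unfolding deriv_eq_vector_derivative by (rule borel_measurable_vector_derivative[OF So continuous_on_subset[OF hc]]) auto
  have Ih_S: "I t * h t = indicator S t * h t" for t using h0[of t] by (force simp: I_def S_def indicator_def)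
  have formulas: "wt (\<lambda>_. 1) A = (LINT t:S|lborel. h t * indicator A (t, \<gamma> t))"
    "wt v A = (LINT t:S|lborel. indicator A (t, \<gamma> t) *\<^sub>R (h t *\<^sub>R vector_derivative \<gamma> (at t)))"
    "wt w A = (LINT t:S|lborel. deriv h t * indicator A (t, \<gamma> t))" if "A \<in> borel_sub (XO \<Omega>)" for A
  proof -
    have A: "A \<in> sets P" using that by (simp add: setsP)
    then have [measurable]: "A \<in> sets borel" and Asub: "A \<subseteq> XO \<Omega>" by (auto simp: sets_P_iff)
    note [measurable] = A
    have [measurable]: "(\<lambda>t. indicat_real A (t, \<gamma> t)) \<in> borel_measurable borel"
      by (rule measurable_compose[of "\<lambda>t. (t, \<gamma> t)" borel borel]) measurable
    have al: "along \<gamma> (\<lambda>p. indicat_real A p *\<^sub>R u p) t = indicat_real A (t, \<gamma> t) *\<^sub>R along \<gamma> u t" for u :: "_ \<Rightarrow> 'c::{banach, second_countable_topology}" and t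
      by (simp add: along_def)
    have base: "wt u A = (LINT t|lborel. (indicator S t * h t) *\<^sub>R (indicat_real A (t, \<gamma> t) *\<^sub>R along \<gamma> u t))"
      if [measurable]: "u \<in> borel_measurable P" for u :: "_ \<Rightarrow> 'c::{banach, second_countable_topology}"
    proof -
      have "wt u A = (\<integral>p. indicat_real A p *\<^sub>R u p \<partial>P)" by (simp add: wt_eq[OF A] set_lebesgue_integral_def)
      also have "\<dots> = (LINT t|lborel. (I t * h t) *\<^sub>R (indicat_real A (t, \<gamma> t) *\<^sub>R along \<gamma> u t))"
        unfolding al[symmetric] I_def by (rule along_integral[OF conc]) measurable
      finally show ?thesis unfolding Ih_S .
    qed
    show "wt (\<lambda>_. 1) A = (LINT t:S|lborel. h t * indicator A (t, \<gamma> t))"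
      unfolding base[of "\<lambda>_. 1::real", simplified] set_lebesgue_integral_def
      by (intro Bochner_Integration.integral_cong) (use Asub in \<open>auto simp: along_def indicator_def\<close>)
    show "wt v A = (LINT t:S|lborel. indicator A (t, \<gamma> t) *\<^sub>R (h t *\<^sub>R vector_derivative \<gamma> (at t)))"
      unfolding base[OF v] set_lebesgue_integral_def V_def[symmetric]
    proof (rule integral_cong_AE)
      \<comment> \<open>Measurability of \<open>vector_derivative\<close> is known after
        multiplication with the indicator of S, so the factors are regrouped.\<close>
      have "(\<lambda>t. (indicator A (t, \<gamma> t) * h t) *\<^sub>R (indicator S t *\<^sub>R vector_derivative \<gamma> (at t))) \<in> borel_measurable lborel"
        by (rule borel_measurable_scaleR[OF _ vdm']) measurable
      then show "(\<lambda>t. indicat_real S t *\<^sub>R indicat_real A (t, \<gamma> t) *\<^sub>R h t *\<^sub>R vector_derivative \<gamma> (at t)) \<in> borel_measurable lborel"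
        by (simp add: mult.commute mult.left_commute)
      show "AE t in lborel. (indicat_real S t * h t) *\<^sub>R indicat_real A (t, \<gamma> t) *\<^sub>R V t = indicat_real S t *\<^sub>R indicat_real A (t, \<gamma> t) *\<^sub>R h t *\<^sub>R vector_derivative \<gamma> (at t)"
        using LD\<gamma>
      proof eventually_elim
        case (elim t)
        then show ?case by (cases "t \<in> S") (auto simp: vector_derivative_at mult.commute)
      qed
    qed measurable
    show "wt w A = (LINT t:S|lborel. deriv h t * indicator A (t, \<gamma> t))"
      unfolding base[OF w] set_lebesgue_integral_def W_def[symmetric]
    proof (rule integral_cong_AE)
      have "(\<lambda>t. (indicator S t *\<^sub>R deriv h t) * indicat_real A (t, \<gamma> t)) \<in> borel_measurable lborel" using vdhm by simp
      then show "(\<lambda>t. indicat_real S t *\<^sub>R (deriv h t * indicat_real A (t, \<gamma> t))) \<in> borel_measurable lborel" by (simp add: mult.assoc)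
      show "AE t in lborel. (indicat_real S t * h t) *\<^sub>R indicat_real A (t, \<gamma> t) *\<^sub>R W t = indicat_real S t *\<^sub>R (deriv h t * indicat_real A (t, \<gamma> t))"
        using LD\<gamma>
      proof eventually_elim
        case (elim t)
        then show ?case by (cases "t \<in> S") (auto simp: DERIV_imp_deriv)
      qed
    qed measurable
  qed
  have M: "(wt (\<lambda>_. 1), wt v, wt w) \<in> M\<Omega> \<Omega>" using triple_in_M[of "\<lambda>_. 1" 1] by (simp add: triple_def)
  have \<gamma>cc: "continuous_on {t \<in> {0..1}. 0 < h t} \<gamma>" by (rule continuous_on_subset[OF \<gamma>c]) auto
  have conn: "connected {t \<in> {0..1}. 0 < h t}" by (rule positivity_interval[OF inv const hc h0 hI])
  show ?thesis
    unfolding Cset_def mem_Collect_eq prod.case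
    by (intro conjI M exI[of _ h] exI[of _ \<gamma>] ballI h0 AC_h AC_sqrt \<gamma>cc AC_s[unfolded \<sigma>_def[abs_def]] conn J1 formulas[unfolded S_def])
       (auto intro: \<gamma>\<Omega>)
qed

end

section \<open>Curves carry only constant invariant weights\<close>

text \<open>Both functions are, almost everywhere, the derivative of the same primitive.\<close>

lemma AE_eq_if_interval_integrals_eq:
  fixes f g :: "real \<Rightarrow> real"
  assumes f: "integrable lborel f" and g: "integrable lborel g"
    and eq: "\<And>s t. a < s \<Longrightarrow> s \<le> t \<Longrightarrow> t < b \<Longrightarrow> (LINT r:{s..t}|lborel. f r) = (LINT r:{s..t}|lborel. g r)"
  shows "AE x in lborel. x \<in> {a<..<b} \<longrightarrow> f x = g x"
proof -
  define F where "F t = (LINT r|lborel. indicator {..t} r * f r)" for t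
  have F: "F t - F s = (LINT r:{s..t}|lborel. f r)" if "s \<le> t" for s t unfolding F_def by (rule primitive_diff[OF f that])
  have "AE x in lborel. x \<in> {a<..<b} \<longrightarrow> (F has_real_derivative f x) (at x)"
    by (rule Lebesgue_differentiation_real[OF f]) (rule F)
  moreover have "AE x in lborel. x \<in> {a<..<b} \<longrightarrow> (F has_real_derivative g x) (at x)"
    by (rule Lebesgue_differentiation_real[OF g]) (simp add: F eq)
  ultimately show ?thesis by eventually_elim (blast intro: DERIV_unique)
qed

context transport begin

text \<open>Uniqueness for u' = w u by contraction. D = U h(x) - U(x) h vanishes at x and has
  derivative w D. On an interval around x where h > m = h x / 2 and the P-integral of |w| from x is
  below m / 2, the maximum M of |D| satisfies M \<le> M / 2, hence is 0.\<close>

lemma ratio_locally_constant: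
  assumes inv: "invariant (\<lambda>_. 1)" and \<theta> [measurable]: "\<theta> \<in> borel_measurable P" and K: "\<And>p. \<bar>\<theta> p\<bar> \<le> 1"
    and Ud: "\<And>t. U t = cU + boundary_flux (\<lambda>p. \<theta> p * w p) t" and hd: "\<And>t. h t = c + boundary_flux w t"
    and eq: "AE p in P. U (fst p) = \<theta> p * h (fst p)" and x: "0 < h x"
  shows "\<exists>d>0. \<forall>t. \<bar>t - x\<bar> < d \<longrightarrow> 0 < h t \<and> U t / h t = U x / h x"
proof -
  have \<theta>wi: "integrable P (\<lambda>p. \<theta> p * w p)" using bounded_mult_integrable[OF \<theta> K w_integrable] by simp
  have awi: "integrable P (\<lambda>p. \<bar>w p\<bar>)" using w_integrable by simp
  have Uc: "continuous_on UNIV U" unfolding Ud using boundary_flux_continuous[OF inv \<theta>wi] by (intro continuous_intros)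
  have hc: "continuous_on UNIV h" unfolding hd using boundary_flux_continuous[OF inv w_integrable] by (intro continuous_intros)
  define G where "G = boundary_flux (\<lambda>p. \<bar>w p\<bar>)"
  have Gc: "continuous_on UNIV G" unfolding G_def by (rule boundary_flux_continuous[OF inv awi])
  define D where "D t = U t * h x - U x * h t" for t
  have Dc: "continuous_on A D" for A unfolding D_def by (intro continuous_intros continuous_on_subset[OF Uc] continuous_on_subset[OF hc]) auto
  define m where "m = h x / 2"
  have m: "0 < m" using x by (simp add: m_def)
  have "isCont h x" "isCont G x" using hc Gc by (auto simp: continuous_on_eq_continuous_at)
  obtain d1 where d1: "d1 > 0" "\<And>t. \<bar>t - x\<bar> < d1 \<Longrightarrow> \<bar>h t - h x\<bar> < m"
    using \<open>isCont h x\<close> m unfolding continuous_at_eps_delta dist_real_def by metis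
  obtain d2 where d2: "d2 > 0" "\<And>t. \<bar>t - x\<bar> < d2 \<Longrightarrow> \<bar>G t - G x\<bar> < m / 2"
    using \<open>isCont G x\<close> m unfolding continuous_at_eps_delta dist_real_def by (metis half_gt_zero)
  \<comment> \<open>Halving puts the closed interval of radius d inside both neighbourhoods; its
    compactness provides the maximum of |D|.\<close>
  define d where "d = min d1 d2 / 2"
  have d: "d > 0" using d1(1) d2(1) by (simp add: d_def)
  have close: "\<bar>t - x\<bar> < d1" "\<bar>t - x\<bar> < d2" if "t \<in> {x - d..x + d}" for t
    using that d1(1) d2(1) by (auto simp: d_def min_def abs_less_iff split: if_splits)
  have hm: "m < h t" if "t \<in> {x - d..x + d}" for t
    using d1(2)[OF close(1)[OF that]] unfolding m_def by linarith
  have "\<exists>t0\<in>{x - d..x + d}. \<forall>t\<in>{x - d..x + d}. \<bar>D t\<bar> \<le> \<bar>D t0\<bar>"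
    using d by (intro continuous_attains_sup continuous_intros Dc) auto
  then obtain t0 where t0: "t0 \<in> {x - d..x + d}" and max: "\<And>t. t \<in> {x - d..x + d} \<Longrightarrow> \<bar>D t\<bar> \<le> \<bar>D t0\<bar>" by blast
  define M where "M = \<bar>D t0\<bar>"
  have incr: "\<bar>D t - D s\<bar> \<le> M / m * (G t - G s)" if st: "s \<le> t" "s \<in> {x - d..x + d}" "t \<in> {x - d..x + d}" for s t
  proof -
    have i1: "integrable P (\<lambda>p. indicat_real {s<..<t} (fst p) * (\<theta> p * w p))" and i2: "integrable P (\<lambda>p. indicat_real {s<..<t} (fst p) * w p)"
      and i3: "integrable P (\<lambda>p. indicat_real {s<..<t} (fst p) * \<bar>w p\<bar>)"
      using \<theta>wi w_integrable awi by (auto intro!: indicator_mult_integrable)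
    have "D t - D s = h x * (\<integral>p. indicat_real {s<..<t} (fst p) * (\<theta> p * w p) \<partial>P) - U x * (\<integral>p. indicat_real {s<..<t} (fst p) * w p \<partial>P)"
      unfolding boundary_flux_diff[OF inv \<theta>wi st(1), symmetric] boundary_flux_diff[OF inv w_integrable st(1), symmetric]
      by (simp add: D_def Ud hd algebra_simps)
    also have "\<dots> = (\<integral>p. h x * (indicat_real {s<..<t} (fst p) * (\<theta> p * w p)) - U x * (indicat_real {s<..<t} (fst p) * w p) \<partial>P)"
      using i1 i2 by simp
    also have "\<bar>\<dots>\<bar> \<le> (\<integral>p. M / m * (indicat_real {s<..<t} (fst p) * \<bar>w p\<bar>) \<partial>P)"
    proof (rule order_trans[OF integral_abs_bound integral_mono_AE])
      show "AE p in P. \<bar>h x * (indicat_real {s<..<t} (fst p) * (\<theta> p * w p)) - U x * (indicat_real {s<..<t} (fst p) * w p)\<bar> \<le> M / m * (indicat_real {s<..<t} (fst p) * \<bar>w p\<bar>)"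
        using eq
      proof eventually_elim
        case (elim p)
        show ?case
        proof (cases "fst p \<in> {s<..<t}")
          case True
          then have N: "fst p \<in> {x - d..x + d}" using st by auto
          \<comment> \<open>On the curve U = \<theta> h, so the integrand equals D w / h and is at
            most M / m times |w|.\<close>
          have D: "D (fst p) = (\<theta> p * h x - U x) * h (fst p)" using elim by (simp add: D_def algebra_simps)
          have "\<bar>\<theta> p * h x - U x\<bar> * m \<le> \<bar>\<theta> p * h x - U x\<bar> * h (fst p)" using hm[OF N] by (intro mult_left_mono) auto
          also have "\<dots> = \<bar>D (fst p)\<bar>" unfolding D using hm[OF N] m by (simp add: abs_mult)
          also have "\<dots> \<le> M" unfolding M_def by (rule max[OF N])
          finally have "\<bar>\<theta> p * h x - U x\<bar> \<le> M / m" using m by (simp add: pos_le_divide_eq)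
          then have "\<bar>\<theta> p * h x - U x\<bar> * \<bar>w p\<bar> \<le> M / m * \<bar>w p\<bar>" by (rule mult_right_mono) simp
          moreover have "h x * (\<theta> p * w p) - U x * w p = (\<theta> p * h x - U x) * w p" by (simp add: algebra_simps)
          ultimately show ?thesis using True by (simp add: abs_mult)
        qed simp
      qed
    qed (use i1 i2 i3 in auto)
    also have "\<dots> = M / m * (G t - G s)" unfolding G_def boundary_flux_diff[OF inv awi st(1)] by simp
    finally show ?thesis .
  qed
  have xN: "x \<in> {x - d..x + d}" using d by simp
  have D0: "D x = 0" by (simp add: D_def)
  have "M \<le> M / m * \<bar>G t0 - G x\<bar>"
  proof (cases "x \<le> t0")
    case True
    have "0 \<le> M / m" using m by (simp add: M_def)
    then show ?thesis using incr[OF True xN t0] mult_left_mono[of "G t0 - G x" "\<bar>G t0 - G x\<bar>" "M / m"] unfolding D0 M_def by linarith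
  next
    case False
    have "0 \<le> M / m" using m by (simp add: M_def)
    then show ?thesis using incr[OF _ t0 xN] False mult_left_mono[of "G x - G t0" "\<bar>G t0 - G x\<bar>" "M / m"] unfolding D0 M_def by linarith
  qed
  also have "\<dots> \<le> M / m * (m / 2)" using d2(2)[OF close(2)[OF t0]] m by (intro mult_left_mono) (auto simp: M_def)
  also have "\<dots> = M / 2" using m by simp
  finally have M0: "M \<le> 0" by simp
  show ?thesis
  proof (intro exI[of _ d] conjI allI impI d)
    fix t assume "\<bar>t - x\<bar> < d"
    then have N: "t \<in> {x - d..x + d}" by (auto simp: abs_less_iff)
    then show ht: "0 < h t" using hm[OF N] m by simp
    have "D t = 0" using max[OF N] M0 unfolding M_def by simp
    then show "U t / h t = U x / h x" using ht x by (simp add: D_def field_simps)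
  qed
qed

text \<open>U is the continuous density in time of \<theta> P, so U / h is a continuous version of
  \<theta> along the curve. By \<open>ratio_locally_constant\<close> it is locally constant, hence
  constant on the connected set where h > 0.\<close>

lemma invariant_const_if_concentrated:
  assumes inv: "invariant (\<lambda>_. 1)" and hd: "\<And>t. h t = c + boundary_flux w t"
    and conc: "concentrated h \<gamma>" and conn: "connected {t \<in> {0<..<1}. 0 < h t}"
    and \<theta> [measurable]: "\<theta> \<in> borel_measurable P" and K: "\<And>p. \<bar>\<theta> p\<bar> \<le> 1" and inv\<theta>: "invariant \<theta>"
  shows "\<exists>k. AE p in P. \<theta> p = k"
proof -
  have hm [measurable]: "h \<in> borel_measurable borel" and \<gamma>m [measurable]: "\<gamma> \<in> borel_measurable borel"
    and h0: "\<And>t. t \<in> {0<..<1} \<Longrightarrow> 0 \<le> h t"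
    and dd: "distr P borel fst = density lborel (\<lambda>t. ennreal (indicator {0<..<1} t * h t))"
    using conc unfolding concentrated_def by (elim conjE; blast)+
  have \<theta>i: "integrable P \<theta>" by (rule bounded_integrable[OF \<theta> K])
  have \<theta>wi: "integrable P (\<lambda>p. \<theta> p * w p)" using bounded_mult_integrable[OF \<theta> K w_integrable] by simp
  have weak: "weak_derivative01 P fst \<theta> (\<lambda>p. \<theta> p * w p)"
    using weak_derivative_smooth[OF inv\<theta> smooth_const[of 1]] by (simp add: Lop_one)
  obtain cU where cU: "\<And>s t. 0 \<le> s \<Longrightarrow> s \<le> t \<Longrightarrow> t \<le> 1 \<Longrightarrow>
     (\<integral>p. indicator {s<..<t} (fst p) * \<theta> p \<partial>P) = (LINT r:{s..t}|lborel. cU + (\<integral>p. indicator {..<r} (fst p) * (\<theta> p * w p) \<partial>P))"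
    by (rule du_Bois_Reymond[OF fin \<theta>i \<theta>wi fst_measurable_P weak]) (rule that; assumption)
  define U where "U t = cU + boundary_flux (\<lambda>p. \<theta> p * w p) t" for t
  have Uc: "continuous_on UNIV U" unfolding U_def[abs_def] using boundary_flux_continuous[OF inv \<theta>wi] by (intro continuous_intros)
  have [measurable]: "U \<in> borel_measurable borel" using Uc by (rule borel_measurable_continuous_onI)
  define a where "a = along \<gamma> \<theta>"
  have [measurable]: "a \<in> borel_measurable borel" unfolding a_def by (rule along_measurable[OF conc \<theta>])
  define f where "f t = indicator {0<..<1} t * h t * a t" for t
  have fi: "integrable lborel f" using along_integrable[OF conc \<theta>] \<theta>i by (simp add: f_def[abs_def] a_def)
  have gi: "integrable lborel (\<lambda>t. indicator {0..1} t *\<^sub>R U t)"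
    using borel_integrable_compact[of "{0..1}" U] continuous_on_subset[OF Uc] by (simp add: set_integrable_def)
  have Ua: "AE t in lborel. t \<in> {0<..<1} \<longrightarrow> f t = indicator {0..1} t *\<^sub>R U t"
  proof (rule AE_eq_if_interval_integrals_eq[OF fi gi])
    fix s t :: real assume st: "0 < s" "s \<le> t" "t < 1"
    have "along \<gamma> (\<lambda>p. indicator {s<..<t} (fst p) * \<theta> p) = (\<lambda>r. indicator {s<..<t} r * a r)"
      by (auto simp: along_def a_def)
    then have "(\<integral>p. indicator {s<..<t} (fst p) * \<theta> p \<partial>P) = (LINT r|lborel. (indicat_real {0<..<1} r * h r) *\<^sub>R (indicator {s<..<t} r * a r))"
      using along_integral[OF conc, of "\<lambda>p. indicator {s<..<t} (fst p) * \<theta> p"] by simp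
    also have "\<dots> = (LINT r:{s..t}|lborel. f r)"
      unfolding set_integral_eq_open[OF fi] by (intro Bochner_Integration.integral_cong) (auto simp: f_def)
    finally have "(LINT r:{s..t}|lborel. f r) = (LINT r:{s..t}|lborel. U r)"
      using cU[of s t] st by (simp add: U_def boundary_flux_def)
    also have "\<dots> = (LINT r:{s..t}|lborel. indicator {0..1} r *\<^sub>R U r)"
      unfolding set_lebesgue_integral_def using st by (intro Bochner_Integration.integral_cong) (auto simp: indicator_def)
    finally show "(LINT r:{s..t}|lborel. f r) = (LINT r:{s..t}|lborel. indicator {0..1} r *\<^sub>R U r)" .
  qed
  \<comment> \<open>Statements at almost every time transfer to P through the density h, which also
    discards the times with h = 0.\<close>
  have push: "AE p in P. 0 < h (fst p) \<and> U (fst p) = h (fst p) * a (fst p)"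
  proof -
    have "AE t in density lborel (\<lambda>t. ennreal (indicator {0<..<1} t * h t)). 0 < h t \<and> U t = h t * a t"
      by (subst AE_density, measurable, use Ua in eventually_elim) (auto simp: f_def indicator_def split: if_splits)
    then have "AE t in distr P borel fst. 0 < h t \<and> U t = h t * a t" by (subst dd)
    then show ?thesis by (subst (asm) AE_distr_iff) measurable
  qed
  have eq: "AE p in P. U (fst p) = \<theta> p * h (fst p)"
    using push along_AE[OF conc \<theta>] by eventually_elim (simp add: a_def)
  have "(\<lambda>t. U t / h t) constant_on {t \<in> {0<..<1}. 0 < h t}"
  proof (rule locally_constant_imp_constant[OF conn])
    fix x assume x: "x \<in> {t \<in> {0<..<1}. 0 < h t}"
    then obtain d where d: "d > 0" "\<And>t. \<bar>t - x\<bar> < d \<Longrightarrow> 0 < h t \<and> U t / h t = U x / h x"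
      using ratio_locally_constant[OF inv \<theta> K U_def hd eq, of x] by blast
    show "\<exists>T. openin (top_of_set {t \<in> {0<..<1}. 0 < h t}) T \<and> x \<in> T \<and> (\<forall>t\<in>T. U t / h t = U x / h x)"
    proof (intro exI conjI ballI)
      show "openin (top_of_set {t \<in> {0<..<1}. 0 < h t}) ({t \<in> {0<..<1}. 0 < h t} \<inter> ball x d)" by (rule openin_open_Int) simp
      show "x \<in> {t \<in> {0<..<1}. 0 < h t} \<inter> ball x d" using x d(1) by simp
      fix t assume "t \<in> {t \<in> {0<..<1}. 0 < h t} \<inter> ball x d"
      then have "\<bar>t - x\<bar> < d" by (simp add: dist_real_def abs_minus_commute)
      from d(2)[OF this] show "U t / h t = U x / h x" by (rule conjunct2)
    qed
  qed
  then obtain k where k: "\<And>t. t \<in> {0<..<1} \<Longrightarrow> 0 < h t \<Longrightarrow> U t / h t = k" by (auto simp: constant_on_def)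
  have "AE p in P. \<theta> p = k"
    using push eq AE_space
  proof eventually_elim
    case (elim p)
    then have "fst p \<in> {0<..<1}" by (auto simp: spaceP XO_def)
    from k[OF this] elim show ?case by (auto simp: field_simps)
  qed
  then show ?thesis ..
qed

end

lemma continuous_on_if_abs_cont01:
  assumes "abs_cont01 f" shows "continuous_on {0..1} f"
  unfolding continuous_on_iff
proof (intro ballI allI impI)
  fix x e :: real assume x: "x \<in> {0..1}" and e: "e > 0"
  obtain d where d: "d > 0" and D: "\<forall>(n::nat) (a::nat \<Rightarrow> real) b. (\<forall>k<n. 0 \<le> a k \<and> a k \<le> b k \<and> b k \<le> 1) \<and>
        (\<forall>k<n. \<forall>j<n. k \<noteq> j \<longrightarrow> b k \<le> a j \<or> b j \<le> a k) \<and> (\<Sum>k<n. b k - a k) < d \<longrightarrow> (\<Sum>k<n. norm (f (b k) - f (a k))) < e"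
    using assms[unfolded abs_cont01_def, THEN spec, THEN mp, OF e] by (elim exE conjE) (rule that)
  have incr: "norm (f t - f s) < e" if "0 \<le> s" "s \<le> t" "t \<le> 1" "t - s < d" for s t
    using D[THEN spec[of _ 1], THEN spec[of _ "\<lambda>_. s"], THEN spec[of _ "\<lambda>_. t"]] that by simp
  show "\<exists>d>0. \<forall>y\<in>{0..1}. dist y x < d \<longrightarrow> dist (f y) (f x) < e"
  proof (intro exI[of _ d] conjI ballI impI d)
    fix y :: real assume y: "y \<in> {0..1}" "dist y x < d"
    show "dist (f y) (f x) < e"
      using incr[of x y] incr[of y x] x y by (cases "x \<le> y") (auto simp: dist_norm norm_minus_commute abs_less_iff)
  qed
qed

context transport begin

text \<open>The h given by \<open>Cset\<close> and the density H from \<open>time_density\<close>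
  have equal integrals over all intervals and are both continuous, hence coincide on [0,1]. This
  identifies h with the flux of w, the form in which \<open>invariant_const_if_concentrated\<close>
  takes it.\<close>

lemma invariant_const_if_Cset:
  assumes C: "triple (\<lambda>_. 1) \<in> Cset \<alpha> \<beta> \<delta> \<Omega>" and inv: "invariant (\<lambda>_. 1)"
    and \<theta>: "\<theta> \<in> borel_measurable P" and K: "\<And>p. \<bar>\<theta> p\<bar> \<le> 1" and inv\<theta>: "invariant \<theta>"
  shows "\<exists>k. AE p in P. \<theta> p = k"
proof -
  obtain h :: "real \<Rightarrow> real" and \<gamma> :: "real \<Rightarrow> real ^ 'd" where h0: "\<And>t. t \<in> {0..1} \<Longrightarrow> 0 \<le> h t" and AC: "AC2 h"
    and \<gamma>c: "continuous_on {t\<in>{0..1}. 0 < h t} \<gamma>" and \<gamma>\<Omega>: "\<gamma> ` {t\<in>{0..1}. 0 < h t} \<subseteq> \<Omega>"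
    and conn: "connected {t\<in>{0..1}. 0 < h t}"
    and \<rho>: "\<And>A. A \<in> borel_sub (XO \<Omega>) \<Longrightarrow> wt (\<lambda>_. 1) A = (LINT t:{t\<in>{0<..<1}. 0 < h t}|lborel. h t * indicator A (t, \<gamma> t))"
    using C unfolding Cset_def triple_def mem_Collect_eq prod.case by (elim conjE exE) (rule that; (assumption | erule (1) bspec | (drule (1) bspec, elim conjE, assumption)))
  have hc: "continuous_on {0..1} h" using AC continuous_on_if_abs_cont01 by (auto simp: AC2_def)
  define S where "S = {t\<in>{0<..<1}. 0 < h t}"
  have So: "open S"
  proof -
    have "open ({0<..<1} \<inter> h -` {0<..})"
      by (rule continuous_open_preimage[OF continuous_on_subset[OF hc]]) auto
    moreover have "S = {0<..<1} \<inter> h -` {0<..}" by (auto simp: S_def)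
    ultimately show ?thesis by simp
  qed
  have [measurable]: "S \<in> sets borel" using So by simp
  \<comment> \<open>\<gamma> is arbitrary off {h > 0}; cutting it to S makes it Borel.\<close>
  define \<gamma>' where "\<gamma>' t = indicator S t *\<^sub>R \<gamma> t" for t
  have [measurable]: "\<gamma>' \<in> borel_measurable borel" unfolding \<gamma>'_def
    by (rule borel_measurable_continuous_on_indicator[OF _ continuous_on_subset[OF \<gamma>c]], use So in simp) (auto simp: S_def)
  have meas: "measure P A = (LINT t:S|lborel. h t * indicator A (t, \<gamma> t))" if "A \<in> sets P" for A
    using \<rho>[of A] that by (simp add: wt_eq setsP S_def set_lebesgue_integral_def)
  have onc: "AE p in P. snd p = \<gamma>' (fst p)"
  proof -
    \<comment> \<open>The points off the graph have measure 0 by the formula for \<rho>, whose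
      integrand only sees points on the graph.\<close>
    define A where "A = {p \<in> space P. snd p \<noteq> \<gamma>' (fst p)}"
    have A [measurable]: "A \<in> sets P" unfolding A_def by measurable
    have "measure P A = (LINT (r::real)|lborel. 0)" unfolding meas[OF A] set_lebesgue_integral_def
      by (intro Bochner_Integration.integral_cong) (auto simp: A_def \<gamma>'_def indicator_def)
    then have "measure P A = 0" by simp
    then have "A \<in> null_sets P" by (simp add: null_sets_def emeasure_eq_measure)
    from AE_not_in[OF this] AE_space show ?thesis by eventually_elim (auto simp: A_def)
  qed
  obtain c where c0: "\<And>t. t \<in> {0..1} \<Longrightarrow> 0 \<le> c + boundary_flux w t"
    and cI: "\<And>s t. 0 \<le> s \<Longrightarrow> s \<le> t \<Longrightarrow> t \<le> 1 \<Longrightarrow> (\<integral>p. indicator {s<..<t} (fst p) \<partial>P) = (LINT r:{s..t}|lborel. c + boundary_flux w r)"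
    and dd: "distr P borel fst = density lborel (\<lambda>t. ennreal (indicator {0<..<1} t * (c + boundary_flux w t)))"
    by (rule time_density[OF inv]) (rule that; assumption)
  define H where "H t = c + boundary_flux w t" for t
  have Hc: "continuous_on A H" for A unfolding H_def
    by (intro continuous_intros continuous_on_subset[OF boundary_flux_continuous[OF inv w_integrable]]) auto
  have hI: "(LINT r:{s..t}|lborel. h r) = (LINT r:{s..t}|lborel. H r)" if st: "0 \<le> s" "s \<le> t" "t \<le> 1" for s t
  proof -
    define A where "A = {p \<in> space P. fst p \<in> {s<..<t}}"
    have A [measurable]: "A \<in> sets P" unfolding A_def by measurable
    have "(\<integral>p. indicator {s<..<t} (fst p) \<partial>P) = (\<integral>p. indicat_real A p \<partial>P)"
      by (intro Bochner_Integration.integral_cong) (auto simp: A_def indicator_def)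
    also have "\<dots> = measure P A" by simp
    also have "\<dots> = (LINT r|lborel. indicat_real S r *\<^sub>R (h r * indicator A (r, \<gamma> r)))" unfolding meas[OF A] set_lebesgue_integral_def ..
    also have "\<dots> = (LINT r|lborel. indicator {s<..<t} r *\<^sub>R (indicator {0..1} r *\<^sub>R h r))"
    proof (intro Bochner_Integration.integral_cong refl)
      fix r
      have "(r, \<gamma> r) \<in> A \<longleftrightarrow> r \<in> {s<..<t}" if "r \<in> S"
        using that \<gamma>\<Omega> by (auto simp: A_def S_def spaceP XO_def)
      moreover have "h r = 0" if "r \<notin> S" "r \<in> {s<..<t}" using that st h0[of r] by (force simp: S_def)
      moreover have "r \<in> {0..1}" if "r \<in> {s<..<t}" using that st by auto
      ultimately show "indicat_real S r *\<^sub>R (h r * indicator A (r, \<gamma> r)) = indicator {s<..<t} r *\<^sub>R (indicator {0..1} r *\<^sub>R h r)"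
        by (cases "r \<in> S"; cases "r \<in> {s<..<t}") (simp_all add: indicator_def)
    qed
    also have "\<dots> = (LINT r:{s..t}|lborel. indicator {0..1} r *\<^sub>R h r)"
      by (rule set_integral_eq_open[symmetric]) (use borel_integrable_compact[of "{0..1}" h] hc in \<open>simp add: set_integrable_def\<close>)
    also have "\<dots> = (LINT r:{s..t}|lborel. h r)"
      unfolding set_lebesgue_integral_def using st by (intro Bochner_Integration.integral_cong) (auto simp: indicator_def)
    finally show ?thesis using cI[OF st] by (simp add: H_def)
  qed
  have si: "set_integrable lborel {s..t} h" "set_integrable lborel {s..t} H" if "0 \<le> s" "t \<le> 1" for s t
    using borel_integrable_compact[of "{s..t}" h] borel_integrable_compact[of "{s..t}" H] Hc continuous_on_subset[OF hc, of "{s..t}"] that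
    by (auto simp: set_integrable_def)
  have z: "(LINT r:{s..t}|lborel. h r - H r) = 0" "(LINT r:{s..t}|lborel. H r - h r) = 0" if "0 \<le> s" "s \<le> t" "t \<le> 1" for s t
    using set_integral_diff(2)[OF si(1)[OF that(1,3)] si(2)[OF that(1,3)]] set_integral_diff(2)[OF si(2)[OF that(1,3)] si(1)[OF that(1,3)]] hI[OF that] by simp_all
  have hH: "h t = H t" if t: "t \<in> {0..1}" for t
  proof -
    have "0 \<le> h t - H t"
      by (rule nonneg_if_interval_integrals_nonneg[of 0 1 "\<lambda>t. h t - H t"]) (use z t in \<open>auto intro!: continuous_intros hc Hc\<close>)
    moreover have "0 \<le> H t - h t"
      by (rule nonneg_if_interval_integrals_nonneg[of 0 1 "\<lambda>t. H t - h t"]) (use z t in \<open>auto intro!: continuous_intros hc Hc\<close>)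
    ultimately show ?thesis by simp
  qed
  have Hm: "H \<in> borel_measurable borel" using Hc by (rule borel_measurable_continuous_onI)
  have conc: "concentrated H \<gamma>'" unfolding concentrated_def
    by (intro conjI Hm onc dd[folded H_def] ballI c0[folded H_def]) auto
  \<comment> \<open>\<open>Cset\<close> speaks of times in [0,1], the concentration statement of
    times in (0,1); intersecting keeps an interval an interval.\<close>
  have "{t \<in> {0<..<1}. 0 < H t} = {0<..<1} \<inter> {t\<in>{0..1}. 0 < h t}" using hH by auto
  moreover have "is_interval ({0<..<1} \<inter> {t\<in>{0..1}. 0 < h t})"
    using conn by (intro is_interval_Int) (auto simp: is_interval_connected_1 is_interval_oo)
  ultimately have "connected {t \<in> {0<..<1}. 0 < H t}" by (simp add: is_interval_connected_1)
  from invariant_const_if_concentrated[OF inv H_def conc this \<theta> K inv\<theta>] show ?thesis .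
qed

end

section \<open>The extremal points\<close>

lemma comb3_swap: "comb3 s y z = comb3 (1 - s) z y"
  by (auto simp: comb3_def add.commute split: prod.splits)

context transport begin

lemma invariant_scale: "invariant \<theta> \<Longrightarrow> invariant (\<lambda>p. c * \<theta> p)"
  by (simp add: invariant_def mult.assoc)

lemma triple_zero: "triple (\<lambda>_. 0) = (\<lambda>A. 0, \<lambda>A. 0, \<lambda>A. 0)"
  by (auto simp: triple_def wt_def set_lebesgue_integral_def)

lemma AE_False_if_null: "measure P (XO \<Omega>) = 0 \<Longrightarrow> AE p in P. False"
proof -
  assume "measure P (XO \<Omega>) = 0"
  then have "space P \<in> null_sets P" by (intro null_setsI) (simp_all add: emeasure_eq_measure flip: spaceP)
  from AE_not_in[OF this] AE_space show ?thesis by eventually_elim simp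
qed

lemma triple_if_null: "measure P (XO \<Omega>) = 0 \<Longrightarrow> triple (\<lambda>_. 1) = (\<lambda>A. 0, \<lambda>A. 0, \<lambda>A. 0)"
  unfolding triple_zero[symmetric] by (rule triple_eq_AE[OF eventually_mono[OF AE_False_if_null]]) auto

lemma wt_one_XO: "wt (\<lambda>_. 1 :: real) (XO \<Omega>) = measure P (XO \<Omega>)"
proof -
  have "XO \<Omega> \<in> sets P" using sets.top[of P] by (simp add: spaceP)
  then show ?thesis by (simp add: wt_eq set_lebesgue_integral_def)
qed

lemma zero_in_Bset: "\<alpha> > 0 \<Longrightarrow> \<beta> > 0 \<Longrightarrow> (\<lambda>A. 0, \<lambda>A. 0, \<lambda>A. 0) \<in> Bset \<alpha> \<beta> \<delta> \<Omega>"
  unfolding triple_zero[symmetric] by (rule triple_in_Bset[where K = 0]) (auto simp: invariant_def)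

lemma not_null_if_cost_pos: "(\<integral>p. \<beta> * energy \<delta> p + \<alpha> \<partial>P) \<noteq> 0 \<Longrightarrow> \<not> (AE p in P. False)"
proof
  assume "(\<integral>p. \<beta> * energy \<delta> p + \<alpha> \<partial>P) \<noteq> 0" and F: "AE p in P. False"
  moreover have "(\<integral>p. \<beta> * energy \<delta> p + \<alpha> \<partial>P) = 0"
    by (rule integral_eq_zero_AE) (rule eventually_mono[OF F], simp)
  ultimately show False by simp
qed

text \<open>By \<open>component_is_multiple\<close> the component is a weight times the given
  triple. The weight is invariant because the component solves the equation, hence constant. By
  homogeneity the cost of the component is that constant, so J \<le> 1 limits it to 1.\<close>

lemma component_is_constant_multiple:
  assumes Y: "transport \<Omega> Q u r" and Z: "transport \<Omega> Q' u' r'" and s: "0 < s" "s < 1" and pos: "\<alpha> > 0" "\<beta> > 0" "\<delta> > 0"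
    and eq: "triple (\<lambda>_. 1) = comb3 s (transport.triple \<Omega> Q u r (\<lambda>_. 1)) (transport.triple \<Omega> Q' u' r' (\<lambda>_. 1))"
    and JY: "(\<integral>p. \<beta> * transport.energy u r \<delta> p + \<alpha> \<partial>Q) \<le> 1" and JZ: "(\<integral>p. \<beta> * transport.energy u' r' \<delta> p + \<alpha> \<partial>Q') \<le> 1"
    and JX: "(\<integral>p. \<beta> * energy \<delta> p + \<alpha> \<partial>P) = 1"
    and inv: "invariant (\<lambda>_. 1)" and invY: "transport.invariant Q u r (\<lambda>_. 1)"
    and const: "\<And>\<theta>. \<theta> \<in> borel_measurable P \<Longrightarrow> (\<And>p. \<bar>\<theta> p\<bar> \<le> 1) \<Longrightarrow> invariant \<theta> \<Longrightarrow> \<exists>c. AE p in P. \<theta> p = c"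
  shows "\<exists>c\<le>1. transport.triple \<Omega> Q u r (\<lambda>_. 1) = triple (\<lambda>_. c)"
proof -
  interpret Y: transport \<Omega> Q u r by fact
  obtain \<theta> where \<theta> [measurable]: "\<theta> \<in> borel_measurable P" and \<theta>0: "\<And>p. 0 \<le> \<theta> p" and \<theta>1: "\<And>p. \<theta> p \<le> 1 / (1 - s)"
    and Y\<theta>: "Y.triple (\<lambda>_. 1) = triple \<theta>"
    using component_is_multiple[OF Y Z s pos eq JY JZ JX] by blast
  have \<theta>b: "\<bar>\<theta> p\<bar> \<le> 1 / (1 - s)" for p using \<theta>0[of p] \<theta>1[of p] by simp
  \<comment> \<open>The factors 1 are kept so that the terms match \<open>cont_eq_wt_iff\<close> and
    \<open>J_wt\<close> at the weight 1.\<close>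
  have comps: "wt \<theta> = Y.wt (\<lambda>_. 1)" "wt (\<lambda>p. \<theta> p *\<^sub>R v p) = Y.wt (\<lambda>p. 1 *\<^sub>R u p)" "wt (\<lambda>p. \<theta> p * w p) = Y.wt (\<lambda>p. 1 * r p)"
    using Y\<theta> unfolding Y.triple_def triple_def by simp_all
  have inv\<theta>: "invariant \<theta>"
    unfolding cont_eq_wt_iff[OF \<theta> \<theta>b, symmetric] comps
    using Y.cont_eq_wt_iff[of "\<lambda>_. 1" 1] invY by simp
  \<comment> \<open>The bound 1 / (1 - s) on \<theta> is scaled to 1, as \<open>const\<close>
    requires.\<close>
  have "\<exists>c. AE p in P. (1 - s) * \<theta> p = c"
  proof (rule const)
    show "\<bar>(1 - s) * \<theta> p\<bar> \<le> 1" for p using mult_left_mono[OF \<theta>1[of p], of "1 - s"] \<theta>0[of p] s by (simp add: abs_mult)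
  qed (use invariant_scale[OF inv\<theta>] in auto)
  then obtain c where c: "AE p in P. (1 - s) * \<theta> p = c" ..
  define k where "k = c / (1 - s)"
  have k: "AE p in P. \<theta> p = k" using c by eventually_elim (use s in \<open>auto simp: k_def field_simps\<close>)
  have Yk: "Y.triple (\<lambda>_. 1) = triple (\<lambda>_. k)" unfolding Y\<theta> by (rule triple_eq_AE[OF k]) auto
  \<comment> \<open>A negative constant contradicts \<theta> \<ge> 0 unless almost every statement
    holds, that is, unless P is null; the cost 1 excludes this.\<close>
  have k0: "0 \<le> k"
  proof (rule ccontr)
    assume "\<not> 0 \<le> k"
    from k have "AE p in P. False" by eventually_elim (use \<theta>0 \<open>\<not> 0 \<le> k\<close> in metis)
    then show False using not_null_if_cost_pos[of \<beta> \<delta> \<alpha>] JX by simp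
  qed
  have "invariant (\<lambda>_. k)" using invariant_scale[OF inv, of k] by simp
  then have "J \<alpha> \<beta> \<delta> \<Omega> (wt (\<lambda>_. k)) (wt (\<lambda>p. k *\<^sub>R v p)) (wt (\<lambda>p. k * w p)) = ennreal (\<integral>p. k * (\<beta> * energy \<delta> p + \<alpha>) \<partial>P)"
    by (intro J_wt[where K = k]) (use k0 pos in auto)
  also have "(\<integral>p. k * (\<beta> * energy \<delta> p + \<alpha>) \<partial>P) = k * (\<integral>p. \<beta> * energy \<delta> p + \<alpha> \<partial>P)" by (rule integral_mult_right_zero)
  finally have Jk: "J \<alpha> \<beta> \<delta> \<Omega> (wt (\<lambda>_. k)) (wt (\<lambda>p. k *\<^sub>R v p)) (wt (\<lambda>p. k * w p)) = ennreal k" using JX by simp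
  have "J \<alpha> \<beta> \<delta> \<Omega> (Y.wt (\<lambda>_. 1)) (Y.wt (\<lambda>p. 1 *\<^sub>R u p)) (Y.wt (\<lambda>p. 1 * r p)) = ennreal (\<integral>p. 1 * (\<beta> * Y.energy \<delta> p + \<alpha>) \<partial>Q)"
    by (rule Y.J_wt[where K = 1]) (use invY pos in auto)
  moreover have "Y.wt (\<lambda>_. 1) = wt (\<lambda>_. k)" "Y.wt (\<lambda>p. 1 *\<^sub>R u p) = wt (\<lambda>p. k *\<^sub>R v p)" "Y.wt (\<lambda>p. 1 * r p) = wt (\<lambda>p. k * w p)"
    using Yk unfolding Y.triple_def triple_def by simp_all
  ultimately have "ennreal k = ennreal (\<integral>p. \<beta> * Y.energy \<delta> p + \<alpha> \<partial>Q)" using Jk by simp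
  also have "\<dots> \<le> 1" using JY by simp
  finally have "k \<le> 1" by simp
  then show ?thesis using Yk by blast
qed

end

text \<open>Triples in \<open>Bset\<close> have nonnegative \<rho>. If a strict convex combination
  has mass 0, then so do both components, and their m and \<mu> vanish with \<rho>.\<close>

lemma extremal_zero:
  fixes \<Omega> :: "(real ^ 'd::finite) set"
  assumes \<Omega>: "closed \<Omega>" "bounded \<Omega>" and pos: "\<alpha> > 0" "\<beta> > 0" "\<delta> > 0"
  shows "(\<lambda>A. 0, \<lambda>A. 0, \<lambda>A. 0) \<in> extremal_points (Bset \<alpha> \<beta> \<delta> \<Omega>)"
  unfolding extremal_points_def
proof (intro CollectI conjI ballI impI)
  \<comment> \<open>A null measure with velocity and rate 0 instantiates the locale, in which 0 is
    the triple with weight 0.\<close>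
  define P where "P = null_measure (restrict_space borel (XO \<Omega>))"
  have XO: "XO \<Omega> \<in> sets borel" unfolding XO_def using \<Omega>(1)
    by (subst borel_prod[symmetric]) (intro pair_measureI; simp)
  interpret transport \<Omega> P "\<lambda>_. 0" "\<lambda>_. 0"
  proof (rule transport.intro)
    show "closed \<Omega>" "bounded \<Omega>" by fact+
    show "space P = XO \<Omega>" by (simp add: P_def space_restrict_space)
    show "sets P = borel_sub (XO \<Omega>)" using XO by (auto simp: P_def borel_sub_def sets_restrict_space_iff)
    show "finite_measure P" by (rule finite_measureI) (simp add: P_def)
  qed auto
  show "(\<lambda>A. 0, \<lambda>A. 0, \<lambda>A. 0) \<in> Bset \<alpha> \<beta> \<delta> \<Omega>" by (rule zero_in_Bset[OF pos(1,2)])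
next
  fix y z and s :: real
  assume y: "y \<in> Bset \<alpha> \<beta> \<delta> \<Omega>" and z: "z \<in> Bset \<alpha> \<beta> \<delta> \<Omega>" and s: "s \<in> {0<..<1}"
    and eq: "(\<lambda>A. 0, \<lambda>A. 0, \<lambda>A. 0) = comb3 s y z"
  obtain \<rho> m \<mu> where yy: "y = (\<rho>, m, \<mu>)" by (rule prod_cases3)
  obtain \<rho>' m' \<mu>' where zz: "z = (\<rho>', m', \<mu>')" by (rule prod_cases3)
  obtain Q u r where Q: "transport \<Omega> Q u r" and yQ: "y = transport.triple \<Omega> Q u r (\<lambda>_. 1)"
    by (rule transport_representation[OF \<Omega> pos y[unfolded yy]]) (rule that; simp add: yy)
  obtain Q' u' r' where Q': "transport \<Omega> Q' u' r'" and zQ: "z = transport.triple \<Omega> Q' u' r' (\<lambda>_. 1)"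
    by (rule transport_representation[OF \<Omega> pos z[unfolded zz]]) (rule that; simp add: zz)
  interpret Y: transport \<Omega> Q u r by fact
  interpret Z: transport \<Omega> Q' u' r' by fact
  have "0 = (1 - s) * Y.wt (\<lambda>_. 1) (XO \<Omega>) + s * Z.wt (\<lambda>_. 1) (XO \<Omega>)"
    using eq unfolding yQ zQ Y.triple_def Z.triple_def comb3_def by (auto dest!: fun_cong[where x = "XO \<Omega>"])
  then have e: "(1 - s) * measure Q (XO \<Omega>) + s * measure Q' (XO \<Omega>) = 0" by (simp add: Y.wt_one_XO Z.wt_one_XO)
  have nn: "0 \<le> (1 - s) * measure Q (XO \<Omega>)" "0 \<le> s * measure Q' (XO \<Omega>)" using s by auto
  have "(1 - s) * measure Q (XO \<Omega>) = 0" "s * measure Q' (XO \<Omega>) = 0" using e nn by linarith+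
  then have "measure Q (XO \<Omega>) = 0" "measure Q' (XO \<Omega>) = 0" using s by auto
  then show "y = z" unfolding yQ zQ by (simp add: Y.triple_if_null Z.triple_if_null)
qed

text \<open>A nonzero extremal point has J = 1: with cost j < 1 it would lie strictly between 0 and
  its multiple by 1 / j. Then all invariant weights are constant and the concentration on a curve
  follows.\<close>

lemma extremal_imp_Cset:
  fixes \<Omega> :: "(real ^ 'd::finite) set"
  assumes \<Omega>: "closed \<Omega>" "bounded \<Omega>" and pos: "\<alpha> > 0" "\<beta> > 0" "\<delta> > 0"
    and x: "x \<in> extremal_points (Bset \<alpha> \<beta> \<delta> \<Omega>)" and nz: "x \<noteq> (\<lambda>A. 0, \<lambda>A. 0, \<lambda>A. 0)"
  shows "x \<in> Cset \<alpha> \<beta> \<delta> \<Omega>"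
proof -
  have xB: "x \<in> Bset \<alpha> \<beta> \<delta> \<Omega>" using x by (simp add: extremal_points_def)
  obtain \<rho> m \<mu> where xx: "x = (\<rho>, m, \<mu>)" by (rule prod_cases3)
  obtain P v w where P: "transport \<Omega> P v w" and xP: "x = transport.triple \<Omega> P v w (\<lambda>_. 1)"
    and inv: "transport.invariant P v w (\<lambda>_. 1)"
    and J: "J \<alpha> \<beta> \<delta> \<Omega> \<rho> m \<mu> = ennreal (\<integral>p. \<beta> * transport.energy v w \<delta> p + \<alpha> \<partial>P)"
    by (rule transport_representation[OF \<Omega> pos xB[unfolded xx]]) (rule that; simp add: xx)
  interpret transport \<Omega> P v w by fact
  define j where "j = (\<integral>p. \<beta> * energy \<delta> p + \<alpha> \<partial>P)"
  have inv_c: "invariant (\<lambda>_. c)" for c using invariant_scale[OF inv, of c] by simp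
  have "ennreal j \<le> 1" using xB J by (simp add: xx Bset_def j_def)
  then have j1: "j \<le> 1" by simp
  have mP: "measure P (XO \<Omega>) \<noteq> 0" using triple_if_null nz xP by blast
  \<comment> \<open>Here \<alpha> > 0 excludes cost 0, since a nonzero triple has positive
    mass.\<close>
  have "(\<integral>p. \<alpha> \<partial>P) \<le> j" unfolding j_def
    using energy_integrable energy_nonneg pos by (intro integral_mono) auto
  then have "\<alpha> * measure P (XO \<Omega>) \<le> j" by (simp add: spaceP mult.commute)
  moreover have "0 < \<alpha> * measure P (XO \<Omega>)" using pos mP zero_less_measure_iff by (simp add: zero_less_measure_iff)
  ultimately have j0: "0 < j" by linarith
  have jI: "(\<integral>p. c * (\<beta> * energy \<delta> p + \<alpha>) \<partial>P) = c * j" for c unfolding j_def by (rule integral_mult_right_zero)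
  have "j = 1"
  proof (rule ccontr)
    assume "j \<noteq> 1"
    then have lt: "j < 1" using j1 by simp
    have 1: "triple (\<lambda>_. 1 / j) \<in> Bset \<alpha> \<beta> \<delta> \<Omega>"
      by (rule triple_in_Bset[where K = "1 / j"]) (use inv_c pos j0 jI[of "1 / j"] in auto)
    have 2: "triple (\<lambda>_. 0) \<in> Bset \<alpha> \<beta> \<delta> \<Omega>" unfolding triple_zero by (rule zero_in_Bset[OF pos(1,2)])
    have "comb3 (1 - j) (triple (\<lambda>_. 1 / j)) (triple (\<lambda>_. 0)) = triple (\<lambda>_. (1 - (1 - j)) * (1 / j) + (1 - j) * 0)"
      by (rule comb3_triple[where K = "1 / j" and K' = 0]) (use j0 in auto)
    then have "x = comb3 (1 - j) (triple (\<lambda>_. 1 / j)) (triple (\<lambda>_. 0))" using j0 by (simp add: xP)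
    moreover have "\<forall>y\<in>Bset \<alpha> \<beta> \<delta> \<Omega>. \<forall>z\<in>Bset \<alpha> \<beta> \<delta> \<Omega>. \<forall>s\<in>{0<..<1}. x = comb3 s y z \<longrightarrow> y = z"
      using x unfolding extremal_points_def mem_Collect_eq by (rule conjunct2)
    moreover have "1 - j \<in> {0<..<1}" using lt j0 by simp
    ultimately have "triple (\<lambda>_. 1 / j) = triple (\<lambda>_. 0)" using 1 2 by blast
    then have "AE p in P. 1 / j = 0" by (rule triple_eqD) auto
    then have "AE p in P. False" using j0 by simp
    then show False using not_null_if_cost_pos[of \<beta> \<delta> \<alpha>] j0 by (simp add: j_def)
  qed
  have const: "\<exists>c. AE p in P. \<theta> p = c" if "\<theta> \<in> borel_measurable P" "\<And>p. \<bar>\<theta> p\<bar> \<le> 1" "invariant \<theta>" for \<theta>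
    by (rule extremal_imp_invariant_const[OF x[unfolded xP] pos(1,2) inv _ that]) (use \<open>j = 1\<close> in \<open>simp add: j_def\<close>)
  have eqs: "\<rho> = wt (\<lambda>_. 1)" "m = wt v" "\<mu> = wt w" using xP by (simp_all add: xx triple_def)
  have J1: "J \<alpha> \<beta> \<delta> \<Omega> (wt (\<lambda>_. 1)) (wt v) (wt w) = 1" using J \<open>j = 1\<close> unfolding eqs j_def by simp
  have ap: approximable by (rule approximable_if_invariant_const) (rule const)
  show ?thesis unfolding xx eqs by (rule triple_one_in_Cset[OF inv ap _ J1]) (rule const)
qed

text \<open>The two components are multiples c and c' of the triple with c, c' \<le> 1, while their
  weighted average is the triple itself; so c = c' = 1.\<close>

lemma Cset_imp_extremal:
  fixes \<Omega> :: "(real ^ 'd::finite) set"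
  assumes \<Omega>: "closed \<Omega>" "bounded \<Omega>" and pos: "\<alpha> > 0" "\<beta> > 0" "\<delta> > 0"
    and x: "x \<in> Cset \<alpha> \<beta> \<delta> \<Omega>"
  shows "x \<in> extremal_points (Bset \<alpha> \<beta> \<delta> \<Omega>)"
proof -
  obtain \<rho> m \<mu> where xx: "x = (\<rho>, m, \<mu>)" by (rule prod_cases3)
  have xM: "(\<rho>, m, \<mu>) \<in> M\<Omega> \<Omega>" and J1: "J \<alpha> \<beta> \<delta> \<Omega> \<rho> m \<mu> = 1" using x unfolding xx Cset_def by auto
  then have xB: "x \<in> Bset \<alpha> \<beta> \<delta> \<Omega>" by (simp add: xx Bset_def)
  obtain P v w where P: "transport \<Omega> P v w" and xP: "x = transport.triple \<Omega> P v w (\<lambda>_. 1)"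
    and inv: "transport.invariant P v w (\<lambda>_. 1)"
    and J: "J \<alpha> \<beta> \<delta> \<Omega> \<rho> m \<mu> = ennreal (\<integral>p. \<beta> * transport.energy v w \<delta> p + \<alpha> \<partial>P)"
    by (rule transport_representation[OF \<Omega> pos xB[unfolded xx]]) (rule that; simp add: xx)
  interpret transport \<Omega> P v w by fact
  have JX: "(\<integral>p. \<beta> * energy \<delta> p + \<alpha> \<partial>P) = 1" using J J1 by simp
  note const = invariant_const_if_Cset[OF x[unfolded xP] inv]
  show ?thesis
    unfolding extremal_points_def
  proof (intro CollectI conjI xB ballI impI)
    fix y z and s :: real
    assume y: "y \<in> Bset \<alpha> \<beta> \<delta> \<Omega>" and z: "z \<in> Bset \<alpha> \<beta> \<delta> \<Omega>" and s: "s \<in> {0<..<1}" and eq: "x = comb3 s y z"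
    obtain \<rho>1 m1 \<mu>1 where yy: "y = (\<rho>1, m1, \<mu>1)" by (rule prod_cases3)
    obtain \<rho>2 m2 \<mu>2 where zz: "z = (\<rho>2, m2, \<mu>2)" by (rule prod_cases3)
    obtain Q u r where Q: "transport \<Omega> Q u r" and yQ: "y = transport.triple \<Omega> Q u r (\<lambda>_. 1)"
      and invY: "transport.invariant Q u r (\<lambda>_. 1)"
      and JY': "J \<alpha> \<beta> \<delta> \<Omega> \<rho>1 m1 \<mu>1 = ennreal (\<integral>p. \<beta> * transport.energy u r \<delta> p + \<alpha> \<partial>Q)"
      by (rule transport_representation[OF \<Omega> pos y[unfolded yy]]) (rule that; simp add: yy)
    obtain Q' u' r' where Q': "transport \<Omega> Q' u' r'" and zQ: "z = transport.triple \<Omega> Q' u' r' (\<lambda>_. 1)"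
      and invZ: "transport.invariant Q' u' r' (\<lambda>_. 1)"
      and JZ': "J \<alpha> \<beta> \<delta> \<Omega> \<rho>2 m2 \<mu>2 = ennreal (\<integral>p. \<beta> * transport.energy u' r' \<delta> p + \<alpha> \<partial>Q')"
      by (rule transport_representation[OF \<Omega> pos z[unfolded zz]]) (rule that; simp add: zz)
    have JY: "(\<integral>p. \<beta> * transport.energy u r \<delta> p + \<alpha> \<partial>Q) \<le> 1" using y JY' by (simp add: yy Bset_def)
    have JZ: "(\<integral>p. \<beta> * transport.energy u' r' \<delta> p + \<alpha> \<partial>Q') \<le> 1" using z JZ' by (simp add: zz Bset_def)
    have s': "0 < s" "s < 1" "0 < 1 - s" "1 - s < 1" using s by auto
    obtain c where c: "c \<le> 1" "y = triple (\<lambda>_. c)"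
      using component_is_constant_multiple[OF Q Q' s'(1,2) pos _ JY JZ JX inv invY const] eq unfolding xP yQ zQ by blast
    obtain c' where c': "c' \<le> 1" "z = triple (\<lambda>_. c')"
      using component_is_constant_multiple[OF Q' Q s'(3,4) pos _ JZ JY JX inv invZ const] eq[unfolded comb3_swap[of s]] unfolding xP yQ zQ by blast
    have "triple (\<lambda>_. 1) = triple (\<lambda>_. (1 - s) * c + s * c')"
      using eq comb3_triple[of "\<lambda>_. c" "\<bar>c\<bar>" "\<lambda>_. c'" "\<bar>c'\<bar>" s] unfolding c c' xP by simp
    then have ae: "AE p in P. 1 = (1 - s) * c + s * c'" by (rule triple_eqD) auto
    have sum1: "1 = (1 - s) * c + s * c'"
    proof (rule ccontr)
      assume "1 \<noteq> (1 - s) * c + s * c'"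
      then have "AE p in P. False" using ae by simp
      then show False using not_null_if_cost_pos[of \<beta> \<delta> \<alpha>] JX by simp
    qed
    have "0 \<le> (1 - s) * (1 - c)" "0 \<le> s * (1 - c')" using c c' s' by auto
    moreover have "(1 - s) * (1 - c) + s * (1 - c') = 0" using sum1 by (simp add: algebra_simps)
    ultimately have "(1 - s) * (1 - c) = 0" "s * (1 - c') = 0" by linarith+
    then have "c = c'" using s' by simp
    then show "y = z" by (simp add: c c')
  qed
qed

theorem theorem6p1:
  fixes \<Omega> :: "(real ^ 'd) set" and \<alpha> \<beta> \<delta> :: real
  assumes "closure_of_bounded_domain \<Omega>"
    and "\<alpha> > 0" and "\<beta> > 0" and "\<delta> > 0"
  shows "extremal_points (Bset \<alpha> \<beta> \<delta> \<Omega>) =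
           Cset \<alpha> \<beta> \<delta> \<Omega> \<union> {(\<lambda>A. 0, \<lambda>A. 0, \<lambda>A. 0)}"
proof -
  have \<Omega>: "closed \<Omega>" "bounded \<Omega>" using assms(1) by (auto simp: closure_of_bounded_domain_def)
  show ?thesis
    using extremal_zero[OF \<Omega> assms(2-4)] extremal_imp_Cset[OF \<Omega> assms(2-4)] Cset_imp_extremal[OF \<Omega> assms(2-4)] by blast
qed

end
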